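(* Let $d\ge 2$, let $\Gamma$ be a convex-cocompact group of isometries of $\mathbb{H}^d$, and let $F : T^1(\mathbb{H}^d/\Gamma)\to\mathbb{R}$ be a Hölder potential satisfying the regularity assumption (R). Let $\mu\in\mathcal{P}(\partial_\infty\mathbb{H}^d)$ be a $(\Gamma,F)$-Patterson-Sullivan density, i.e. $\mu=\mu_x$ for some basepoint $x\in\mathbb{H}^d$, normalized to be a probability measure. Then there exists a probability measure $\nu\in\mathcal{P}(\Gamma)$ with exponential moment such that $\mu$ is $\nu$-stationary and such that the support of $\nu$ generates $\Gamma$.
   Context: $\mathcal{P}(X)$ denotes the set of Borel probability measures on $X$. Throughout, $\Gamma$ is a non-elementary, discrete, torsion-free group of orientation-preserving isometries of the hyperbolic space $\mathbb{H}^d$, $M:=\mathbb{H}^d/\Gamma$, and $\partial_\infty\mathbb{H}^d$ is the ideal boundary. The limit set $\Lambda_\Gamma\subset\partial_\infty\mathbb{H}^d$ is the set of accumulation points of any orbit $\Gamma x$, and $\mathrm{Hull}(\Lambda_\Gamma)\subset\mathbb{H}^d$ is its convex hull. $\Gamma$ is convex-cocompact if $\mathrm{Hull}(\Lambda_\Gamma)/\Gamma$ is compact ($M$ itself may be compact). Let $p:T^1M\to M$ be the projection and $\Omega\Gamma:=p^{-1}(\mathrm{Hull}(\Lambda_\Gamma)/\Gamma)\subset T^1M$. A potential $F:T^1M\to\mathbb{R}$ lifts to a $\Gamma$-invariant map $\tilde F:T^1\mathbb{H}^d\to\mathbb{R}$. For $x\ne y$ in $\mathbb{H}^d$, $\int_x^y\tilde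 F:=\int_0^{d(x,y)}\tilde F(\dot c_{x,y}(s))\,ds$, where $c_{x,y}$ is the unit speed geodesic from $x$ to $y$. The critical exponent is $$\delta_{\Gamma,F}:=\limsup_{n\to\infty}\frac1n\ln\sum_{\gamma\in\Gamma,\ n-c<d(x,\gamma y)\le n}e^{\int_x^{\gamma y}\tilde F}$$ (independent of $x,y\in\mathbb{H}^d$ and $c>0$). The Gibbs cocycle is $C_{F,\xi}(x,y):=\lim_{t\to+\infty}\left(\int_y^{\xi_t}\tilde F-\int_x^{\xi_t}\tilde F\right)$, where $(\xi_t)$ is any geodesic ray converging to $\xi\in\partial_\infty\mathbb{H}^d$. The $(\Gamma,F)$-Patterson-Sullivan densities are the family, unique up to a common scalar multiple, of finite nonzero measures $(\mu_x)_{x\in\mathbb{H}^d}$ on $\partial_\infty\mathbb{H}^d$ such that for all $\gamma\in\Gamma$ and $x,y\in\mathbb{H}^d$: $\gamma_*\mu_x=\mu_{\gamma x}$ and $d\mu_x(\xi)=e^{-C_{F-\delta_{\Gamma,F},\xi}(x,y)}\,d\mu_y(\xi)$. They are supported on $\Lambda_\Gamma$. Regularity assumption (R): $F$ is Hölder regular and $\sup_{\Omega\Gamma}F<\delta_{\Gamma,F}$. For $\nu\in\mathcal{P}(\Gamma)$, a measure $\mu\in\mathcal{P}(\partial_\infty\mathbb{H}^d)$ is $\nu$-stationary if $\mu=\nu*\mu:=\int_\Gamma\gamma_*\mu\,d\nu(\gamma)$. Identifying orientation-preserving isometries of $\mathbb{H}^d$ with matrices in $SO(d,1)$ (hyperboloid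 model), $\nu$ has exponential moment if there is $\varepsilon>0$ with $\int_\Gamma\|\gamma\|^\varepsilon d\nu(\gamma)<\infty$, for some matrix norm $\|\cdot\|$. *)

theory Defs
  imports "HOL-Probability.Probability" "HOL-Algebra.Generated_Groups"
begin

text \<open>
  Hyperbolic space \<open>H\<^sup>d\<close> with \<open>d = CARD('n)\<close> is the upper sheet of the hyperboloid in
  Minkowski space \<open>R\<^bsup>d,1\<^esup>\<close>. The coordinate \<open>None\<close> is the time coordinate.
\<close>

type_synonym 'n mink = "real ^ 'n option"
type_synonym 'n mink_mat = "real ^ 'n option ^ 'n option"

definition mform :: "'n::finite mink \<Rightarrow> 'n mink \<Rightarrow> real" where
  "mform x y = (\<Sum>i\<in>UNIV. x $ Some i * y $ Some i) - x $ None * y $ None"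

definition hyp_space :: "'n::finite mink set" where
  "hyp_space = {x. mform x x = -1 \<and> 0 < x $ None}"

definition origin :: "'n::finite mink" where
  "origin = axis None 1"

definition hyp_dist :: "'n::finite mink \<Rightarrow> 'n mink \<Rightarrow> real" where
  "hyp_dist x y = arcosh (- mform x y)"

definition hyp_unit_tangent :: "('n::finite mink \<times> 'n mink) set" where
  "hyp_unit_tangent = {(x, v). x \<in> hyp_space \<and> mform x v = 0 \<and> mform v v = 1}"

text \<open>
  The first component of \<open>geo_flow t (x, v)\<close> is the point at time \<open>t\<close> of the unit speed geodesic
  starting at \<open>x\<close> with velocity \<open>v\<close>; the second component is the velocity there.
\<close>

definition geo_flow :: "real \<Rightarrow> 'n::finite mink \<times> 'n mink \<Rightarrow> 'n mink \<times> 'n mink" where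
  "geo_flow t u =
     (cosh t *\<^sub>R fst u + sinh t *\<^sub>R snd u, sinh t *\<^sub>R fst u + cosh t *\<^sub>R snd u)"

text \<open>For \<open>x \<noteq> y\<close>, the initial velocity of the unit speed geodesic from \<open>x\<close> to \<open>y\<close>:
  solve \<open>y = cosh r *\<^sub>R x + sinh r *\<^sub>R v\<close> with \<open>r = hyp_dist x y\<close>.\<close>

definition geo_dir :: "'n::finite mink \<Rightarrow> 'n mink \<Rightarrow> 'n mink" where
  "geo_dir x y =
     (1 / sinh (hyp_dist x y)) *\<^sub>R (y - cosh (hyp_dist x y) *\<^sub>R x)"

definition geo_segment :: "'n::finite mink \<Rightarrow> 'n mink \<Rightarrow> 'n mink set" where
  "geo_segment x y = (\<lambda>t. fst (geo_flow t (x, geo_dir x y))) ` {0..hyp_dist x y}"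

definition geo_convex :: "'n::finite mink set \<Rightarrow> bool" where
  "geo_convex C \<longleftrightarrow> C \<subseteq> hyp_space \<and> (\<forall>x\<in>C. \<forall>y\<in>C. x \<noteq> y \<longrightarrow> geo_segment x y \<subseteq> C)"

text \<open>
  An ideal point is a ray of the light cone, represented by its vector with time coordinate 1.
  The central projection to the slice of height 1 sends \<open>hyp_space\<close> to the open unit ball
  (Klein model) bounded by \<open>ideal_boundary\<close>; this gives the topology of the compactification.
\<close>

definition ideal_boundary :: "'n::finite mink set" where
  "ideal_boundary = {z. mform z z = 0 \<and> z $ None = 1}"

definition klein :: "'n::finite mink \<Rightarrow> 'n mink" where
  "klein x = (1 / x $ None) *\<^sub>R x"

definition boundary_borel :: "'n::finite mink measure" where
  "boundary_borel = restrict_space borel ideal_boundary"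

definition boundary_act :: "'n::finite mink_mat \<Rightarrow> 'n mink \<Rightarrow> 'n mink" where
  "boundary_act g z = klein (g *v z)"

definition ray_tendsto :: "'n::finite mink \<times> 'n mink \<Rightarrow> 'n mink \<Rightarrow> bool" where
  "ray_tendsto u \<xi> \<longleftrightarrow> ((\<lambda>t. klein (fst (geo_flow t u))) \<longlongrightarrow> \<xi>) at_top"

text \<open>Orientation-preserving isometries: the matrices of \<open>SO(d,1)\<close> preserving the upper sheet.\<close>

definition isom_group :: "'n::finite mink_mat monoid" where
  "isom_group =
     \<lparr>carrier = {g. det g = 1 \<and> (\<forall>x y. mform (g *v x) (g *v y) = mform x y) \<and>
                    (\<forall>x\<in>hyp_space. g *v x \<in> hyp_space)},
      monoid.mult = (**), one = mat 1\<rparr>"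

definition torsion_free :: "'n::finite mink_mat set \<Rightarrow> bool" where
  "torsion_free \<Gamma> \<longleftrightarrow>
     (\<forall>g\<in>\<Gamma>. \<forall>k::nat. 0 < k \<and> g [^]\<^bsub>isom_group\<^esub> k = \<one>\<^bsub>isom_group\<^esub> \<longrightarrow> g = \<one>\<^bsub>isom_group\<^esub>)"

definition point_orbit :: "'n::finite mink_mat set \<Rightarrow> 'n mink \<Rightarrow> 'n mink set" where
  "point_orbit \<Gamma> x = (\<lambda>g. g *v x) ` \<Gamma>"

definition tangent_orbit ::
    "'n::finite mink_mat set \<Rightarrow> 'n mink \<times> 'n mink \<Rightarrow> ('n mink \<times> 'n mink) set" where
  "tangent_orbit \<Gamma> u = (\<lambda>g. (g *v fst u, g *v snd u)) ` \<Gamma>"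

text \<open>The limit set does not depend on the choice of the orbit; neither does the critical exponent
  below.\<close>

definition limit_set :: "'n::finite mink_mat set \<Rightarrow> 'n mink set" where
  "limit_set \<Gamma> = {\<xi> \<in> ideal_boundary. \<xi> islimpt klein ` point_orbit \<Gamma> origin}"

definition nonelementary :: "'n::finite mink_mat set \<Rightarrow> bool" where
  "nonelementary \<Gamma> \<longleftrightarrow> infinite (limit_set \<Gamma>)"

text \<open>The hull is the smallest convex set containing all geodesics with both endpoints in \<open>L\<close>;
  \<open>(x, - v)\<close> generates the reversed geodesic of \<open>(x, v)\<close>.\<close>

definition hyp_hull :: "'n::finite mink set \<Rightarrow> 'n mink set" where
  "hyp_hull L = \<Inter> {C. geo_convex C \<and>
     (\<forall>(x, v)\<in>hyp_unit_tangent.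
        (\<exists>\<xi>\<in>L. ray_tendsto (x, v) \<xi>) \<and> (\<exists>\<eta>\<in>L. ray_tendsto (x, - v) \<eta>) \<longrightarrow> x \<in> C)}"

text \<open>The quotient \<open>S / \<Gamma>\<close>, for an invariant set \<open>S\<close> of points, has the orbits as its points and
  carries the quotient topology.\<close>

definition quotient_topology ::
    "'n::finite mink_mat set \<Rightarrow> 'n mink set \<Rightarrow> 'n mink set topology" where
  "quotient_topology \<Gamma> S =
     topology (\<lambda>U. U \<subseteq> point_orbit \<Gamma> ` S \<and> openin (top_of_set S) {x \<in> S. point_orbit \<Gamma> x \<in> U})"

lemma openin_quotient_topology:
  "openin (quotient_topology \<Gamma> S) U \<longleftrightarrow>
     U \<subseteq> point_orbit \<Gamma> ` S \<and> openin (top_of_set S) {x \<in> S. point_orbit \<Gamma> x \<in> U}"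
proof -
  let ?P = "\<lambda>U. U \<subseteq> point_orbit \<Gamma> ` S \<and> openin (top_of_set S) {x \<in> S. point_orbit \<Gamma> x \<in> U}"
  have "istopology ?P"
    unfolding istopology_def
  proof (intro conjI allI impI)
    fix A B assume "?P A" "?P B"
    then have "openin (top_of_set S) ({x \<in> S. point_orbit \<Gamma> x \<in> A} \<inter> {x \<in> S. point_orbit \<Gamma> x \<in> B})"
      by (intro openin_Int) auto
    also have "{x \<in> S. point_orbit \<Gamma> x \<in> A} \<inter> {x \<in> S. point_orbit \<Gamma> x \<in> B} = {x \<in> S. point_orbit \<Gamma> x \<in> A \<inter> B}"
      by auto
    finally show "openin (top_of_set S) {x \<in> S. point_orbit \<Gamma> x \<in> A \<inter> B}" .
    show "A \<inter> B \<subseteq> point_orbit \<Gamma> ` S" using \<open>?P A\<close> by auto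
  next
    fix \<K> assume K: "\<forall>K\<in>\<K>. ?P K"
    then have "openin (top_of_set S) (\<Union>K\<in>\<K>. {x \<in> S. point_orbit \<Gamma> x \<in> K})"
      by (intro openin_Union) auto
    also have "(\<Union>K\<in>\<K>. {x \<in> S. point_orbit \<Gamma> x \<in> K}) = {x \<in> S. point_orbit \<Gamma> x \<in> \<Union>\<K>}"
      by auto
    finally show "openin (top_of_set S) {x \<in> S. point_orbit \<Gamma> x \<in> \<Union>\<K>}" .
    show "\<Union>\<K> \<subseteq> point_orbit \<Gamma> ` S" using K by auto
  qed
  then show ?thesis
    unfolding quotient_topology_def by (simp add: topology_inverse')
qed

definition convex_cocompact :: "'n::finite mink_mat set \<Rightarrow> bool" where
  "convex_cocompact \<Gamma> \<longleftrightarrow> compact_space (quotient_topology \<Gamma> (hyp_hull (limit_set \<Gamma>)))"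

definition quot_unit_tangent :: "'n::finite mink_mat set \<Rightarrow> ('n mink \<times> 'n mink) set set" where
  "quot_unit_tangent \<Gamma> = tangent_orbit \<Gamma> ` hyp_unit_tangent"

text \<open>The base point projection from the unit tangent bundle of \<open>H\<^sup>d / \<Gamma>\<close> maps a tangent orbit
  \<open>P\<close> to the orbit \<open>fst ` P\<close>.\<close>

definition Omega :: "'n::finite mink_mat set \<Rightarrow> ('n mink \<times> 'n mink) set set" where
  "Omega \<Gamma> = {P \<in> quot_unit_tangent \<Gamma>. fst ` P \<in> point_orbit \<Gamma> ` hyp_hull (limit_set \<Gamma>)}"

text \<open>
  An isometry-invariant distance on the unit tangent bundle, due to Paulin, Pollicott and
  Schapira; it defines the same Hoelder functions as the Sasaki distance.
\<close>

definition tangent_dist :: "'n::finite mink \<times> 'n mink \<Rightarrow> 'n mink \<times> 'n mink \<Rightarrow> real" where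
  "tangent_dist u w = (1 / sqrt pi) *
     (\<integral>t. hyp_dist (fst (geo_flow t u)) (fst (geo_flow t w)) * exp (- (t\<^sup>2)) \<partial>lborel)"

definition quot_tangent_dist ::
    "('n::finite mink \<times> 'n mink) set \<Rightarrow> ('n mink \<times> 'n mink) set \<Rightarrow> real" where
  "quot_tangent_dist P Q = (INF (u, w)\<in>P \<times> Q. tangent_dist u w)"

text \<open>A potential is a function on \<open>quot_unit_tangent \<Gamma>\<close>, that is, on the unit tangent bundle of
  \<open>H\<^sup>d / \<Gamma>\<close>.\<close>

type_synonym 'n potential = "('n mink \<times> 'n mink) set \<Rightarrow> real"

definition holder_potential :: "'n::finite mink_mat set \<Rightarrow> 'n potential \<Rightarrow> bool" where
  "holder_potential \<Gamma> F \<longleftrightarrow>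
     (\<exists>C \<alpha>. 0 < \<alpha> \<and> \<alpha> \<le> 1 \<and>
       (\<forall>P\<in>quot_unit_tangent \<Gamma>. \<forall>Q\<in>quot_unit_tangent \<Gamma>.
          \<bar>F P - F Q\<bar> \<le> C * quot_tangent_dist P Q powr \<alpha>))"

definition lift_potential ::
    "'n::finite mink_mat set \<Rightarrow> 'n potential \<Rightarrow> 'n mink \<times> 'n mink \<Rightarrow> real" where
  "lift_potential \<Gamma> F u = F (tangent_orbit \<Gamma> u)"

definition path_integral ::
    "'n::finite mink_mat set \<Rightarrow> 'n potential \<Rightarrow> 'n mink \<Rightarrow> 'n mink \<Rightarrow> real" where
  "path_integral \<Gamma> F x y =
     integral {0..hyp_dist x y} (\<lambda>s. lift_potential \<Gamma> F (geo_flow s (x, geo_dir x y)))"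

text \<open>The annuli have width \<open>c = 1\<close>. An empty annulus contributes \<open>ln 0 = -\<infinity>\<close>, which has to be
  spelled out because \<open>ln 0 = 0\<close> in the reals.\<close>

definition annulus_sum :: "'n::finite mink_mat set \<Rightarrow> 'n potential \<Rightarrow> nat \<Rightarrow> real" where
  "annulus_sum \<Gamma> F n =
     (\<Sum>g | g \<in> \<Gamma> \<and> real n - 1 < hyp_dist origin (g *v origin)
                  \<and> hyp_dist origin (g *v origin) \<le> real n.
        exp (path_integral \<Gamma> F origin (g *v origin)))"

definition critical_exponent :: "'n::finite mink_mat set \<Rightarrow> 'n potential \<Rightarrow> ereal" where
  "critical_exponent \<Gamma> F =
     limsup (\<lambda>n. if annulus_sum \<Gamma> F n = 0 then -\<infinity> else ereal (1 / real n * ln (annulus_sum \<Gamma> F n)))"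

definition regular_potential :: "'n::finite mink_mat set \<Rightarrow> 'n potential \<Rightarrow> bool" where
  "regular_potential \<Gamma> F \<longleftrightarrow>
     holder_potential \<Gamma> F \<and> (SUP P\<in>Omega \<Gamma>. ereal (F P)) < critical_exponent \<Gamma> F"

definition gibbs_cocycle ::
    "'n::finite mink_mat set \<Rightarrow> 'n potential \<Rightarrow> 'n mink \<Rightarrow> 'n mink \<Rightarrow> 'n mink \<Rightarrow> real" where
  "gibbs_cocycle \<Gamma> F \<xi> x y =
     (THE L. \<forall>u\<in>hyp_unit_tangent. ray_tendsto u \<xi> \<longrightarrow>
        ((\<lambda>t. path_integral \<Gamma> F y (fst (geo_flow t u)) - path_integral \<Gamma> F x (fst (geo_flow t u)))
           \<longlongrightarrow> L) at_top)"

definition patterson_sullivan ::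
    "'n::finite mink_mat set \<Rightarrow> 'n potential \<Rightarrow> ('n mink \<Rightarrow> 'n mink measure) \<Rightarrow> bool" where
  "patterson_sullivan \<Gamma> F M \<longleftrightarrow>
     (\<forall>x\<in>hyp_space. finite_measure (M x) \<and> sets (M x) = sets boundary_borel
        \<and> emeasure (M x) (space (M x)) \<noteq> 0) \<and>
     (\<forall>g\<in>\<Gamma>. \<forall>x\<in>hyp_space. distr (M x) boundary_borel (boundary_act g) = M (g *v x)) \<and>
     (\<forall>x\<in>hyp_space. \<forall>y\<in>hyp_space.
        M x = density (M y) (\<lambda>\<xi>. ennreal (exp (-
          gibbs_cocycle \<Gamma> (\<lambda>P. F P - real_of_ereal (critical_exponent \<Gamma> F)) \<xi> x y))))"

text \<open>Since \<open>\<Gamma>\<close> is discrete, hence countable, the probability measures on \<open>\<Gamma>\<close> are the probability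
  mass functions with support in \<open>\<Gamma>\<close>.\<close>

definition stationary :: "'n::finite mink_mat pmf \<Rightarrow> 'n mink measure \<Rightarrow> bool" where
  "stationary \<nu> \<mu> \<longleftrightarrow>
     (\<forall>A\<in>sets boundary_borel.
        emeasure \<mu> A =
          (\<integral>\<^sup>+ g. emeasure (distr \<mu> boundary_borel (boundary_act g)) A \<partial>measure_pmf \<nu>))"

definition exponential_moment :: "'n::finite mink_mat pmf \<Rightarrow> bool" where
  "exponential_moment \<nu> \<longleftrightarrow>
     (\<exists>\<epsilon>>0. (\<integral>\<^sup>+ g. ennreal (norm g powr \<epsilon>) \<partial>measure_pmf \<nu>) < \<infinity>)"

end

theory Submission
  imports Defs
begin

text \<open>
  Write \<open>f g\<close> for the density of the translate of the measure \<open>\<mu>\<close> by \<open>g\<close> with respect to \<open>\<mu>\<close>. One needs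
  positive weights \<open>c g\<close> with \<open>(\<Sum>g. c g * f g \<xi>) = 1\<close> for almost all \<open>\<xi>\<close>. By the Hoelder continuity of the
  potential, \<open>f g\<close> is almost constant on balls of radius \<open>exp (- n)\<close>, where \<open>n\<close> is the displacement
  of \<open>g\<close>; by the gap between the supremum of the potential and the critical exponent, it is
  concentrated on the shadow of \<open>g x\<close>. Hence a function \<open>R\<close> on the limit set that varies
  little at scale \<open>exp (- n)\<close> can be approximated, up to a bounded factor, by a combination of the \<open>f g\<close> with
  displacement about \<open>n\<close>. Subtracting a small multiple of it from \<open>R\<close> loses a definite proportion of
  \<open>R\<close> and leaves a function of the same kind at the next scale. Starting from 1, the remainders, and
  with them the masses of the successive annuli, decay geometrically; this is the exponential moment.
  All elements of the group receive positive weight, so the support generates. The measure lives on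
  the limit set because the Poincare series diverges at the critical exponent, by submultiplicativity
  of the weights.
\<close>

section \<open>Geodesics in the hyperboloid model\<close>

text \<open>Two obstacles shape the estimates: the potential can be unbounded when the quotient is
  not compact, and reversing vectors can change it. Being Hoelder, it grows at most linearly with
  the distance from the orbit of \<open>x\<close>, so comparisons of path integrals carry a factor
  \<open>1 + hyp_dist b p\<close>; convex-cocompactness keeps the relevant points close to the
  orbit. Asymmetry decides how the gap enters. If \<open>h\<close> moves \<open>x\<close> near the
  centre of the tripod with ends \<open>x\<close>, \<open>g x\<close>, \<xi>, and
  \<open>g = h ** k\<close>, then the weight of \<open>g\<close> times its density at \<xi> is at
  most a constant times the weights of \<open>k\<close> and of its inverse, which follow the path
  from the centre to \<open>g x\<close> and back. The gap makes the latter decay exponentially in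
  the displacement of \<open>k\<close>: half of the rate lifts the exponent of the weight of
  \<open>k\<close> above the critical one, where the Poincare series converges, and the rest
  controls the tails of the density. Masses are bounded by integration: every density has integral
  1, and the weighted sum over a shell is at most the remainder before it.\<close>

lemma mform_eq_inner: "mform x y = inner x y - 2 * (x $ None * y $ None)"
  by (simp add: mform_def inner_vec_def UNIV_option_conv sum.insert_if sum.reindex)

lemma mform_commute: "mform x y = mform y x"
  by (simp add: mform_eq_inner inner_commute mult.commute)

lemma mform_add_left: "mform (x + y) z = mform x z + mform y z"
  and mform_add_right: "mform z (x + y) = mform z x + mform z y"
  and mform_diff_left: "mform (x - y) z = mform x z - mform y z"
  and mform_diff_right: "mform z (x - y) = mform z x - mform z y"
  and mform_scaleR_left: "mform (c *\<^sub>R x) z = c * mform x z"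
  and mform_scaleR_right: "mform z (c *\<^sub>R x) = c * mform z x"
  and mform_minus_left: "mform (- x) z = - mform x z"
  and mform_minus_right: "mform z (- x) = - mform z x"
  by (simp_all add: mform_eq_inner inner_simps algebra_simps)

lemmas mform_simps = mform_add_left mform_add_right mform_diff_left mform_diff_right
  mform_scaleR_left mform_scaleR_right mform_minus_left mform_minus_right

lemma continuous_mform [continuous_intros]:
  assumes "continuous_on S f" "continuous_on S g"
  shows "continuous_on S (\<lambda>t. mform (f t) (g t))"
  unfolding mform_eq_inner using assms by (intro continuous_intros)

lemma tendsto_mform [tendsto_intros]:
  assumes "(f \<longlongrightarrow> a) G" "(g \<longlongrightarrow> b) G"
  shows "((\<lambda>t. mform (f t) (g t)) \<longlongrightarrow> mform a b) G"
  unfolding mform_eq_inner using assms by (intro tendsto_intros)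

text \<open>The form and the squared norm are \<open>sdot\<close> minus and plus the time product,
  which reduces the causal inequalities below to Cauchy-Schwarz in the spatial coordinates.\<close>

definition sdot :: "'n::finite mink \<Rightarrow> 'n mink \<Rightarrow> real" where
  "sdot x y = (\<Sum>i\<in>UNIV. x $ Some i * y $ Some i)"

lemma mform_sdot: "mform x y = sdot x y - x $ None * y $ None"
  by (simp add: mform_def sdot_def)

lemma sdot_nonneg: "0 \<le> sdot x x"
  unfolding sdot_def by (intro sum_nonneg) simp

lemma sdot_Cauchy_Schwarz: "(sdot x y)\<^sup>2 \<le> sdot x x * sdot y y"
  using Cauchy_Schwarz_ineq[of "\<chi> i. x $ Some i" "\<chi> i. y $ Some i"]
  by (simp add: sdot_def inner_vec_def)

lemma norm_sq_mink: "(norm x)\<^sup>2 = sdot x x + (x $ None)\<^sup>2"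
  unfolding power2_norm_eq_inner
  by (simp add: inner_vec_def UNIV_option_conv sum.insert_if sum.reindex sdot_def power2_eq_square)

lemma hyp_space_time_ge: assumes "x \<in> hyp_space" shows "1 \<le> x $ None"
proof -
  have "sdot x x = (x $ None)\<^sup>2 - 1" "0 < x $ None"
    using assms by (auto simp: hyp_space_def mform_sdot power2_eq_square)
  then have "1\<^sup>2 \<le> (x $ None)\<^sup>2" using sdot_nonneg[of x] by simp
  then show ?thesis using \<open>0 < x $ None\<close> by (metis less_eq_real_def power2_le_imp_le)
qed

lemma origin_in_hyp_space [simp]: "(origin :: 'n::finite mink) \<in> hyp_space"
  by (simp add: origin_def hyp_space_def mform_def axis_def)

text \<open>The orthogonal complement of a timelike vector is spacelike, quantitatively.
  Orthogonality expresses the time part of \<open>u\<close> through \<open>sdot x u\<close>; as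
  \<open>sdot x x\<close> falls short of the squared time coordinate by exactly 1, Cauchy-Schwarz
  leaves a definite fraction of \<open>sdot u u\<close> in \<open>mform u u\<close>.\<close>

lemma norm_sq_le_mform_perp:
  assumes "x \<in> hyp_space" "mform x u = 0"
  shows "(norm u)\<^sup>2 \<le> 2 * (x $ None)\<^sup>2 * mform u u"
proof -
  define a where "a = (x $ None)\<^sup>2"
  have s: "sdot x x = a - 1" and a: "1 \<le> a"
    using assms hyp_space_time_ge[OF assms(1)]
    by (auto simp: hyp_space_def mform_sdot a_def one_le_power) (simp add: power2_eq_square)
  have "sdot x u = x $ None * u $ None" using assms by (simp add: mform_sdot)
  then have 1: "a * (u $ None)\<^sup>2 \<le> (a - 1) * sdot u u"
    using sdot_Cauchy_Schwarz[of x u] s by (simp add: a_def power_mult_distrib)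
  have m: "mform u u = sdot u u - (u $ None)\<^sup>2" by (simp add: mform_sdot power2_eq_square)
  have "a * mform u u \<ge> sdot u u" unfolding m using 1 by (simp add: algebra_simps)
  moreover have "(u $ None)\<^sup>2 \<le> sdot u u"
  proof -
    have "a * (u $ None)\<^sup>2 \<le> a * sdot u u" using 1 sdot_nonneg[of u] by (simp add: algebra_simps)
    then show ?thesis using a by simp
  qed
  ultimately show ?thesis by (simp add: norm_sq_mink a_def)
qed

lemma mform_perp_nonneg:
  assumes "x \<in> hyp_space" "mform x u = 0" shows "0 \<le> mform u u"
proof -
  have "0 \<le> 2 * (x $ None)\<^sup>2 * mform u u"
    using norm_sq_le_mform_perp[OF assms] by (meson order_trans zero_le_power2)
  moreover have "0 < 2 * (x $ None)\<^sup>2" using hyp_space_time_ge[OF assms(1)] by simp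
  ultimately show ?thesis by (simp add: zero_le_mult_iff)
qed

text \<open>Reverse Cauchy-Schwarz. The component of \<open>y\<close> orthogonal to \<open>x\<close>
  has nonnegative square, so the square of \<open>c\<close> is at least 1; that \<open>c\<close> is
  positive comes from both points being on the upper sheet. This is what makes \<open>arcosh\<close>
  meaningful in \<open>hyp_dist\<close>.\<close>

lemma mform_hyp_le: assumes "x \<in> hyp_space" "y \<in> hyp_space" shows "mform x y \<le> -1"
proof -
  define c where "c = - mform x y"
  have xx: "mform x x = -1" "mform y y = -1" using assms by (auto simp: hyp_space_def)
  have "mform x (y - c *\<^sub>R x) = 0" by (simp add: mform_simps xx c_def)
  then have "0 \<le> mform (y - c *\<^sub>R x) (y - c *\<^sub>R x)"
    using mform_perp_nonneg assms by blast
  also have "\<dots> = c\<^sup>2 - 1"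
    using mform_commute[of x y] by (simp add: mform_simps xx c_def power2_eq_square algebra_simps)
  finally have "1\<^sup>2 \<le> c\<^sup>2" by simp
  moreover have "0 < c"
  proof -
    have "(sdot x y)\<^sup>2 \<le> ((x $ None)\<^sup>2 - 1) * ((y $ None)\<^sup>2 - 1)"
    proof -
      have "sdot x x = (x $ None)\<^sup>2 - 1" "sdot y y = (y $ None)\<^sup>2 - 1"
        using xx by (simp_all add: mform_sdot power2_eq_square)
      then show ?thesis using sdot_Cauchy_Schwarz[of x y] by simp
    qed
    also have "\<dots> < (x $ None * y $ None)\<^sup>2"
    proof -
      have "1 \<le> (x $ None)\<^sup>2" "1 \<le> (y $ None)\<^sup>2"
        using hyp_space_time_ge[OF assms(1)] hyp_space_time_ge[OF assms(2)] by (auto intro: one_le_power)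
      then show ?thesis by (simp add: algebra_simps power_mult_distrib)
    qed
    finally have "\<bar>sdot x y\<bar> < \<bar>x $ None * y $ None\<bar>" by (metis abs_le_square_iff not_le)
    moreover have "0 < x $ None * y $ None"
      using hyp_space_time_ge[OF assms(1)] hyp_space_time_ge[OF assms(2)] by simp
    ultimately show ?thesis unfolding c_def mform_sdot by linarith
  qed
  ultimately have "1 \<le> c" by (meson less_eq_real_def power2_le_imp_le)
  then show ?thesis by (simp add: c_def)
qed

lemma cosh_hyp_dist:
  assumes "x \<in> hyp_space" "y \<in> hyp_space"
  shows "cosh (hyp_dist x y) = - mform x y"
  using mform_hyp_le[OF assms] by (simp add: hyp_dist_def)

lemma hyp_dist_nonneg [simp]:
  assumes "x \<in> hyp_space" "y \<in> hyp_space"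
  shows "0 \<le> hyp_dist x y"
  using mform_hyp_le[OF assms] by (simp add: hyp_dist_def)

lemma hyp_dist_commute: "hyp_dist x y = hyp_dist y x"
  by (simp add: hyp_dist_def mform_commute)

lemma hyp_dist_self [simp]: "x \<in> hyp_space \<Longrightarrow> hyp_dist x x = 0"
  by (simp add: hyp_dist_def hyp_space_def)

section \<open>Unit speed geodesics and the angle between directions\<close>

definition geo_point :: "'n::finite mink \<Rightarrow> 'n mink \<Rightarrow> real \<Rightarrow> 'n mink" where
  "geo_point x v t = cosh t *\<^sub>R x + sinh t *\<^sub>R v"

definition geo_vel :: "'n::finite mink \<Rightarrow> 'n mink \<Rightarrow> real \<Rightarrow> 'n mink" where
  "geo_vel x v t = sinh t *\<^sub>R x + cosh t *\<^sub>R v"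

lemma geo_flow_eq: "geo_flow t (x, v) = (geo_point x v t, geo_vel x v t)"
  by (simp add: geo_flow_def geo_point_def geo_vel_def)

lemma hyp_unit_tangentD:
  assumes "(x, v) \<in> hyp_unit_tangent"
  shows "x \<in> hyp_space" "mform x x = -1" "mform x v = 0" "mform v x = 0" "mform v v = 1"
  using assms by (auto simp: hyp_unit_tangent_def hyp_space_def mform_commute)

lemma cosh_sq_real: "(cosh t)\<^sup>2 = 1 + (sinh t)\<^sup>2" for t :: real
  using cosh_square_eq[of t] by simp

text \<open>A vector on the lower sheet has its negative on the upper one, where the product with
  \<open>x\<close> is at most -1; so the sign of one product decides the sheet. This keeps geodesics
  and images under isometries on the upper sheet.\<close>

lemma hyp_space_connected:
  assumes "x \<in> hyp_space" "mform y y = -1" "mform x y \<le> 0"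
  shows "y \<in> hyp_space"
proof -
  have y: "sdot y y = (y $ None)\<^sup>2 - 1" using assms by (simp add: mform_sdot power2_eq_square)
  then have "1 \<le> (y $ None)\<^sup>2" using sdot_nonneg[of y] by simp
  then have "y $ None \<noteq> 0" by auto
  moreover have "\<not> y $ None < 0"
  proof
    assume "y $ None < 0"
    then have "- y \<in> hyp_space" using assms by (simp add: hyp_space_def mform_simps)
    then show False using mform_hyp_le[OF assms(1), of "-y"] assms(3) by (simp add: mform_simps)
  qed
  ultimately show ?thesis using assms by (simp add: hyp_space_def)
qed

lemma geo_point_in_hyp_space:
  assumes "(x, v) \<in> hyp_unit_tangent"
  shows "geo_point x v t \<in> hyp_space"
proof (rule hyp_space_connected)
  note u = hyp_unit_tangentD[OF assms]
  show "x \<in> hyp_space" by fact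
  show "mform (geo_point x v t) (geo_point x v t) = -1"
    using cosh_sq_real[of t] by (simp add: geo_point_def mform_simps u power2_eq_square)
  show "mform x (geo_point x v t) \<le> 0"
    using cosh_real_ge_1[of t] by (simp add: geo_point_def mform_simps u)
qed

lemma geo_flow_in_tangent:
  assumes "(x, v) \<in> hyp_unit_tangent"
  shows "(geo_point x v t, geo_vel x v t) \<in> hyp_unit_tangent"
proof -
  note u = hyp_unit_tangentD[OF assms]
  have "mform (geo_point x v t) (geo_vel x v t) = 0"
    by (simp add: geo_point_def geo_vel_def mform_simps u)
  moreover have "mform (geo_vel x v t) (geo_vel x v t) = 1"
    using cosh_sq_real[of t] by (simp add: geo_vel_def mform_simps u power2_eq_square)
  ultimately show ?thesis
    using geo_point_in_hyp_space[OF assms] by (simp add: hyp_unit_tangent_def)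
qed

lemma geo_point_add:
  "geo_point (geo_point x v t) (geo_vel x v t) s = geo_point x v (t + s)"
  by (simp add: geo_point_def geo_vel_def cosh_add sinh_add algebra_simps)

lemma geo_vel_add:
  "geo_vel (geo_point x v t) (geo_vel x v t) s = geo_vel x v (t + s)"
  by (simp add: geo_point_def geo_vel_def cosh_add sinh_add algebra_simps)

lemma geo_point_0 [simp]: "geo_point x v 0 = x"
  and geo_vel_0 [simp]: "geo_vel x v 0 = v"
  by (simp_all add: geo_point_def geo_vel_def)

lemma geo_point_uminus: "geo_point x (- v) t = geo_point x v (- t)"
  by (simp add: geo_point_def)

lemma geo_vel_uminus: "geo_vel x (- v) t = - geo_vel x v (- t)"
  by (simp add: geo_vel_def)

lemma tangent_uminus: "(x, v) \<in> hyp_unit_tangent \<Longrightarrow> (x, - v) \<in> hyp_unit_tangent"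
  by (simp add: hyp_unit_tangent_def mform_simps)

lemma geo_point_reverse:
  "geo_point (geo_point x v l) (- geo_vel x v l) t = geo_point x v (l - t)"
  by (simp add: geo_point_uminus geo_point_add)

lemma geo_vel_reverse:
  "geo_vel (geo_point x v l) (- geo_vel x v l) t = - geo_vel x v (l - t)"
  by (simp add: geo_vel_uminus geo_vel_add)

text \<open>For unit tangent vectors at the same point this is \<open>sin\<^sup>2 (\<theta> / 2)\<close>, with \<open>\<theta>\<close> the angle
  between them.\<close>

definition half_sin_sq :: "'n::finite mink \<Rightarrow> 'n mink \<Rightarrow> real" where
  "half_sin_sq v w = (1 - mform v w) / 2"

lemma half_sin_sq_eq:
  assumes "(x, v) \<in> hyp_unit_tangent" "(x, w) \<in> hyp_unit_tangent"
  shows "half_sin_sq v w = mform (v - w) (v - w) / 4"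
  using hyp_unit_tangentD[OF assms(1)] hyp_unit_tangentD[OF assms(2)] mform_commute[of v w]
  by (simp add: half_sin_sq_def mform_simps)

lemma half_sin_sq_commute: "half_sin_sq v w = half_sin_sq w v"
  by (simp add: half_sin_sq_def mform_commute)

lemma half_sin_sq_self [simp]: "(x, v) \<in> hyp_unit_tangent \<Longrightarrow> half_sin_sq v v = 0"
  by (simp add: half_sin_sq_def hyp_unit_tangentD)

lemma half_sin_sq_nonneg:
  assumes "(x, v) \<in> hyp_unit_tangent" "(x, w) \<in> hyp_unit_tangent"
  shows "0 \<le> half_sin_sq v w"
proof -
  note v = hyp_unit_tangentD[OF assms(1)] and w = hyp_unit_tangentD[OF assms(2)]
  show ?thesis unfolding half_sin_sq_eq[OF assms]
    using mform_perp_nonneg[of x "v - w"] v w by (simp add: mform_simps)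
qed

lemma half_sin_sq_le_1:
  assumes "(x, v) \<in> hyp_unit_tangent" "(x, w) \<in> hyp_unit_tangent"
  shows "half_sin_sq v w \<le> 1"
proof -
  have "0 \<le> half_sin_sq v (- w)" using half_sin_sq_nonneg assms tangent_uminus by blast
  then show ?thesis by (simp add: half_sin_sq_def mform_simps)
qed

text \<open>\<open>half_sin_sq\<close> is a quarter of the squared length of the difference in a
  positive definite tangent space, so this is the parallelogram inequality. The factor 2 reappears
  in the later angular constants.\<close>

lemma half_sin_sq_triangle:
  assumes "(x, u) \<in> hyp_unit_tangent" "(x, v) \<in> hyp_unit_tangent" "(x, w) \<in> hyp_unit_tangent"
  shows "half_sin_sq u w \<le> 2 * half_sin_sq u v + 2 * half_sin_sq v w"
proof -
  note u = hyp_unit_tangentD[OF assms(1)] and v = hyp_unit_tangentD[OF assms(2)]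
    and w = hyp_unit_tangentD[OF assms(3)]
  have "mform x (u - v - (v - w)) = 0" unfolding mform_simps u v w by simp
  then have "0 \<le> mform (u - v - (v - w)) (u - v - (v - w))"
    using mform_perp_nonneg u(1) by blast
  then show ?thesis
    unfolding half_sin_sq_eq[OF assms(1,3)] half_sin_sq_eq[OF assms(1,2)] half_sin_sq_eq[OF assms(2,3)]
      mform_add_left mform_add_right mform_diff_left mform_diff_right
    using mform_commute[of u v] mform_commute[of v w] mform_commute[of u w] by argo
qed

text \<open>The half-angle form is chosen because, for nonnegative times, both summands are
  nonnegative: dropping one or the other gives bounds for the distance and for the angle.\<close>

lemma hyperbolic_law_of_cosines:
  assumes "(x, v) \<in> hyp_unit_tangent" "(x, w) \<in> hyp_unit_tangent"
  shows "cosh (hyp_dist (geo_point x v s) (geo_point x w t)) =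
           cosh (s - t) + 2 * sinh s * sinh t * half_sin_sq v w"
proof -
  note v = hyp_unit_tangentD[OF assms(1)] and w = hyp_unit_tangentD[OF assms(2)]
  show ?thesis
    unfolding cosh_hyp_dist[OF geo_point_in_hyp_space[OF assms(1)] geo_point_in_hyp_space[OF assms(2)]]
    by (simp add: geo_point_def mform_simps v w cosh_diff half_sin_sq_def field_simps)
qed

lemma hyp_dist_geo_point:
  assumes "(x, v) \<in> hyp_unit_tangent"
  shows "hyp_dist (geo_point x v s) (geo_point x v t) = \<bar>s - t\<bar>"
proof -
  have "cosh (hyp_dist (geo_point x v s) (geo_point x v t)) = cosh \<bar>s - t\<bar>"
    using hyperbolic_law_of_cosines[OF assms assms, of s t] assms by simp
  then show ?thesis
    using geo_point_in_hyp_space[OF assms] by (metis arcosh_cosh_real abs_ge_zero hyp_dist_nonneg)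
qed

lemma hyp_dist_geo_point_0:
  assumes "(x, v) \<in> hyp_unit_tangent" "0 \<le> t"
  shows "hyp_dist x (geo_point x v t) = t"
  using hyp_dist_geo_point[OF assms(1), of 0 t] assms(2) by simp

lemma geo_dir_geo_point:
  assumes "(x, v) \<in> hyp_unit_tangent" "0 < t"
  shows "geo_dir x (geo_point x v t) = v"
  using assms by (simp add: geo_dir_def hyp_dist_geo_point_0) (simp add: geo_point_def)

lemma geo_dir_props:
  assumes "x \<in> hyp_space" "y \<in> hyp_space" "0 < hyp_dist x y"
  shows "(x, geo_dir x y) \<in> hyp_unit_tangent" "y = geo_point x (geo_dir x y) (hyp_dist x y)"
proof -
  define r where "r = hyp_dist x y"
  have r: "0 < sinh r" using assms by (simp add: r_def)
  have c: "cosh r = - mform x y" using cosh_hyp_dist assms by (simp add: r_def)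
  have xx: "mform x x = -1" "mform y y = -1" using assms by (auto simp: hyp_space_def)
  have "mform x (geo_dir x y) = 0" unfolding geo_dir_def r_def[symmetric]
    by (simp add: mform_simps xx c)
  moreover have "mform (geo_dir x y) (geo_dir x y) = 1"
  proof -
    have "(sinh r)\<^sup>2 = (mform x y)\<^sup>2 - 1" using cosh_sq_real[of r] c by simp
    then show ?thesis unfolding geo_dir_def r_def[symmetric] using r
      by (simp add: mform_simps xx c mform_commute[of y x] divide_simps power2_eq_square) (metis diff_self mult_eq_0_iff less_irrefl sinh_real_zero_iff)
  qed
  ultimately show "(x, geo_dir x y) \<in> hyp_unit_tangent"
    using assms by (simp add: hyp_unit_tangent_def)
  show "y = geo_point x (geo_dir x y) (hyp_dist x y)"
    unfolding geo_dir_def geo_point_def r_def[symmetric] using r by simp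
qed

text \<open>The direction towards any other point serves: either the auxiliary point
  \<open>z\<close> at distance 1 from the origin differs from \<open>x\<close>, or \<open>x\<close>
  is \<open>z\<close> and the origin is the other point.\<close>

lemma exists_unit_tangent:
  assumes "(x :: 'n::finite mink) \<in> hyp_space" obtains v where "(x, v) \<in> hyp_unit_tangent"
proof -
  obtain y :: "'n mink" where y: "y \<in> hyp_space" "0 < hyp_dist x y"
  proof -
    obtain i :: 'n where True by simp
    define e :: "'n mink" where "e = axis (Some i) 1"
    have e: "mform e e = 1" "e $ None = 0" by (auto simp: e_def mform_eq_inner inner_axis') (auto simp: axis_def)
    have oe: "(origin, e) \<in> hyp_unit_tangent"
      using e origin_in_hyp_space unfolding hyp_unit_tangent_def
      by (simp add: mform_eq_inner) (simp add: origin_def inner_axis' e_def)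
    define z where "z = geo_point origin e 1"
    have z: "z \<in> hyp_space" "hyp_dist origin z = 1"
      using geo_point_in_hyp_space[OF oe] hyp_dist_geo_point_0[OF oe] by (simp_all add: z_def)
    show thesis
    proof (cases "0 < hyp_dist x z")
      case True then show ?thesis using that z by blast
    next
      case False
      then have xz: "hyp_dist x z = 0" using hyp_dist_nonneg[OF assms z(1)] by linarith
      have "x = z"
      proof -
        define u where "u = z - x"
        have c: "mform x z = -1" using cosh_hyp_dist[OF assms z(1)] xz by simp
        have xx: "mform x x = -1" "mform z z = -1" using assms z by (auto simp: hyp_space_def)
        have "mform x u = 0" "mform u u = 0" unfolding u_def using c xx mform_commute[of x z]
          by (simp_all add: mform_simps)
        then have "(norm u)\<^sup>2 \<le> 0" using norm_sq_le_mform_perp[OF assms, of u] by simp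
        then show ?thesis by (simp add: u_def)
      qed
      then show ?thesis using that[of origin] z by (simp add: hyp_dist_commute)
    qed
  qed
  then show thesis using that geo_dir_props(1)[OF assms y] by blast
qed

lemma hyp_dist_eq_0_iff:
  assumes "x \<in> hyp_space" "y \<in> hyp_space"
  shows "hyp_dist x y = 0 \<longleftrightarrow> x = y"
proof
  assume xy: "hyp_dist x y = 0"
  define u where "u = y - x"
  have c: "mform x y = -1" using cosh_hyp_dist[OF assms] xy by simp
  have xx: "mform x x = -1" "mform y y = -1" using assms by (auto simp: hyp_space_def)
  have "mform x u = 0" "mform u u = 0" unfolding u_def using c xx mform_commute[of x y]
    by (simp_all add: mform_simps)
  then have "(norm u)\<^sup>2 \<le> 0" using norm_sq_le_mform_perp[OF assms(1), of u] by simp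
  then show "x = y" by (simp add: u_def)
qed (use assms in auto)

lemma exists_geo_point:
  assumes "x \<in> hyp_space" "y \<in> hyp_space"
  obtains v where "(x, v) \<in> hyp_unit_tangent" "y = geo_point x v (hyp_dist x y)"
proof (cases "0 < hyp_dist x y")
  case True then show ?thesis using that geo_dir_props[OF assms] by blast
next
  case False
  then have "hyp_dist x y = 0" using hyp_dist_nonneg[OF assms] by linarith
  moreover from this have "x = y" using hyp_dist_eq_0_iff assms by blast
  ultimately show ?thesis using exists_unit_tangent[OF assms(1)] that by (metis geo_point_0)
qed

text \<open>The angle at \<open>y\<close> is at most a straight angle: bounding
  \<open>half_sin_sq\<close> by 1 in the law of cosines turns its right-hand side into the addition
  formula for \<open>cosh (a + b)\<close>.\<close>

lemma hyp_dist_triangle: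
  assumes "x \<in> hyp_space" "y \<in> hyp_space" "z \<in> hyp_space"
  shows "hyp_dist x z \<le> hyp_dist x y + hyp_dist y z"
proof -
  obtain v where v: "(y, v) \<in> hyp_unit_tangent" "x = geo_point y v (hyp_dist y x)"
    using exists_geo_point assms by blast
  obtain w where w: "(y, w) \<in> hyp_unit_tangent" "z = geo_point y w (hyp_dist y z)"
    using exists_geo_point assms by blast
  define a b where "a = hyp_dist y x" and "b = hyp_dist y z"
  have ab: "0 \<le> a" "0 \<le> b" using assms by (auto simp: a_def b_def)
  have "cosh (hyp_dist x z) = cosh (a - b) + 2 * sinh a * sinh b * half_sin_sq v w"
    using hyperbolic_law_of_cosines[OF v(1) w(1), of a b] v(2) w(2) by (simp add: a_def b_def)
  also have "\<dots> \<le> cosh (a - b) + 2 * sinh a * sinh b * 1"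
    using half_sin_sq_le_1[OF v(1) w(1)] ab by (intro add_left_mono mult_left_mono) auto
  also have "\<dots> = cosh (a + b)" by (simp add: cosh_add cosh_diff)
  finally have "hyp_dist x z \<le> a + b"
    using ab assms cosh_real_nonneg_le_iff[of "hyp_dist x z" "a + b"] by simp
  then show ?thesis by (simp add: a_def b_def hyp_dist_commute)
qed

text \<open>The equal-time law of cosines after halving the distance. Read forwards it is the
  exponential divergence of geodesics from a common point; read backwards, with that point at the
  far end, it is the contraction behind thin triangles.\<close>

lemma hyp_dist_same_time:
  assumes "(x, v) \<in> hyp_unit_tangent" "(x, w) \<in> hyp_unit_tangent"
  shows "sinh (hyp_dist (geo_point x v s) (geo_point x w s) / 2) = \<bar>sinh s\<bar> * sqrt (half_sin_sq v w)"
proof -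
  define d where "d = hyp_dist (geo_point x v s) (geo_point x w s)"
  have d0: "0 \<le> d" unfolding d_def using geo_point_in_hyp_space assms by (intro hyp_dist_nonneg) blast+
  have "cosh d = 1 + 2 * (sinh (d/2))\<^sup>2"
    using cosh_double[of "d/2"] cosh_sq_real[of "d/2"] by simp
  then have "(sinh (d/2))\<^sup>2 = (sinh s)\<^sup>2 * half_sin_sq v w"
    using hyperbolic_law_of_cosines[OF assms, of s s] by (simp add: d_def power2_eq_square)
  then have "sqrt ((sinh (d/2))\<^sup>2) = sqrt ((sinh s)\<^sup>2 * half_sin_sq v w)" by simp
  then show ?thesis using d0 by (simp add: real_sqrt_mult d_def)
qed

lemma real_le_sinh: assumes "0 \<le> (t :: real)" shows "t \<le> sinh t"
  
proof (rule DERIV_nonneg_imp_nondecreasing[of 0 t "\<lambda>t. sinh t - t", simplified])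
  show "0 \<le> t" by fact
  fix u :: real
  show "\<exists>y. ((\<lambda>t. sinh t - t) has_real_derivative y) (at u) \<and> 0 \<le> y"
    by (rule exI[of _ "cosh u - 1"]) (auto intro!: derivative_eq_intros simp: cosh_real_ge_1)
qed

lemma hyp_dist_same_time_le:
  assumes "(x, v) \<in> hyp_unit_tangent" "(x, w) \<in> hyp_unit_tangent"
  shows "hyp_dist (geo_point x v s) (geo_point x w s) \<le> 2 * \<bar>sinh s\<bar> * sqrt (half_sin_sq v w)"
  using real_le_sinh[of "hyp_dist (geo_point x v s) (geo_point x w s) / 2"]
    hyp_dist_same_time[OF assms, of s] geo_point_in_hyp_space[OF assms(1)] geo_point_in_hyp_space[OF assms(2)]
  by simp

lemma hyp_dist_diff_le:
  assumes "(x, v) \<in> hyp_unit_tangent" "(x, w) \<in> hyp_unit_tangent" "0 \<le> s" "0 \<le> t"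
  shows "\<bar>s - t\<bar> \<le> hyp_dist (geo_point x v s) (geo_point x w t)"
proof -
  have "cosh \<bar>s - t\<bar> \<le> cosh (hyp_dist (geo_point x v s) (geo_point x w t))"
    unfolding hyperbolic_law_of_cosines[OF assms(1,2)]
    using half_sin_sq_nonneg[OF assms(1,2)] assms(3,4) by simp
  moreover have "0 \<le> hyp_dist (geo_point x v s) (geo_point x w t)"
    using geo_point_in_hyp_space assms by (intro hyp_dist_nonneg) blast+
  ultimately show ?thesis
    using cosh_real_nonneg_le_iff[of "\<bar>s - t\<bar>" "hyp_dist (geo_point x v s) (geo_point x w t)"] by simp
qed

section \<open>Thin triangles and integrals along geodesics\<close>

lemma sinh_diff_le: fixes l t :: real assumes "0 \<le> t" shows "sinh (l - t) \<le> exp (- t) * sinh l"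
proof -
  have "exp (- t - l) \<le> exp (t - l)" using assms by simp
  then show ?thesis by (simp add: sinh_field_def right_diff_distrib mult_exp_exp diff_divide_distrib)
qed

lemma sinh_le_exp: "sinh t \<le> exp t" for t :: real
proof -
  have "0 < exp t" "0 < exp (- t)" by simp_all
  then show ?thesis unfolding sinh_field_def by argo
qed

lemma cosh_le_exp: assumes "0 \<le> (t :: real)" shows "cosh t \<le> exp t"
proof -
  have "exp (- t) \<le> exp t" using assms by simp
  then show ?thesis unfolding cosh_field_def by argo
qed

lemma exp_le_sinh: assumes "1 \<le> (t :: real)" shows "exp t / 4 \<le> sinh t"
proof -
  have "2 * exp (- t) \<le> exp 1 * exp (- t)" using exp_ge_add_one_self[of 1] by (intro mult_right_mono) auto
  also have "\<dots> \<le> exp t" using assms by (simp add: mult_exp_exp)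
  finally show ?thesis unfolding sinh_field_def by argo
qed

text \<open>Both sides are viewed from the common end \<open>z\<close>, where they are geodesics
  from one point. At distance \<open>l\<close> from \<open>z\<close> they are at most
  \<open>2 * m\<close> apart, and running towards \<open>z\<close> for time \<open>t\<close>
  contracts this by \<open>exp (- t)\<close>, since \<open>sinh (l - t)\<close> is at most that
  multiple of \<open>sinh l\<close>.\<close>

lemma thin_triangle_close:
  assumes "(x, v) \<in> hyp_unit_tangent" "y \<in> hyp_space" "hyp_dist x y \<le> m" "m \<le> t" "t \<le> l"
  obtains w s where "(y, w) \<in> hyp_unit_tangent"
    "geo_point x v l = geo_point y w (hyp_dist y (geo_point x v l))"
    "0 \<le> s" "s \<le> hyp_dist y (geo_point x v l)"
    "hyp_dist (geo_point x v t) (geo_point y w s) \<le> 2 * exp (m - t)"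
proof -
  define z where "z = geo_point x v l"
  have x: "x \<in> hyp_space" using hyp_unit_tangentD[OF assms(1)] by simp
  have z: "z \<in> hyp_space" using geo_point_in_hyp_space[OF assms(1)] by (simp add: z_def)
  have m: "0 \<le> m" using hyp_dist_nonneg[OF x assms(2)] assms(3) by linarith
  define a where "a = - geo_vel x v l"
  have za: "(z, a) \<in> hyp_unit_tangent" unfolding z_def a_def
    by (intro tangent_uminus geo_flow_in_tangent assms)
  have rev: "geo_point x v r = geo_point z a (l - r)" for r
    unfolding z_def a_def geo_point_reverse by simp
  obtain b where b: "(z, b) \<in> hyp_unit_tangent" "y = geo_point z b (hyp_dist z y)"
    using exists_geo_point z assms(2) by blast
  define l2 where "l2 = hyp_dist z y"
  have l2: "0 \<le> l2" using z assms by (simp add: l2_def)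
  have xz: "x = geo_point z a l" using rev[of 0] by simp
  have dl: "\<bar>l - l2\<bar> \<le> m"
    using hyp_dist_diff_le[OF za b(1), of l l2] xz b(2) l2 m assms by (simp add: l2_def)
  define w where "w = - geo_vel z b l2"
  have yl2: "y = geo_point z b l2" using b(2) by (simp add: l2_def)
  have w: "(y, w) \<in> hyp_unit_tangent" unfolding w_def yl2
    by (intro tangent_uminus geo_flow_in_tangent b)
  have revw: "geo_point y w r = geo_point z b (l2 - r)" for r
    unfolding yl2 w_def geo_point_reverse by simp
  define q where "q = geo_point z b l"
  define \<sigma> where "\<sigma> = sqrt (half_sin_sq a b)"
  have \<sigma>: "0 \<le> \<sigma>" unfolding \<sigma>_def using half_sin_sq_nonneg[OF za b(1)] by simp
  have q: "q \<in> hyp_space" unfolding q_def by (rule geo_point_in_hyp_space[OF b(1)])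
  have "hyp_dist x q \<le> hyp_dist x y + hyp_dist y q" using hyp_dist_triangle x assms q by blast
  also have "hyp_dist y q = \<bar>l2 - l\<bar>" unfolding q_def yl2 by (rule hyp_dist_geo_point[OF b(1)])
  finally have "hyp_dist x q / 2 \<le> m" using dl assms by linarith
  then have "sinh (hyp_dist x q / 2) \<le> sinh m" by simp
  then have 1: "\<bar>sinh l\<bar> * \<sigma> \<le> sinh m"
    using hyp_dist_same_time[OF za b(1), of l] xz by (simp add: q_def \<sigma>_def)
  have l0: "0 \<le> l" using m assms by linarith
  have "sinh (l - t) * \<sigma> \<le> exp (- t) * (sinh l * \<sigma>)"
    using mult_right_mono[OF sinh_diff_le[of t l] \<sigma>] m assms by (simp add: mult.assoc)
  also have "\<dots> \<le> exp (- t) * exp m" using 1 l0 sinh_le_exp[of m] by (intro mult_left_mono) auto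
  finally have "\<bar>sinh (l - t)\<bar> * \<sigma> \<le> exp (m - t)" using assms by (simp add: mult_exp_exp)
  then have "hyp_dist (geo_point x v t) (geo_point z b (l - t)) \<le> 2 * exp (m - t)"
    unfolding rev[of t] using hyp_dist_same_time_le[OF za b(1), of "l - t"] by (simp add: \<sigma>_def)
  \<comment> \<open>The partner has parameter \<open>l2 - (l - t)\<close> from \<open>y\<close>; it
    is nonnegative because \<open>l2\<close> differs from \<open>l\<close> by at most
    \<open>m\<close>, which is at most \<open>t\<close>.\<close>
  then show thesis
    using that[OF w, of "l2 - (l - t)"] revw[of l2] revw[of "l2 - (l - t)"] dl assms
    by (simp add: z_def l2_def hyp_dist_commute)
qed

lemma almost_geodesic_angle_aux:
  assumes v: "(a, v) \<in> hyp_unit_tangent" and w: "(a, w) \<in> hyp_unit_tangent" and "0 \<le> r" "0 \<le> l"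
    and "r + hyp_dist (geo_point a v r) (geo_point a w l) \<le> l + C"
  shows "2 * (sinh r * sinh l * half_sin_sq v w) \<le> exp (l - r + C)"
proof -
  define d where "d = hyp_dist (geo_point a v r) (geo_point a w l)"
  have d: "0 \<le> d" unfolding d_def by (intro hyp_dist_nonneg geo_point_in_hyp_space[OF v] geo_point_in_hyp_space[OF w])
  have "2 * (sinh r * sinh l * half_sin_sq v w) \<le> cosh d"
    using hyperbolic_law_of_cosines[OF v w, of r l] cosh_real_pos[of "r - l"] unfolding d_def by argo
  also have "\<dots> \<le> exp d" by (rule cosh_le_exp[OF d])
  also have "\<dots> \<le> exp (l - r + C)" using assms by (simp add: d_def)
  finally show ?thesis .
qed

text \<open>Stability of geodesics: near-equality in the triangle inequality forces a small angle at
  \<open>a\<close>, so small that after time \<open>hyp_dist a p\<close> the two sides are still a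
  bounded distance apart. The minimum covers a point \<open>p\<close> that lies farther from
  \<open>a\<close> than the end of the segment.\<close>

lemma almost_geodesic_near:
  assumes w: "(a, w) \<in> hyp_unit_tangent" and "0 \<le> l" "p \<in> hyp_space" "0 \<le> C"
    and d: "hyp_dist a p + hyp_dist p (geo_point a w l) \<le> l + C"
  shows "hyp_dist p (geo_point a w (min (hyp_dist a p) l)) \<le> 2 * exp (C / 2) + C"
proof -
  define r where "r = hyp_dist a p"
  have a: "a \<in> hyp_space" using hyp_unit_tangentD[OF w] by simp
  have r: "0 \<le> r" using a assms by (simp add: r_def)
  show ?thesis
  proof (cases "r \<le> l")
    case False
    then have "hyp_dist p (geo_point a w l) \<le> C" using d by (simp add: r_def)
    moreover have "(0::real) \<le> 2 * exp (C / 2)" by simp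
    ultimately have "hyp_dist p (geo_point a w l) \<le> 2 * exp (C / 2) + C" by linarith
    then show ?thesis using False by (simp add: r_def)
  next
    case True
    obtain v where v: "(a, v) \<in> hyp_unit_tangent" "p = geo_point a v r"
      using exists_geo_point[OF a assms(3)] by (metis r_def)
    define h where "h = half_sin_sq v w"
    have h: "0 \<le> h" unfolding h_def by (rule half_sin_sq_nonneg[OF v(1) w])
    have 1: "2 * (sinh r * sinh l * h) \<le> exp (l - r + C)"
      unfolding h_def
    proof (rule almost_geodesic_angle_aux[OF v(1) w r assms(2)])
      show "r + hyp_dist (geo_point a v r) (geo_point a w l) \<le> l + C"
        unfolding v(2)[symmetric] using d by (simp only: r_def)
    qed
    have "(sinh r)\<^sup>2 * h \<le> exp C"
    proof -
      have "sinh r \<le> exp (r - l) * sinh l" using sinh_diff_le[of "l - r" l] True by simp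
      then have "sinh r * (sinh r * h) \<le> (exp (r - l) * sinh l) * (sinh r * h)"
        using h r by (intro mult_right_mono) auto
      also have "\<dots> = exp (r - l) * (sinh r * sinh l * h)" by simp
      also have "\<dots> \<le> exp (r - l) * exp (l - r + C)"
      proof (intro mult_left_mono)
        have "0 \<le> sinh r * sinh l * h" using r h assms(2) by simp
        then show "sinh r * sinh l * h \<le> exp (l - r + C)" using 1 by linarith
      qed simp
      also have "\<dots> = exp C" by (simp add: mult_exp_exp)
      finally show ?thesis by (simp add: power2_eq_square mult.assoc)
    qed
    then have "sqrt ((sinh r)\<^sup>2 * h) \<le> sqrt (exp C)" by simp
    also have "sqrt (exp C) = exp (C / 2)"
      by (rule real_sqrt_unique) (simp_all add: power2_eq_square mult_exp_exp)
    finally have "\<bar>sinh r\<bar> * sqrt h \<le> exp (C / 2)" by (simp add: real_sqrt_mult)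
    then have "hyp_dist p (geo_point a w r) \<le> 2 * exp (C / 2)"
      using hyp_dist_same_time_le[OF v(1) w, of r] v(2) by (simp add: h_def)
    then show ?thesis using True assms(4) by (simp add: r_def)
  qed
qed

text \<open>The angular version of stability: a point almost on the way to another is seen in almost
  the same direction, up to order \<open>exp (- r)\<close> in angle. The exponent has slack beyond
  the law of cosines so that short sides, where \<open>sinh\<close> and \<open>exp\<close> are not
  comparable, are covered by the trivial bound 1.\<close>

lemma almost_geodesic_angle:
  assumes v: "(a, v) \<in> hyp_unit_tangent" and w: "(a, w) \<in> hyp_unit_tangent" and "0 \<le> r" "0 \<le> l" "0 \<le> C"
    and d: "r + hyp_dist (geo_point a v r) (geo_point a w l) \<le> l + C"
  shows "half_sin_sq v w \<le> 8 * exp (2 + 2 * C - 2 * r)"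
proof (cases "1 \<le> r \<and> 1 \<le> l")
  case True
  define h where "h = half_sin_sq v w"
  have h: "0 \<le> h" unfolding h_def by (rule half_sin_sq_nonneg[OF v w])
  have "exp (r + l) / 16 * h \<le> sinh r * sinh l * h"
    using mult_mono[OF exp_le_sinh[of r] exp_le_sinh[of l]] True h
    by (intro mult_right_mono) (auto simp: exp_add)
  also have "2 * \<dots> \<le> exp (l - r + C)"
    unfolding h_def using almost_geodesic_angle_aux[OF v w] assms by blast
  finally have "exp (r + l) * h \<le> 8 * exp (l - r + C)" by (simp add: mult.commute)
  moreover have "exp (l - r + C) = exp (r + l) * exp (C - 2 * r)" unfolding mult_exp_exp by simp
  ultimately have "exp (r + l) * h \<le> exp (r + l) * (8 * exp (C - 2 * r))" by (simp only: mult.left_commute)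
  then have "h \<le> 8 * exp (C - 2 * r)" by (simp only: mult_le_cancel_left_pos exp_gt_zero)
  also have "\<dots> \<le> 8 * exp (2 + 2 * C - 2 * r)" using assms by simp
  finally show ?thesis by (simp add: h_def)
next
  case False
  have "r \<le> l + C"
  proof -
    have "0 \<le> hyp_dist (geo_point a v r) (geo_point a w l)"
      by (intro hyp_dist_nonneg geo_point_in_hyp_space[OF v] geo_point_in_hyp_space[OF w])
    then show ?thesis using d by linarith
  qed
  then have "r \<le> 1 + C" using False assms by auto
  then have "1 \<le> exp (2 + 2 * C - 2 * r)" by simp
  then show ?thesis using half_sin_sq_le_1[OF v w] by linarith
qed

text \<open>A lower bound on the angle makes the triangle a tripod whose centre is within about
  \<open>k\<close> of \<open>x\<close>. The constant 3 absorbs the numerical factor 8, which is at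
  most \<open>exp 3\<close>, and also covers times below 1.\<close>

lemma wide_angle_dist:
  assumes v: "(x, v) \<in> hyp_unit_tangent" and w: "(x, w) \<in> hyp_unit_tangent" and "0 \<le> s" "0 \<le> t" "0 \<le> k"
    and h: "exp (- 2 * k) \<le> half_sin_sq v w"
  shows "s + t - 2 * k - 3 \<le> hyp_dist (geo_point x v s) (geo_point x w t)"
proof (cases "1 \<le> s \<and> 1 \<le> t")
  case True
  define d where "d = hyp_dist (geo_point x v s) (geo_point x w t)"
  have d: "0 \<le> d" unfolding d_def by (intro hyp_dist_nonneg geo_point_in_hyp_space[OF v] geo_point_in_hyp_space[OF w])
  have "exp (s + t) / 16 * exp (- 2 * k) \<le> sinh s * sinh t * half_sin_sq v w"
    using mult_mono[OF exp_le_sinh[of s] exp_le_sinh[of t]] True h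
    by (intro mult_mono) (auto simp: exp_add)
  also have "2 * \<dots> \<le> cosh d"
    using hyperbolic_law_of_cosines[OF v w, of s t] cosh_real_pos[of "s - t"] unfolding d_def by argo
  also have "\<dots> \<le> exp d" by (rule cosh_le_exp[OF d])
  finally have 1: "exp (s + t - 2 * k) \<le> 8 * exp d" by (simp add: mult_exp_exp)
  have "exp (3::real) = exp 1 * exp 1 * exp 1" by (simp add: mult_exp_exp)
  moreover have "2 \<le> exp (1::real)" using exp_ge_add_one_self[of 1] by simp
  ultimately have "8 \<le> exp (3::real)"
    using mult_mono[of 2 "exp (1::real)" 2 "exp 1"] mult_mono[of 4 "exp (1::real) * exp 1" 2 "exp 1"] by simp
  then have "exp (s + t - 2 * k) \<le> exp (3 + d)" using 1 by (simp add: exp_add) (meson exp_ge_zero mult_right_mono order_trans)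
  then show ?thesis by (simp add: d_def)
next
  case False
  have "\<bar>s - t\<bar> \<le> hyp_dist (geo_point x v s) (geo_point x w t)"
    by (rule hyp_dist_diff_le[OF v w assms(3,4)])
  then show ?thesis using False assms by linarith
qed

section \<open>The Gaussian-averaged distance between unit tangent vectors\<close>

definition gauss_const :: real where
  "gauss_const = (1 / sqrt pi) * (\<integral>t. 2 * exp (\<bar>t\<bar> - t\<^sup>2) \<partial>lborel)"

lemma integrable_gauss_exp: "integrable lborel (\<lambda>t::real. exp (\<bar>t\<bar> - t\<^sup>2))"
  and integral_gauss: "(\<integral>t. exp (- (t\<^sup>2)) \<partial>lborel) = sqrt pi"
proof -
  have e: "normal_density 0 (1 / sqrt 2) = (\<lambda>t. exp (- (t\<^sup>2)) / sqrt pi)"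
    by (auto simp: normal_density_def fun_eq_iff power_divide)
  have "(\<integral>t. exp (- (t\<^sup>2)) / sqrt pi \<partial>lborel) = 1"
  proof -
    have "0 < 1 / sqrt (2::real)" by simp
    from integral_normal_density[OF this, of 0] show ?thesis unfolding e .
  qed
  then have "(\<integral>t. exp (- (t\<^sup>2)) \<partial>lborel) / sqrt pi = 1" by (simp only: integral_divide_zero)
  then show "(\<integral>t. exp (- (t\<^sup>2)) \<partial>lborel) = sqrt pi" by (metis divide_eq_1_iff)
  have "integrable lborel (\<lambda>t. std_normal_density t)" by simp
  then have "integrable lborel (\<lambda>t::real. (1 / sqrt (2 * pi)) * exp (- t\<^sup>2 / 2))"
    by (simp only: std_normal_density_def)
  then have "integrable lborel (\<lambda>t::real. (exp 1 * sqrt (2 * pi)) * ((1 / sqrt (2 * pi)) * exp (- t\<^sup>2 / 2)))"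
    by (rule integrable_mult_right)
  then have g2: "integrable lborel (\<lambda>t::real. exp 1 * exp (- t\<^sup>2 / 2))" by simp
  \<comment> \<open>Completing the square dominates the integrand by a multiple of the standard
    normal density.\<close>
  show "integrable lborel (\<lambda>t::real. exp (\<bar>t\<bar> - t\<^sup>2))"
  proof (rule Bochner_Integration.integrable_bound[OF g2])
    show "AE t in lborel. norm (exp (\<bar>t\<bar> - t\<^sup>2)) \<le> norm (exp 1 * exp (- t\<^sup>2 / 2) :: real)"
    proof (intro AE_I2)
      fix t :: real
      have "0 \<le> (\<bar>t\<bar> - 1)\<^sup>2" by simp
      then have "\<bar>t\<bar> - t\<^sup>2 \<le> 1 + - t\<^sup>2 / 2" by (simp add: power2_eq_square algebra_simps)
      then have "exp (\<bar>t\<bar> - t\<^sup>2) \<le> exp (1 + - t\<^sup>2 / 2)" by (simp only: exp_le_cancel_iff)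
      then show "norm (exp (\<bar>t\<bar> - t\<^sup>2)) \<le> norm (exp 1 * exp (- t\<^sup>2 / 2) :: real)"
        by (simp only: exp_add real_norm_def abs_exp_cancel abs_mult)
    qed
  qed measurable
qed

lemma gauss_const_nonneg: "0 \<le> gauss_const"
  unfolding gauss_const_def by (intro mult_nonneg_nonneg integral_nonneg_AE) auto

lemma tangent_dist_le:
  assumes "\<And>t. hyp_dist (fst (geo_flow t u)) (fst (geo_flow t w)) \<le> c * exp \<bar>t\<bar>" "0 \<le> c"
  shows "tangent_dist u w \<le> c * gauss_const"
proof -
  have "(\<integral>t. hyp_dist (fst (geo_flow t u)) (fst (geo_flow t w)) * exp (- (t\<^sup>2)) \<partial>lborel)
      \<le> (\<integral>t. c * (2 * exp (\<bar>t\<bar> - t\<^sup>2)) \<partial>lborel)"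
  proof (rule integral_mono')
    fix t :: real
    have "hyp_dist (fst (geo_flow t u)) (fst (geo_flow t w)) * exp (- (t\<^sup>2)) \<le> c * exp \<bar>t\<bar> * exp (- (t\<^sup>2))"
      by (intro mult_right_mono assms) simp
    also have "\<dots> = c * exp (\<bar>t\<bar> - t\<^sup>2)" by (simp add: exp_diff exp_minus field_simps)
    also have "\<dots> \<le> c * (2 * exp (\<bar>t\<bar> - t\<^sup>2))" using assms(2) by (intro mult_left_mono) auto
    finally show "hyp_dist (fst (geo_flow t u)) (fst (geo_flow t w)) * exp (- (t\<^sup>2)) \<le> c * (2 * exp (\<bar>t\<bar> - t\<^sup>2))" .
  qed (use assms integrable_gauss_exp in auto)
  then have "tangent_dist u w \<le> (1 / sqrt pi) * (\<integral>t. c * (2 * exp (\<bar>t\<bar> - t\<^sup>2)) \<partial>lborel)"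
    unfolding tangent_dist_def by (intro mult_left_mono) auto
  then show ?thesis by (simp add: gauss_const_def)
qed

lemma tangent_dist_nonneg:
  assumes "u \<in> hyp_unit_tangent" "w \<in> hyp_unit_tangent"
  shows "0 \<le> tangent_dist u w"
proof -
  have "0 \<le> hyp_dist (fst (geo_flow t u)) (fst (geo_flow t w))" for t
    using assms by (cases u; cases w) (auto simp: geo_flow_eq geo_point_in_hyp_space)
  then show ?thesis unfolding tangent_dist_def
    by (intro mult_nonneg_nonneg integral_nonneg_AE) auto
qed

lemma tangent_dist_flow:
  assumes "(x, v) \<in> hyp_unit_tangent"
  shows "tangent_dist (geo_flow s (x, v)) (geo_flow s' (x, v)) = \<bar>s - s'\<bar>"
  by (simp add: tangent_dist_def geo_flow_eq geo_point_add hyp_dist_geo_point[OF assms] integral_gauss)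

text \<open>The distance at total time \<open>s + t\<close> is controlled by \<open>sinh\<close> of
  that time; splitting off \<open>exp s\<close> leaves a factor in the averaging variable that the
  Gaussian absorbs. This exponential rate is what lets Hoelder errors be integrated along
  arbitrarily long segments.\<close>

lemma tangent_dist_same_point:
  assumes v: "(x, v) \<in> hyp_unit_tangent" and w: "(x, w) \<in> hyp_unit_tangent" and "0 \<le> s"
  shows "tangent_dist (geo_flow s (x, v)) (geo_flow s (x, w))
     \<le> 2 * sqrt (half_sin_sq v w) * exp s * gauss_const"
proof (rule tangent_dist_le)
  have h: "0 \<le> half_sin_sq v w" by (rule half_sin_sq_nonneg[OF v w])
  then show "0 \<le> 2 * sqrt (half_sin_sq v w) * exp s" by simp
  fix t :: real
  have "\<bar>sinh (s + t)\<bar> = sinh \<bar>s + t\<bar>" by simp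
  also have "\<dots> \<le> exp \<bar>s + t\<bar>" by (rule sinh_le_exp)
  also have "\<dots> \<le> exp s * exp \<bar>t\<bar>" using assms(3) by (simp add: mult_exp_exp)
  finally have "2 * \<bar>sinh (s + t)\<bar> * sqrt (half_sin_sq v w) \<le> 2 * (exp s * exp \<bar>t\<bar>) * sqrt (half_sin_sq v w)"
    using h by (intro mult_right_mono) auto
  then show "hyp_dist (fst (geo_flow t (geo_flow s (x, v)))) (fst (geo_flow t (geo_flow s (x, w))))
      \<le> 2 * sqrt (half_sin_sq v w) * exp s * exp \<bar>t\<bar>"
    using hyp_dist_same_time_le[OF v w, of "s + t"] by (simp add: geo_flow_eq geo_point_add mult_ac)
qed

text \<open>Coarse on purpose: it serves to show that a Hoelder potential grows at most linearly
  with the distance from the orbit.\<close>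

lemma tangent_dist_base:
  assumes v: "(x, v) \<in> hyp_unit_tangent" and w: "(y, w) \<in> hyp_unit_tangent"
  shows "tangent_dist (x, v) (y, w) \<le> (2 + hyp_dist x y) * gauss_const"
proof (rule tangent_dist_le)
  note vx = hyp_unit_tangentD(1)[OF v] and wy = hyp_unit_tangentD(1)[OF w]
  have d: "0 \<le> hyp_dist x y" by (rule hyp_dist_nonneg[OF vx wy])
  then show "0 \<le> 2 + hyp_dist x y" by simp
  fix t :: real
  have p: "geo_point x v t \<in> hyp_space" "geo_point y w t \<in> hyp_space"
    by (intro geo_point_in_hyp_space v w)+
  have "hyp_dist (geo_point x v t) (geo_point y w t) \<le> \<bar>t\<bar> + (hyp_dist x y + \<bar>t\<bar>)"
    using hyp_dist_triangle[OF p(1) vx p(2)] hyp_dist_triangle[OF vx wy p(2)]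
      hyp_dist_geo_point[OF v, of t 0] hyp_dist_geo_point[OF w, of 0 t] by simp
  also have "\<dots> \<le> (2 + hyp_dist x y) * (1 + \<bar>t\<bar>)" using d by (simp add: algebra_simps)
  also have "\<dots> \<le> (2 + hyp_dist x y) * exp \<bar>t\<bar>"
    using d exp_ge_add_one_self[of "\<bar>t\<bar>"] by (intro mult_left_mono) auto
  finally show "hyp_dist (fst (geo_flow t (x, v))) (fst (geo_flow t (y, w))) \<le> (2 + hyp_dist x y) * exp \<bar>t\<bar>"
    by (simp add: geo_flow_eq)
qed

text \<open>The Gaussian weight is even, so time can be reversed under the integral. Reversed
  potentials therefore keep their Hoelder constant, and estimates at one end of a segment transfer
  to the other.\<close>

lemma tangent_dist_flip:
  "tangent_dist (x, - v) (y, - w) = tangent_dist (x, v) (y, w)"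
proof -
  define f where "f t = hyp_dist (geo_point x v t) (geo_point y w t) * exp (- (t\<^sup>2))" for t
  have "(\<integral>t. f t \<partial>lborel) = (\<integral>t. f (- t) \<partial>lborel)"
    using lborel_integral_real_affine[of "-1" f 0] by simp
  then show ?thesis by (simp add: tangent_dist_def geo_flow_eq geo_point_uminus f_def)
qed

text \<open>\<open>path_integral\<close> for a function on the unit tangent bundle of hyperbolic
  space itself, so that shifted and reversed potentials are treated alike without passing to the
  quotient.\<close>

definition pint :: "('n::finite mink \<times> 'n mink \<Rightarrow> real) \<Rightarrow> 'n mink \<Rightarrow> 'n mink \<Rightarrow> real" where
  "pint \<phi> x y = integral {0..hyp_dist x y} (\<lambda>s. \<phi> (geo_flow s (x, geo_dir x y)))"

lemma pint_geo_point:
  assumes "(x, v) \<in> hyp_unit_tangent" "0 \<le> t"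
  shows "pint \<phi> x (geo_point x v t) = integral {0..t} (\<lambda>s. \<phi> (geo_flow s (x, v)))"
  using assms by (cases "t = 0") (auto simp: pint_def hyp_dist_geo_point_0 geo_dir_geo_point dest: hyp_unit_tangentD)

lemma pint_flip:
  assumes "x \<in> hyp_space" "y \<in> hyp_space"
  shows "pint (\<lambda>(p, v). \<phi> (p, - v)) x y = pint \<phi> y x"
proof -
  obtain v where v: "(y, v) \<in> hyp_unit_tangent" "x = geo_point y v (hyp_dist y x)"
    using exists_geo_point assms by blast
  define l where "l = hyp_dist y x"
  have l: "0 \<le> l" using assms by (simp add: l_def)
  define w where "w = - geo_vel y v l"
  have xl: "x = geo_point y v l" using v by (simp add: l_def)
  have w: "(x, w) \<in> hyp_unit_tangent" unfolding w_def xl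
    by (intro tangent_uminus geo_flow_in_tangent v)
  have fl: "geo_flow s (x, w) = (geo_point y v (l - s), - geo_vel y v (l - s))" for s
    unfolding geo_flow_eq xl w_def geo_point_reverse geo_vel_reverse by simp
  have yl: "y = geo_point x w l" using arg_cong[OF fl[of l], of fst] by (simp add: geo_flow_eq)
  have "pint (\<lambda>(p, v). \<phi> (p, - v)) x y = integral {0..l} (\<lambda>s. \<phi> (geo_flow (l - s) (y, v)))"
    unfolding yl pint_geo_point[OF w l] fl by (simp add: geo_flow_eq)
  also have "\<dots> = integral {0..l} (\<lambda>s. \<phi> (geo_flow s (y, v)))"
  proof -
    have "integral {-0 - l .. - 0} (\<lambda>s. \<phi> (geo_flow (l - (- s)) (y, v))) = integral {0..l} (\<lambda>s. \<phi> (geo_flow (l - s) (y, v)))"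
      using Henstock_Kurzweil_Integration.integral_reflect_real[of l 0 "\<lambda>s. \<phi> (geo_flow (l - s) (y, v))"] by simp
    moreover have "integral {- l .. 0} (\<lambda>s. \<phi> (geo_flow (l + s) (y, v))) = integral {0..l} (\<lambda>s. \<phi> (geo_flow s (y, v)))"
      using integral_shift_real_ivl[of 0 "l" l "\<lambda>s. \<phi> (geo_flow s (y, v))"] by (simp add: add.commute)
    ultimately show ?thesis by simp
  qed
  also have "\<dots> = pint \<phi> y x" unfolding xl pint_geo_point[OF v(1) l] ..
  finally show ?thesis .
qed

section \<open>Hoelder potentials\<close>

lemma sinh_le_mult_exp: assumes "0 \<le> (r :: real)" shows "sinh r \<le> r * exp r"
proof -
  have "1 - exp (- 2 * r) \<le> 2 * r" using exp_ge_add_one_self[of "- 2 * r"] by simp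
  then have "exp r * (1 - exp (- 2 * r)) \<le> exp r * (2 * r)" by (intro mult_left_mono) auto
  then show ?thesis by (simp add: sinh_field_def right_diff_distrib mult_exp_exp mult_ac)
qed

lemma exp_minus_one_le: "exp y - 1 \<le> y * exp y" for y :: real
proof -
  have "1 - y \<le> exp (- y)" using exp_ge_add_one_self[of "- y"] by simp
  then have "exp y * (1 - y) \<le> exp y * exp (- y)" by (intro mult_left_mono) auto
  then show ?thesis by (simp add: algebra_simps mult_exp_exp)
qed

lemma exp_one_le_3: "exp 1 \<le> (3 :: real)"
  using exp_le by simp

text \<open>The left side is the integral of \<open>(\<sigma> * exp s) powr \<alpha>\<close> over a
  segment of length \<open>l\<close>: exponential growth makes it comparable to its final value, so
  \<open>l\<close> disappears from the bound. Segments of length at most 1 are separate because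
  there \<open>sinh l\<close> is comparable to \<open>l\<close>, not to
  \<open>exp l\<close>.\<close>

lemma holder_integral_bound:
  fixes \<sigma> l r \<alpha> :: real
  assumes "0 < \<alpha>" "\<alpha> \<le> 1" "0 \<le> \<sigma>" "0 \<le> l" "sinh l * \<sigma> \<le> r"
  shows "\<sigma> powr \<alpha> * ((exp (\<alpha> * l) - 1) / \<alpha>) \<le> 4 / \<alpha> * r powr \<alpha>"
proof -
  have r: "0 \<le> r" using assms by (meson mult_nonneg_nonneg order_trans sinh_real_nonneg_iff)
  show ?thesis
  proof (cases "l \<le> 1")
    case True
    have "(exp (\<alpha> * l) - 1) / \<alpha> \<le> 3 * l"
    proof -
      have "exp (\<alpha> * l) \<le> exp 1" using assms True by (simp add: mult_le_one)
      then have "exp (\<alpha> * l) \<le> 3" using exp_one_le_3 by linarith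
      then have "\<alpha> * l * exp (\<alpha> * l) \<le> \<alpha> * l * 3" using assms by (intro mult_left_mono) auto
      then have "exp (\<alpha> * l) - 1 \<le> \<alpha> * (3 * l)" using exp_minus_one_le[of "\<alpha> * l"] by linarith
      then show ?thesis using assms by (simp add: divide_le_eq mult.commute)
    qed
    then have "\<sigma> powr \<alpha> * ((exp (\<alpha> * l) - 1) / \<alpha>) \<le> \<sigma> powr \<alpha> * (3 * l)"
      by (intro mult_left_mono) auto
    also have "l \<le> l powr \<alpha>"
      using powr_mono'[of \<alpha> 1 l] assms True by simp
    then have "\<sigma> powr \<alpha> * (3 * l) \<le> \<sigma> powr \<alpha> * (3 * l powr \<alpha>)"
      by (intro mult_left_mono) auto
    also have "\<dots> = 3 * (l * \<sigma>) powr \<alpha>" using assms by (simp add: powr_mult)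
    also have "\<dots> \<le> 3 * r powr \<alpha>"
    proof (intro mult_left_mono powr_mono2)
      show "l * \<sigma> \<le> r" using mult_right_mono[OF real_le_sinh[OF assms(4)] assms(3)] assms by linarith
    qed (use assms in auto)
    also have "\<dots> \<le> 4 / \<alpha> * r powr \<alpha>"
      using assms by (intro mult_right_mono) (auto simp: field_simps)
    finally show ?thesis .
  next
    case False
    have "\<sigma> powr \<alpha> * ((exp (\<alpha> * l) - 1) / \<alpha>) \<le> \<sigma> powr \<alpha> * (exp (\<alpha> * l) / \<alpha>)"
      using assms by (intro mult_left_mono divide_right_mono) auto
    also have "\<sigma> powr \<alpha> * (exp (\<alpha> * l) / \<alpha>) = (exp l * \<sigma>) powr \<alpha> / \<alpha>"
      using assms by (simp add: powr_mult powr_def[of "exp l"])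
    also have "\<dots> \<le> (4 * r) powr \<alpha> / \<alpha>"
    proof (intro divide_right_mono powr_mono2)
      have "exp l * \<sigma> \<le> 4 * sinh l * \<sigma>"
        using exp_le_sinh[of l] False assms by (intro mult_right_mono) auto
      then show "exp l * \<sigma> \<le> 4 * r" using assms by linarith
    qed (use assms in auto)
    also have "\<dots> = 4 powr \<alpha> * r powr \<alpha> / \<alpha>" using r by (simp add: powr_mult)
    also have "\<dots> \<le> 4 * r powr \<alpha> / \<alpha>"
      using powr_mono[of \<alpha> 1 "4::real"] assms by (intro divide_right_mono mult_right_mono) auto
    finally show ?thesis by simp
  qed
qed

text \<open>\<open>Orb\<close> will be the orbit of the base point. Linear growth from any of its
  points takes the place of boundedness, which can fail over a noncompact quotient.\<close>

locale hyp_potential =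
  fixes \<phi> :: "'n::finite mink \<times> 'n mink \<Rightarrow> real" and K \<alpha> :: real and Orb :: "'n mink set" and B :: real
  assumes K_nonneg: "0 \<le> K" and alpha: "0 < \<alpha>" "\<alpha> \<le> 1" and B_nonneg: "0 \<le> B"
    and holder: "u \<in> hyp_unit_tangent \<Longrightarrow> w \<in> hyp_unit_tangent \<Longrightarrow> \<bar>\<phi> u - \<phi> w\<bar> \<le> K * tangent_dist u w powr \<alpha>"
    and Orb: "Orb \<subseteq> hyp_space"
    and growth: "u \<in> hyp_unit_tangent \<Longrightarrow> b \<in> Orb \<Longrightarrow> \<bar>\<phi> u\<bar> \<le> B * (1 + hyp_dist b (fst u))"
begin

lemma flip_potential: "hyp_potential (\<lambda>(p, v). \<phi> (p, - v)) K \<alpha> Orb B"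
proof
  fix u w :: "'n mink \<times> 'n mink" assume u: "u \<in> hyp_unit_tangent" and w: "w \<in> hyp_unit_tangent"
  show "\<bar>(case u of (p, v) \<Rightarrow> \<phi> (p, - v)) - (case w of (p, v) \<Rightarrow> \<phi> (p, - v))\<bar> \<le> K * tangent_dist u w powr \<alpha>"
    using holder[of "(fst u, - snd u)" "(fst w, - snd w)"] u w tangent_dist_flip[of "fst u" "snd u" "fst w" "snd w"]
    by (cases u; cases w) (auto simp: tangent_uminus)
next
  fix u :: "'n mink \<times> 'n mink" and b assume "u \<in> hyp_unit_tangent" "b \<in> Orb"
  then show "\<bar>case u of (p, v) \<Rightarrow> \<phi> (p, - v)\<bar> \<le> B * (1 + hyp_dist b (fst u))"
    using growth[of "(fst u, - snd u)" b] by (cases u) (auto simp: tangent_uminus)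
qed (use K_nonneg alpha B_nonneg Orb in auto)

lemma continuous_on_flow:
  assumes "(x, v) \<in> hyp_unit_tangent"
  shows "continuous_on A (\<lambda>s. \<phi> (geo_flow s (x, v)))"
proof -
  have "((\<lambda>s. \<phi> (geo_flow s (x, v))) \<longlongrightarrow> \<phi> (geo_flow a (x, v))) (at a)" for a
  proof (rule LIM_zero_cancel, rule Lim_null_comparison)
    have "\<bar>\<phi> (geo_flow s (x, v)) - \<phi> (geo_flow a (x, v))\<bar> \<le> K * \<bar>s - a\<bar> powr \<alpha>" for s
      using holder[of "geo_flow s (x, v)" "geo_flow a (x, v)"] geo_flow_in_tangent[OF assms]
      by (simp add: tangent_dist_flow[OF assms]) (simp add: geo_flow_eq)
    then show "\<forall>\<^sub>F s in at a. norm (\<phi> (geo_flow s (x, v)) - \<phi> (geo_flow a (x, v))) \<le> K * \<bar>s - a\<bar> powr \<alpha>"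
      by simp
    have "((\<lambda>s. \<bar>s - a\<bar> powr \<alpha>) \<longlongrightarrow> 0) (at a)"
      using alpha by (intro tendsto_zero_powrI[of _ _ _ \<alpha>] tendsto_eq_intros) auto
    then show "((\<lambda>s. K * \<bar>s - a\<bar> powr \<alpha>) \<longlongrightarrow> 0) (at a)" by (rule tendsto_mult_right_zero)
  qed
  then show ?thesis by (intro continuous_at_imp_continuous_on) (auto simp: isCont_def)
qed

lemma integrable_flow:
  assumes "(x, v) \<in> hyp_unit_tangent"
  shows "(\<lambda>s. \<phi> (geo_flow s (x, v))) integrable_on {a..b}"
  by (intro integrable_continuous_real continuous_on_flow assms)

lemma pint_split:
  assumes v: "(x, v) \<in> hyp_unit_tangent" and "0 \<le> t" "t \<le> s"
  shows "pint \<phi> x (geo_point x v s) = pint \<phi> x (geo_point x v t) + pint \<phi> (geo_point x v t) (geo_point x v s)"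
proof -
  let ?f = "\<lambda>s. \<phi> (geo_flow s (x, v))"
  have "geo_point x v s = geo_point (geo_point x v t) (geo_vel x v t) (s - t)"
    by (simp add: geo_point_add)
  then have "pint \<phi> (geo_point x v t) (geo_point x v s) = integral {0..s - t} (\<lambda>r. \<phi> (geo_flow r (geo_point x v t, geo_vel x v t)))"
    using pint_geo_point[OF geo_flow_in_tangent[OF v], of "s - t" \<phi> t] assms by simp
  also have "\<dots> = integral {t - t..s - t} (\<lambda>r. ?f (r + t))"
    by (simp add: geo_flow_eq geo_point_add geo_vel_add add.commute)
  also have "\<dots> = integral {t..s} ?f"
    by (rule integral_shift_real_ivl)
  finally show ?thesis
    using Henstock_Kurzweil_Integration.integral_combine[OF assms(2,3) integrable_flow[OF v]] assms by (simp add: pint_geo_point)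
qed

definition holder_const :: real where "holder_const = K * (2 * gauss_const) powr \<alpha> * (4 / \<alpha>)"

lemma holder_const_nonneg: "0 \<le> holder_const"
  unfolding holder_const_def using K_nonneg alpha by simp

text \<open>Two geodesics issuing from one point separate exponentially, so the error is concentrated
  near the endpoints, where the potential is bounded by \<open>Q\<close>.\<close>

lemma pint_endpoint_aux:
  assumes v: "(x, v) \<in> hyp_unit_tangent" and w: "(x, w) \<in> hyp_unit_tangent" and l: "0 \<le> l" "l \<le> l'"
    and r: "hyp_dist (geo_point x v l) (geo_point x w l') = r"
    and Q: "\<And>u. u \<in> hyp_unit_tangent \<Longrightarrow> hyp_dist (geo_point x v l) (fst u) \<le> 2 * r \<Longrightarrow> \<bar>\<phi> u\<bar> \<le> Q"
  shows "\<bar>pint \<phi> x (geo_point x v l) - pint \<phi> x (geo_point x w l')\<bar> \<le> holder_const * sinh r powr \<alpha> + Q * r"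
proof -
  define p p' where "p = geo_point x v l" and "p' = geo_point x w l'"
  note pv = geo_point_in_hyp_space[OF v] and pw = geo_point_in_hyp_space[OF w]
  have pp: "p \<in> hyp_space" "p' \<in> hyp_space" by (simp_all add: p_def p'_def pv pw)
  have r0: "0 \<le> r" using r pp by (auto simp: p_def p'_def)
  have lr: "l' - l \<le> r" using hyp_dist_diff_le[OF v w, of l l'] l r by simp
  have Q0: "0 \<le> Q"
    using Q[OF geo_flow_in_tangent[OF v, of l]] r0 pv[of l] by simp
  define \<sigma> where "\<sigma> = sqrt (half_sin_sq v w)"
  have s0: "0 \<le> \<sigma>" unfolding \<sigma>_def using half_sin_sq_nonneg[OF v w] by simp
  \<comment> \<open>The endpoint at time \<open>l'\<close> is within \<open>r\<close> of
    \<open>p\<close> and the extra time is at most \<open>r\<close>, so at equal time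
    \<open>l\<close> the geodesics are at most \<open>2 * r\<close> apart; this bounds
    \<open>sinh l * \<sigma>\<close> in terms of \<open>r\<close> alone.\<close>
  have "hyp_dist p (geo_point x w l) \<le> 2 * r"
    using hyp_dist_triangle[OF pp(1) pp(2) pw[of l]] hyp_dist_geo_point[OF w, of l' l] r lr l
    by (simp add: p_def p'_def)
  then have "sinh (hyp_dist p (geo_point x w l) / 2) \<le> sinh r" by simp
  then have sl: "sinh l * \<sigma> \<le> sinh r"
    using hyp_dist_same_time[OF v w, of l] l by (simp add: p_def \<sigma>_def)
  let ?f = "\<lambda>s. \<phi> (geo_flow s (x, v))" and ?g = "\<lambda>s. \<phi> (geo_flow s (x, w))"
  define c where "c = K * (2 * gauss_const) powr \<alpha> * \<sigma> powr \<alpha>"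
  have c0: "0 \<le> c" unfolding c_def using K_nonneg by simp
  have I: "((\<lambda>s. c * exp (\<alpha> * s)) has_integral c * (exp (\<alpha> * l) / \<alpha>) - c * (exp (\<alpha> * 0) / \<alpha>)) {0..l}"
    using alpha by (intro fundamental_theorem_of_calculus l)
      (auto intro!: derivative_eq_intros simp flip: has_real_derivative_iff_has_vector_derivative)
  have "norm (integral {0..l} (\<lambda>s. ?f s - ?g s)) \<le> integral {0..l} (\<lambda>s. c * exp (\<alpha> * s))"
  proof (rule Henstock_Kurzweil_Integration.integral_norm_bound_integral)
    show "(\<lambda>s. ?f s - ?g s) integrable_on {0..l}"
      by (intro integrable_diff integrable_flow v w)
    show "(\<lambda>s. c * exp (\<alpha> * s)) integrable_on {0..l}" using I by blast
    fix s assume s: "s \<in> {0..l}"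
    have t: "geo_flow s (x, v) \<in> hyp_unit_tangent" "geo_flow s (x, w) \<in> hyp_unit_tangent"
      using geo_flow_in_tangent v w by (auto simp: geo_flow_eq)
    have "\<bar>?f s - ?g s\<bar> \<le> K * tangent_dist (geo_flow s (x, v)) (geo_flow s (x, w)) powr \<alpha>"
      by (intro holder t)
    also have "\<dots> \<le> K * (2 * \<sigma> * exp s * gauss_const) powr \<alpha>"
      using tangent_dist_same_point[OF v w, of s] s alpha K_nonneg tangent_dist_nonneg[OF t]
      by (intro mult_left_mono powr_mono2) (auto simp: \<sigma>_def)
    also have "2 * \<sigma> * exp s * gauss_const = (2 * gauss_const) * (\<sigma> * exp s)" by simp
    also have "K * ((2 * gauss_const) * (\<sigma> * exp s)) powr \<alpha> = c * exp (\<alpha> * s)"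
      using gauss_const_nonneg s0 by (simp add: powr_mult c_def powr_def[of "exp s"])
    finally show "norm (?f s - ?g s) \<le> c * exp (\<alpha> * s)" by simp
  qed
  also have "\<dots> = c * ((exp (\<alpha> * l) - 1) / \<alpha>)"
    using integral_unique[OF I] by (simp add: right_diff_distrib diff_divide_distrib)
  also have "\<dots> = K * (2 * gauss_const) powr \<alpha> * (\<sigma> powr \<alpha> * ((exp (\<alpha> * l) - 1) / \<alpha>))"
    by (simp add: c_def)
  also have "\<dots> \<le> K * (2 * gauss_const) powr \<alpha> * (4 / \<alpha> * sinh r powr \<alpha>)"
    using holder_integral_bound[OF alpha s0 l(1) sl] K_nonneg by (intro mult_left_mono) auto
  also have "\<dots> = holder_const * sinh r powr \<alpha>" by (simp add: holder_const_def)
  finally have 1: "\<bar>integral {0..l} ?f - integral {0..l} ?g\<bar> \<le> holder_const * sinh r powr \<alpha>"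
    using Henstock_Kurzweil_Integration.integral_diff[OF integrable_flow[OF v] integrable_flow[OF w], of 0 l] by simp
  have "norm (integral {l..l'} ?g) \<le> Q * (l' - l)"
  proof (rule integral_bound[OF l(2)])
    show "continuous_on {l..l'} ?g" by (rule continuous_on_flow[OF w])
    fix s assume s: "s \<in> {l..l'}"
    have "hyp_dist p (geo_point x w s) \<le> 2 * r"
      using hyp_dist_triangle[OF pp(1) pp(2) pw[of s]] hyp_dist_geo_point[OF w, of l' s] r lr l s
      by (simp add: p_def p'_def)
    then show "norm (?g s) \<le> Q"
      using Q[of "geo_flow s (x, w)"] geo_flow_in_tangent[OF w] by (simp add: geo_flow_eq p_def)
  qed
  also have "\<dots> \<le> Q * r" using Q0 lr by (intro mult_left_mono)
  finally have 2: "\<bar>integral {l..l'} ?g\<bar> \<le> Q * r" by simp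
  have "integral {0..l'} ?g = integral {0..l} ?g + integral {l..l'} ?g"
    using Henstock_Kurzweil_Integration.integral_combine[OF l integrable_flow[OF w]] by simp
  then show ?thesis using 1 2 l v w by (simp add: pint_geo_point)
qed

text \<open>What matters is uniformity: the constant depends neither on the common starting point
  \<open>x\<close> nor on the length of the segments. The size of the potential enters through the
  distance from \<open>p\<close> to whichever orbit point \<open>b\<close> is convenient. As the
  auxiliary estimate wants the shorter segment first, the two orders of length are treated
  apart.\<close>

lemma pint_endpoint:
  fixes R :: real
  assumes "0 \<le> R"
  shows "\<exists>C\<ge>0. \<forall>x\<in>hyp_space. \<forall>p\<in>hyp_space. \<forall>p'\<in>hyp_space. \<forall>b\<in>Orb. hyp_dist p p' \<le> R \<longrightarrow>
    \<bar>pint \<phi> x p - pint \<phi> x p'\<bar> \<le> C * (1 + hyp_dist b p) * hyp_dist p p' powr \<alpha>"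
proof -
  define C where "C = holder_const * exp (R * \<alpha>) + B * (1 + 3 * R) * (1 + R)"
  have C0: "0 \<le> C" unfolding C_def using holder_const_nonneg B_nonneg assms by simp
  have main: "\<bar>pint \<phi> x p - pint \<phi> x p'\<bar> \<le> holder_const * sinh (hyp_dist p p') powr \<alpha> + B * (1 + hyp_dist b p + 3 * R) * hyp_dist p p'"
    if x: "x \<in> hyp_space" and p: "p \<in> hyp_space" and p': "p' \<in> hyp_space" and b: "b \<in> Orb"
      and d: "hyp_dist p p' \<le> R" for x p p' b
  proof -
    obtain v where v: "(x, v) \<in> hyp_unit_tangent" "p = geo_point x v (hyp_dist x p)"
      using exists_geo_point x p by blast
    obtain w where w: "(x, w) \<in> hyp_unit_tangent" "p' = geo_point x w (hyp_dist x p')"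
      using exists_geo_point x p' by blast
    have bH: "b \<in> hyp_space" using b Orb by auto
    note nn = hyp_dist_nonneg[OF x p] hyp_dist_nonneg[OF x p'] hyp_dist_nonneg[OF p p'] hyp_dist_nonneg[OF bH p]
    show ?thesis
    proof (cases "hyp_dist x p \<le> hyp_dist x p'")
      case True
      show ?thesis
      proof (rule pint_endpoint_aux[OF v(1) w(1) nn(1) True, folded v(2) w(2)])
        show "hyp_dist p p' = hyp_dist p p'" ..
        fix u assume u: "u \<in> hyp_unit_tangent" "hyp_dist p (fst u) \<le> 2 * hyp_dist p p'"
        have uH: "fst u \<in> hyp_space" using u(1) by (auto simp: hyp_unit_tangent_def)
        have "hyp_dist b (fst u) \<le> hyp_dist b p + 3 * R"
          using hyp_dist_triangle[OF bH p uH] u(2) d nn assms by linarith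
        then have "B * (1 + hyp_dist b (fst u)) \<le> B * (1 + hyp_dist b p + 3 * R)"
          using B_nonneg by (intro mult_left_mono) auto
        then show "\<bar>\<phi> u\<bar> \<le> B * (1 + hyp_dist b p + 3 * R)" using growth[OF u(1) b] by linarith
      qed
    next
      case False
      then have F: "hyp_dist x p' \<le> hyp_dist x p" by simp
      have "\<bar>pint \<phi> x p' - pint \<phi> x p\<bar>
          \<le> holder_const * sinh (hyp_dist p p') powr \<alpha> + B * (1 + hyp_dist b p + 3 * R) * hyp_dist p p'"
      proof (rule pint_endpoint_aux[OF w(1) v(1) nn(2) F, folded v(2) w(2)])
        show "hyp_dist p' p = hyp_dist p p'" by (rule hyp_dist_commute)
        fix u assume u: "u \<in> hyp_unit_tangent" "hyp_dist p' (fst u) \<le> 2 * hyp_dist p p'"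
        have uH: "fst u \<in> hyp_space" using u(1) by (auto simp: hyp_unit_tangent_def)
        have "hyp_dist b (fst u) \<le> hyp_dist b p + 3 * R"
          using hyp_dist_triangle[OF bH p uH] hyp_dist_triangle[OF p p' uH] u(2) d nn assms by linarith
        then have "B * (1 + hyp_dist b (fst u)) \<le> B * (1 + hyp_dist b p + 3 * R)"
          using B_nonneg by (intro mult_left_mono) auto
        then show "\<bar>\<phi> u\<bar> \<le> B * (1 + hyp_dist b p + 3 * R)" using growth[OF u(1) b] by linarith
      qed
      then show ?thesis by (simp only: abs_minus_commute)
    qed
  qed
  show ?thesis
  proof (intro exI[of _ C] conjI ballI impI C0)
    fix x p p' b :: "'n mink"
    assume x: "x \<in> hyp_space" and p: "p \<in> hyp_space" and p': "p' \<in> hyp_space" and b: "b \<in> Orb"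
      and d: "hyp_dist p p' \<le> R"
    define r where "r = hyp_dist p p'"
    define e where "e = 1 + hyp_dist b p"
    have r: "0 \<le> r" "r \<le> R" using p p' d by (auto simp: r_def)
    have e: "1 \<le> e" using b Orb p hyp_dist_nonneg[of b p] by (auto simp: e_def)
    have "sinh r powr \<alpha> \<le> (r * exp R) powr \<alpha>"
    proof (intro powr_mono2)
      have "r * exp r \<le> r * exp R" using r by (intro mult_left_mono) auto
      then show "sinh r \<le> r * exp R" using sinh_le_mult_exp[OF r(1)] by linarith
    qed (use r alpha in auto)
    also have "\<dots> = exp (R * \<alpha>) * r powr \<alpha>" using r by (simp add: powr_mult powr_def[of "exp R"])
    finally have "holder_const * sinh r powr \<alpha> \<le> holder_const * (exp (R * \<alpha>) * r powr \<alpha>)"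
      using holder_const_nonneg by (intro mult_left_mono)
    also have "\<dots> \<le> holder_const * (exp (R * \<alpha>) * r powr \<alpha>) * e"
      using mult_left_mono[OF e, of "holder_const * (exp (R * \<alpha>) * r powr \<alpha>)"] holder_const_nonneg by simp
    finally have 1: "holder_const * sinh r powr \<alpha> \<le> holder_const * exp (R * \<alpha>) * e * r powr \<alpha>" by (simp only: mult_ac)
    \<comment> \<open>The leftover piece contributes linearly in \<open>r\<close>; on the bounded
      range of distances a linear term is again Hoelder.\<close>
    have "r \<le> (1 + R) * r powr \<alpha>"
    proof (cases "r \<le> 1")
      case True
      then have "r \<le> r powr \<alpha>" using powr_mono'[of \<alpha> 1 r] alpha r by simp
      also have "\<dots> \<le> (1 + R) * r powr \<alpha>" using assms by (simp add: algebra_simps)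
      finally show ?thesis .
    next
      case False
      then have "1 \<le> r powr \<alpha>" using alpha by (intro ge_one_powr_ge_zero) auto
      then have "R * 1 \<le> R * r powr \<alpha>" using assms by (intro mult_left_mono)
      then show ?thesis using r \<open>1 \<le> r powr \<alpha>\<close> by (simp add: algebra_simps)
    qed
    then have "B * (e + 3 * R) * r \<le> B * ((1 + 3 * R) * e) * ((1 + R) * r powr \<alpha>)"
    proof (intro mult_mono)
      have "3 * R * 1 \<le> 3 * R * e" using assms e by (intro mult_left_mono) auto
      then show "e + 3 * R \<le> (1 + 3 * R) * e" by (simp add: algebra_simps)
    qed (use B_nonneg assms e r in auto)
    then have 2: "B * (e + 3 * R) * r \<le> B * (1 + 3 * R) * (1 + R) * e * r powr \<alpha>" by (simp only: mult_ac)
    have "\<bar>pint \<phi> x p - pint \<phi> x p'\<bar> \<le> holder_const * sinh r powr \<alpha> + B * (e + 3 * R) * r"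
      using main[OF x p p' b d] by (simp add: r_def e_def)
    also have "\<dots> \<le> C * e * r powr \<alpha>"
      using 1 2 unfolding C_def by (simp only: distrib_right)
    finally show "\<bar>pint \<phi> x p - pint \<phi> x p'\<bar> \<le> C * (1 + hyp_dist b p) * hyp_dist p p' powr \<alpha>"
      by (simp add: r_def e_def)
  qed
qed

lemma pint_startpoint:
  fixes R :: real
  assumes "0 \<le> R"
  shows "\<exists>C\<ge>0. \<forall>x\<in>hyp_space. \<forall>p\<in>hyp_space. \<forall>p'\<in>hyp_space. \<forall>b\<in>Orb. hyp_dist p p' \<le> R \<longrightarrow>
    \<bar>pint \<phi> p x - pint \<phi> p' x\<bar> \<le> C * (1 + hyp_dist b p) * hyp_dist p p' powr \<alpha>"
proof -
  obtain C where C: "C \<ge> 0" "\<forall>x\<in>hyp_space. \<forall>p\<in>hyp_space. \<forall>p'\<in>hyp_space. \<forall>b\<in>Orb. hyp_dist p p' \<le> R \<longrightarrow>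
    \<bar>pint (\<lambda>(p, v). \<phi> (p, - v)) x p - pint (\<lambda>(p, v). \<phi> (p, - v)) x p'\<bar> \<le> C * (1 + hyp_dist b p) * hyp_dist p p' powr \<alpha>"
    using hyp_potential.pint_endpoint[OF flip_potential assms] by blast
  show ?thesis using C by (intro exI[of _ C] conjI ballI impI C(1)) (simp add: pint_flip)
qed

text \<open>Path integrals are exactly additive at points of the geodesic; moving the intermediate
  point \<open>p\<close> to the nearby \<open>geo_point a w s\<close> costs one endpoint error and
  one startpoint error.\<close>

lemma pint_via_near_point:
  fixes R :: real
  assumes "0 \<le> R"
  shows "\<exists>C\<ge>0. \<forall>a w p l s b. (a, w) \<in> hyp_unit_tangent \<and> p \<in> hyp_space \<and> b \<in> Orb \<and> 0 \<le> s \<and> s \<le> l \<and>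
      hyp_dist p (geo_point a w s) \<le> R \<longrightarrow>
    \<bar>pint \<phi> a (geo_point a w l) - pint \<phi> a p - pint \<phi> p (geo_point a w l)\<bar> \<le>
      C * (1 + hyp_dist b p) * hyp_dist p (geo_point a w s) powr \<alpha>"
proof -
  obtain C1 where C1: "C1 \<ge> 0" "\<And>x p p' b. x \<in> hyp_space \<Longrightarrow> p \<in> hyp_space \<Longrightarrow> p' \<in> hyp_space \<Longrightarrow>
      b \<in> Orb \<Longrightarrow> hyp_dist p p' \<le> R \<Longrightarrow>
      \<bar>pint \<phi> x p - pint \<phi> x p'\<bar> \<le> C1 * (1 + hyp_dist b p) * hyp_dist p p' powr \<alpha>"
    using pint_endpoint[OF assms] by blast
  obtain C2 where C2: "C2 \<ge> 0" "\<And>x p p' b. x \<in> hyp_space \<Longrightarrow> p \<in> hyp_space \<Longrightarrow> p' \<in> hyp_space \<Longrightarrow>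
      b \<in> Orb \<Longrightarrow> hyp_dist p p' \<le> R \<Longrightarrow>
      \<bar>pint \<phi> p x - pint \<phi> p' x\<bar> \<le> C2 * (1 + hyp_dist b p) * hyp_dist p p' powr \<alpha>"
    using pint_startpoint[OF assms] by blast
  show ?thesis
  proof (intro exI[of _ "C1 + C2"] conjI allI impI)
    show "0 \<le> C1 + C2" using C1 C2 by simp
    fix a w p :: "'n mink" and l s :: real and b
    assume *: "(a, w) \<in> hyp_unit_tangent \<and> p \<in> hyp_space \<and> b \<in> Orb \<and> 0 \<le> s \<and> s \<le> l \<and>
      hyp_dist p (geo_point a w s) \<le> R"
    define q z where "q = geo_point a w s" and "z = geo_point a w l"
    have qz: "q \<in> hyp_space" "z \<in> hyp_space" using * geo_point_in_hyp_space by (auto simp: q_def z_def)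
    have a: "a \<in> hyp_space" using * hyp_unit_tangentD by blast
    have "pint \<phi> a z = pint \<phi> a q + pint \<phi> q z" unfolding q_def z_def using * by (intro pint_split) auto
    moreover have "\<bar>pint \<phi> a p - pint \<phi> a q\<bar> \<le> C1 * (1 + hyp_dist b p) * hyp_dist p q powr \<alpha>"
      using * qz a by (intro C1) (auto simp: q_def)
    moreover have "\<bar>pint \<phi> p z - pint \<phi> q z\<bar> \<le> C2 * (1 + hyp_dist b p) * hyp_dist p q powr \<alpha>"
      using * qz a by (intro C2) (auto simp: q_def)
    ultimately have "\<bar>pint \<phi> a z - pint \<phi> a p - pint \<phi> p z\<bar> \<le>
        C1 * (1 + hyp_dist b p) * hyp_dist p q powr \<alpha> + C2 * (1 + hyp_dist b p) * hyp_dist p q powr \<alpha>"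
      by linarith
    then show "\<bar>pint \<phi> a (geo_point a w l) - pint \<phi> a p - pint \<phi> p (geo_point a w l)\<bar> \<le>
      (C1 + C2) * (1 + hyp_dist b p) * hyp_dist p (geo_point a w s) powr \<alpha>"
      by (simp add: q_def z_def distrib_right)
  qed
qed

lemma pint_almost_geodesic:
  fixes C :: real
  assumes "0 \<le> C"
  shows "\<exists>C'\<ge>0. \<forall>a\<in>hyp_space. \<forall>p\<in>hyp_space. \<forall>z\<in>hyp_space. \<forall>b\<in>Orb.
     hyp_dist a p + hyp_dist p z \<le> hyp_dist a z + C \<longrightarrow>
     \<bar>pint \<phi> a z - pint \<phi> a p - pint \<phi> p z\<bar> \<le> C' * (1 + hyp_dist b p)"
proof -
  define R where "R = 2 * exp (C / 2) + C"
  have R: "0 \<le> R" unfolding R_def using assms by simp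
  obtain C1 where C1: "C1 \<ge> 0" "\<And>a w p l s b. (a, w) \<in> hyp_unit_tangent \<Longrightarrow> p \<in> hyp_space \<Longrightarrow> b \<in> Orb \<Longrightarrow>
      0 \<le> s \<Longrightarrow> s \<le> l \<Longrightarrow> hyp_dist p (geo_point a w s) \<le> R \<Longrightarrow>
    \<bar>pint \<phi> a (geo_point a w l) - pint \<phi> a p - pint \<phi> p (geo_point a w l)\<bar> \<le>
      C1 * (1 + hyp_dist b p) * hyp_dist p (geo_point a w s) powr \<alpha>"
    using pint_via_near_point[OF R] by blast
  show ?thesis
  proof (intro exI[of _ "C1 * R powr \<alpha>"] conjI ballI impI)
    show "0 \<le> C1 * R powr \<alpha>" using C1 by simp
    fix a p z b :: "'n mink" assume a: "a \<in> hyp_space" and p: "p \<in> hyp_space" and z: "z \<in> hyp_space" and b: "b \<in> Orb"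
      and d: "hyp_dist a p + hyp_dist p z \<le> hyp_dist a z + C"
    obtain w where w: "(a, w) \<in> hyp_unit_tangent" "z = geo_point a w (hyp_dist a z)"
      using exists_geo_point a z by blast
    define s where "s = min (hyp_dist a p) (hyp_dist a z)"
    have s: "0 \<le> s" "s \<le> hyp_dist a z" using a p z by (auto simp: s_def)
    have bH: "0 \<le> hyp_dist b p" using b Orb p by auto
    have "hyp_dist p (geo_point a w s) \<le> R" unfolding s_def R_def
      using almost_geodesic_near[OF w(1) hyp_dist_nonneg[OF a z] p assms] d w(2) by simp
    moreover have "0 \<le> hyp_dist p (geo_point a w s)" using p geo_point_in_hyp_space[OF w(1)] by auto
    ultimately have "hyp_dist p (geo_point a w s) powr \<alpha> \<le> R powr \<alpha>" "hyp_dist p (geo_point a w s) \<le> R"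
      using alpha by (auto intro: powr_mono2)
    then have "\<bar>pint \<phi> a z - pint \<phi> a p - pint \<phi> p z\<bar> \<le> C1 * (1 + hyp_dist b p) * hyp_dist p (geo_point a w s) powr \<alpha>"
      using C1(2)[OF w(1) p b s] w(2) by simp
    also have "\<dots> \<le> C1 * (1 + hyp_dist b p) * R powr \<alpha>"
      using C1(1) bH \<open>_ powr \<alpha> \<le> _\<close> by (intro mult_left_mono) auto
    finally show "\<bar>pint \<phi> a z - pint \<phi> a p - pint \<phi> p z\<bar> \<le> C1 * R powr \<alpha> * (1 + hyp_dist b p)"
      by (simp only: mult_ac)
  qed
qed

text \<open>Below, \<open>p\<close> and \<open>p'\<close> are the points at time \<open>t\<close> of the two geodesics from \<open>x\<close>: beyond time \<open>t\<close>,
  the geodesics from \<open>y\<close> and from \<open>x\<close> to the same point have merged, and up to time \<open>t\<close> those to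
  different points have not yet separated.\<close>

lemma cocycle_holder:
  "\<exists>C\<ge>0. \<forall>x y v w b m t s s'. (x, v) \<in> hyp_unit_tangent \<and> (x, w) \<in> hyp_unit_tangent \<and> y \<in> hyp_space \<and> b \<in> Orb \<and>
      hyp_dist x y \<le> m \<and> m \<le> t \<and> t \<le> s \<and> t \<le> s' \<and> 2 * (sinh t * sqrt (half_sin_sq v w)) \<le> 1 \<longrightarrow>
    \<bar>(pint \<phi> y (geo_point x v s) - pint \<phi> x (geo_point x v s)) -
     (pint \<phi> y (geo_point x w s') - pint \<phi> x (geo_point x w s'))\<bar> \<le>
     C * (1 + hyp_dist b (geo_point x v t)) * (exp (\<alpha> * (m - t)) + (sinh t * sqrt (half_sin_sq v w)) powr \<alpha>)"
proof -
  obtain C1 where C1: "C1 \<ge> 0" "\<And>x p p' b. x \<in> hyp_space \<Longrightarrow> p \<in> hyp_space \<Longrightarrow> p' \<in> hyp_space \<Longrightarrow>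
      b \<in> Orb \<Longrightarrow> hyp_dist p p' \<le> 1 \<Longrightarrow>
      \<bar>pint \<phi> x p - pint \<phi> x p'\<bar> \<le> C1 * (1 + hyp_dist b p) * hyp_dist p p' powr \<alpha>"
    using pint_endpoint[of 1] by force
  obtain C2 where C2: "C2 \<ge> 0" "\<And>a w p l s b. (a, w) \<in> hyp_unit_tangent \<Longrightarrow> p \<in> hyp_space \<Longrightarrow> b \<in> Orb \<Longrightarrow>
      0 \<le> s \<Longrightarrow> s \<le> l \<Longrightarrow> hyp_dist p (geo_point a w s) \<le> 2 \<Longrightarrow>
    \<bar>pint \<phi> a (geo_point a w l) - pint \<phi> a p - pint \<phi> p (geo_point a w l)\<bar> \<le>
      C2 * (1 + hyp_dist b p) * hyp_dist p (geo_point a w s) powr \<alpha>"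
    using pint_via_near_point[of 2] by force
  have two: "(2 * c) powr \<alpha> \<le> 2 * c powr \<alpha>" if "0 \<le> c" for c
  proof -
    have "(2 * c) powr \<alpha> = 2 powr \<alpha> * c powr \<alpha>" using that by (simp add: powr_mult)
    also have "\<dots> \<le> 2 * c powr \<alpha>" using powr_mono[of \<alpha> 1 "2::real"] alpha by (intro mult_right_mono) auto
    finally show ?thesis .
  qed
  \<comment> \<open>Shortening the segments from time \<open>s\<close> to time \<open>t\<close>:
    from \<open>x\<close> the integral splits exactly at the time-\<open>t\<close> point, from
    \<open>y\<close> it splits up to the thin-triangle error, and the common tail cancels.\<close>
  have I: "\<bar>(pint \<phi> y (geo_point x v s) - pint \<phi> x (geo_point x v s)) - (pint \<phi> y (geo_point x v t) - pint \<phi> x (geo_point x v t))\<bar>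
      \<le> 2 * C2 * (1 + hyp_dist b (geo_point x v t)) * exp (\<alpha> * (m - t))"
    if v: "(x, v) \<in> hyp_unit_tangent" and y: "y \<in> hyp_space" and b: "b \<in> Orb"
      and m: "hyp_dist x y \<le> m" "m \<le> t" "t \<le> s" for x y v b m t s
  proof -
    define p z where "p = geo_point x v t" and "z = geo_point x v s"
    have x: "x \<in> hyp_space" using hyp_unit_tangentD[OF v] by simp
    have p: "p \<in> hyp_space" "z \<in> hyp_space" using geo_point_in_hyp_space[OF v] by (auto simp: p_def z_def)
    have t0: "0 \<le> t" using hyp_dist_nonneg[OF x y] m by linarith
    have bp: "0 \<le> hyp_dist b p" using b Orb p by auto
    have sp: "pint \<phi> x z = pint \<phi> x p + pint \<phi> p z" unfolding p_def z_def using m t0 by (intro pint_split v) auto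
    obtain w r where w: "(y, w) \<in> hyp_unit_tangent" "z = geo_point y w (hyp_dist y z)" "0 \<le> r" "r \<le> hyp_dist y z"
      "hyp_dist p (geo_point y w r) \<le> 2 * exp (m - t)"
      using thin_triangle_close[OF v y m] unfolding z_def p_def by blast
    have d2: "hyp_dist p (geo_point y w r) \<le> 2"
    proof -
      have "exp (m - t) \<le> 1" using m by simp
      then show ?thesis using w(5) by linarith
    qed
    have "\<bar>pint \<phi> y z - pint \<phi> y p - pint \<phi> p z\<bar> \<le> C2 * (1 + hyp_dist b p) * hyp_dist p (geo_point y w r) powr \<alpha>"
      using C2(2)[OF w(1) p(1) b w(3,4) d2] w(2) by simp
    also have "\<dots> \<le> C2 * (1 + hyp_dist b p) * (2 * exp (\<alpha> * (m - t)))"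
    proof (intro mult_left_mono)
      have "hyp_dist p (geo_point y w r) powr \<alpha> \<le> (2 * exp (m - t)) powr \<alpha>"
        using w(5) alpha p geo_point_in_hyp_space[OF w(1)] by (intro powr_mono2) auto
      also have "\<dots> \<le> 2 * exp (m - t) powr \<alpha>" by (rule two) simp
      also have "exp (m - t) powr \<alpha> = exp (\<alpha> * (m - t))" by (simp add: powr_def)
      finally show "hyp_dist p (geo_point y w r) powr \<alpha> \<le> 2 * exp (\<alpha> * (m - t))" .
    qed (use C2(1) bp in auto)
    finally show ?thesis using sp unfolding p_def[symmetric] z_def[symmetric] by simp
  qed
  define C where "C = 6 * C2 + 4 * C1"
  show ?thesis
  proof (intro exI[of _ C] conjI allI impI)
    show "0 \<le> C" unfolding C_def using C1 C2 by simp
    fix x y v w :: "'n mink" and b m t s s'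
    assume *: "(x, v) \<in> hyp_unit_tangent \<and> (x, w) \<in> hyp_unit_tangent \<and> y \<in> hyp_space \<and> b \<in> Orb \<and>
      hyp_dist x y \<le> m \<and> m \<le> t \<and> t \<le> s \<and> t \<le> s' \<and> 2 * (sinh t * sqrt (half_sin_sq v w)) \<le> 1"
    then have v: "(x, v) \<in> hyp_unit_tangent" and w: "(x, w) \<in> hyp_unit_tangent" and y: "y \<in> hyp_space"
      and b: "b \<in> Orb" by auto
    have x: "x \<in> hyp_space" using hyp_unit_tangentD[OF v] by simp
    have t0: "0 \<le> t" using hyp_dist_nonneg[OF x y] * by linarith
    define p p' where "p = geo_point x v t" and "p' = geo_point x w t"
    have p: "p \<in> hyp_space" "p' \<in> hyp_space"
      using geo_point_in_hyp_space v w by (auto simp: p_def p'_def)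
    have bH: "b \<in> hyp_space" using b Orb by auto
    define \<eta> where "\<eta> = sinh t * sqrt (half_sin_sq v w)"
    have \<eta>: "0 \<le> \<eta>" unfolding \<eta>_def using half_sin_sq_nonneg[OF v w] t0 by simp
    define e where "e = 1 + hyp_dist b p"
    have e: "1 \<le> e" using bH p by (simp add: e_def)
    have d: "hyp_dist p p' \<le> 2 * \<eta>"
      using hyp_dist_same_time_le[OF v w, of t] t0 by (simp add: p_def p'_def \<eta>_def)
    then have d1: "hyp_dist p p' \<le> 1" using * by (simp add: \<eta>_def)
    have bp': "1 + hyp_dist b p' \<le> 2 * e"
      using hyp_dist_triangle[OF bH p] d1 e by (simp add: e_def)
    have "hyp_dist p p' powr \<alpha> \<le> (2 * \<eta>) powr \<alpha>"
      using d alpha p by (intro powr_mono2) auto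
    also have "\<dots> \<le> 2 * \<eta> powr \<alpha>" by (rule two[OF \<eta>])
    finally have dp: "C1 * e * hyp_dist p p' powr \<alpha> \<le> C1 * e * (2 * \<eta> powr \<alpha>)"
      using C1(1) e by (intro mult_left_mono) auto
    have 1: "\<bar>pint \<phi> y p - pint \<phi> y p'\<bar> \<le> C1 * e * (2 * \<eta> powr \<alpha>)"
      using C1(2)[OF y p b d1] dp by (simp add: e_def)
    have 2: "\<bar>pint \<phi> x p - pint \<phi> x p'\<bar> \<le> C1 * e * (2 * \<eta> powr \<alpha>)"
      using C1(2)[OF x p b d1] dp by (simp add: e_def)
    have 3: "\<bar>(pint \<phi> y (geo_point x v s) - pint \<phi> x (geo_point x v s)) - (pint \<phi> y p - pint \<phi> x p)\<bar>
      \<le> 2 * C2 * e * exp (\<alpha> * (m - t))"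
      using I[OF v y b, of m t s] * by (simp add: p_def e_def)
    have "\<bar>(pint \<phi> y (geo_point x w s') - pint \<phi> x (geo_point x w s')) - (pint \<phi> y p' - pint \<phi> x p')\<bar>
      \<le> 2 * C2 * (1 + hyp_dist b p') * exp (\<alpha> * (m - t))"
      using I[OF w y b, of m t s'] * by (simp add: p'_def)
    also have "\<dots> \<le> 2 * C2 * (2 * e) * exp (\<alpha> * (m - t))"
      using C2(1) bp' by (intro mult_right_mono mult_left_mono) auto
    finally have 4: "\<bar>(pint \<phi> y (geo_point x w s') - pint \<phi> x (geo_point x w s')) - (pint \<phi> y p' - pint \<phi> x p')\<bar>
      \<le> 4 * C2 * e * exp (\<alpha> * (m - t))" by simp
    have "\<bar>(pint \<phi> y (geo_point x v s) - pint \<phi> x (geo_point x v s)) -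
     (pint \<phi> y (geo_point x w s') - pint \<phi> x (geo_point x w s'))\<bar> \<le>
      6 * C2 * e * exp (\<alpha> * (m - t)) + 4 * C1 * e * \<eta> powr \<alpha>" using 1 2 3 4 by linarith
    also have "\<dots> \<le> C * e * exp (\<alpha> * (m - t)) + C * e * \<eta> powr \<alpha>"
      unfolding C_def using C1(1) C2(1) e by (intro add_mono mult_right_mono) auto
    finally show "\<bar>(pint \<phi> y (geo_point x v s) - pint \<phi> x (geo_point x v s)) -
     (pint \<phi> y (geo_point x w s') - pint \<phi> x (geo_point x w s'))\<bar> \<le>
     C * (1 + hyp_dist b (geo_point x v t)) * (exp (\<alpha> * (m - t)) + (sinh t * sqrt (half_sin_sq v w)) powr \<alpha>)"
      by (simp add: e_def p_def \<eta>_def distrib_left)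
  qed
qed

end

section \<open>Isometries and ideal points\<close>

lemma mform_origin: "mform origin x = - x $ None"
  by (simp add: mform_eq_inner) (simp add: origin_def inner_axis')

lemma isom_groupD:
  assumes "g \<in> carrier isom_group"
  shows "mform (g *v x) (g *v y) = mform x y" "x \<in> hyp_space \<Longrightarrow> g *v x \<in> hyp_space" "det g = 1"
  using assms by (auto simp: isom_group_def)

lemma isom_group_mult [simp]: "g \<otimes>\<^bsub>isom_group\<^esub> h = g ** h"
  and isom_group_one [simp]: "\<one>\<^bsub>isom_group\<^esub> = mat 1"
  by (simp_all add: isom_group_def)

text \<open>For inverses the issue is the sheet. The inverse matrix preserves the form, so it sends
  an upper point to one of the two sheets; if that were the lower one, \<open>g\<close> would map
  its negative, an upper point, to the lower sheet.\<close>

lemma group_isom_group: "group (isom_group :: 'n::finite mink_mat monoid)"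
proof (rule groupI)
  fix x y :: "'n mink_mat"
  assume "x \<in> carrier isom_group" "y \<in> carrier isom_group"
  then show "x \<otimes>\<^bsub>isom_group\<^esub> y \<in> carrier isom_group"
    by (auto simp: isom_group_def det_mul simp flip: matrix_vector_mul_assoc)
next
  show "\<one>\<^bsub>isom_group\<^esub> \<in> carrier (isom_group :: 'n mink_mat monoid)" by (auto simp: isom_group_def)
next
  fix g :: "'n mink_mat" assume g: "g \<in> carrier isom_group"
  then have "invertible g" using isom_groupD(3)[OF g] by (simp add: invertible_det_nz)
  then obtain h where h: "g ** h = mat 1" "h ** g = mat 1" unfolding invertible_def by blast
  have gh: "g *v (h *v x) = x" for x by (simp add: matrix_vector_mul_assoc h)
  have "det h = 1" using arg_cong[OF h(1), of det] isom_groupD(3)[OF g] by (simp add: det_mul)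
  moreover have m: "mform (h *v x) (h *v y) = mform x y" for x y
    using isom_groupD(1)[OF g, of "h *v x" "h *v y"] by (simp add: gh)
  moreover have hyp: "h *v x \<in> hyp_space" if x: "x \<in> hyp_space" for x
  proof -
    define y where "y = h *v x"
    have y: "mform y y = -1" using x m by (simp add: hyp_space_def y_def)
    show ?thesis
    proof (cases "mform origin y \<le> 0")
      case True
      then show ?thesis using hyp_space_connected[OF origin_in_hyp_space y] by (simp add: y_def)
    next
      case False
      then have "mform origin (- y) \<le> 0" by (simp add: mform_simps)
      moreover have "mform (- y) (- y) = -1" using y by (simp add: mform_simps)
      ultimately have "- y \<in> hyp_space" using hyp_space_connected[OF origin_in_hyp_space] by blast
      then have "g *v (- y) \<in> hyp_space" by (rule isom_groupD(2)[OF g])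
      also have "g *v (- y) = - x" using gh[of x] matrix_vector_mult_diff_distrib[of g 0 y] by (simp add: y_def)
      finally show ?thesis using x by (simp add: hyp_space_def)
    qed
  qed
  ultimately have "h \<in> carrier isom_group" by (simp add: isom_group_def)
  then show "\<exists>y\<in>carrier isom_group. y \<otimes>\<^bsub>isom_group\<^esub> g = \<one>\<^bsub>isom_group\<^esub>" using h by auto
qed (auto simp: matrix_mul_assoc isom_group_def)

lemma isom_dist:
  assumes "g \<in> carrier isom_group" shows "hyp_dist (g *v x) (g *v y) = hyp_dist x y"
  by (simp add: hyp_dist_def isom_groupD(1)[OF assms])

lemma isom_tangent:
  assumes "g \<in> carrier isom_group" "(x, v) \<in> hyp_unit_tangent" shows "(g *v x, g *v v) \<in> hyp_unit_tangent"
  using assms by (simp add: hyp_unit_tangent_def isom_groupD)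

lemma isom_geo_point: "g *v geo_point x v t = geo_point (g *v x) (g *v v) t"
  and isom_geo_vel: "g *v geo_vel x v t = geo_vel (g *v x) (g *v v) t"
  by (simp_all add: geo_point_def geo_vel_def matrix_vector_right_distrib matrix_vector_mult_scaleR)

lemma isom_geo_dir:
  assumes "g \<in> carrier isom_group" shows "geo_dir (g *v x) (g *v y) = g *v geo_dir x y"
  by (simp add: geo_dir_def isom_dist[OF assms] matrix_vector_mult_diff_distrib matrix_vector_mult_scaleR)

lemma pint_invariant:
  assumes "g \<in> carrier isom_group" "\<And>u. \<phi> (g *v fst u, g *v snd u) = \<phi> u"
  shows "pint \<phi> (g *v x) (g *v y) = pint \<phi> x y"
proof -
  have "\<phi> (geo_flow s (g *v x, g *v geo_dir x y)) = \<phi> (geo_flow s (x, geo_dir x y))" for s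
    using assms(2)[of "geo_flow s (x, geo_dir x y)"] by (simp add: geo_flow_eq isom_geo_point isom_geo_vel)
  then show ?thesis by (simp add: pint_def isom_dist[OF assms(1)] isom_geo_dir[OF assms(1)])
qed

lemma norm_matrix_le_entries: "norm (A :: real^'m^'k) \<le> (\<Sum>i\<in>UNIV. \<Sum>j\<in>UNIV. \<bar>A $ i $ j\<bar>)"
proof -
  have "norm A \<le> (\<Sum>i\<in>UNIV. norm (A $ i))" unfolding norm_vec_def by (rule L2_set_le_sum) simp
  also have "\<dots> \<le> (\<Sum>i\<in>UNIV. \<Sum>j\<in>UNIV. \<bar>A $ i $ j\<bar>)" by (intro sum_mono norm_le_l1_cart)
  finally show ?thesis .
qed

lemma matrix_entry_le_norm: "\<bar>A $ i $ j\<bar> \<le> norm (A :: real^'m^'k)"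
  using component_le_norm_cart[of "A $ i" j] Finite_Cartesian_Product.norm_nth_le[of A i] by linarith

lemma norm_hyp_space_le:
  assumes "p \<in> hyp_space" shows "norm p \<le> 2 * exp (hyp_dist origin p)"
proof -
  have c: "p $ None = cosh (hyp_dist origin p)"
    using cosh_hyp_dist[OF origin_in_hyp_space assms] by (simp add: mform_origin)
  have "sdot p p = (p $ None)\<^sup>2 - 1" using assms by (simp add: hyp_space_def mform_sdot power2_eq_square)
  moreover have "(2 * (p $ None))\<^sup>2 = 4 * (p $ None)\<^sup>2" by (simp add: power_mult_distrib)
  ultimately have "(norm p)\<^sup>2 \<le> (2 * (p $ None))\<^sup>2"
    using norm_sq_mink[of p] zero_le_power2[of "p $ None"] by linarith
  then have "norm p \<le> 2 * (p $ None)"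
    using hyp_space_time_ge[OF assms] by (intro power2_le_imp_le[of "norm p"]) auto
  then show ?thesis using cosh_le_exp[OF hyp_dist_nonneg[OF origin_in_hyp_space assms]] c by linarith
qed

text \<open>The columns of \<open>g\<close> are combinations of the images of two points at distance at most 1 from the
  origin.\<close>

lemma isom_norm_le:
  "\<exists>C>0. \<forall>g \<in> carrier (isom_group :: 'n::finite mink_mat monoid). norm g \<le> C * exp (hyp_dist origin (g *v origin))"
proof -
  have col: "norm (g *v axis j 1) \<le> 10 * exp (hyp_dist origin (g *v origin))"
    if g: "g \<in> carrier isom_group" for g :: "'n mink_mat" and j
  proof (cases j)
    case None
    then have "norm (g *v axis j 1) \<le> 2 * exp (hyp_dist origin (g *v origin))"
      using norm_hyp_space_le[OF isom_groupD(2)[OF g origin_in_hyp_space]] by (simp flip: origin_def)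
    moreover have "0 < exp (hyp_dist origin (g *v origin))" by simp
    ultimately show ?thesis by linarith
  next
    case (Some i)
    define e :: "'n mink" where "e = axis j 1"
    have oe: "(origin, e) \<in> hyp_unit_tangent"
      unfolding hyp_unit_tangent_def using origin_in_hyp_space Some
      by (simp add: mform_origin) (simp add: mform_eq_inner inner_axis' e_def, simp add: axis_def)
    define p where "p = geo_point origin e 1"
    have p: "p \<in> hyp_space" unfolding p_def by (rule geo_point_in_hyp_space[OF oe])
    note gp = isom_groupD(2)[OF g p] and go = isom_groupD(2)[OF g origin_in_hyp_space]
    define E where "E = exp (hyp_dist origin (g *v origin))"
    have E: "0 < E" by (simp add: E_def)
    have "hyp_dist origin (g *v p) \<le> hyp_dist origin (g *v origin) + 1"
      using hyp_dist_triangle[OF origin_in_hyp_space go gp] isom_dist[OF g, of origin p]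
        hyp_dist_geo_point_0[OF oe, of 1] by (simp add: p_def)
    then have "exp (hyp_dist origin (g *v p)) \<le> E * exp 1" by (simp add: E_def mult_exp_exp)
    then have 1: "norm (g *v p) \<le> 2 * (E * 3)"
      using norm_hyp_space_le[OF gp] mult_left_mono[OF exp_one_le_3, of E] E by linarith
    have c3: "cosh (1::real) \<le> 2"
    proof -
      have "exp (- 1 :: real) \<le> 1" by simp
      then show ?thesis unfolding cosh_field_def using exp_one_le_3 by argo
    qed
    have "g *v p = cosh 1 *\<^sub>R (g *v origin) + sinh 1 *\<^sub>R (g *v e)"
      unfolding p_def isom_geo_point by (simp add: geo_point_def)
    then have "sinh 1 *\<^sub>R (g *v e) = g *v p - cosh 1 *\<^sub>R (g *v origin)" by simp
    then have "norm (sinh 1 *\<^sub>R (g *v e)) \<le> norm (g *v p) + norm (cosh 1 *\<^sub>R (g *v origin))"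
      using norm_triangle_ineq4 by metis
    also have "norm (cosh 1 *\<^sub>R (g *v origin)) \<le> 2 * (2 * E)"
    proof -
      have "\<bar>cosh 1\<bar> * norm (g *v origin) \<le> 2 * (2 * E)"
        using norm_hyp_space_le[OF go] c3 E cosh_real_pos[of 1] unfolding E_def by (intro mult_mono) auto
      then show ?thesis by simp
    qed
    finally have 2: "sinh 1 * norm (g *v e) \<le> 10 * E" using 1 by simp
    have "1 * norm (g *v e) \<le> sinh 1 * norm (g *v e)"
      using real_le_sinh[of 1] by (intro mult_right_mono) auto
    then have "norm (g *v e) \<le> 10 * E" using 2 by linarith
    then show ?thesis by (simp add: e_def E_def)
  qed
  define N where "N = real (CARD('n option))"
  have N: "0 < N" by (simp add: N_def)
  show ?thesis
  proof (intro exI[of _ "N * N * 10"] conjI ballI)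
    fix g :: "'n mink_mat" assume g: "g \<in> carrier isom_group"
    have "norm g \<le> (\<Sum>i\<in>UNIV. \<Sum>j\<in>UNIV. \<bar>g $ i $ j\<bar>)" by (rule norm_matrix_le_entries)
    also have "\<dots> \<le> (\<Sum>i\<in>(UNIV::'n option set). \<Sum>j\<in>(UNIV::'n option set). 10 * exp (hyp_dist origin (g *v origin)))"
    proof (intro sum_mono)
      fix i j
      have "g $ i $ j = (g *v axis j 1) $ i" by (simp add: matrix_vector_mult_basis column_def)
      then show "\<bar>g $ i $ j\<bar> \<le> 10 * exp (hyp_dist origin (g *v origin))"
        using component_le_norm_cart[of "g *v axis j 1" i] col[OF g, of j] by simp
    qed
    also have "\<dots> = N * N * 10 * exp (hyp_dist origin (g *v origin))" by (simp add: N_def)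
    finally show "norm g \<le> N * N * 10 * exp (hyp_dist origin (g *v origin))" .
  qed (use N in simp)
qed

lemma norm_matrix_mult_le:
  fixes A B :: "real^'m^'m"
  shows "norm (A ** B) \<le> real (CARD('m)) ^ 3 * (norm A * norm B)"
proof -
  have "norm (A ** B) \<le> (\<Sum>i\<in>UNIV. \<Sum>j\<in>UNIV. \<bar>(A ** B) $ i $ j\<bar>)" by (rule norm_matrix_le_entries)
  also have "\<dots> \<le> (\<Sum>i\<in>(UNIV::'m set). \<Sum>j\<in>(UNIV::'m set). \<Sum>k\<in>(UNIV::'m set). norm A * norm B)"
  proof (rule sum_mono, rule sum_mono)
    fix i j
    have "\<bar>(A ** B) $ i $ j\<bar> \<le> (\<Sum>k\<in>UNIV. \<bar>A $ i $ k * B $ k $ j\<bar>)"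
      by (simp add: matrix_matrix_mult_def)
    also have "\<dots> \<le> (\<Sum>k\<in>(UNIV::'m set). norm A * norm B)"
      unfolding abs_mult by (intro sum_mono mult_mono matrix_entry_le_norm) auto
    finally show "\<bar>(A ** B) $ i $ j\<bar> \<le> (\<Sum>k\<in>(UNIV::'m set). norm A * norm B)" .
  qed
  also have "\<dots> = real (CARD('m)) ^ 3 * (norm A * norm B)" by (simp add: power3_eq_cube)
  finally show ?thesis .
qed

section \<open>Discrete groups of isometries\<close>

locale discrete_isom_group =
  fixes \<Gamma> :: "'n::finite mink_mat set"
  assumes subgroup: "subgroup \<Gamma> isom_group" and discrete: "topological_space_class.discrete \<Gamma>"
begin

lemma carrier: "g \<in> \<Gamma> \<Longrightarrow> g \<in> carrier isom_group"
  using subgroup.mem_carrier[OF subgroup] .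

lemma one_in: "mat 1 \<in> \<Gamma>"
  using subgroup.one_closed[OF subgroup] by simp

lemma mult_in: "g \<in> \<Gamma> \<Longrightarrow> h \<in> \<Gamma> \<Longrightarrow> g ** h \<in> \<Gamma>"
  using subgroup.m_closed[OF subgroup, of g h] by simp

definition ginv :: "'n mink_mat \<Rightarrow> 'n mink_mat" where "ginv g = m_inv isom_group g"

lemma ginv_in: "g \<in> \<Gamma> \<Longrightarrow> ginv g \<in> \<Gamma>"
  unfolding ginv_def using subgroup.m_inv_closed[OF subgroup] .

lemma ginv_mult: "g \<in> \<Gamma> \<Longrightarrow> ginv g ** g = mat 1" "g \<in> \<Gamma> \<Longrightarrow> g ** ginv g = mat 1"
  unfolding ginv_def using group.l_inv[OF group_isom_group carrier] group.r_inv[OF group_isom_group carrier] by force+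

lemma ginv_act: "g \<in> \<Gamma> \<Longrightarrow> ginv g *v (g *v x) = x" "g \<in> \<Gamma> \<Longrightarrow> g *v (ginv g *v x) = x"
  by (simp_all add: matrix_vector_mul_assoc ginv_mult)

lemma ginv_ginv: "g \<in> \<Gamma> \<Longrightarrow> ginv (ginv g) = g"
  unfolding ginv_def using group.inv_inv[OF group_isom_group carrier] .

lemma act_hyp: "g \<in> \<Gamma> \<Longrightarrow> x \<in> hyp_space \<Longrightarrow> g *v x \<in> hyp_space"
  using isom_groupD(2) carrier by blast

lemma dist_ginv: assumes "g \<in> \<Gamma>" shows "hyp_dist (ginv g *v x) y = hyp_dist x (g *v y)"
  using isom_dist[OF carrier[OF assms], of "ginv g *v x" y] by (simp add: ginv_act[OF assms])

text \<open>Discreteness is a property of the set of matrices. Bounded displacement bounds the norm,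
  so infinitely many such elements accumulate somewhere, possibly outside the group. Quotients bring
  this back to the identity: for two elements \<open>g\<close>, \<open>h\<close> close to each
  other, \<open>ginv g ** h\<close> is close to the identity, because \<open>ginv g\<close> has the
  same displacement as \<open>g\<close> and hence bounded norm, and the identity is
  isolated.\<close>

lemma finite_orbit_ball_origin: "finite {g\<in>\<Gamma>. hyp_dist origin (g *v origin) \<le> r}"
proof (rule ccontr)
  let ?S = "{g\<in>\<Gamma>. hyp_dist origin (g *v origin) \<le> r}"
  assume inf: "infinite ?S"
  obtain C where C: "C > 0" "\<And>g :: 'n mink_mat. g \<in> carrier isom_group \<Longrightarrow> norm g \<le> C * exp (hyp_dist origin (g *v origin))"
    using isom_norm_le by blast
  have n: "norm g \<le> C * exp r" if "g \<in> ?S" for g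
  proof -
    have "norm g \<le> C * exp (hyp_dist origin (g *v origin))" using that C(2) carrier by blast
    also have "\<dots> \<le> C * exp r" using that C(1) by (intro mult_left_mono) auto
    finally show ?thesis .
  qed
  then have "?S \<subseteq> cball 0 (C * exp r)" by auto
  then obtain A where A: "A islimpt ?S"
    using Heine_Borel_imp_Bolzano_Weierstrass[OF compact_cball inf] by blast
  have "(mat 1 :: 'n mink_mat) isolated_in \<Gamma>" using discreteD[OF discrete one_in] .
  then obtain e where e: "e > 0" "\<And>y. y \<in> \<Gamma> \<Longrightarrow> dist (mat 1) y < e \<Longrightarrow> y = mat 1"
    by (auto simp: isolated_in_dist_Ex_iff)
  define c where "c = real (CARD('n option)) ^ 3 * (C * exp r)"
  have c: "c > 0" using C by (simp add: c_def)
  have "infinite (?S \<inter> ball A (e / (2 * c)))"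
    using A e(1) c unfolding islimpt_eq_infinite_ball by simp
  then have two: "infinite (?S \<inter> ball A (e / (2 * c)) - {g})" for g by simp
  obtain g where "g \<in> ?S \<inter> ball A (e / (2 * c))"
    using infinite_imp_nonempty[OF two[of "mat 1"]] by blast
  then have g: "g \<in> ?S" "dist A g < e / (2 * c)" by simp_all
  obtain h where "h \<in> ?S \<inter> ball A (e / (2 * c)) - {g}"
    using infinite_imp_nonempty[OF two[of g]] by blast
  then have h: "h \<in> ?S" "dist A h < e / (2 * c)" "h \<noteq> g" by simp_all
  have g\<Gamma>: "g \<in> \<Gamma>" "hyp_dist origin (g *v origin) \<le> r" using g(1) by auto
  have "hyp_dist origin (ginv g *v origin) = hyp_dist origin (g *v origin)"
    using dist_ginv[OF g\<Gamma>(1), of origin origin] by (simp only: hyp_dist_commute)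
  then have gi: "ginv g \<in> ?S" using g\<Gamma> ginv_in by simp
  have "dist h g < e / c"
  proof -
    have "dist h g \<le> dist A h + dist A g" by (metis dist_commute dist_triangle)
    also have "\<dots> < e / (2 * c) + e / (2 * c)" using g h by simp
    finally show ?thesis using c by (simp add: field_simps)
  qed
  then have d: "c * norm (h - g) < e" using c by (simp add: dist_norm field_simps)
  have "ginv g ** h - mat 1 = ginv g ** (h - g)"
  proof -
    have "ginv g ** h = ginv g ** ((h - g) + g)" by simp
    also have "\<dots> = ginv g ** (h - g) + ginv g ** g" by (rule matrix_add_ldistrib)
    finally show ?thesis using ginv_mult g by simp
  qed
  then have "norm (ginv g ** h - mat 1) \<le> real (CARD('n option)) ^ 3 * (norm (ginv g) * norm (h - g))"
    using norm_matrix_mult_le[of "ginv g" "h - g"] by metis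
  also have "\<dots> \<le> real (CARD('n option)) ^ 3 * (C * exp r * norm (h - g))"
    using n[OF gi] by (intro mult_left_mono mult_right_mono) auto
  also have "\<dots> < e" using d by (simp add: c_def mult_ac)
  finally have "ginv g ** h = mat 1"
    using e(2)[of "ginv g ** h"] mult_in ginv_in g h by (auto simp: dist_norm norm_minus_commute)
  then have "g ** (ginv g ** h) = g" by simp
  then have "h = g" using g by (simp add: matrix_mul_assoc ginv_mult)
  then show False using h by simp
qed

lemma finite_orbit_ball: assumes "x \<in> hyp_space" shows "finite {g\<in>\<Gamma>. hyp_dist x (g *v x) \<le> r}"
proof (rule finite_subset[OF _ finite_orbit_ball_origin])
  show "{g\<in>\<Gamma>. hyp_dist x (g *v x) \<le> r} \<subseteq> {g\<in>\<Gamma>. hyp_dist origin (g *v origin) \<le> r + 2 * hyp_dist origin x}"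
  proof safe
    fix g assume g: "g \<in> \<Gamma>" "hyp_dist x (g *v x) \<le> r"
    note H = origin_in_hyp_space assms act_hyp[OF g(1) assms] act_hyp[OF g(1) origin_in_hyp_space]
    show "hyp_dist origin (g *v origin) \<le> r + 2 * hyp_dist origin x"
      using hyp_dist_triangle[OF H(1) H(2) H(4)] hyp_dist_triangle[OF H(2) H(3) H(4)] g
        isom_dist[OF carrier[OF g(1)], of x origin] by (simp add: hyp_dist_commute[of x origin])
  qed
qed

lemma countable_group: "countable \<Gamma>"
proof -
  have "\<Gamma> \<subseteq> (\<Union>n::nat. {g\<in>\<Gamma>. hyp_dist origin (g *v origin) \<le> real n})"
    using real_arch_simple by blast
  then show ?thesis
    by (rule countable_subset) (intro countable_UN countableI_type countable_finite finite_orbit_ball_origin)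
qed

end

section \<open>Ideal points and convergence in polar coordinates\<close>

lemma ideal_boundary_mform_neg:
  assumes "x \<in> hyp_space" "\<xi> \<in> ideal_boundary" shows "mform x \<xi> < 0"
proof -
  have x: "sdot x x = (x $ None)\<^sup>2 - 1" using assms by (simp add: hyp_space_def mform_sdot power2_eq_square)
  have \<xi>: "sdot \<xi> \<xi> = 1" "\<xi> $ None = 1" using assms by (auto simp: ideal_boundary_def mform_sdot)
  have "(sdot x \<xi>)\<^sup>2 \<le> (x $ None)\<^sup>2 - 1" using sdot_Cauchy_Schwarz[of x \<xi>] x \<xi> by simp
  then have "(sdot x \<xi>)\<^sup>2 < (x $ None)\<^sup>2" by simp
  then have "\<bar>sdot x \<xi>\<bar> < x $ None"
    using hyp_space_time_ge[OF assms(1)] by (metis abs_le_square_iff abs_of_nonneg not_le order_trans zero_le_one)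
  then show ?thesis using \<xi> by (simp add: mform_sdot)
qed

text \<open>The direction at \<open>x\<close> of the ray to the ideal point \<open>\<xi>\<close>: \<open>x + v\<close> has to be a multiple of \<open>\<xi>\<close>, and
  \<open>v\<close> orthogonal to \<open>x\<close>.\<close>

definition ray_dir :: "'n::finite mink \<Rightarrow> 'n mink \<Rightarrow> 'n mink" where
  "ray_dir x \<xi> = (- 1 / mform x \<xi>) *\<^sub>R \<xi> - x"

lemma ray_dir_tangent:
  assumes "x \<in> hyp_space" "\<xi> \<in> ideal_boundary" shows "(x, ray_dir x \<xi>) \<in> hyp_unit_tangent"
proof -
  have n: "mform x \<xi> \<noteq> 0" using ideal_boundary_mform_neg[OF assms] by simp
  have "mform x x = -1" "mform \<xi> \<xi> = 0" using assms by (auto simp: hyp_space_def ideal_boundary_def)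
  then show ?thesis using assms n
    by (simp add: hyp_unit_tangent_def ray_dir_def mform_simps mform_commute[of \<xi> x] field_simps)
qed

lemma klein_scale: "c \<noteq> 0 \<Longrightarrow> klein (c *\<^sub>R z) = klein z"
  by (simp add: klein_def)

lemma klein_add_ray_dir:
  assumes "x \<in> hyp_space" "\<xi> \<in> ideal_boundary" shows "klein (x + ray_dir x \<xi>) = \<xi>" "(x + ray_dir x \<xi>) $ None \<noteq> 0"
proof -
  have n: "mform x \<xi> \<noteq> 0" using ideal_boundary_mform_neg[OF assms] by simp
  have e: "x + ray_dir x \<xi> = (- 1 / mform x \<xi>) *\<^sub>R \<xi>" by (simp add: ray_dir_def)
  have \<xi>: "\<xi> $ None = 1" using assms by (simp add: ideal_boundary_def)
  show "klein (x + ray_dir x \<xi>) = \<xi>" unfolding e using n by (subst klein_scale) (auto simp: klein_def \<xi>)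
  show "(x + ray_dir x \<xi>) $ None \<noteq> 0" unfolding e using n \<xi> by simp
qed

lemma isCont_klein: "z $ None \<noteq> 0 \<Longrightarrow> isCont klein z"
  unfolding klein_def by (intro continuous_intros) auto

lemma mform_klein:
  assumes "z \<in> hyp_space" shows "mform (klein z) (klein z) = - 1 / (z $ None)\<^sup>2"
  using assms by (simp add: klein_def mform_simps hyp_space_def power2_eq_square)

lemma klein_hyp_not_ideal: "z \<in> hyp_space \<Longrightarrow> \<xi> \<in> ideal_boundary \<Longrightarrow> klein z \<noteq> \<xi>"
  using mform_klein[of z] hyp_space_time_ge[of z] by (auto simp: ideal_boundary_def)

lemma filterlim_at_top_cosh:
  assumes "filterlim (\<lambda>s. cosh (f s)) at_top F" "\<forall>\<^sub>F s in F. (0::real) \<le> f s"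
  shows "filterlim f at_top F"
  unfolding filterlim_at_top
proof
  fix Z :: real
  have "\<forall>\<^sub>F s in F. cosh \<bar>Z\<bar> \<le> cosh (f s)" using assms(1) unfolding filterlim_at_top by blast
  then show "\<forall>\<^sub>F s in F. Z \<le> f s" using assms(2)
  proof eventually_elim
    case (elim s)
    then have "\<bar>Z\<bar> \<le> f s" using cosh_real_nonneg_le_iff[of "\<bar>Z\<bar>" "f s"] by simp
    then show ?case by linarith
  qed
qed

text \<open>Convergence in the Klein ball, read in polar coordinates at \<open>x\<close>. Scaled to
  time coordinate 1, \<open>f s\<close> has a product with \<open>x\<close> that stays away from 0
  while its own square tends to 0; the quotient of the root of the one by the other is
  \<open>inverse (cosh (hyp_dist x (f s)))\<close>, so the distance diverges. The angle then follows
  because \<open>tanh\<close> of the distance tends to 1.\<close>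

lemma klein_tendstoD:
  assumes x: "x \<in> hyp_space" and \<xi>: "\<xi> \<in> ideal_boundary" and f: "\<forall>\<^sub>F s in F. f s \<in> hyp_space"
    and lim: "((\<lambda>s. klein (f s)) \<longlongrightarrow> \<xi>) F"
  shows "filterlim (\<lambda>s. hyp_dist x (f s)) at_top F"
    "((\<lambda>s. half_sin_sq (ray_dir x \<xi>) (geo_dir x (f s))) \<longlongrightarrow> 0) F"
proof -
  define m where "m = - mform x \<xi>"
  have m: "0 < m" using ideal_boundary_mform_neg[OF x \<xi>] by (simp add: m_def)
  have zz: "mform \<xi> \<xi> = 0" using \<xi> by (simp add: ideal_boundary_def)
  have l1: "((\<lambda>s. - mform x (klein (f s))) \<longlongrightarrow> m) F"
    unfolding m_def by (intro tendsto_intros lim)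
  have ev: "\<forall>\<^sub>F s in F. 0 < - mform x (klein (f s))" using order_tendstoD(1)[OF l1 m] .
  have c: "cosh (hyp_dist x (f s)) = f s $ None * - mform x (klein (f s))" if "f s \<in> hyp_space" for s
    using cosh_hyp_dist[OF x that] hyp_space_time_ge[OF that] by (simp add: klein_def mform_simps)
  have "((\<lambda>s. sqrt (- mform (klein (f s)) (klein (f s))) / (- mform x (klein (f s)))) \<longlongrightarrow> sqrt (- mform \<xi> \<xi>) / m) F"
    using m unfolding m_def by (intro tendsto_intros lim) auto
  then have "((\<lambda>s. sqrt (- mform (klein (f s)) (klein (f s))) / (- mform x (klein (f s)))) \<longlongrightarrow> 0) F"
    by (simp add: zz)
  then have l2: "((\<lambda>s. inverse (cosh (hyp_dist x (f s)))) \<longlongrightarrow> 0) F"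
  proof (rule Lim_transform_eventually)
    show "\<forall>\<^sub>F s in F. sqrt (- mform (klein (f s)) (klein (f s))) / (- mform x (klein (f s))) = inverse (cosh (hyp_dist x (f s)))"
      using f
    proof eventually_elim
      case (elim s)
      have "sqrt (- mform (klein (f s)) (klein (f s))) = 1 / f s $ None"
        using mform_klein[OF elim] hyp_space_time_ge[OF elim] by (simp add: real_sqrt_divide)
      then show ?case using c[OF elim] by (simp add: field_simps)
    qed
  qed
  have l3: "filterlim (\<lambda>s. cosh (hyp_dist x (f s))) at_top F"
  proof -
    have "filterlim (\<lambda>s. inverse (inverse (cosh (hyp_dist x (f s))))) at_top F"
      by (rule filterlim_inverse_at_top[OF l2]) (auto simp: cosh_real_pos)
    then show ?thesis by simp
  qed
  show top: "filterlim (\<lambda>s. hyp_dist x (f s)) at_top F"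
    by (rule filterlim_at_top_cosh[OF l3]) (use f in eventually_elim, use x in auto)
  have "((\<lambda>s. tanh (hyp_dist x (f s))) \<longlongrightarrow> 1) F" by (rule filterlim_compose[OF tanh_real_at_top top])
  then have l4: "((\<lambda>s. (1 - inverse (tanh (hyp_dist x (f s))) * (mform (ray_dir x \<xi>) (klein (f s)) / (- mform x (klein (f s))))) / 2)
     \<longlongrightarrow> (1 - inverse 1 * (mform (ray_dir x \<xi>) \<xi> / m)) / 2) F"
    using m unfolding m_def by (intro tendsto_intros lim) auto
  have "mform (ray_dir x \<xi>) \<xi> = m" by (simp add: ray_dir_def mform_simps zz m_def)
  then have "((\<lambda>s. (1 - inverse (tanh (hyp_dist x (f s))) * (mform (ray_dir x \<xi>) (klein (f s)) / (- mform x (klein (f s))))) / 2)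
     \<longlongrightarrow> 0) F" using l4 m by simp
  then show "((\<lambda>s. half_sin_sq (ray_dir x \<xi>) (geo_dir x (f s))) \<longlongrightarrow> 0) F"
  proof (rule Lim_transform_eventually)
    show "\<forall>\<^sub>F s in F. (1 - inverse (tanh (hyp_dist x (f s))) * (mform (ray_dir x \<xi>) (klein (f s)) / (- mform x (klein (f s))))) / 2
       = half_sin_sq (ray_dir x \<xi>) (geo_dir x (f s))"
      using f ev
    proof eventually_elim
      case (elim s)
      define d where "d = hyp_dist x (f s)"
      have t: "f s $ None \<noteq> 0" using hyp_space_time_ge[OF elim(1)] by simp
      have "mform (ray_dir x \<xi>) (geo_dir x (f s)) = mform (ray_dir x \<xi>) (f s) / sinh d"
        using hyp_unit_tangentD(4)[OF ray_dir_tangent[OF x \<xi>]] by (simp add: geo_dir_def mform_simps d_def)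
      also have "mform (ray_dir x \<xi>) (f s) = f s $ None * mform (ray_dir x \<xi>) (klein (f s))"
        using t by (simp add: klein_def mform_simps)
      also have "f s $ None = cosh d / - mform x (klein (f s))" using c[OF elim(1)] elim(2) by (simp add: d_def field_simps)
      finally have "mform (ray_dir x \<xi>) (geo_dir x (f s)) = inverse (tanh d) * (mform (ray_dir x \<xi>) (klein (f s)) / (- mform x (klein (f s))))"
        by (simp add: tanh_def)
      then show ?case by (simp add: half_sin_sq_def d_def)
    qed
  qed
qed

text \<open>Up to scaling, which the central projection ignores, \<open>f s\<close> is
  \<open>x\<close> plus \<open>tanh\<close> of its distance times its direction. Small
  \<open>half_sin_sq\<close> is genuine closeness of directions because the form controls the norm
  on the tangent space at \<open>x\<close>.\<close>

lemma klein_tendstoI: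
  assumes x: "x \<in> hyp_space" and \<xi>: "\<xi> \<in> ideal_boundary" and f: "\<forall>\<^sub>F s in F. f s \<in> hyp_space"
    and top: "filterlim (\<lambda>s. hyp_dist x (f s)) at_top F"
    and h: "((\<lambda>s. half_sin_sq (ray_dir x \<xi>) (geo_dir x (f s))) \<longlongrightarrow> 0) F"
  shows "((\<lambda>s. klein (f s)) \<longlongrightarrow> \<xi>) F"
proof -
  have ev: "\<forall>\<^sub>F s in F. 0 < hyp_dist x (f s)" using top unfolding filterlim_at_top_dense by blast
  have "((\<lambda>s. ray_dir x \<xi> - geo_dir x (f s)) \<longlongrightarrow> 0) F"
  proof (rule Lim_null_comparison)
    show "\<forall>\<^sub>F s in F. norm (ray_dir x \<xi> - geo_dir x (f s)) \<le> sqrt (8 * (x $ None)\<^sup>2 * half_sin_sq (ray_dir x \<xi>) (geo_dir x (f s)))"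
      using f ev
    proof eventually_elim
      case (elim s)
      note v = ray_dir_tangent[OF x \<xi>] and w = geo_dir_props(1)[OF x elim]
      let ?u = "ray_dir x \<xi> - geo_dir x (f s)"
      have "mform x ?u = 0" using hyp_unit_tangentD[OF v] hyp_unit_tangentD[OF w] by (simp add: mform_simps)
      then have "(norm ?u)\<^sup>2 \<le> 2 * (x $ None)\<^sup>2 * mform ?u ?u" by (rule norm_sq_le_mform_perp[OF x])
      also have "\<dots> = 8 * (x $ None)\<^sup>2 * half_sin_sq (ray_dir x \<xi>) (geo_dir x (f s))"
        using half_sin_sq_eq[OF v w] by simp
      finally show ?case by (rule real_le_rsqrt)
    qed
    have "((\<lambda>s. sqrt (8 * (x $ None)\<^sup>2 * half_sin_sq (ray_dir x \<xi>) (geo_dir x (f s)))) \<longlongrightarrow> sqrt (8 * (x $ None)\<^sup>2 * 0)) F"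
      by (intro tendsto_intros h)
    then show "((\<lambda>s. sqrt (8 * (x $ None)\<^sup>2 * half_sin_sq (ray_dir x \<xi>) (geo_dir x (f s)))) \<longlongrightarrow> 0) F" by simp
  qed
  then have "((\<lambda>s. ray_dir x \<xi> - (ray_dir x \<xi> - geo_dir x (f s))) \<longlongrightarrow> ray_dir x \<xi> - 0) F"
    by (intro tendsto_intros)
  then have d: "((\<lambda>s. geo_dir x (f s)) \<longlongrightarrow> ray_dir x \<xi>) F" by simp
  have "((\<lambda>s. x + tanh (hyp_dist x (f s)) *\<^sub>R geo_dir x (f s)) \<longlongrightarrow> x + 1 *\<^sub>R ray_dir x \<xi>) F"
    by (intro tendsto_intros d filterlim_compose[OF tanh_real_at_top top])
  then have "((\<lambda>s. klein (x + tanh (hyp_dist x (f s)) *\<^sub>R geo_dir x (f s))) \<longlongrightarrow> klein (x + ray_dir x \<xi>)) F"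
    using isCont_tendsto_compose[OF isCont_klein[OF klein_add_ray_dir(2)[OF x \<xi>]]] by simp
  then have "((\<lambda>s. klein (x + tanh (hyp_dist x (f s)) *\<^sub>R geo_dir x (f s))) \<longlongrightarrow> \<xi>) F"
    using klein_add_ray_dir(1)[OF x \<xi>] by simp
  then show ?thesis
  proof (rule Lim_transform_eventually)
    show "\<forall>\<^sub>F s in F. klein (x + tanh (hyp_dist x (f s)) *\<^sub>R geo_dir x (f s)) = klein (f s)"
      using f ev
    proof eventually_elim
      case (elim s)
      let ?d = "hyp_dist x (f s)"
      have "f s = cosh ?d *\<^sub>R (x + tanh ?d *\<^sub>R geo_dir x (f s))"
        using geo_dir_props(2)[OF x elim] by (simp add: geo_point_def tanh_def scaleR_add_right)
      then show ?case using klein_scale[of "cosh ?d"] by (metis cosh_real_nonzero)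
    qed
  qed
qed

lemma ray_tendsto_ray_dir:
  assumes x: "x \<in> hyp_space" and \<xi>: "\<xi> \<in> ideal_boundary"
  shows "ray_tendsto (x, ray_dir x \<xi>) \<xi>"
  unfolding ray_tendsto_def geo_flow_eq fst_conv
proof (rule klein_tendstoI[OF x \<xi>])
  note v = ray_dir_tangent[OF x \<xi>]
  show "\<forall>\<^sub>F s in at_top. geo_point x (ray_dir x \<xi>) s \<in> hyp_space" using geo_point_in_hyp_space[OF v] by simp
  show "filterlim (\<lambda>s. hyp_dist x (geo_point x (ray_dir x \<xi>) s)) at_top at_top"
  proof (rule filterlim_mono_eventually[OF filterlim_ident])
    show "\<forall>\<^sub>F s in at_top. s = hyp_dist x (geo_point x (ray_dir x \<xi>) s)"
      using eventually_ge_at_top[of 0] by eventually_elim (simp add: hyp_dist_geo_point_0[OF v])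
  qed auto
  show "((\<lambda>s. half_sin_sq (ray_dir x \<xi>) (geo_dir x (geo_point x (ray_dir x \<xi>) s))) \<longlongrightarrow> 0) at_top"
  proof (rule Lim_transform_eventually[OF tendsto_const])
    show "\<forall>\<^sub>F s in at_top. 0 = half_sin_sq (ray_dir x \<xi>) (geo_dir x (geo_point x (ray_dir x \<xi>) s))"
      using eventually_gt_at_top[of 0] by eventually_elim (simp add: geo_dir_geo_point[OF v] half_sin_sq_self[OF v])
  qed
qed

text \<open>The image of a null vector cannot have vanishing time coordinate: its product with the
  origin equals the product of the original null vector with a point of the hyperboloid, which is
  negative.\<close>

lemma boundary_act_in:
  assumes "g \<in> carrier isom_group" "\<xi> \<in> ideal_boundary"
  shows "boundary_act g \<xi> \<in> ideal_boundary" "(g *v \<xi>) $ None \<noteq> 0"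
proof -
  obtain h where h: "h \<in> carrier isom_group" "g ** h = mat 1"
    using group.r_inv[OF group_isom_group assms(1)] group.inv_closed[OF group_isom_group assms(1)] by auto
  have "mform origin (g *v \<xi>) = mform (g *v (h *v origin)) (g *v \<xi>)" by (simp add: matrix_vector_mul_assoc h)
  also have "\<dots> = mform (h *v origin) \<xi>" using isom_groupD(1)[OF assms(1)] by simp
  also have "\<dots> < 0" 
    by (rule ideal_boundary_mform_neg[OF isom_groupD(2)[OF h(1) origin_in_hyp_space] assms(2)])
  finally show 1: "(g *v \<xi>) $ None \<noteq> 0" by (simp add: mform_origin)
  have "mform (g *v \<xi>) (g *v \<xi>) = 0" using isom_groupD(1)[OF assms(1)] assms(2) by (simp add: ideal_boundary_def)
  then show "boundary_act g \<xi> \<in> ideal_boundary"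
    using 1 by (simp add: ideal_boundary_def boundary_act_def klein_def mform_simps)
qed

lemma klein_act_tendsto:
  assumes g: "g \<in> carrier isom_group" and \<xi>: "\<xi> \<in> ideal_boundary"
    and f: "\<forall>\<^sub>F s in F. f s \<in> hyp_space" and lim: "((\<lambda>s. klein (f s)) \<longlongrightarrow> \<xi>) F"
  shows "((\<lambda>s. klein (g *v f s)) \<longlongrightarrow> boundary_act g \<xi>) F"
proof -
  have "((\<lambda>s. g *v klein (f s)) \<longlongrightarrow> g *v \<xi>) F"
    by (rule bounded_linear.tendsto[OF matrix_vector_mul_bounded_linear lim])
  then have "((\<lambda>s. klein (g *v klein (f s))) \<longlongrightarrow> boundary_act g \<xi>) F"
    unfolding boundary_act_def by (rule isCont_tendsto_compose[OF isCont_klein[OF boundary_act_in(2)[OF g \<xi>]]])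
  then show ?thesis
  proof (rule Lim_transform_eventually)
    show "\<forall>\<^sub>F s in F. klein (g *v klein (f s)) = klein (g *v f s)"
      using f
    proof eventually_elim
      case (elim s)
      then have "1 / f s $ None \<noteq> 0" using hyp_space_time_ge[OF elim] by simp
      then show ?case using klein_scale[of "1 / f s $ None" "g *v f s"] by (simp add: klein_def[of "f s"] matrix_vector_mult_scaleR)
    qed
  qed
qed

lemma ray_tendsto_act:
  assumes g: "g \<in> carrier isom_group" and \<xi>: "\<xi> \<in> ideal_boundary" and v: "(x, v) \<in> hyp_unit_tangent"
    and r: "ray_tendsto (x, v) \<xi>"
  shows "ray_tendsto (g *v x, g *v v) (boundary_act g \<xi>)"
  using klein_act_tendsto[OF g \<xi>, of "\<lambda>t. geo_point x v t" at_top] r geo_point_in_hyp_space[OF v]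
  by (simp add: ray_tendsto_def geo_flow_eq isom_geo_point)

section \<open>Limit set and convex hull\<close>

lemma nearby_directions:
  assumes "(x, v) \<in> hyp_unit_tangent" "(x, w) \<in> hyp_unit_tangent" "0 \<le> r" "0 \<le> l" "0 \<le> R"
    and d: "hyp_dist (geo_point x v r) (geo_point x w l) \<le> R"
  shows "half_sin_sq v w \<le> 8 * exp (2 + 4 * R - 2 * r)"
proof -
  have "r \<le> l + R" using hyp_dist_diff_le[OF assms(1-4)] d by linarith
  then show ?thesis using almost_geodesic_angle[OF assms(1-4), of "2 * R"] d assms(5) by simp
qed

lemma nearby_geo_dir:
  assumes "x \<in> hyp_space" "a \<in> hyp_space" "b \<in> hyp_space" "0 < hyp_dist x a" "0 < hyp_dist x b"
    and d: "hyp_dist a b \<le> R"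
  shows "half_sin_sq (geo_dir x a) (geo_dir x b) \<le> 8 * exp (2 + 4 * R - 2 * hyp_dist x a)"
proof -
  note a = geo_dir_props[OF assms(1,2,4)] and b = geo_dir_props[OF assms(1,3,5)]
  have R: "0 \<le> R" using hyp_dist_nonneg[OF assms(2,3)] d by linarith
  show ?thesis
    using nearby_directions[OF a(1) b(1) _ _ R, of "hyp_dist x a" "hyp_dist x b", folded a(2) b(2)] assms by simp
qed

lemma origin_None: "origin $ None = 1"
  by (simp add: origin_def)

lemma geo_convex_hyp_space: "geo_convex hyp_space"
  unfolding geo_convex_def geo_segment_def
proof (intro conjI ballI impI subset_refl)
  fix x y :: "'n::finite mink" assume x: "x \<in> hyp_space" and y: "y \<in> hyp_space" and "x \<noteq> y"
  then have "0 < hyp_dist x y" using hyp_dist_eq_0_iff[OF x y] hyp_dist_nonneg[OF x y] by linarith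
  then show "(\<lambda>t. fst (geo_flow t (x, geo_dir x y))) ` {0..hyp_dist x y} \<subseteq> hyp_space"
    using geo_point_in_hyp_space[OF geo_dir_props(1)[OF x y]] by (auto simp: geo_flow_eq)
qed

lemma hyp_hull_subset: "hyp_hull L \<subseteq> hyp_space"
  unfolding hyp_hull_def using geo_convex_hyp_space by (auto simp: hyp_unit_tangent_def)

lemma geo_convex_hyp_hull: "geo_convex (hyp_hull L)"
proof -
  have "geo_segment x y \<subseteq> hyp_hull L" if "x \<in> hyp_hull L" "y \<in> hyp_hull L" "x \<noteq> y" for x y
    using that unfolding hyp_hull_def geo_convex_def by blast
  then show ?thesis unfolding geo_convex_def using hyp_hull_subset by blast
qed

lemma geo_point_in_hyp_hull:
  assumes "x \<in> hyp_hull L" "y \<in> hyp_hull L" "0 \<le> t" "t \<le> hyp_dist x y" "0 < hyp_dist x y"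
  shows "geo_point x (geo_dir x y) t \<in> hyp_hull L"
proof -
  have "x \<noteq> y" using assms hyp_hull_subset by fastforce
  then have "geo_segment x y \<subseteq> hyp_hull L"
    using geo_convex_hyp_hull[of L, unfolded geo_convex_def] assms(1,2) by blast
  moreover have "geo_point x (geo_dir x y) t \<in> geo_segment x y"
    unfolding geo_segment_def geo_flow_eq using assms by auto
  ultimately show ?thesis by blast
qed

lemma continuous_on_hyp_dist [continuous_intros]:
  assumes "continuous_on S f" "continuous_on S g" "\<And>s. s \<in> S \<Longrightarrow> f s \<in> hyp_space" "\<And>s. s \<in> S \<Longrightarrow> g s \<in> hyp_space"
  shows "continuous_on S (\<lambda>s. hyp_dist (f s) (g s))"
  unfolding hyp_dist_def
proof (rule continuous_on_compose2[OF continuous_on_arcosh[OF order_refl]])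
  show "continuous_on S (\<lambda>s. - mform (f s) (g s))"
    by (intro continuous_on_minus continuous_mform assms(1,2))
  show "(\<lambda>s. - mform (f s) (g s)) ` S \<subseteq> {1..}"
    using mform_hyp_le assms(3,4) by force
qed

text \<open>The geodesic between two ideal points is explicit: the normalised sum of the null
  vectors \<xi> and \<eta> is a point on it, the normalised difference the velocity there. The
  number \<open>q\<close>, from which the factor \<open>a\<close> is computed, is positive because
  distinct null vectors of equal height have a spacelike difference.\<close>

lemma hyp_hull_nonempty:
  assumes "\<xi> \<in> L" "\<eta> \<in> L" "\<xi> \<noteq> \<eta>" "L \<subseteq> ideal_boundary"
  shows "hyp_hull L \<noteq> {}"
proof -
  have I: "\<xi> \<in> ideal_boundary" "\<eta> \<in> ideal_boundary" using assms by auto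
  define v where "v = ray_dir origin \<xi>"
  define w where "w = ray_dir origin \<eta>"
  have v: "(origin, v) \<in> hyp_unit_tangent" and w: "(origin, w) \<in> hyp_unit_tangent"
    unfolding v_def w_def by (intro ray_dir_tangent origin_in_hyp_space I)+
  define q where "q = - mform \<xi> \<eta>"
  have z: "mform \<xi> \<xi> = 0" "mform \<eta> \<eta> = 0" "\<xi> $ None = 1" "\<eta> $ None = 1"
    using I by (auto simp: ideal_boundary_def)
  have "(norm (\<xi> - \<eta>))\<^sup>2 \<le> 2 * mform (\<xi> - \<eta>) (\<xi> - \<eta>)"
    using norm_sq_le_mform_perp[OF origin_in_hyp_space, of "\<xi> - \<eta>"] z by (simp add: mform_origin origin_None)
  moreover have "mform (\<xi> - \<eta>) (\<xi> - \<eta>) = 2 * q" using z mform_commute[of \<xi> \<eta>] by (simp add: mform_simps q_def)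
  ultimately have "(norm (\<xi> - \<eta>))\<^sup>2 \<le> 4 * q" by simp
  moreover have "0 < (norm (\<xi> - \<eta>))\<^sup>2" using assms(3) by simp
  ultimately have q: "0 < q" by linarith
  define a where "a = 1 / sqrt (2 * q)"
  have a: "0 < a" "a * a * (2 * q) = 1" using q by (auto simp: a_def)
  have "2 * a * (a * q) = 1" using a(2) by (simp only: mult_ac)
  moreover have "a * q \<noteq> 0" using a(1) q by simp
  ultimately have aq: "1 / (a * q) = 2 * a" by (metis nonzero_eq_divide_eq)
  define x where "x = a *\<^sub>R (\<xi> + \<eta>)"
  define u where "u = a *\<^sub>R (\<xi> - \<eta>)"
  have x: "x \<in> hyp_space"
    unfolding hyp_space_def using a z mform_commute[of \<xi> \<eta>] by (simp add: x_def mform_simps q_def)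
  have T: "(x, u) \<in> hyp_unit_tangent"
    unfolding hyp_unit_tangent_def using x a z mform_commute[of \<xi> \<eta>] by (simp add: x_def u_def mform_simps q_def)
  have "u = ray_dir x \<xi>"
  proof -
    have "mform x \<xi> = - (a * q)" using z mform_commute[of \<xi> \<eta>] by (simp add: x_def mform_simps q_def)
    then have "- 1 / mform x \<xi> = 2 * a" using aq by (simp only: minus_divide_divide) 
    then show ?thesis unfolding ray_dir_def u_def x_def[symmetric]
      by (simp add: vec_eq_iff) (simp add: x_def algebra_simps)
  qed
  then have r1: "ray_tendsto (x, u) \<xi>" using ray_tendsto_ray_dir[OF x I(1)] by simp
  have "- u = ray_dir x \<eta>"
  proof -
    have "mform x \<eta> = - (a * q)" using z mform_commute[of \<xi> \<eta>] by (simp add: x_def mform_simps q_def)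
    then have "- 1 / mform x \<eta> = 2 * a" using aq by (simp only: minus_divide_divide) 
    then show ?thesis unfolding ray_dir_def u_def x_def[symmetric]
      by (simp add: vec_eq_iff) (simp add: x_def algebra_simps)
  qed
  then have r2: "ray_tendsto (x, - u) \<eta>" using ray_tendsto_ray_dir[OF x I(2)] by simp
  have "x \<in> hyp_hull L" unfolding hyp_hull_def using T r1 r2 assms(1,2) by blast
  then show ?thesis by blast
qed

lemma ray_dir_inj:
  assumes "x \<in> hyp_space" "\<xi> \<in> ideal_boundary" "\<eta> \<in> ideal_boundary" "half_sin_sq (ray_dir x \<xi>) (ray_dir x \<eta>) = 0"
  shows "\<xi> = \<eta>"
proof -
  note v = ray_dir_tangent[OF assms(1,2)] and w = ray_dir_tangent[OF assms(1,3)]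
  let ?u = "ray_dir x \<xi> - ray_dir x \<eta>"
  have "mform x ?u = 0" using hyp_unit_tangentD[OF v] hyp_unit_tangentD[OF w] by (simp add: mform_simps)
  then have "(norm ?u)\<^sup>2 \<le> 2 * (x $ None)\<^sup>2 * mform ?u ?u" by (rule norm_sq_le_mform_perp[OF assms(1)])
  also have "\<dots> = 0" using half_sin_sq_eq[OF v w] assms(4) by simp
  finally have "ray_dir x \<xi> = ray_dir x \<eta>" by simp
  then show ?thesis using klein_add_ray_dir(1)[OF assms(1,2)] klein_add_ray_dir(1)[OF assms(1,3)] by metis
qed

text \<open>Angles are compared through some \<open>f s\<close> whose direction is already close to
  that of \<xi>; \<open>half_sin_sq\<close> satisfies the triangle inequality only up to a factor 2,
  hence \<open>2 * c\<close>.\<close>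

lemma limit_of_directions:
  assumes x: "x \<in> hyp_space" and \<xi>: "\<xi> \<in> ideal_boundary" and v: "(x, v) \<in> hyp_unit_tangent"
    and f: "\<And>s. f s \<in> hyp_space" and lim: "((\<lambda>s::real. klein (f s)) \<longlongrightarrow> \<xi>) at_top"
    and b: "\<And>s w. s \<ge> s0 \<Longrightarrow> (x, w) \<in> hyp_unit_tangent \<Longrightarrow> f s = geo_point x w (hyp_dist x (f s)) \<Longrightarrow> half_sin_sq v w \<le> c"
  shows "half_sin_sq v (ray_dir x \<xi>) \<le> 2 * c"
proof (rule field_le_epsilon)
  fix e :: real assume e: "0 < e"
  note t = klein_tendstoD[OF x \<xi> always_eventually[OF allI[OF f]] lim]
  have "\<forall>\<^sub>F s in at_top. half_sin_sq (ray_dir x \<xi>) (geo_dir x (f s)) < e / 2"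
    using order_tendstoD(2)[OF t(2), of "e / 2"] e by simp
  moreover have "\<forall>\<^sub>F s in at_top. 0 < hyp_dist x (f s)" using t(1) unfolding filterlim_at_top_dense by blast
  ultimately have "\<forall>\<^sub>F s in at_top. s \<ge> s0 \<and> 0 < hyp_dist x (f s) \<and> half_sin_sq (ray_dir x \<xi>) (geo_dir x (f s)) < e / 2"
    using eventually_ge_at_top[of s0] by eventually_elim auto
  then obtain s where s: "s \<ge> s0" "0 < hyp_dist x (f s)" "half_sin_sq (ray_dir x \<xi>) (geo_dir x (f s)) < e / 2"
    by (metis (mono_tags, lifting) eventually_happens trivial_limit_at_top_linorder)
  note w = geo_dir_props[OF x f s(2)]
  have "half_sin_sq v (ray_dir x \<xi>) \<le> 2 * half_sin_sq v (geo_dir x (f s)) + 2 * half_sin_sq (geo_dir x (f s)) (ray_dir x \<xi>)"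
    by (rule half_sin_sq_triangle[OF v w(1) ray_dir_tangent[OF x \<xi>]])
  also have "half_sin_sq v (geo_dir x (f s)) \<le> c" by (rule b[OF s(1) w])
  finally show "half_sin_sq v (ray_dir x \<xi>) \<le> 2 * c + e" using s(3) by (simp add: half_sin_sq_commute)
qed

section \<open>The limit set seen from an arbitrary base point\<close>

context discrete_isom_group
begin

lemma limit_set_ideal: "limit_set \<Gamma> \<subseteq> ideal_boundary"
  by (auto simp: limit_set_def)

lemma limit_set_sequence:
  assumes "\<xi> \<in> limit_set \<Gamma>"
  obtains g where "\<And>n::nat. g n \<in> \<Gamma>" "(\<lambda>n. klein (g n *v origin)) \<longlonglongrightarrow> \<xi>"
proof -
  have "\<xi> islimpt klein ` point_orbit \<Gamma> origin" using assms by (simp add: limit_set_def)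
  then obtain f where f: "\<And>n::nat. f n \<in> klein ` point_orbit \<Gamma> origin" "f \<longlonglongrightarrow> \<xi>"
    unfolding islimpt_sequential by blast
  then have "\<forall>n. \<exists>g\<in>\<Gamma>. f n = klein (g *v origin)" by (auto simp: point_orbit_def)
  then obtain g where g: "\<And>n. g n \<in> \<Gamma>" "\<And>n. f n = klein (g n *v origin)" by metis
  moreover have "f = (\<lambda>n. klein (g n *v origin))" using g(2) by blast
  ultimately show thesis using that[of g] f(2) by simp
qed

text \<open>A boundary limit of orbit points is automatically an accumulation point, because no
  orbit point is ideal.\<close>

lemma limit_setI:
  assumes "\<xi> \<in> ideal_boundary" "\<And>n::nat. g n \<in> \<Gamma>" "(\<lambda>n. klein (g n *v origin)) \<longlonglongrightarrow> \<xi>"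
  shows "\<xi> \<in> limit_set \<Gamma>"
proof -
  have "klein (g n *v origin) \<in> klein ` point_orbit \<Gamma> origin - {\<xi>}" for n
    using klein_hyp_not_ideal[OF act_hyp[OF assms(2) origin_in_hyp_space] assms(1)] assms(2) unfolding point_orbit_def by blast
  then have "\<xi> islimpt klein ` point_orbit \<Gamma> origin"
    unfolding islimpt_sequential using assms(3) by (intro exI[of _ "\<lambda>n. klein (g n *v origin)"]) blast
  then show ?thesis unfolding limit_set_def using assms(1) by blast
qed

lemma limit_set_invariant:
  assumes "g \<in> \<Gamma>" "\<xi> \<in> limit_set \<Gamma>" shows "boundary_act g \<xi> \<in> limit_set \<Gamma>"
proof -
  obtain h where h: "\<And>n::nat. h n \<in> \<Gamma>" "(\<lambda>n. klein (h n *v origin)) \<longlonglongrightarrow> \<xi>"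
    using limit_set_sequence[OF assms(2)] by blast
  have \<xi>: "\<xi> \<in> ideal_boundary" using assms limit_set_ideal by blast
  have "(\<lambda>n. klein (g *v (h n *v origin))) \<longlonglongrightarrow> boundary_act g \<xi>"
    using klein_act_tendsto[OF carrier[OF assms(1)] \<xi> _ h(2)] act_hyp[OF h(1) origin_in_hyp_space] by simp
  then show ?thesis
    using limit_setI[of "boundary_act g \<xi>" "\<lambda>n. g ** h n"] boundary_act_in(1)[OF carrier[OF assms(1)] \<xi>] mult_in[OF assms(1) h(1)]
    by (simp add: matrix_vector_mul_assoc)
qed

text \<open>The limit set is defined through the orbit of the origin. The orbit of \<open>x\<close>
  follows it at the constant distance \<open>R\<close>, and far away this changes directions at
  \<open>x\<close> by an exponentially small amount.\<close>

lemma limit_setD: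
  assumes x: "x \<in> hyp_space" and "\<xi> \<in> limit_set \<Gamma>" "0 < \<epsilon>"
  shows "\<exists>g\<in>\<Gamma>. N \<le> hyp_dist x (g *v x) \<and> 0 < hyp_dist x (g *v x) \<and> half_sin_sq (ray_dir x \<xi>) (geo_dir x (g *v x)) < \<epsilon>"
proof -
  obtain g where g: "\<And>n::nat. g n \<in> \<Gamma>" "(\<lambda>n. klein (g n *v origin)) \<longlonglongrightarrow> \<xi>"
    using limit_set_sequence[OF assms(2)] by blast
  have \<xi>: "\<xi> \<in> ideal_boundary" using assms limit_set_ideal by blast
  note go = act_hyp[OF g(1) origin_in_hyp_space] and gx = act_hyp[OF g(1) x]
  note t = klein_tendstoD[OF x \<xi> always_eventually[OF allI[OF go]] g(2)]
  define R where "R = hyp_dist origin x"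
  have d: "hyp_dist (g n *v origin) (g n *v x) = R" for n by (simp add: isom_dist[OF carrier[OF g(1)]] R_def)
  have "(\<lambda>s. 8 * exp (2 + 4 * R - 2 * s)) = (\<lambda>s::real. 8 * exp (2 + 4 * R) * (exp (-s) * exp (-s)))"
    by (auto simp: mult_exp_exp)
  moreover have "((\<lambda>s::real. 8 * exp (2 + 4 * R) * (exp (-s) * exp (-s))) \<longlongrightarrow> 8 * exp (2 + 4 * R) * (0 * 0)) at_top"
    by (intro tendsto_intros filterlim_compose[OF exp_at_bot filterlim_uminus_at_bot_at_top])
  ultimately have "((\<lambda>s. 8 * exp (2 + 4 * R - 2 * s)) \<longlongrightarrow> 0) at_top" by simp
  from filterlim_compose[OF this t(1)]
  have "\<forall>\<^sub>F n in sequentially. 8 * exp (2 + 4 * R - 2 * hyp_dist x (g n *v origin)) < \<epsilon> / 4"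
    by (rule order_tendstoD(2)) (use assms(3) in simp)
  moreover have "\<forall>\<^sub>F n in sequentially. half_sin_sq (ray_dir x \<xi>) (geo_dir x (g n *v origin)) < \<epsilon> / 4"
    using order_tendstoD(2)[OF t(2), of "\<epsilon> / 4"] assms(3) by simp
  moreover have "\<forall>\<^sub>F n in sequentially. max N 0 + R < hyp_dist x (g n *v origin)"
    using t(1) unfolding filterlim_at_top_dense by blast
  ultimately have "\<forall>\<^sub>F n in sequentially. 8 * exp (2 + 4 * R - 2 * hyp_dist x (g n *v origin)) < \<epsilon> / 4 \<and>
     half_sin_sq (ray_dir x \<xi>) (geo_dir x (g n *v origin)) < \<epsilon> / 4 \<and> max N 0 + R < hyp_dist x (g n *v origin)"
    by eventually_elim auto
  then obtain n where n: "8 * exp (2 + 4 * R - 2 * hyp_dist x (g n *v origin)) < \<epsilon> / 4"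
     "half_sin_sq (ray_dir x \<xi>) (geo_dir x (g n *v origin)) < \<epsilon> / 4" "max N 0 + R < hyp_dist x (g n *v origin)"
    by (metis (mono_tags, lifting) eventually_happens trivial_limit_sequentially)
  have R: "0 \<le> R" using x by (simp add: R_def)
  have p: "0 < hyp_dist x (g n *v origin)" "0 < hyp_dist x (g n *v x)" "N \<le> hyp_dist x (g n *v x)"
    using n(3) R hyp_dist_triangle[OF x gx[of n] go[of n]] d[of n] by (auto simp: hyp_dist_commute)
  have "half_sin_sq (geo_dir x (g n *v origin)) (geo_dir x (g n *v x)) < \<epsilon> / 4"
    using nearby_geo_dir[OF x go gx p(1,2), of R] d[of n] n(1) by simp
  then have "half_sin_sq (ray_dir x \<xi>) (geo_dir x (g n *v x)) < \<epsilon>"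
    using half_sin_sq_triangle[OF ray_dir_tangent[OF x \<xi>] geo_dir_props(1)[OF x go p(1)] geo_dir_props(1)[OF x gx p(2)]] n(2)
    by linarith
  then show ?thesis using p g(1) by blast
qed

text \<open>By contraposition, with one number \<open>n\<close> for both the distance and the angle:
  failure for all \<open>n\<close> produces orbit points going to infinity in directions converging
  to that of \<xi>, which puts \<xi> in the limit set. These \<open>n\<close> index the exhaustion
  of the complement used later.\<close>

lemma not_limit_setD:
  assumes x: "x \<in> hyp_space" and \<xi>: "\<xi> \<in> ideal_boundary" "\<xi> \<notin> limit_set \<Gamma>"
  shows "\<exists>n::nat. 0 < n \<and> (\<forall>g\<in>\<Gamma>. real n \<le> hyp_dist x (g *v x) \<longrightarrow> 1 / real n \<le> half_sin_sq (ray_dir x \<xi>) (geo_dir x (g *v x)))"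
proof (rule ccontr)
  assume "\<not> ?thesis"
  then have "\<forall>n. \<exists>g\<in>\<Gamma>. real (Suc n) \<le> hyp_dist x (g *v x) \<and> half_sin_sq (ray_dir x \<xi>) (geo_dir x (g *v x)) < 1 / real (Suc n)"
    by (metis linorder_not_le zero_less_Suc)
  then obtain g where g: "\<And>n. g n \<in> \<Gamma>" "\<And>n. real (Suc n) \<le> hyp_dist x (g n *v x)"
    "\<And>n. half_sin_sq (ray_dir x \<xi>) (geo_dir x (g n *v x)) < 1 / real (Suc n)" by metis
  note go = act_hyp[OF g(1) origin_in_hyp_space] and gx = act_hyp[OF g(1) x]
  define R where "R = hyp_dist origin x"
  have R: "0 \<le> R" using x by (simp add: R_def)
  have d: "hyp_dist (g n *v x) (g n *v origin) = R" for n by (simp add: isom_dist[OF carrier[OF g(1)]] R_def hyp_dist_commute)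
  have do: "real n - R < hyp_dist x (g n *v origin)" for n
    using hyp_dist_triangle[OF x go gx, of n n] d[of n] g(2)[of n] by (simp add: hyp_dist_commute)
  have "(\<lambda>n. klein (g n *v origin)) \<longlonglongrightarrow> \<xi>"
  proof (rule klein_tendstoI[OF x \<xi>(1) always_eventually[OF allI[OF go]]])
    show "filterlim (\<lambda>n. hyp_dist x (g n *v origin)) at_top sequentially"
    proof (rule filterlim_at_top_mono)
      show "filterlim (\<lambda>n. - R + real n) at_top sequentially"
        by (intro filterlim_tendsto_add_at_top[OF tendsto_const] filterlim_real_sequentially)
      show "\<forall>\<^sub>F n in sequentially. - R + real n \<le> hyp_dist x (g n *v origin)"
        using do by (intro always_eventually allI) (smt (verit))
    qed
    show "(\<lambda>n. half_sin_sq (ray_dir x \<xi>) (geo_dir x (g n *v origin))) \<longlonglongrightarrow> 0"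
    proof (rule Lim_null_comparison)
      have "(\<lambda>n. 2 * (1 / real (Suc n)) + 16 * exp (2 + 4 * R) * (exp (- real n) * exp (- real n))) \<longlonglongrightarrow> 2 * 0 + 16 * exp (2 + 4 * R) * (0 * 0)"
        by (intro tendsto_intros filterlim_compose[OF exp_at_bot] filterlim_compose[OF filterlim_uminus_at_bot_at_top] filterlim_real_sequentially
            LIMSEQ_Suc[OF lim_1_over_n])
      then show "(\<lambda>n. 2 * (1 / real (Suc n)) + 16 * exp (2 + 4 * R) * (exp (- real n) * exp (- real n))) \<longlonglongrightarrow> 0" by simp
      have "\<forall>\<^sub>F n in sequentially. real n > R" using filterlim_real_sequentially unfolding filterlim_at_top_dense by blast
      then show "\<forall>\<^sub>F n in sequentially. norm (half_sin_sq (ray_dir x \<xi>) (geo_dir x (g n *v origin)))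
          \<le> 2 * (1 / real (Suc n)) + 16 * exp (2 + 4 * R) * (exp (- real n) * exp (- real n))"
      proof eventually_elim
        case (elim n)
        have p: "0 < hyp_dist x (g n *v x)" "0 < hyp_dist x (g n *v origin)"
          using g(2)[of n] do[of n] elim by auto
        note T = ray_dir_tangent[OF x \<xi>(1)] geo_dir_props(1)[OF x gx p(1)] geo_dir_props(1)[OF x go p(2)]
        have "half_sin_sq (geo_dir x (g n *v x)) (geo_dir x (g n *v origin)) \<le> 8 * exp (2 + 4 * R - 2 * hyp_dist x (g n *v x))"
          by (rule nearby_geo_dir[OF x gx go p]) (simp add: d)
        also have "\<dots> \<le> 8 * exp (2 + 4 * R - 2 * real n)" using g(2)[of n] by simp
        also have "\<dots> = 8 * exp (2 + 4 * R) * (exp (- real n) * exp (- real n))" by (simp add: mult_exp_exp)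
        finally show ?case
          using half_sin_sq_triangle[OF T] g(3)[of n] half_sin_sq_nonneg[OF T(1,3)] by simp
      qed
    qed
  qed
  then show False using limit_setI[OF \<xi>(1), of g, OF g(1)] \<xi>(2) by blast
qed

text \<open>If \<xi> is not seen from \<open>x\<close> in the direction of
  \<open>ginv g *v x\<close>, the path from that point through \<open>x\<close> to \<xi> is almost
  geodesic, since a wide angle makes distances nearly add. Its image under \<open>g\<close> is an
  almost geodesic path from \<open>x\<close> through \<open>g *v x\<close> to the translate of
  \<xi>, which therefore lies in the shadow of \<open>g *v x\<close>.\<close>

lemma direction_of_translate:
  assumes x: "x \<in> hyp_space" and g: "g \<in> \<Gamma>" and \<xi>I: "\<xi> \<in> ideal_boundary" and k: "0 \<le> k"
    and u: "(x, u) \<in> hyp_unit_tangent" "ginv g *v x = geo_point x u (hyp_dist x (g *v x))" "exp (- 2 * k) \<le> half_sin_sq u (ray_dir x \<xi>)"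
    and v: "(x, v) \<in> hyp_unit_tangent" "g *v x = geo_point x v (hyp_dist x (g *v x))"
  shows "half_sin_sq v (ray_dir x (boundary_act g \<xi>)) \<le> 16 * exp (2 + 2 * (2 * k + 3)) * exp (- 2 * hyp_dist x (g *v x))"
proof -
  define l where "l = hyp_dist x (g *v x)"
  have l0: "0 \<le> l" using x act_hyp[OF g x] by (simp add: l_def)
  note r = ray_dir_tangent[OF x \<xi>I]
  define \<eta> where "\<eta> = boundary_act g \<xi>"
  have \<eta>: "\<eta> \<in> ideal_boundary" unfolding \<eta>_def by (rule boundary_act_in(1)[OF carrier[OF g] \<xi>I])
  define q where "q s = g *v geo_point x (ray_dir x \<xi>) s" for s
  have q: "q s \<in> hyp_space" for s unfolding q_def by (intro act_hyp g geo_point_in_hyp_space[OF r])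
  have lim: "((\<lambda>s. klein (q s)) \<longlongrightarrow> \<eta>) at_top"
    unfolding q_def \<eta>_def using klein_act_tendsto[OF carrier[OF g] \<xi>I, of "\<lambda>s. geo_point x (ray_dir x \<xi>) s" at_top] geo_point_in_hyp_space[OF r] ray_tendsto_ray_dir[OF x \<xi>I]
    by (simp add: ray_tendsto_def geo_flow_eq)
  have "half_sin_sq v (ray_dir x \<eta>) \<le> 2 * (8 * exp (2 + 2 * (2 * k + 3) - 2 * l))"
  proof (rule limit_of_directions[OF x \<eta> v(1) q lim, of 0])
    fix s :: real and w assume s: "0 \<le> s" and w: "(x, w) \<in> hyp_unit_tangent" "q s = geo_point x w (hyp_dist x (q s))"
    have 1: "hyp_dist x (q s) = hyp_dist (ginv g *v x) (geo_point x (ray_dir x \<xi>) s)"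
      unfolding q_def using dist_ginv[OF g] by simp
    have 2: "l + s - 2 * k - 3 \<le> hyp_dist x (q s)"
      unfolding 1 u(2) l_def[symmetric] by (rule wide_angle_dist[OF u(1) r l0 s k u(3)])
    have 3: "hyp_dist (g *v x) (q s) = s"
      unfolding q_def isom_dist[OF carrier[OF g]] by (rule hyp_dist_geo_point_0[OF r s])
    show "half_sin_sq v w \<le> 8 * exp (2 + 2 * (2 * k + 3) - 2 * l)"
    proof (rule almost_geodesic_angle[of x v w l "hyp_dist x (q s)"])
      show "l + hyp_dist (geo_point x v l) (geo_point x w (hyp_dist x (q s))) \<le> hyp_dist x (q s) + (2 * k + 3)"
        using 2 3 v w(2) by (simp add: l_def)
    qed (use v w l0 k hyp_dist_nonneg[OF x q] in auto)
  qed
  also have "\<dots> = 16 * exp (2 + 2 * (2 * k + 3)) * exp (- 2 * l)" by (simp add: mult_exp_exp)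
  finally show ?thesis by (simp add: l_def \<eta>_def)
qed

text \<open>The preimage under \<open>g\<close> of any set competing in the definition of the hull
  competes as well, because \<open>g\<close> maps the limit set into itself and geodesics to
  geodesics; so this preimage contains the hull.\<close>

lemma hull_invariant:
  assumes g: "g \<in> \<Gamma>" and x: "x \<in> hyp_hull (limit_set \<Gamma>)" shows "g *v x \<in> hyp_hull (limit_set \<Gamma>)"
  unfolding hyp_hull_def
proof (rule InterI, clarify)
  fix C assume C: "geo_convex C" and e: "\<forall>(x, v)\<in>hyp_unit_tangent.
        (\<exists>\<xi>\<in>limit_set \<Gamma>. ray_tendsto (x, v) \<xi>) \<and> (\<exists>\<eta>\<in>limit_set \<Gamma>. ray_tendsto (x, - v) \<eta>) \<longrightarrow> x \<in> C"
  note gc = carrier[OF g]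
  let ?C = "{y \<in> hyp_space. g *v y \<in> C}"
  have "geo_convex ?C"
    unfolding geo_convex_def
  proof (intro conjI ballI impI)
    fix a b assume a: "a \<in> ?C" and b: "b \<in> ?C" and ab: "a \<noteq> b"
    have aH: "a \<in> hyp_space" "b \<in> hyp_space" using a b by auto
    have d: "0 < hyp_dist a b"
      using ab hyp_dist_eq_0_iff[OF aH] hyp_dist_nonneg[OF aH] by linarith
    have "g *v a \<noteq> g *v b" using ginv_act(1)[OF g] ab by metis
    then have s: "geo_segment (g *v a) (g *v b) \<subseteq> C" using C a b by (auto simp: geo_convex_def)
    show "geo_segment a b \<subseteq> ?C"
    proof
      fix p assume "p \<in> geo_segment a b"
      then obtain t where t: "t \<in> {0..hyp_dist a b}" "p = geo_point a (geo_dir a b) t"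
        by (auto simp: geo_segment_def geo_flow_eq)
      have "g *v p \<in> geo_segment (g *v a) (g *v b)"
        unfolding geo_segment_def geo_flow_eq isom_dist[OF gc] isom_geo_dir[OF gc] t(2) isom_geo_point using t(1) by auto
      moreover have "p \<in> hyp_space" using t(2) geo_point_in_hyp_space geo_dir_props(1)[of a b] a b d by blast
      ultimately show "p \<in> ?C" using s by auto
    qed
  qed auto
  moreover have "\<forall>(x, v)\<in>hyp_unit_tangent.
        (\<exists>\<xi>\<in>limit_set \<Gamma>. ray_tendsto (x, v) \<xi>) \<and> (\<exists>\<eta>\<in>limit_set \<Gamma>. ray_tendsto (x, - v) \<eta>) \<longrightarrow> x \<in> ?C"
  proof clarify
    fix y v \<xi> \<eta> assume T: "(y, v) \<in> hyp_unit_tangent" and \<xi>: "\<xi> \<in> limit_set \<Gamma>" "ray_tendsto (y, v) \<xi>"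
      and \<eta>: "\<eta> \<in> limit_set \<Gamma>" "ray_tendsto (y, - v) \<eta>"
    have "ray_tendsto (g *v y, g *v v) (boundary_act g \<xi>)"
      using ray_tendsto_act[OF gc _ T \<xi>(2)] \<xi>(1) limit_set_ideal by blast
    moreover have "ray_tendsto (g *v y, g *v (- v)) (boundary_act g \<eta>)"
      using ray_tendsto_act[OF gc _ tangent_uminus[OF T] \<eta>(2)] \<eta>(1) limit_set_ideal by blast
    moreover have "g *v (- v) = - (g *v v)" using matrix_vector_mult_diff_distrib[of g 0 v] by simp
    ultimately have "g *v y \<in> C"
      using e isom_tangent[OF gc T] limit_set_invariant[OF g \<xi>(1)] limit_set_invariant[OF g \<eta>(1)] by fastforce
    then show "y \<in> hyp_space \<and> g *v y \<in> C" using hyp_unit_tangentD[OF T] by simp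
  qed
  ultimately have "x \<in> ?C" using x unfolding hyp_hull_def by blast
  then show "g *v x \<in> C" by simp
qed

end

section \<open>Consequences of convex-cocompactness\<close>

locale cocompact_isom_group = discrete_isom_group +
  assumes nonelementary: "nonelementary \<Gamma>" and cocompact: "convex_cocompact \<Gamma>"
begin

lemma two_limit_points: obtains \<xi> \<eta> where "\<xi> \<in> limit_set \<Gamma>" "\<eta> \<in> limit_set \<Gamma>" "\<xi> \<noteq> \<eta>"
proof -
  have inf: "infinite (limit_set \<Gamma>)" using nonelementary by (simp add: nonelementary_def)
  then obtain \<xi> where \<xi>: "\<xi> \<in> limit_set \<Gamma>" using infinite_imp_nonempty by blast
  have "limit_set \<Gamma> - {\<xi>} \<noteq> {}" using inf by (intro infinite_imp_nonempty) simp
  then show thesis using that \<xi> by blast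
qed

text \<open>The points of the hull at distance less than \<open>n\<close> from the orbit of
  \<open>y\<close> form a saturated open set, so their images are an increasing open cover of the
  compact quotient. Here \<open>y\<close> is any point, not only one of the hull.\<close>

lemma hull_cobounded:
  assumes y: "y \<in> hyp_space"
  obtains D where "0 \<le> D" "\<And>p. p \<in> hyp_hull (limit_set \<Gamma>) \<Longrightarrow> \<exists>h\<in>\<Gamma>. hyp_dist p (h *v y) \<le> D"
proof -
  define S where "S = hyp_hull (limit_set \<Gamma>)"
  define V where "V n = {p \<in> S. \<exists>h\<in>\<Gamma>. hyp_dist p (h *v y) < real n}" for n
  define U where "U n = point_orbit \<Gamma> ` V n" for n
  let ?Q = "quotient_topology \<Gamma> S"
  have SH: "S \<subseteq> hyp_space" using hyp_hull_subset by (simp add: S_def)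
  have pre: "{p \<in> S. point_orbit \<Gamma> p \<in> U n} = V n" for n
  proof
    show "{p \<in> S. point_orbit \<Gamma> p \<in> U n} \<subseteq> V n"
    proof clarify
      fix p assume p: "p \<in> S" "point_orbit \<Gamma> p \<in> U n"
      then obtain q where q: "q \<in> V n" "point_orbit \<Gamma> p = point_orbit \<Gamma> q" by (auto simp: U_def)
      have "p \<in> point_orbit \<Gamma> p" using one_in by (auto simp: point_orbit_def intro!: image_eqI[of _ _ "mat 1"])
      then obtain g where g: "g \<in> \<Gamma>" "p = g *v q" using q by (auto simp: point_orbit_def)
      obtain h where h: "h \<in> \<Gamma>" "hyp_dist q (h *v y) < real n" using q by (auto simp: V_def)
      have "hyp_dist p ((g ** h) *v y) < real n"
        using h isom_dist[OF carrier[OF g(1)], of q "h *v y"] by (simp add: g(2) flip: matrix_vector_mul_assoc)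
      then show "p \<in> V n" unfolding V_def using p mult_in[OF g(1) h(1)] by blast
    qed
  qed (auto simp: V_def U_def)
  have op: "openin ?Q (U n)" for n
    unfolding openin_quotient_topology pre
  proof
    show "U n \<subseteq> point_orbit \<Gamma> ` S" by (auto simp: U_def V_def)
    have "V n = (\<Union>h\<in>\<Gamma>. S \<inter> (\<lambda>p. hyp_dist p (h *v y)) -` {..<real n})" by (auto simp: V_def)
    also have "openin (top_of_set S) \<dots>"
    proof (intro openin_Union ballI, clarify)
      fix h assume h: "h \<in> \<Gamma>"
      have "continuous_on S (\<lambda>p. hyp_dist p (h *v y))"
        using SH act_hyp[OF h y] by (intro continuous_intros) auto
      then show "openin (top_of_set S) (S \<inter> (\<lambda>p. hyp_dist p (h *v y)) -` {..<real n})"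
        by (intro continuous_openin_preimage_gen) auto
    qed
    finally show "openin (top_of_set S) (V n)" .
  qed
  have ts: "topspace ?Q \<subseteq> (\<Union>n. U n)"
  proof
    fix P assume "P \<in> topspace ?Q"
    then have "P \<in> point_orbit \<Gamma> ` S" using openin_topspace[of ?Q] unfolding openin_quotient_topology by blast
    then obtain p where p: "p \<in> S" "P = point_orbit \<Gamma> p" by blast
    obtain n where "hyp_dist p (mat 1 *v y) < real n" using reals_Archimedean2 by blast
    then have "p \<in> V n" unfolding V_def using p(1) one_in by blast
    then show "P \<in> (\<Union>n. U n)" using p by (auto simp: U_def)
  qed
  have "compact_space ?Q" using cocompact by (simp add: convex_cocompact_def S_def)
  then obtain \<F> where F: "finite \<F>" "\<F> \<subseteq> range U" "topspace ?Q \<subseteq> \<Union>\<F>"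
    unfolding compact_space_alt using op ts by (metis (no_types, lifting) image_iff)
  then obtain N where N: "finite N" "\<F> = U ` N" by (meson finite_subset_image)
  define m where "m = Max (insert 0 N)"
  have "\<exists>h\<in>\<Gamma>. hyp_dist p (h *v y) \<le> real m" if p: "p \<in> S" for p
  proof -
    have "openin ?Q (point_orbit \<Gamma> ` S)"
      unfolding openin_quotient_topology by (auto intro: openin_subtopology_self)
        (metis (mono_tags, lifting) Collect_cong Collect_mem_eq image_eqI openin_subtopology_self)
    then have "point_orbit \<Gamma> p \<in> topspace ?Q" using p openin_subset by blast
    then obtain n where n: "n \<in> N" "point_orbit \<Gamma> p \<in> U n" using F N by auto
    then have "p \<in> V n" using pre p by blast
    then obtain h where "h \<in> \<Gamma>" "hyp_dist p (h *v y) < real n" by (auto simp: V_def)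
    moreover have "n \<le> m" using n N by (simp add: m_def)
    ultimately show ?thesis by force
  qed
  then show thesis using that[of "real m"] by (auto simp: S_def)
qed

text \<open>The segment from \<open>y\<close> to \<open>g *v y\<close> with \<open>y\<close> in the
  hull stays in the hull and hence near the orbit of \<open>x\<close>; replacing its ends by
  \<open>x\<close> and \<open>g *v x\<close>, which may lie outside the hull, costs multiples of the
  distance \<open>E\<close>.\<close>

lemma orbit_quasi_convex:
  assumes x: "x \<in> hyp_space"
  shows "\<exists>C\<ge>0. \<forall>g\<in>\<Gamma>. \<forall>t. 0 \<le> t \<and> t \<le> hyp_dist x (g *v x) \<longrightarrow>
    (\<exists>h\<in>\<Gamma>. hyp_dist x (h *v x) + hyp_dist (h *v x) (g *v x) \<le> hyp_dist x (g *v x) + C \<and> \<bar>hyp_dist x (h *v x) - t\<bar> \<le> C)"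
proof -
  obtain y where y: "y \<in> hyp_hull (limit_set \<Gamma>)"
    using hyp_hull_nonempty[OF _ _ _ limit_set_ideal] two_limit_points by blast
  then have yH: "y \<in> hyp_space" using hyp_hull_subset by blast
  obtain D where D: "0 \<le> D" "\<And>p. p \<in> hyp_hull (limit_set \<Gamma>) \<Longrightarrow> \<exists>h\<in>\<Gamma>. hyp_dist p (h *v x) \<le> D"
    using hull_cobounded[OF x] by blast
  define E where "E = hyp_dist x y"
  have E: "0 \<le> E" using x yH by (simp add: E_def)
  show ?thesis
  proof (intro exI[of _ "4 * E + 2 * D"] conjI ballI allI impI)
    show "0 \<le> 4 * E + 2 * D" using D E by simp
    fix g t assume g: "g \<in> \<Gamma>" and t: "0 \<le> t \<and> t \<le> hyp_dist x (g *v x)"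
    note gx = act_hyp[OF g x] and gy = act_hyp[OF g yH]
    define l where "l = hyp_dist y (g *v y)"
    have l0: "0 \<le> l" using yH gy by (simp add: l_def)
    have Eg: "hyp_dist (g *v x) (g *v y) = E" by (simp add: isom_dist[OF carrier[OF g]] E_def)
    have ll: "l \<le> hyp_dist x (g *v x) + 2 * E" "hyp_dist x (g *v x) \<le> l + 2 * E"
      using hyp_dist_triangle[OF yH x gy] hyp_dist_triangle[OF x gx gy] hyp_dist_triangle[OF x yH gx] hyp_dist_triangle[OF yH gy gx] Eg
      by (auto simp: hyp_dist_commute l_def E_def)
    \<comment> \<open>The segment between the translates of \<open>y\<close> may be shorter than the
      one for \<open>x\<close>, so the prescribed time is truncated; the lengths differ by at most
      \<open>2 * E\<close>.\<close>
    define s where "s = min t l"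
    have s: "0 \<le> s" "s \<le> l" "\<bar>s - t\<bar> \<le> 2 * E" using t l0 ll E by (auto simp: s_def)
    obtain p where p: "p \<in> hyp_hull (limit_set \<Gamma>)" "hyp_dist y p = s" "hyp_dist p (g *v y) = l - s"
    proof (cases "0 < l")
      case True
      define v where "v = geo_dir y (g *v y)"
      have v: "(y, v) \<in> hyp_unit_tangent" "g *v y = geo_point y v l"
        using geo_dir_props[OF yH gy] True by (auto simp: l_def v_def)
      show ?thesis
      proof (rule that[of "geo_point y v s"])
        show "geo_point y v s \<in> hyp_hull (limit_set \<Gamma>)" unfolding v_def
          using geo_point_in_hyp_hull[OF y hull_invariant[OF g y] s(1)] s(2) True by (simp add: l_def)
        show "hyp_dist y (geo_point y v s) = s" by (rule hyp_dist_geo_point_0[OF v(1) s(1)])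
        show "hyp_dist (geo_point y v s) (g *v y) = l - s" using hyp_dist_geo_point[OF v(1), of s l] v(2) s by simp
      qed
    next
      case False
      then have "l = 0" using l0 by simp
      then show ?thesis using that[of y] y s yH by (simp add: l_def)
    qed
    have pH: "p \<in> hyp_space" using p hyp_hull_subset by blast
    obtain h where h: "h \<in> \<Gamma>" "hyp_dist p (h *v x) \<le> D" using D(2)[OF p(1)] by blast
    note hx = act_hyp[OF h(1) x]
    have h': "hyp_dist (h *v x) p \<le> D" using h by (simp add: hyp_dist_commute)
    have 1: "hyp_dist x (h *v x) \<le> E + s + D"
      using hyp_dist_triangle[OF x pH hx] hyp_dist_triangle[OF x yH pH] p h by (simp add: E_def)
    have 2: "hyp_dist (h *v x) (g *v x) \<le> D + (l - s) + E"
      using hyp_dist_triangle[OF hx pH gx] hyp_dist_triangle[OF pH gy gx] p h' Eg by (simp add: hyp_dist_commute)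
    have 3: "s \<le> E + hyp_dist x (h *v x) + D"
      using hyp_dist_triangle[OF yH x pH] hyp_dist_triangle[OF x hx pH] p h' by (simp add: E_def hyp_dist_commute)
    show "\<exists>h\<in>\<Gamma>. hyp_dist x (h *v x) + hyp_dist (h *v x) (g *v x) \<le> hyp_dist x (g *v x) + (4 * E + 2 * D) \<and>
          \<bar>hyp_dist x (h *v x) - t\<bar> \<le> 4 * E + 2 * D"
      using 1 2 3 ll s h(1) E D(1) by (intro bexI[of _ h]) auto
  qed
qed

text \<open>Up to any given time, a ray to a limit point is followed by a segment towards an orbit
  point seen in nearly the same direction, and quasi-convexity applies to that segment.\<close>

lemma orbit_near_ray:
  assumes x: "x \<in> hyp_space"
  shows "\<exists>C\<ge>0. \<forall>\<xi>\<in>limit_set \<Gamma>. \<forall>t\<ge>0. \<exists>h\<in>\<Gamma>. hyp_dist (h *v x) (geo_point x (ray_dir x \<xi>) t) \<le> C"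
proof -
  obtain C where C: "C \<ge> 0" "\<And>g t. g \<in> \<Gamma> \<Longrightarrow> 0 \<le> t \<Longrightarrow> t \<le> hyp_dist x (g *v x) \<Longrightarrow>
    (\<exists>h\<in>\<Gamma>. hyp_dist x (h *v x) + hyp_dist (h *v x) (g *v x) \<le> hyp_dist x (g *v x) + C \<and> \<bar>hyp_dist x (h *v x) - t\<bar> \<le> C)"
    using orbit_quasi_convex[OF x] by blast
  show ?thesis
  proof (intro exI[of _ "2 * exp (C / 2) + 2 * C + 2"] conjI ballI allI impI)
    show "0 \<le> 2 * exp (C / 2) + 2 * C + 2" using C(1) by (simp add: add_nonneg_nonneg)
    fix \<xi> t assume \<xi>: "\<xi> \<in> limit_set \<Gamma>" and t: "0 \<le> (t::real)"
    \<comment> \<open>Chosen so that \<open>sinh t\<close> times the half-angle sine is at most 1: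
      ray and segment are then at most 2 apart at time \<open>t\<close>.\<close>
    define \<epsilon> where "\<epsilon> = 1 / (1 + (sinh t)\<^sup>2)"
    have den: "0 < 1 + (sinh t)\<^sup>2" using zero_le_power2[of "sinh t"] by linarith
    have \<epsilon>: "0 < \<epsilon>" using den by (simp add: \<epsilon>_def)
    obtain g where g: "g \<in> \<Gamma>" "t \<le> hyp_dist x (g *v x)" "0 < hyp_dist x (g *v x)"
      "half_sin_sq (ray_dir x \<xi>) (geo_dir x (g *v x)) < \<epsilon>"
      using limit_setD[OF x \<xi> \<epsilon>, of t] by blast
    have v: "(x, ray_dir x \<xi>) \<in> hyp_unit_tangent" using ray_dir_tangent[OF x] \<xi> limit_set_ideal by blast
    define w where "w = geo_dir x (g *v x)"
    have w: "(x, w) \<in> hyp_unit_tangent" "g *v x = geo_point x w (hyp_dist x (g *v x))"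
      using geo_dir_props[OF x act_hyp[OF g(1) x] g(3)] by (simp_all add: w_def)
    have "\<bar>sinh t\<bar> * sqrt (half_sin_sq (ray_dir x \<xi>) w) \<le> 1"
    proof -
      have "(sinh t)\<^sup>2 * half_sin_sq (ray_dir x \<xi>) w \<le> (sinh t)\<^sup>2 * \<epsilon>" using g(4) by (intro mult_left_mono) (auto simp: w_def)
      also have "\<dots> \<le> 1" using den by (simp add: \<epsilon>_def)
      finally have "sqrt ((sinh t)\<^sup>2 * half_sin_sq (ray_dir x \<xi>) w) \<le> sqrt 1" by (rule real_sqrt_le_mono)
      then show ?thesis by (simp add: real_sqrt_mult)
    qed
    then have 1: "hyp_dist (geo_point x (ray_dir x \<xi>) t) (geo_point x w t) \<le> 2"
      using hyp_dist_same_time_le[OF v w(1), of t] by linarith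
    obtain h where h: "h \<in> \<Gamma>" "hyp_dist x (h *v x) + hyp_dist (h *v x) (g *v x) \<le> hyp_dist x (g *v x) + C"
      "\<bar>hyp_dist x (h *v x) - t\<bar> \<le> C" using C(2)[OF g(1) t g(2)] by blast
    define s where "s = min (hyp_dist x (h *v x)) (hyp_dist x (g *v x))"
    note hx = act_hyp[OF h(1) x]
    have 2: "hyp_dist (h *v x) (geo_point x w s) \<le> 2 * exp (C / 2) + C"
      unfolding s_def using almost_geodesic_near[OF w(1) _ hx C(1), of "hyp_dist x (g *v x)", folded w(2)] h(2) g(3) by simp
    have "\<bar>s - t\<bar> \<le> C" using h(3) g(2) by (auto simp: s_def)
    then have 3: "hyp_dist (geo_point x w s) (geo_point x w t) \<le> C" using hyp_dist_geo_point[OF w(1), of s t] by simp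
    note P = geo_point_in_hyp_space[OF w(1)] geo_point_in_hyp_space[OF v]
    have "hyp_dist (h *v x) (geo_point x (ray_dir x \<xi>) t) \<le> 2 * exp (C / 2) + C + (C + 2)"
      using hyp_dist_triangle[OF hx P(1)[of s] P(2)[of t]] hyp_dist_triangle[OF P(1)[of s] P(1)[of t] P(2)[of t]] 1 2 3
      by (simp add: hyp_dist_commute)
    then show "\<exists>h\<in>\<Gamma>. hyp_dist (h *v x) (geo_point x (ray_dir x \<xi>) t) \<le> 2 * exp (C / 2) + 2 * C + 2"
      using h(1) by (intro bexI[of _ h]) auto
  qed
qed

text \<open>Of two distinct limit points at least one is seen at a definite angle from the direction
  of \<open>ginv g *v x\<close>; its translate by \<open>g\<close> is in the shadow of
  \<open>g *v x\<close>. The points found here become the centres \<open>pt g\<close> of the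
  densities.\<close>

lemma limit_point_in_shadow:
  assumes x: "x \<in> hyp_space"
  shows "\<exists>C\<ge>0. \<forall>g\<in>\<Gamma>. \<exists>\<eta>\<in>limit_set \<Gamma>. \<forall>v. (x, v) \<in> hyp_unit_tangent \<and> g *v x = geo_point x v (hyp_dist x (g *v x)) \<longrightarrow>
     half_sin_sq v (ray_dir x \<eta>) \<le> C * exp (- 2 * hyp_dist x (g *v x))"
proof -
  obtain \<xi>1 \<xi>2 where \<xi>: "\<xi>1 \<in> limit_set \<Gamma>" "\<xi>2 \<in> limit_set \<Gamma>" "\<xi>1 \<noteq> \<xi>2" using two_limit_points by blast
  then have I: "\<xi>1 \<in> ideal_boundary" "\<xi>2 \<in> ideal_boundary" using limit_set_ideal by auto
  note v1 = ray_dir_tangent[OF x I(1)] and v2 = ray_dir_tangent[OF x I(2)]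
  \<comment> \<open>A quarter, because the triangle inequality for \<open>half_sin_sq\<close> has a
    factor 2 on both terms: two values below \<open>c\<close> would bring the limit points closer
    than they are.\<close>
  define c where "c = half_sin_sq (ray_dir x \<xi>1) (ray_dir x \<xi>2) / 4"
  have c: "0 < c" using ray_dir_inj[OF x I] \<xi>(3) half_sin_sq_nonneg[OF v1 v2] unfolding c_def by fastforce
  define k where "k = - ln c / 2"
  have k: "exp (- 2 * k) = c" using c by (simp add: k_def)
  have "c \<le> 1" unfolding c_def using half_sin_sq_le_1[OF v1 v2] by simp
  then have k0: "0 \<le> k" using c by (simp add: k_def)
  define C where "C = 16 * exp (2 + 2 * (2 * k + 3))"
  show ?thesis
  proof (intro exI[of _ C] conjI ballI)
    show "0 \<le> C" by (simp add: C_def)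
    fix g assume g: "g \<in> \<Gamma>"
    define l where "l = hyp_dist x (g *v x)"
    have l0: "0 \<le> l" using x act_hyp[OF g x] by (simp add: l_def)
    note gi = act_hyp[OF ginv_in[OF g] x]
    have dl: "hyp_dist x (ginv g *v x) = l" using dist_ginv[OF g, of x x] by (simp add: l_def hyp_dist_commute)
    obtain u where u: "(x, u) \<in> hyp_unit_tangent" "ginv g *v x = geo_point x u l"
      using exists_geo_point[OF x gi] dl by metis
    have "\<exists>\<xi>\<in>limit_set \<Gamma>. c \<le> half_sin_sq u (ray_dir x \<xi>)"
    proof (rule ccontr)
      assume "\<not> ?thesis"
      then have "half_sin_sq u (ray_dir x \<xi>1) < c" "half_sin_sq u (ray_dir x \<xi>2) < c" using \<xi> by auto
      then show False using half_sin_sq_triangle[OF v1 u(1) v2] by (simp add: c_def half_sin_sq_commute)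
    qed
    then obtain \<xi> where \<xi>: "\<xi> \<in> limit_set \<Gamma>" "c \<le> half_sin_sq u (ray_dir x \<xi>)" by blast
    then have \<xi>I: "\<xi> \<in> ideal_boundary" using limit_set_ideal by blast
    show "\<exists>\<eta>\<in>limit_set \<Gamma>. \<forall>v. (x, v) \<in> hyp_unit_tangent \<and> g *v x = geo_point x v (hyp_dist x (g *v x)) \<longrightarrow>
     half_sin_sq v (ray_dir x \<eta>) \<le> C * exp (- 2 * hyp_dist x (g *v x))"
      using direction_of_translate[OF x g \<xi>I k0 u(1)] u(2) \<xi> k
      by (intro bexI[of _ "boundary_act g \<xi>"] limit_set_invariant[OF g \<xi>(1)]) (auto simp: l_def C_def)
  qed
qed

end

section \<open>Decomposing a constant into peaked densities\<close>

lemma abs_diff_le_of_ln: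
  fixes a b t :: real
  assumes "0 < a" "0 < b" "\<bar>ln a - ln b\<bar> \<le> t"
  shows "\<bar>a - b\<bar> \<le> b * (t * exp t)"
proof -
  have 1: "ln a \<le> ln b + t" "ln b \<le> ln a + t" using assms(3) by linarith+
  have "exp (ln a) \<le> exp (ln b + t)" using 1 by simp
  then have a: "a \<le> b * exp t" using assms by (simp add: exp_add)
  have "exp (ln b) \<le> exp (ln a + t)" using 1 by simp
  then have "b * exp (- t) \<le> a * exp t * exp (- t)" using assms by (simp add: exp_add)
  then have b: "b * exp (- t) \<le> a" by (simp add: mult.assoc mult_exp_exp)
  have e: "exp t - 1 \<le> t * exp t" by (rule exp_minus_one_le)
  have "1 - exp (- t) \<le> t" using exp_ge_add_one_self[of "- t"] by simp
  also have "t \<le> t * exp t" using assms(3) by (simp add: mult_le_cancel_left1)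
  finally have e': "1 - exp (- t) \<le> t * exp t" .
  have "a - b \<le> b * (exp t - 1)" using a by (simp add: algebra_simps)
  also have "\<dots> \<le> b * (t * exp t)" using e assms by (intro mult_left_mono) auto
  finally have 2: "a - b \<le> b * (t * exp t)" .
  have "b - a \<le> b * (1 - exp (- t))" using b by (simp add: algebra_simps)
  also have "\<dots> \<le> b * (t * exp t)" using e' assms by (intro mult_left_mono) auto
  finally show ?thesis using 2 by linarith
qed

definition len_shell :: "'g set \<Rightarrow> ('g \<Rightarrow> real) \<Rightarrow> real \<Rightarrow> nat \<Rightarrow> 'g set" where
  "len_shell \<Gamma> len L j = {g \<in> \<Gamma>. real j * L \<le> len g \<and> len g < (real j + 1) * L}"

lemma len_shell_disjoint:
  assumes "0 < L" "i \<noteq> j" shows "len_shell \<Gamma> len L i \<inter> len_shell \<Gamma> len L j = {}"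
proof (rule ccontr)
  assume "\<not> ?thesis"
  then obtain g where "real i * L < (real j + 1) * L" "real j * L < (real i + 1) * L"
    by (fastforce simp: len_shell_def)
  then have "real i < real j + 1" "real j < real i + 1" using assms(1) by (simp_all only: mult_less_cancel_right_pos)
  then show False using assms(2) by linarith
qed

lemma len_shell_index:
  assumes "0 < L" "g \<in> \<Gamma>" "0 \<le> len g" shows "g \<in> len_shell \<Gamma> len L (nat \<lfloor>len g / L\<rfloor>)"
proof -
  define n where "n = nat \<lfloor>len g / L\<rfloor>"
  have "0 \<le> len g / L" using assms by simp
  then have "real n \<le> len g / L" "len g / L < real n + 1" unfolding n_def by linarith+
  then have "g \<in> len_shell \<Gamma> len L n" using assms by (auto simp: len_shell_def le_divide_eq divide_less_eq)
  then show ?thesis by (simp only: n_def)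
qed

text \<open>An abstract form of the shadow estimates: \<open>f g\<close> is a density that peaks, with height comparable
  to \<open>1 / w g\<close>, on a ball of radius \<open>exp (- len g)\<close> around \<open>pt g\<close>.\<close>

locale shadow_system =
  fixes \<Gamma> :: "'g set" and \<Lambda> :: "'b set" and d :: "'b \<Rightarrow> 'b \<Rightarrow> real" and f :: "'g \<Rightarrow> 'b \<Rightarrow> real"
    and len w :: "'g \<Rightarrow> real" and pt :: "'g \<Rightarrow> 'b" and A \<beta> \<theta> :: real
  assumes d_nonneg: "\<xi> \<in> \<Lambda> \<Longrightarrow> \<eta> \<in> \<Lambda> \<Longrightarrow> 0 \<le> d \<xi> \<eta>"
    and d_le_1: "\<xi> \<in> \<Lambda> \<Longrightarrow> \<eta> \<in> \<Lambda> \<Longrightarrow> d \<xi> \<eta> \<le> 1"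
    and d_commute: "d \<xi> \<eta> = d \<eta> \<xi>"
    and f_pos: "g \<in> \<Gamma> \<Longrightarrow> \<xi> \<in> \<Lambda> \<Longrightarrow> 0 < f g \<xi>"
    and len_nonneg: "g \<in> \<Gamma> \<Longrightarrow> 0 \<le> len g"
    and w_pos: "g \<in> \<Gamma> \<Longrightarrow> 0 < w g"
    and pt_in: "g \<in> \<Gamma> \<Longrightarrow> pt g \<in> \<Lambda>"
    and finite_len: "finite {g\<in>\<Gamma>. len g \<le> r}"
    and params: "0 \<le> A" "0 < \<beta>" "0 < \<theta>"
    and f_holder: "g \<in> \<Gamma> \<Longrightarrow> \<xi> \<in> \<Lambda> \<Longrightarrow> \<eta> \<in> \<Lambda> \<Longrightarrow> len g \<le> m \<Longrightarrow> d \<xi> \<eta> \<le> exp (- m) \<Longrightarrow>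
      \<bar>ln (f g \<xi>) - ln (f g \<eta>)\<bar> \<le> A * (exp m * d \<xi> \<eta>) powr \<beta>"
    and upper: "\<exists>C. \<forall>m\<ge>0. \<forall>\<xi>\<in>\<Lambda>. (\<Sum>g | g \<in> \<Gamma> \<and> m \<le> len g \<and> len g < m + L.
      w g * f g \<xi> * (1 + exp (len g) * d \<xi> (pt g)) powr \<theta>) \<le> C"
    and lower: "\<exists>C L. \<forall>m\<ge>0. \<forall>\<xi>\<in>\<Lambda>. \<exists>g\<in>\<Gamma>. m \<le> len g \<and> len g < m + L \<and> 1 \<le> C * (w g * f g \<xi>) \<and>
      exp (len g) * d \<xi> (pt g) \<le> C"
begin

abbreviation shell :: "real \<Rightarrow> nat \<Rightarrow> 'g set" where "shell \<equiv> len_shell \<Gamma> len"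

lemma finite_shell: "finite (shell L j)"
  unfolding len_shell_def by (rule finite_subset[OF _ finite_len[of "(real j + 1) * L"]]) auto

text \<open>The part of the constant 1 that is left after the first \<open>j\<close> shells have been used: the \<open>j\<close>-th
  shell contributes an approximation, at scale \<open>exp (- j L)\<close>, of the fraction \<open>\<epsilon>\<close> of what is left.\<close>

primrec rem :: "real \<Rightarrow> real \<Rightarrow> nat \<Rightarrow> 'b \<Rightarrow> real" where
  "rem \<epsilon> L 0 = (\<lambda>\<xi>. 1)"
| "rem \<epsilon> L (Suc j) = (\<lambda>\<xi>. rem \<epsilon> L j \<xi> - \<epsilon> * (\<Sum>g\<in>shell L j. rem \<epsilon> L j (pt g) * (w g * f g \<xi>)))"

text \<open>The remainder stays nearly constant on balls of radius \<open>exp (- j L)\<close>, and each step multiplies it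
  by a factor between \<open>1 - q\<close> and \<open>1 - \<epsilon> c\<close>. Hence its values at distance \<open>exp (- i L)\<close> have ratio
  at most \<open>(1 - q)\<close> to the power \<open>-(j - i)\<close>, up to a constant; this is the growth that \<open>upper\<close> absorbs.\<close>

lemma rem_induction:
  fixes L C q \<epsilon> c :: real
  assumes L: "1 \<le> L" "exp (- L * \<beta>) \<le> 1 / 4" and q: "0 < q" "q \<le> 1 / 4" "q * (A * exp A + 1) \<le> 1 / 4" "2 * q \<le> \<theta>"
    and C: "\<And>j \<xi>. \<xi> \<in> \<Lambda> \<Longrightarrow> (\<Sum>g\<in>shell L j. w g * f g \<xi> * (1 + exp (len g) * d \<xi> (pt g)) powr \<theta>) \<le> C" "0 < C"
    and \<epsilon>: "\<epsilon> * (4 * C) = q"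
    and c: "\<And>j \<xi>. \<xi> \<in> \<Lambda> \<Longrightarrow> \<exists>g\<in>shell L j. c * (4 * (1 + exp (len g) * d \<xi> (pt g)) powr \<theta>) \<le> w g * f g \<xi>" "0 < c"
      "\<epsilon> * c \<le> 1"
  shows "(\<forall>\<xi>\<in>\<Lambda>. 0 < rem \<epsilon> L j \<xi>) \<and>
    (\<forall>\<xi>\<in>\<Lambda>. \<forall>\<eta>\<in>\<Lambda>. d \<xi> \<eta> \<le> exp (- (real j * L)) \<longrightarrow>
       \<bar>rem \<epsilon> L j \<xi> - rem \<epsilon> L j \<eta>\<bar> \<le> 1 / 2 * rem \<epsilon> L j \<eta> * (exp (real j * L) * d \<xi> \<eta>) powr \<beta>) \<and>
    (\<forall>i<j. \<forall>\<xi>\<in>\<Lambda>. (1 - q) * rem \<epsilon> L i \<xi> \<le> rem \<epsilon> L (Suc i) \<xi> \<and> rem \<epsilon> L (Suc i) \<xi> \<le> (1 - \<epsilon> * c) * rem \<epsilon> L i \<xi>)"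
proof (induction j rule: less_induct)
  case (less k)
  let ?R = "rem \<epsilon> L"
  have \<epsilon>0: "0 < \<epsilon>"
  proof (rule ccontr)
    assume "\<not> 0 < \<epsilon>"
    then have "\<epsilon> * (4 * C) \<le> 0" using C(2) by (intro mult_nonpos_nonneg) auto
    then show False using \<epsilon> q by simp
  qed
  show ?case
  proof (cases k)
    case 0
    then show ?thesis by simp
  next
    case (Suc j)
    have pos: "0 < ?R i \<xi>" if "i \<le> j" "\<xi> \<in> \<Lambda>" for i \<xi> using less[of i] that Suc by auto
    have mic: "\<bar>?R i \<xi> - ?R i \<eta>\<bar> \<le> 1 / 2 * ?R i \<eta> * (exp (real i * L) * d \<xi> \<eta>) powr \<beta>"
      if "i \<le> j" "\<xi> \<in> \<Lambda>" "\<eta> \<in> \<Lambda>" "d \<xi> \<eta> \<le> exp (- (real i * L))" for i \<xi> \<eta> using less[of i] that Suc by auto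
    have rat: "(1 - q) * ?R i \<xi> \<le> ?R (Suc i) \<xi>" "?R (Suc i) \<xi> \<le> (1 - \<epsilon> * c) * ?R i \<xi>" if "i < j" "\<xi> \<in> \<Lambda>" for i \<xi>
      using less[of j] that Suc by auto
    have mic2: "?R i \<xi> \<le> 3 / 2 * ?R i \<eta>" if i: "i \<le> j" "\<xi> \<in> \<Lambda>" "\<eta> \<in> \<Lambda>" "d \<xi> \<eta> \<le> exp (- (real i * L))" for i \<xi> \<eta>
    proof -
      have "exp (real i * L) * d \<xi> \<eta> \<le> exp (real i * L) * exp (- (real i * L))" using i by (intro mult_left_mono) auto
      then have "exp (real i * L) * d \<xi> \<eta> \<le> 1" by (simp add: mult_exp_exp)
      then have "(exp (real i * L) * d \<xi> \<eta>) powr \<beta> \<le> 1" using params d_nonneg[OF i(2,3)] by (intro powr_le1) auto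
      then have "1 / 2 * ?R i \<eta> * (exp (real i * L) * d \<xi> \<eta>) powr \<beta> \<le> 1 / 2 * ?R i \<eta> * 1"
        using pos[OF i(1,3)] by (intro mult_left_mono) auto
      then show ?thesis using mic[OF i] by linarith
    qed
    have down: "?R (i + n) \<xi> \<le> ?R i \<xi> \<and> (1 - q) ^ n * ?R i \<xi> \<le> ?R (i + n) \<xi>" if "i + n \<le> j" "\<xi> \<in> \<Lambda>" for i n \<xi>
      using that(1)
    proof (induction n)
      case (Suc n)
      have p: "0 < ?R (i + n) \<xi>" using pos Suc that by auto
      have "?R (i + Suc n) \<xi> \<le> (1 - \<epsilon> * c) * ?R (i + n) \<xi>" using rat(2)[of "i + n" \<xi>] Suc that by simp
      also have "\<dots> \<le> 1 * ?R (i + n) \<xi>" using p \<epsilon>0 c by (intro mult_right_mono) auto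
      finally have 1: "?R (i + Suc n) \<xi> \<le> ?R i \<xi>" using Suc by simp
      have "(1 - q) ^ Suc n * ?R i \<xi> = (1 - q) * ((1 - q) ^ n * ?R i \<xi>)" by simp
      also have "\<dots> \<le> (1 - q) * ?R (i + n) \<xi>" using Suc q by (intro mult_left_mono) auto
      also have "\<dots> \<le> ?R (i + Suc n) \<xi>" using rat(1)[of "i + n" \<xi>] Suc that by simp
      finally show ?case using 1 by blast
    qed simp
    \<comment> \<open>The macroscopic comparison. Go back to the last scale \<open>i\<close> at
      which \<xi> and \<eta> are still in one ball, where the values agree up to the factor 3/2;
      from there to \<open>j\<close> the value at \<xi> can only fall, and the one at \<eta> keeps
      at least the fraction \<open>(1 - q) ^ n\<close>.\<close>
    have mac: "?R j \<xi> \<le> 4 * ?R j \<eta> * (1 + exp (real j * L) * d \<xi> \<eta>) powr \<theta>" if \<xi>: "\<xi> \<in> \<Lambda>" and \<eta>: "\<eta> \<in> \<Lambda>" for \<xi> \<eta>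
    proof (cases "d \<xi> \<eta> \<le> exp (- (real j * L))")
      case True
      have "1 \<le> (1 + exp (real j * L) * d \<xi> \<eta>) powr \<theta>"
        using params d_nonneg[OF \<xi> \<eta>] by (intro ge_one_powr_ge_zero) auto
      then have "4 * ?R j \<eta> * 1 \<le> 4 * ?R j \<eta> * (1 + exp (real j * L) * d \<xi> \<eta>) powr \<theta>"
        using pos[of j \<eta>] \<eta> by (intro mult_left_mono) auto
      moreover have "?R j \<xi> \<le> 3 / 2 * ?R j \<eta>" using mic2[OF _ \<xi> \<eta> True] by simp
      moreover have "0 < ?R j \<eta>" using pos \<eta> by simp
      ultimately show ?thesis by linarith
    next
      case False
      define D where "D = d \<xi> \<eta>"
      have D: "exp (- (real j * L)) < D" "D \<le> 1" using False d_le_1[OF \<xi> \<eta>] by (auto simp: D_def)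
      have D0: "0 < D" using D(1) by (meson exp_gt_zero less_trans)
      define i where "i = nat \<lfloor>- ln D / L\<rfloor>"
      have "0 \<le> - ln D / L" using D D0 L by (intro divide_nonneg_nonneg) auto
      then have i: "real i \<le> - ln D / L" "- ln D / L < real i + 1" unfolding i_def by linarith+
      have "- (real j * L) < ln D" using D(1) D0 by (metis exp_gt_zero ln_exp ln_less_cancel_iff)
      then have "- ln D < real j * L" by simp
      then have "- ln D / L < real j" using L by (subst pos_divide_less_eq) auto
      then have ij: "i < j" using i by linarith
      have "real i * L \<le> - ln D" using i(1) L by (subst (asm) pos_le_divide_eq) auto
      then have "exp (ln D) \<le> exp (- (real i * L))" by simp
      then have Di: "d \<xi> \<eta> \<le> exp (- (real i * L))" unfolding D_def[symmetric] using D0 by (simp only: exp_ln)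
      define n where "n = j - i"
      have n: "j = i + n" using ij by (simp add: n_def)
      \<comment> \<open>\<tau> is the largest possible rate of decay per step. As
        \<open>2 * q\<close> is at most \<theta>, so is \<tau>, and the loss at \<eta> is at most
        twice the \<theta>-th power of 1 plus the rescaled distance; with the factor 3/2 this stays
        below the 4 of the claim.\<close>
      define \<tau> where "\<tau> = - ln (1 - q)"
      have e\<tau>: "exp (- \<tau>) = 1 - q" using q by (simp add: \<tau>_def)
      have \<tau>2: "exp \<tau> \<le> 2"
      proof -
        have "exp \<tau> = 1 / (1 - q)" unfolding e\<tau>[symmetric] by (simp add: exp_minus field_simps)
        then show ?thesis using q by (simp add: divide_le_eq)
      qed
      have "\<tau> \<le> 2 * q"
      proof -
        have "1 / (1 - q) \<le> 1 + 2 * q"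
        proof -
          have "q * q \<le> q * (1 / 4)" using q by (intro mult_left_mono) auto
          then have "1 \<le> (1 + 2 * q) * (1 - q)" using q by (simp add: algebra_simps)
          then show ?thesis using q by (simp add: divide_le_eq)
        qed
        also have "\<dots> \<le> exp (2 * q)" by (rule exp_ge_add_one_self)
        finally have "ln (1 / (1 - q)) \<le> ln (exp (2 * q))" using q by (subst ln_le_cancel_iff) auto
        then have "ln (1 / (1 - q)) \<le> 2 * q" by simp
        then show ?thesis using q by (simp add: \<tau>_def ln_div)
      qed
      then have \<tau>: "\<tau> \<le> \<theta>" "0 \<le> \<tau>" using q by (auto simp: \<tau>_def)
      have nn: "real n \<le> (ln (exp (real j * L) * D)) / L + 1"
      proof -
        have "ln (exp (real j * L) * D) = real j * L + ln D" using D0 by (simp add: ln_mult)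
        then have "ln (exp (real j * L) * D) / L = real j + ln D / L" using L by (simp add: add_divide_distrib)
        then show ?thesis using i(2) ij by (simp add: n_def of_nat_diff)
      qed
      have base: "1 \<le> exp (real j * L) * D"
      proof -
        have "exp (real j * L) * exp (- (real j * L)) \<le> exp (real j * L) * D" using D by (intro mult_left_mono) auto
        then show ?thesis by (simp add: mult_exp_exp)
      qed
      have "exp (\<tau> * real n) \<le> exp \<tau> * (1 + exp (real j * L) * D) powr \<theta>"
      proof -
        have "\<tau> * real n \<le> \<tau> * (ln (exp (real j * L) * D) / L + 1)" using nn \<tau> by (intro mult_left_mono)
        also have "ln (exp (real j * L) * D) / L \<le> ln (exp (real j * L) * D)"
        proof -
          have "ln (exp (real j * L) * D) * 1 \<le> ln (exp (real j * L) * D) * L" using base L by (intro mult_left_mono ln_ge_zero)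
          then show ?thesis using L by (simp add: divide_le_eq)
        qed
        then have "\<tau> * (ln (exp (real j * L) * D) / L + 1) \<le> \<tau> * (ln (exp (real j * L) * D) + 1)" using \<tau> by (intro mult_left_mono) auto
        also have "\<dots> = \<tau> * ln (exp (real j * L) * D) + \<tau>" by (simp add: algebra_simps)
        also have "\<tau> * ln (exp (real j * L) * D) \<le> \<theta> * ln (1 + exp (real j * L) * D)"
          using base \<tau> params by (intro mult_mono) auto
        finally have "exp (\<tau> * real n) \<le> exp (\<theta> * ln (1 + exp (real j * L) * D) + \<tau>)" by simp
        also have "\<dots> = exp \<tau> * (1 + exp (real j * L) * D) powr \<theta>" using base by (simp add: exp_add powr_def)
        finally show ?thesis .
      qed
      also have "\<dots> \<le> 2 * (1 + exp (real j * L) * D) powr \<theta>" using \<tau>2 by (intro mult_right_mono) auto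
      finally have E: "exp (\<tau> * real n) \<le> 2 * (1 + exp (real j * L) * D) powr \<theta>" .
      have "(1 - q) ^ n = exp (- (\<tau> * real n))" using e\<tau> by (metis exp_of_nat_mult mult.commute mult_minus_left)
      then have "?R i \<eta> = exp (\<tau> * real n) * ((1 - q) ^ n * ?R i \<eta>)" by (simp add: mult.assoc[symmetric] mult_exp_exp)
      also have "\<dots> \<le> exp (\<tau> * real n) * ?R j \<eta>" using down[of i n \<eta>] \<eta> n by (intro mult_left_mono) auto
      also have "\<dots> \<le> 2 * (1 + exp (real j * L) * D) powr \<theta> * ?R j \<eta>" using E pos[of j \<eta>] \<eta> by (intro mult_right_mono) auto
      finally have "?R i \<eta> \<le> 2 * (1 + exp (real j * L) * D) powr \<theta> * ?R j \<eta>" .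
      moreover have "?R j \<xi> \<le> ?R i \<xi>" using down[of i n \<xi>] \<xi> n by auto
      moreover have "?R i \<xi> \<le> 3 / 2 * ?R i \<eta>" using mic2[OF _ \<xi> \<eta> Di] ij by simp
      moreover have "0 \<le> (1 + exp (real j * L) * D) powr \<theta> * ?R j \<eta>" using pos[of j \<eta>] \<eta> by simp
      ultimately show ?thesis unfolding D_def by (simp add: mult_ac)
    qed
    define G where "G \<xi> = (\<Sum>g\<in>shell L j. ?R j (pt g) * (w g * f g \<xi>))" for \<xi>
    have RS: "?R (Suc j) \<xi> = ?R j \<xi> - \<epsilon> * G \<xi>" for \<xi> by (simp add: G_def)
    have jl: "exp (real j * L) * d \<xi> (pt g) \<le> exp (len g) * d \<xi> (pt g)" if "\<xi> \<in> \<Lambda>" "g \<in> shell L j" for \<xi> g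
      using that d_nonneg[OF that(1) pt_in] by (intro mult_right_mono) (auto simp: len_shell_def)
    have gS: "g \<in> \<Gamma>" "pt g \<in> \<Lambda>" if "g \<in> shell L j" for g using that pt_in by (auto simp: len_shell_def)
    have wf: "0 < w g * f g \<xi>" if "g \<in> shell L j" "\<xi> \<in> \<Lambda>" for g \<xi> using gS[OF that(1)] w_pos f_pos that by simp
    \<comment> \<open>The growth allowed by the macroscopic comparison is exactly the weight carried
      by the sum that \<open>C\<close> bounds.\<close>
    have Gup: "G \<xi> \<le> 4 * C * ?R j \<xi>" if \<xi>: "\<xi> \<in> \<Lambda>" for \<xi>
    proof -
      have "G \<xi> \<le> (\<Sum>g\<in>shell L j. 4 * ?R j \<xi> * (w g * f g \<xi> * (1 + exp (len g) * d \<xi> (pt g)) powr \<theta>))"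
        unfolding G_def
      proof (rule sum_mono)
        fix g assume g: "g \<in> shell L j"
        have "?R j (pt g) \<le> 4 * ?R j \<xi> * (1 + exp (real j * L) * d \<xi> (pt g)) powr \<theta>"
          using mac[OF gS(2)[OF g] \<xi>] by (simp add: d_commute)
        also have "\<dots> \<le> 4 * ?R j \<xi> * (1 + exp (len g) * d \<xi> (pt g)) powr \<theta>"
          using jl[OF \<xi> g] pos[of j \<xi>] \<xi> params d_nonneg[OF \<xi> gS(2)[OF g]] by (intro mult_left_mono powr_mono2) auto
        finally have "?R j (pt g) * (w g * f g \<xi>) \<le> 4 * ?R j \<xi> * (1 + exp (len g) * d \<xi> (pt g)) powr \<theta> * (w g * f g \<xi>)"
          using wf[OF g \<xi>] by (intro mult_right_mono) auto
        then show "?R j (pt g) * (w g * f g \<xi>) \<le> 4 * ?R j \<xi> * (w g * f g \<xi> * (1 + exp (len g) * d \<xi> (pt g)) powr \<theta>)"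
          by (simp only: mult_ac)
      qed
      also have "\<dots> = 4 * ?R j \<xi> * (\<Sum>g\<in>shell L j. w g * f g \<xi> * (1 + exp (len g) * d \<xi> (pt g)) powr \<theta>)"
        by (simp only: sum_distrib_left)
      also have "\<dots> \<le> 4 * ?R j \<xi> * C" using C(1)[OF \<xi>] pos[of j \<xi>] \<xi> by (intro mult_left_mono) auto
      finally show ?thesis by (simp add: mult_ac)
    qed
    have Glow: "c * ?R j \<xi> \<le> G \<xi>" if \<xi>: "\<xi> \<in> \<Lambda>" for \<xi>
    proof -
      obtain g where g: "g \<in> shell L j" "c * (4 * (1 + exp (len g) * d \<xi> (pt g)) powr \<theta>) \<le> w g * f g \<xi>"
        using c(1)[OF \<xi>] by blast
      have "?R j \<xi> \<le> 4 * ?R j (pt g) * (1 + exp (real j * L) * d \<xi> (pt g)) powr \<theta>"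
        by (rule mac[OF \<xi> gS(2)[OF g(1)]])
      also have "\<dots> \<le> 4 * ?R j (pt g) * (1 + exp (len g) * d \<xi> (pt g)) powr \<theta>"
        using jl[OF \<xi> g(1)] pos[of j "pt g"] \<xi> params d_nonneg[OF \<xi> gS(2)[OF g(1)]] gS[OF g(1)] by (intro mult_left_mono powr_mono2) auto
      finally have "c * ?R j \<xi> \<le> c * (4 * ?R j (pt g) * (1 + exp (len g) * d \<xi> (pt g)) powr \<theta>)"
        using c by (intro mult_left_mono) auto
      also have "\<dots> = ?R j (pt g) * (c * (4 * (1 + exp (len g) * d \<xi> (pt g)) powr \<theta>))" by (simp only: mult_ac)
      also have "\<dots> \<le> ?R j (pt g) * (w g * f g \<xi>)" using g(2) pos[of j "pt g"] gS[OF g(1)] by (intro mult_left_mono) auto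
      also have "\<dots> \<le> G \<xi>" unfolding G_def
      proof (rule member_le_sum[OF g(1) _ finite_shell])
        fix h assume "h \<in> shell L j - {g}"
        then have h: "h \<in> shell L j" by simp
        then show "0 \<le> ?R j (pt h) * (w h * f h \<xi>)" using wf[OF h \<xi>] pos[OF order_refl gS(2)[OF h]] by (metis less_imp_le mult_nonneg_nonneg)
      qed
      finally show ?thesis .
    qed
    have ratj: "(1 - q) * ?R j \<xi> \<le> ?R (Suc j) \<xi>" "?R (Suc j) \<xi> \<le> (1 - \<epsilon> * c) * ?R j \<xi>" if \<xi>: "\<xi> \<in> \<Lambda>" for \<xi>
    proof -
      have "\<epsilon> * G \<xi> \<le> \<epsilon> * (4 * C * ?R j \<xi>)" using Gup[OF \<xi>] \<epsilon>0 by (intro mult_left_mono) auto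
      also have "\<dots> = (\<epsilon> * (4 * C)) * ?R j \<xi>" by simp
      finally show "(1 - q) * ?R j \<xi> \<le> ?R (Suc j) \<xi>" unfolding RS \<epsilon> by (simp add: algebra_simps)
      have "\<epsilon> * (c * ?R j \<xi>) \<le> \<epsilon> * G \<xi>" using Glow[OF \<xi>] \<epsilon>0 by (intro mult_left_mono) auto
      then show "?R (Suc j) \<xi> \<le> (1 - \<epsilon> * c) * ?R j \<xi>" unfolding RS by (simp add: algebra_simps)
    qed
    have posS: "0 < ?R (Suc j) \<xi>" if \<xi>: "\<xi> \<in> \<Lambda>" for \<xi>
    proof -
      have "0 < (1 - q) * ?R j \<xi>" using pos[OF order_refl \<xi>] q by (intro mult_pos_pos) auto
      then show ?thesis using ratj(1)[OF \<xi>] by linarith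
    qed
    \<comment> \<open>Regularity at the next scale: rescaling by \<open>exp L\<close> shrinks the
      inherited oscillation from 1/2 to at most 1/8, the subtracted sum adds at most
      \<open>q * (A * exp A)\<close>, and the choice of \<open>q\<close> keeps the total below
      \<open>(1 - q) / 2\<close>. Relative to the new, smaller remainder this is again 1/2.\<close>
    have micS: "\<bar>?R (Suc j) \<xi> - ?R (Suc j) \<eta>\<bar> \<le> 1 / 2 * ?R (Suc j) \<eta> * (exp (real (Suc j) * L) * d \<xi> \<eta>) powr \<beta>"
      if \<xi>: "\<xi> \<in> \<Lambda>" and \<eta>: "\<eta> \<in> \<Lambda>" and D: "d \<xi> \<eta> \<le> exp (- (real (Suc j) * L))" for \<xi> \<eta>
    proof -
      define m where "m = real (Suc j) * L"
      define u where "u = (exp m * d \<xi> \<eta>) powr \<beta>"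
      have d0: "0 \<le> d \<xi> \<eta>" by (rule d_nonneg[OF \<xi> \<eta>])
      have "exp m * d \<xi> \<eta> \<le> exp m * exp (- m)" using D by (intro mult_left_mono) (auto simp: m_def)
      then have "exp m * d \<xi> \<eta> \<le> 1" by (simp add: mult_exp_exp)
      then have u: "u \<le> 1" "0 \<le> u" unfolding u_def using params d0 by (auto intro!: powr_le1)
      have Rj: "0 < ?R j \<eta>" by (rule pos[OF order_refl \<eta>])
      have "\<bar>?R j \<xi> - ?R j \<eta>\<bar> \<le> 1 / 2 * ?R j \<eta> * (exp (real j * L) * d \<xi> \<eta>) powr \<beta>"
      proof (rule mic[OF order_refl \<xi> \<eta>])
        have "- (real (Suc j) * L) \<le> - (real j * L)" using L by (simp add: algebra_simps)
        then show "d \<xi> \<eta> \<le> exp (- (real j * L))" using D by (meson exp_le_cancel_iff order_trans)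
      qed
      also have "(exp (real j * L) * d \<xi> \<eta>) powr \<beta> = exp (- L * \<beta>) * u"
      proof -
        have "exp (- L) * exp m = exp (real j * L)" unfolding mult_exp_exp m_def by (simp add: distrib_right)
        then have "exp (real j * L) * d \<xi> \<eta> = exp (- L) * (exp m * d \<xi> \<eta>)" by (simp only: mult.assoc[symmetric])
        moreover have "(exp (- L) * (exp m * d \<xi> \<eta>)) powr \<beta> = exp (- L) powr \<beta> * u"
          using d0 by (simp add: powr_mult u_def)
        moreover have "exp (- L) powr \<beta> = exp (- L * \<beta>)" by (simp add: powr_def mult.commute)
        ultimately show ?thesis by metis
      qed
      also have "1 / 2 * ?R j \<eta> * (exp (- L * \<beta>) * u) \<le> 1 / 2 * ?R j \<eta> * (1 / 4 * u)"
        using L u Rj by (intro mult_left_mono mult_right_mono) auto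
      finally have 1: "\<bar>?R j \<xi> - ?R j \<eta>\<bar> \<le> 1 / 8 * ?R j \<eta> * u" by simp
      have "\<bar>G \<xi> - G \<eta>\<bar> \<le> (\<Sum>g\<in>shell L j. ?R j (pt g) * (w g * f g \<eta>) * (A * exp A * u))"
      proof -
        have "\<bar>G \<xi> - G \<eta>\<bar> \<le> (\<Sum>g\<in>shell L j. \<bar>?R j (pt g) * (w g * f g \<xi>) - ?R j (pt g) * (w g * f g \<eta>)\<bar>)"
          unfolding G_def sum_subtractf[symmetric] by (rule sum_abs)
        also have "\<dots> \<le> (\<Sum>g\<in>shell L j. ?R j (pt g) * (w g * f g \<eta>) * (A * exp A * u))"
        proof (rule sum_mono)
          fix g assume g: "g \<in> shell L j"
          have "\<bar>ln (f g \<xi>) - ln (f g \<eta>)\<bar> \<le> A * u"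
            unfolding u_def using g D by (intro f_holder gS \<xi> \<eta>) (auto simp: len_shell_def m_def algebra_simps)
          then have "\<bar>f g \<xi> - f g \<eta>\<bar> \<le> f g \<eta> * (A * u * exp (A * u))"
            by (rule abs_diff_le_of_ln[OF f_pos[OF gS(1)[OF g] \<xi>] f_pos[OF gS(1)[OF g] \<eta>]])
          also have "\<dots> \<le> f g \<eta> * (A * u * exp A)"
          proof (intro mult_left_mono)
            show "exp (A * u) \<le> exp A" using u params by (simp add: mult_le_cancel_left2)
          qed (use f_pos[OF gS(1)[OF g] \<eta>] params u in auto)
          finally have "(?R j (pt g) * w g) * \<bar>f g \<xi> - f g \<eta>\<bar> \<le> (?R j (pt g) * w g) * (f g \<eta> * (A * u * exp A))"
            using pos[OF order_refl gS(2)[OF g]] w_pos[OF gS(1)[OF g]] by (intro mult_left_mono) auto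
          moreover have "\<bar>?R j (pt g) * (w g * f g \<xi>) - ?R j (pt g) * (w g * f g \<eta>)\<bar> = (?R j (pt g) * w g) * \<bar>f g \<xi> - f g \<eta>\<bar>"
          proof -
            have "?R j (pt g) * (w g * f g \<xi>) - ?R j (pt g) * (w g * f g \<eta>) = (?R j (pt g) * w g) * (f g \<xi> - f g \<eta>)" by (simp add: algebra_simps)
            then show ?thesis using pos[OF order_refl gS(2)[OF g]] w_pos[OF gS(1)[OF g]] by (simp add: abs_mult)
          qed
          ultimately show "\<bar>?R j (pt g) * (w g * f g \<xi>) - ?R j (pt g) * (w g * f g \<eta>)\<bar> \<le> ?R j (pt g) * (w g * f g \<eta>) * (A * exp A * u)"
            by (simp add: mult_ac)
        qed
        finally show ?thesis .
      qed
      also have "\<dots> = G \<eta> * (A * exp A * u)" unfolding G_def by (simp only: sum_distrib_right)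
      also have "\<dots> \<le> 4 * C * ?R j \<eta> * (A * exp A * u)" using Gup[OF \<eta>] params u by (intro mult_right_mono) auto
      finally have "\<epsilon> * \<bar>G \<xi> - G \<eta>\<bar> \<le> \<epsilon> * (4 * C * ?R j \<eta> * (A * exp A * u))" using \<epsilon>0 by (intro mult_left_mono) auto
      also have "\<dots> = (\<epsilon> * (4 * C)) * (A * exp A) * (?R j \<eta> * u)" by (simp only: mult_ac)
      finally have 2: "\<epsilon> * \<bar>G \<xi> - G \<eta>\<bar> \<le> q * (A * exp A) * (?R j \<eta> * u)" unfolding \<epsilon> .
      have "\<bar>?R (Suc j) \<xi> - ?R (Suc j) \<eta>\<bar> \<le> \<bar>?R j \<xi> - ?R j \<eta>\<bar> + \<epsilon> * \<bar>G \<xi> - G \<eta>\<bar>"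
      proof -
        have "?R (Suc j) \<xi> - ?R (Suc j) \<eta> = (?R j \<xi> - ?R j \<eta>) - \<epsilon> * (G \<xi> - G \<eta>)" unfolding RS by (simp add: algebra_simps)
        also have "\<bar>\<dots>\<bar> \<le> \<bar>?R j \<xi> - ?R j \<eta>\<bar> + \<bar>\<epsilon> * (G \<xi> - G \<eta>)\<bar>" by (rule abs_triangle_ineq4)
        finally show ?thesis using \<epsilon>0 by (simp add: abs_mult)
      qed
      also have "\<dots> \<le> 1 / 8 * (?R j \<eta> * u) + q * (A * exp A) * (?R j \<eta> * u)" using 1 2 by simp
      also have "\<dots> = (1 / 8 + q * (A * exp A)) * (?R j \<eta> * u)" by (simp only: distrib_right)
      also have "\<dots> \<le> (1 / 2 * (1 - q)) * (?R j \<eta> * u)"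
        using q Rj u by (intro mult_right_mono) (auto simp: algebra_simps)
      also have "\<dots> = 1 / 2 * ((1 - q) * ?R j \<eta>) * u" by simp
      also have "\<dots> \<le> 1 / 2 * ?R (Suc j) \<eta> * u" using ratj(1)[OF \<eta>] u by (intro mult_right_mono mult_left_mono) auto
      finally show ?thesis unfolding u_def m_def .
    qed
    show ?thesis unfolding Suc
    proof (intro conjI ballI allI impI)
      fix i \<xi> assume i: "i < Suc j" and \<xi>: "\<xi> \<in> \<Lambda>"
      show "(1 - q) * ?R i \<xi> \<le> ?R (Suc i) \<xi>" using rat(1)[of i \<xi>] ratj(1)[OF \<xi>] i \<xi> by (cases "i = j") auto
      show "?R (Suc i) \<xi> \<le> (1 - \<epsilon> * c) * ?R i \<xi>" using rat(2)[of i \<xi>] ratj(2)[OF \<xi>] i \<xi> by (cases "i = j") auto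
    qed (use posS micS in auto)
  qed
qed

text \<open>The weight of \<open>g\<close> is \<epsilon> times the remainder left before its own
  shell, evaluated at \<open>pt g\<close>, times \<open>w g\<close>; subtracting the partial sums
  from 1 then gives the remainders themselves. The constants have a forced order: \<open>L\<close>,
  then \<open>C\<close>, which depends on \<open>L\<close> through the upper estimate, then
  \<epsilon> from \<open>C\<close> and \<open>q\<close>.\<close>

theorem exists_decomposition:
  "\<exists>c L \<rho>. 0 < L \<and> 0 \<le> \<rho> \<and> \<rho> < 1 \<and> (\<forall>g\<in>\<Gamma>. 0 < c g) \<and>
    (\<forall>\<xi>\<in>\<Lambda>. \<forall>j. 0 \<le> 1 - (\<Sum>i<j. \<Sum>g\<in>shell L i. c g * f g \<xi>) \<and> 1 - (\<Sum>i<j. \<Sum>g\<in>shell L i. c g * f g \<xi>) \<le> \<rho> ^ j)"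
proof -
  obtain C1 L1 where low: "\<And>m \<xi>. m \<ge> 0 \<Longrightarrow> \<xi> \<in> \<Lambda> \<Longrightarrow> \<exists>g\<in>\<Gamma>. m \<le> len g \<and> len g < m + L1 \<and> 1 \<le> C1 * (w g * f g \<xi>) \<and>
      exp (len g) * d \<xi> (pt g) \<le> C1"
    using lower by blast
  define C0 where "C0 = max C1 1"
  \<comment> \<open>\<open>L1\<close> ensures that each shell contains an element supplied by the
    lower estimate, \<open>2 / \<beta>\<close> that the oscillation shrinks by
    \<open>exp (- 2)\<close>, which is at most 1/4, per shell.\<close>
  define L where "L = max (max L1 1) (2 / \<beta>)"
  have L: "1 \<le> L" "L1 \<le> L" "2 / \<beta> \<le> L" by (auto simp: L_def)
  have "2 \<le> L * \<beta>" using L(3) params by (simp add: divide_le_eq)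
  then have "exp (- L * \<beta>) \<le> exp (- 2)" by simp
  also have "exp (- 2) \<le> (1 / 4 :: real)"
  proof -
    have "(2::real) * 2 \<le> exp 1 * exp 1" using exp_ge_add_one_self[of 1] by (intro mult_mono) auto
    then have "4 \<le> exp (2::real)" by (simp add: mult_exp_exp)
    then show ?thesis by (simp add: exp_minus divide_simps)
  qed
  finally have L4: "exp (- L * \<beta>) \<le> 1 / 4" .
  have sh: "shell L j = {g \<in> \<Gamma>. real j * L \<le> len g \<and> len g < real j * L + L}" for j
    by (simp add: len_shell_def algebra_simps)
  obtain C2 where C2: "\<forall>m\<ge>0. \<forall>\<xi>\<in>\<Lambda>. (\<Sum>g | g \<in> \<Gamma> \<and> m \<le> len g \<and> len g < m + L.
      w g * f g \<xi> * (1 + exp (len g) * d \<xi> (pt g)) powr \<theta>) \<le> C2" using upper[of L] by blast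
  define C where "C = max C2 1"
  have C: "(\<Sum>g\<in>shell L j. w g * f g \<xi> * (1 + exp (len g) * d \<xi> (pt g)) powr \<theta>) \<le> C" if "\<xi> \<in> \<Lambda>" for j \<xi>
    using C2[rule_format, of "real j * L" \<xi>] that L unfolding sh C_def by simp
  \<comment> \<open>The first bound keeps the oscillation of the next remainder under control, the
    second keeps the macroscopic growth exponent below \<theta>.\<close>
  define q where "q = min (1 / (4 * (A * exp A + 1))) (\<theta> / 2)"
  have A1: "0 \<le> A * exp A" using params by simp
  have q: "0 < q" "q * (A * exp A + 1) \<le> 1 / 4" "2 * q \<le> \<theta>"
  proof -
    have "0 < 1 / (4 * (A * exp A + 1))" using A1 by (intro divide_pos_pos mult_pos_pos add_nonneg_pos) auto
    moreover have "0 < \<theta> / 2" using params by simp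
    ultimately show "0 < q" unfolding q_def by (metis min_less_iff_conj)
    have "q * (A * exp A + 1) \<le> 1 / (4 * (A * exp A + 1)) * (A * exp A + 1)"
      unfolding q_def using A1 by (intro mult_right_mono) auto
    also have "\<dots> = 1 / 4" using A1 by (simp add: add_nonneg_pos less_imp_neq[symmetric] field_simps)
    finally show "q * (A * exp A + 1) \<le> 1 / 4" .
    show "2 * q \<le> \<theta>" by (simp add: q_def)
  qed
  have q4: "q \<le> 1 / 4"
  proof -
    have "q * 1 \<le> q * (A * exp A + 1)" using A1 q by (intro mult_left_mono) auto
    then show ?thesis using q by linarith
  qed
  define \<epsilon> where "\<epsilon> = q / (4 * C)"
  have C1: "1 \<le> C" by (simp add: C_def)
  have \<epsilon>: "\<epsilon> * (4 * C) = q" "0 < \<epsilon>" "\<epsilon> \<le> 1"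
    using C1 q q4 by (auto simp: \<epsilon>_def divide_le_eq)
  define c where "c = 1 / (4 * C0 * (1 + C0) powr \<theta>)"
  have C0: "1 \<le> C0" "C1 \<le> C0" by (auto simp: C0_def)
  have c0: "0 < c" using C0 by (simp add: c_def)
  have "1 \<le> (1 + C0) powr \<theta>" using C0 params by (intro ge_one_powr_ge_zero) auto
  then have "1 * 1 \<le> (4 * C0) * (1 + C0) powr \<theta>" using C0 by (intro mult_mono) auto
  then have c1: "c \<le> 1" by (simp add: c_def divide_le_eq)
  have clow: "\<exists>g\<in>shell L j. c * (4 * (1 + exp (len g) * d \<xi> (pt g)) powr \<theta>) \<le> w g * f g \<xi>" if \<xi>: "\<xi> \<in> \<Lambda>" for j \<xi>
  proof -
    have "0 \<le> real j * L" using L by simp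
    then obtain g where g: "g \<in> \<Gamma>" "real j * L \<le> len g" "len g < real j * L + L1" "1 \<le> C1 * (w g * f g \<xi>)"
      "exp (len g) * d \<xi> (pt g) \<le> C1" using low \<xi> by blast
    have wf: "0 < w g * f g \<xi>" using g(1) \<xi> w_pos f_pos by simp
    have "C1 * (w g * f g \<xi>) \<le> C0 * (w g * f g \<xi>)" using wf C0 by (intro mult_right_mono) auto
    then have 1: "1 / C0 \<le> w g * f g \<xi>" using g(4) C0 by (simp add: divide_le_eq mult.commute)
    have "(1 + exp (len g) * d \<xi> (pt g)) powr \<theta> \<le> (1 + C0) powr \<theta>"
      using g(5) C0 params d_nonneg[OF \<xi> pt_in[OF g(1)]] by (intro powr_mono2) auto
    then have "c * (4 * (1 + exp (len g) * d \<xi> (pt g)) powr \<theta>) \<le> c * (4 * (1 + C0) powr \<theta>)"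
      using c0 by (intro mult_left_mono) auto
    also have "\<dots> = 1 / C0" using C0 by (simp add: c_def)
    finally show ?thesis using 1 g L by (intro bexI[of _ g]) (auto simp: sh)
  qed
  have ec: "\<epsilon> * c \<le> 1" using mult_mono[of \<epsilon> 1 c 1] \<epsilon> c0 c1 by simp
  have C': "0 < C" using C1 by simp
  note main = rem_induction[OF L(1) L4 q(1) q4 q(2,3) C C' \<epsilon>(1) clow c0 ec]
  define a where "a g = \<epsilon> * (rem \<epsilon> L (nat \<lfloor>len g / L\<rfloor>) (pt g) * w g)" for g
  have jj: "nat \<lfloor>len g / L\<rfloor> = j" if "g \<in> shell L j" for g j
  proof -
    have "real j \<le> len g / L" "len g / L < real j + 1"
      using that L by (auto simp: len_shell_def le_divide_eq divide_less_eq)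
    then show ?thesis by linarith
  qed
  have rem_eq: "1 - (\<Sum>i<j. \<Sum>g\<in>shell L i. a g * f g \<xi>) = rem \<epsilon> L j \<xi>" for j \<xi>
  proof (induction j)
    case (Suc j)
    have "(\<Sum>g\<in>shell L j. a g * f g \<xi>) = \<epsilon> * (\<Sum>g\<in>shell L j. rem \<epsilon> L j (pt g) * (w g * f g \<xi>))"
      unfolding sum_distrib_left by (rule sum.cong) (auto simp: a_def jj)
    then show ?case using Suc by simp
  qed simp
  have rem_le: "rem \<epsilon> L j \<xi> \<le> (1 - \<epsilon> * c) ^ j" if \<xi>: "\<xi> \<in> \<Lambda>" for j \<xi>
  proof (induction j)
    case (Suc j)
    have "rem \<epsilon> L (Suc j) \<xi> \<le> (1 - \<epsilon> * c) * rem \<epsilon> L j \<xi>" using main[of "Suc j"] \<xi> by blast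
    also have "\<dots> \<le> (1 - \<epsilon> * c) * (1 - \<epsilon> * c) ^ j" using Suc ec by (intro mult_left_mono) auto
    finally show ?case by simp
  qed simp
  show ?thesis
  proof (intro exI conjI ballI allI)
    show "0 < L" using L by simp
    show "0 \<le> 1 - \<epsilon> * c" using ec by simp
    show "1 - \<epsilon> * c < 1" using \<epsilon> c0 by simp
    show "0 < a g" if "g \<in> \<Gamma>" for g
      unfolding a_def using main[of "nat \<lfloor>len g / L\<rfloor>"] pt_in[OF that] w_pos[OF that] \<epsilon> by simp
    show "0 \<le> 1 - (\<Sum>i<j. \<Sum>g\<in>shell L i. a g * f g \<xi>)" if "\<xi> \<in> \<Lambda>" for \<xi> j
      unfolding rem_eq using main[of j] that by (simp add: less_imp_le)
    show "1 - (\<Sum>i<j. \<Sum>g\<in>shell L i. a g * f g \<xi>) \<le> (1 - \<epsilon> * c) ^ j" if "\<xi> \<in> \<Lambda>" for \<xi> j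
      unfolding rem_eq by (rule rem_le[OF that])
  qed
qed

end

section \<open>The critical exponent\<close>

lemma sum_UNION_le:
  fixes f :: "'a \<Rightarrow> real"
  assumes "finite I" "\<And>i. finite (A i)" "\<And>a. 0 \<le> f a"
  shows "(\<Sum>a\<in>(\<Union>i\<in>I. A i). f a) \<le> (\<Sum>i\<in>I. \<Sum>a\<in>A i. f a)"
  using assms(1)
proof (induction I)
  case (insert i I)
  have "(\<Sum>a\<in>A i \<union> (\<Union>i\<in>I. A i). f a) \<le> (\<Sum>a\<in>A i. f a) + (\<Sum>a\<in>(\<Union>i\<in>I. A i). f a)"
    using sum.union_inter[of "A i" "\<Union>i\<in>I. A i" f] sum_nonneg[of "A i \<inter> (\<Union>i\<in>I. A i)" f] assms insert(1) by simp
  then show ?case using insert by simp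
qed simp

text \<open>Each of the three terms contributes at most a third of \<open>K * q ^ i\<close>. The
  conditions on \<theta> are stated for three powers since \<open>q\<close> may be on either side of
  1: growth is wanted for finiteness of the critical exponent, decay for divergence at it.\<close>

lemma recurrence_growth:
  fixes S :: "nat \<Rightarrow> real"
  assumes S: "\<And>i. 0 \<le> S i" and q: "0 < q" "3 * \<theta> \<le> q ^ (j + 1)" "3 * \<theta> \<le> q ^ j" "3 * \<theta> \<le> q ^ (j - 1)" "0 \<le> \<theta>"
    and j: "2 \<le> j"
    and rec: "\<And>i. j + 1 \<le> i \<Longrightarrow> S i \<le> \<theta> * (S (i - j - 1) + S (i - j) + S (i - j + 1))"
  shows "\<exists>K\<ge>0. \<forall>i. S i \<le> K * q ^ i"
proof -
  define K where "K = (\<Sum>i\<le>j. S i / q ^ i)"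
  have K: "0 \<le> K" unfolding K_def using S q by (intro sum_nonneg) auto
  have "S i \<le> K * q ^ i" for i
  proof (induction i rule: less_induct)
    case (less i)
    show ?case
    proof (cases "i \<le> j")
      case True
      have "S i / q ^ i \<le> K" unfolding K_def using True S q by (intro member_le_sum) auto
      then show ?thesis using q by (simp add: divide_le_eq)
    next
      case False
      then have i: "j + 1 \<le> i" by simp
      have 1: "\<theta> * S (i - n) \<le> K * q ^ i / 3" if "3 * \<theta> \<le> q ^ n" "1 \<le> n" "n \<le> i" for n
      proof -
        have "3 * \<theta> * S (i - n) \<le> q ^ n * (K * q ^ (i - n))"
          using less[of "i - n"] that S q i by (intro mult_mono) auto
        also have "\<dots> = K * q ^ i" using that by (simp flip: power_add)
        finally show ?thesis by simp
      qed
      have "S i \<le> \<theta> * (S (i - (j + 1)) + S (i - j) + S (i - (j - 1)))"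
        using rec[OF i] j i by (simp add: Suc_diff_le)
      also have "\<dots> = \<theta> * S (i - (j + 1)) + \<theta> * S (i - j) + \<theta> * S (i - (j - 1))" by (simp add: algebra_simps)
      also have "\<dots> \<le> K * q ^ i / 3 + K * q ^ i / 3 + K * q ^ i / 3"
        using i j by (intro add_mono 1 q) auto
      also have "\<dots> = K * q ^ i" by simp
      finally show ?thesis .
    qed
  qed
  then show ?thesis using K by blast
qed

locale gibbs_setting = cocompact_isom_group \<Gamma> for \<Gamma> :: "'n::finite mink_mat set" +
  fixes F :: "'n potential" and x :: "'n mink"
  assumes holder_F: "holder_potential \<Gamma> F" and x: "x \<in> hyp_space"
begin

definition pot :: "real \<Rightarrow> 'n mink \<times> 'n mink \<Rightarrow> real" where "pot s u = lift_potential \<Gamma> F u - s"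

definition orb :: "'n mink set" where "orb = (\<lambda>g. g *v x) ` \<Gamma>"

definition len :: "'n mink_mat \<Rightarrow> real" where "len g = hyp_dist x (g *v x)"

text \<open>The terms of the Poincare series at exponent \<open>s\<close>: subtracting the constant
  \<open>s\<close> from the potential multiplies by \<open>exp (- s * len g)\<close>.\<close>

definition wt :: "real \<Rightarrow> 'n mink_mat \<Rightarrow> real" where "wt s g = exp (pint (pot s) x (g *v x))"

lemma orbit_hyp: "g \<in> \<Gamma> \<Longrightarrow> g *v x \<in> hyp_space"
  by (rule act_hyp[OF _ x])

lemma orbI: "g \<in> \<Gamma> \<Longrightarrow> g *v x \<in> orb" and x_orb: "x \<in> orb"
  using one_in matrix_vector_mul_lid[of x] unfolding orb_def by (blast, metis image_eqI)

lemma len_nonneg: "g \<in> \<Gamma> \<Longrightarrow> 0 \<le> len g"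
  unfolding len_def using x orbit_hyp by simp

lemma len_ginv: "g \<in> \<Gamma> \<Longrightarrow> len (ginv g) = len g"
  unfolding len_def using dist_ginv[of g x x] by (simp add: hyp_dist_commute)

lemma dist_orbit: "h \<in> \<Gamma> \<Longrightarrow> hyp_dist (h *v x) (g *v x) = len (ginv h ** g)"
  using isom_dist[OF carrier, of h x "ginv h *v (g *v x)"] by (simp add: len_def ginv_act flip: matrix_vector_mul_assoc)

lemma finite_len: "finite {g\<in>\<Gamma>. len g \<le> r}"
  unfolding len_def by (rule finite_orbit_ball[OF x])

lemma tangent_orbit_act:
  assumes "g \<in> \<Gamma>" shows "tangent_orbit \<Gamma> (g *v fst u, g *v snd u) = tangent_orbit \<Gamma> u"
proof
  show "tangent_orbit \<Gamma> (g *v fst u, g *v snd u) \<subseteq> tangent_orbit \<Gamma> u"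
    using mult_in[OF _ assms] by (auto simp: tangent_orbit_def matrix_vector_mul_assoc)
  show "tangent_orbit \<Gamma> u \<subseteq> tangent_orbit \<Gamma> (g *v fst u, g *v snd u)"
  proof
    fix p assume "p \<in> tangent_orbit \<Gamma> u"
    then obtain h where h: "h \<in> \<Gamma>" "p = (h *v fst u, h *v snd u)" by (auto simp: tangent_orbit_def)
    have "h ** ginv g \<in> \<Gamma>" by (intro mult_in h ginv_in assms)
    moreover have "p = ((h ** ginv g) *v (g *v fst u), (h ** ginv g) *v (g *v snd u))"
      using h ginv_act(1)[OF assms] by (simp flip: matrix_vector_mul_assoc)
    ultimately show "p \<in> tangent_orbit \<Gamma> (g *v fst u, g *v snd u)" unfolding tangent_orbit_def by auto
  qed
qed

lemma pot_invariant: "g \<in> \<Gamma> \<Longrightarrow> pot s (g *v fst u, g *v snd u) = pot s u"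
  by (simp add: pot_def lift_potential_def tangent_orbit_act)

lemma pint_pot_invariant: "g \<in> \<Gamma> \<Longrightarrow> pint (pot s) (g *v p) (g *v z) = pint (pot s) p z"
  by (rule pint_invariant) (simp_all add: carrier pot_invariant)

lemma tangent_orbit_self: "u \<in> tangent_orbit \<Gamma> u"
  unfolding tangent_orbit_def using one_in by (auto intro!: image_eqI[of _ _ "mat 1"])

lemma tangent_orbit_subset: "u \<in> hyp_unit_tangent \<Longrightarrow> tangent_orbit \<Gamma> u \<subseteq> hyp_unit_tangent"
  using isom_tangent[OF carrier] by (cases u) (auto simp: tangent_orbit_def)

text \<open>A function on the quotient that is Hoelder for the infimum over representatives is
  Hoelder upstairs, because each pair of representatives is at least as far apart. Linear growth
  comes from comparison with the translate over \<open>b\<close> of one fixed vector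
  \<open>v0\<close>, at which invariance gives a fixed value.\<close>

lemma pot_potential: "\<exists>K \<alpha> B. hyp_potential (pot s) K \<alpha> orb B"
proof -
  obtain C \<alpha> where a: "0 < \<alpha>" "\<alpha> \<le> 1" and h: "\<And>P Q. P \<in> quot_unit_tangent \<Gamma> \<Longrightarrow> Q \<in> quot_unit_tangent \<Gamma> \<Longrightarrow>
    \<bar>F P - F Q\<bar> \<le> C * quot_tangent_dist P Q powr \<alpha>"
    using holder_F unfolding holder_potential_def by blast
  define K where "K = max C 0"
  have hol: "\<bar>pot s u - pot s w\<bar> \<le> K * tangent_dist u w powr \<alpha>"
    if u: "u \<in> hyp_unit_tangent" and w: "w \<in> hyp_unit_tangent" for u w
  proof -
    let ?D = "quot_tangent_dist (tangent_orbit \<Gamma> u) (tangent_orbit \<Gamma> w)"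
    let ?f = "\<lambda>(u, w). tangent_dist u w"
    have nn: "0 \<le> ?f p" if "p \<in> tangent_orbit \<Gamma> u \<times> tangent_orbit \<Gamma> w" for p
      using that tangent_orbit_subset[OF u] tangent_orbit_subset[OF w] tangent_dist_nonneg by (cases p) (simp, blast)
    have ne: "tangent_orbit \<Gamma> u \<times> tangent_orbit \<Gamma> w \<noteq> {}" using tangent_orbit_self by blast
    have "0 \<le> ?D" unfolding quot_tangent_dist_def by (rule cINF_greatest[OF ne nn])
    moreover have "?D \<le> ?f (u, w)" unfolding quot_tangent_dist_def
      by (rule cINF_lower) (use nn tangent_orbit_self in \<open>auto intro!: bdd_belowI2[of _ 0]\<close>)
    ultimately have D: "?D powr \<alpha> \<le> tangent_dist u w powr \<alpha>" using a by (intro powr_mono2) auto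
    have "\<bar>pot s u - pot s w\<bar> \<le> C * ?D powr \<alpha>"
      using h[of "tangent_orbit \<Gamma> u" "tangent_orbit \<Gamma> w"] u w by (simp add: pot_def lift_potential_def quot_unit_tangent_def)
    also have "\<dots> \<le> K * ?D powr \<alpha>" by (intro mult_right_mono) (auto simp: K_def)
    also have "\<dots> \<le> K * tangent_dist u w powr \<alpha>" using D by (intro mult_left_mono) (auto simp: K_def)
    finally show ?thesis .
  qed
  obtain v0 where v0: "(x, v0) \<in> hyp_unit_tangent" using exists_unit_tangent[OF x] by blast
  define B where "B = \<bar>pot s (x, v0)\<bar> + 2 * K * gauss_const powr \<alpha>"
  have K: "0 \<le> K" by (simp add: K_def)
  have gr: "\<bar>pot s u\<bar> \<le> B * (1 + hyp_dist b (fst u))" if u: "u \<in> hyp_unit_tangent" and b: "b \<in> orb" for u b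
  proof -
    obtain g where g: "g \<in> \<Gamma>" "b = g *v x" using b by (auto simp: orb_def)
    have gv: "(g *v x, g *v v0) \<in> hyp_unit_tangent" by (rule isom_tangent[OF carrier[OF g(1)] v0])
    have u': "(fst u, snd u) \<in> hyp_unit_tangent" using u by simp
    define D where "D = hyp_dist b (fst u)"
    have D: "0 \<le> D" unfolding D_def g(2) using orbit_hyp[OF g(1)] hyp_unit_tangentD(1)[OF u'] by simp
    have td: "0 \<le> tangent_dist (g *v x, g *v v0) u" by (rule tangent_dist_nonneg[OF gv u])
    have "tangent_dist (g *v x, g *v v0) u \<le> (2 + D) * gauss_const"
      using tangent_dist_base[OF gv u'] by (simp add: D_def g(2))
    then have "tangent_dist (g *v x, g *v v0) u powr \<alpha> \<le> ((2 + D) * gauss_const) powr \<alpha>" using td a by (intro powr_mono2) auto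
    also have "\<dots> = (2 + D) powr \<alpha> * gauss_const powr \<alpha>" using D gauss_const_nonneg by (simp add: powr_mult)
    also have "\<dots> \<le> (2 + D) * gauss_const powr \<alpha>"
      using powr_mono[of \<alpha> 1 "2 + D"] a D by (intro mult_right_mono) auto
    also have "\<dots> \<le> 2 * (1 + D) * gauss_const powr \<alpha>" using D by (intro mult_right_mono) auto
    finally have "K * tangent_dist (g *v x, g *v v0) u powr \<alpha> \<le> K * (2 * (1 + D) * gauss_const powr \<alpha>)"
      using K by (intro mult_left_mono)
    moreover have "pot s (g *v x, g *v v0) = pot s (x, v0)" using pot_invariant[OF g(1), of s "(x, v0)"] by simp
    ultimately have "\<bar>pot s u\<bar> \<le> \<bar>pot s (x, v0)\<bar> + K * (2 * (1 + D) * gauss_const powr \<alpha>)"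
      using hol[OF gv u] by linarith
    also have "\<bar>pot s (x, v0)\<bar> \<le> \<bar>pot s (x, v0)\<bar> * (1 + D)" using D by (simp add: mult_le_cancel_left1)
    finally show ?thesis by (simp add: B_def D_def algebra_simps)
  qed
  have "hyp_potential (pot s) K \<alpha> orb B"
  proof
    show "0 \<le> B" unfolding B_def using K by simp
    show "orb \<subseteq> hyp_space" using orbit_hyp by (auto simp: orb_def)
  qed (use K a hol gr in auto)
  then show ?thesis by blast
qed

lemma pint_pot_shift:
  assumes "y \<in> hyp_space" "z \<in> hyp_space"
  shows "pint (pot s) y z = pint (pot 0) y z - s * hyp_dist y z"
proof -
  obtain K \<alpha> B where "hyp_potential (pot 0) K \<alpha> orb B" using pot_potential by blast
  then interpret hyp_potential "pot 0" K \<alpha> orb B .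
  obtain v where v: "(y, v) \<in> hyp_unit_tangent" "z = geo_point y v (hyp_dist y z)"
    using exists_geo_point assms by blast
  define l where "l = hyp_dist y z"
  have l: "0 \<le> l" using assms by (simp add: l_def)
  have z: "z = geo_point y v l" using v by (simp add: l_def)
  have "pot s u = pot 0 u - s" for u by (simp add: pot_def)
  then have "pint (pot s) y z = integral {0..l} (\<lambda>r. pot 0 (geo_flow r (y, v)) - s)"
    unfolding z pint_geo_point[OF v(1) l] by simp
  also have "\<dots> = integral {0..l} (\<lambda>r. pot 0 (geo_flow r (y, v))) - integral {0..l} (\<lambda>r. s)"
    by (intro Henstock_Kurzweil_Integration.integral_diff integrable_flow v) auto
  also have "\<dots> = pint (pot 0) y z - s * l" unfolding z pint_geo_point[OF v(1) l] using l by simp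
  finally show ?thesis by (simp add: l_def)
qed

lemma wt_shift: assumes "g \<in> \<Gamma>" shows "wt s g = exp ((r - s) * len g) * wt r g"
  unfolding wt_def using pint_pot_shift[OF x orbit_hyp[OF assms], of s] pint_pot_shift[OF x orbit_hyp[OF assms], of r]
  by (simp add: mult_exp_exp len_def algebra_simps)

lemma wt_pos: "0 < wt s g" by (simp add: wt_def)

lemma pint_orbit_almost_geodesic:
  fixes C :: real
  assumes "0 \<le> C"
  shows "\<exists>C'\<ge>0. \<forall>a\<in>hyp_space. \<forall>h\<in>\<Gamma>. \<forall>z\<in>hyp_space.
     hyp_dist a (h *v x) + hyp_dist (h *v x) z \<le> hyp_dist a z + C \<longrightarrow>
     \<bar>pint (pot s) a z - pint (pot s) a (h *v x) - pint (pot s) (h *v x) z\<bar> \<le> C'"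
proof -
  obtain K \<alpha> B where "hyp_potential (pot s) K \<alpha> orb B" using pot_potential by blast
  then interpret hyp_potential "pot s" K \<alpha> orb B .
  obtain C' where C': "C' \<ge> 0" "\<And>a p z b. a \<in> hyp_space \<Longrightarrow> p \<in> hyp_space \<Longrightarrow> z \<in> hyp_space \<Longrightarrow> b \<in> orb \<Longrightarrow>
     hyp_dist a p + hyp_dist p z \<le> hyp_dist a z + C \<Longrightarrow>
     \<bar>pint (pot s) a z - pint (pot s) a p - pint (pot s) p z\<bar> \<le> C' * (1 + hyp_dist b p)"
    using pint_almost_geodesic[OF assms] by blast
  show ?thesis
  proof (intro exI[of _ C'] conjI ballI impI C'(1))
    fix a h z assume "a \<in> hyp_space" and h: "h \<in> \<Gamma>" and "z \<in> hyp_space"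
      "hyp_dist a (h *v x) + hyp_dist (h *v x) z \<le> hyp_dist a z + C"
    then show "\<bar>pint (pot s) a z - pint (pot s) a (h *v x) - pint (pot s) (h *v x) z\<bar> \<le> C'"
      using C'(2)[OF _ orbit_hyp[OF h] _ orbI[OF h], of a z] orbit_hyp[OF h] by simp
  qed
qed

lemma pint_base_change:
  assumes y: "y \<in> hyp_space"
  shows "\<exists>C\<ge>0. \<forall>g\<in>\<Gamma>. \<bar>pint (pot s) y (g *v y) - pint (pot s) x (g *v x)\<bar> \<le> C"
proof -
  obtain K \<alpha> B where "hyp_potential (pot s) K \<alpha> orb B" using pot_potential by blast
  then interpret hyp_potential "pot s" K \<alpha> orb B .
  define R where "R = hyp_dist x y"
  have R: "0 \<le> R" using x y by (simp add: R_def)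
  obtain C1 where C1: "C1 \<ge> 0" "\<And>z p p' b. z \<in> hyp_space \<Longrightarrow> p \<in> hyp_space \<Longrightarrow> p' \<in> hyp_space \<Longrightarrow>
      b \<in> orb \<Longrightarrow> hyp_dist p p' \<le> R \<Longrightarrow>
      \<bar>pint (pot s) z p - pint (pot s) z p'\<bar> \<le> C1 * (1 + hyp_dist b p) * hyp_dist p p' powr \<alpha>"
    using pint_endpoint[OF R] by blast
  obtain C2 where C2: "C2 \<ge> 0" "\<And>z p p' b. z \<in> hyp_space \<Longrightarrow> p \<in> hyp_space \<Longrightarrow> p' \<in> hyp_space \<Longrightarrow>
      b \<in> orb \<Longrightarrow> hyp_dist p p' \<le> R \<Longrightarrow>
      \<bar>pint (pot s) p z - pint (pot s) p' z\<bar> \<le> C2 * (1 + hyp_dist b p) * hyp_dist p p' powr \<alpha>"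
    using pint_startpoint[OF R] by blast
  show ?thesis
  proof (intro exI[of _ "(C1 + C2) * R powr \<alpha>"] conjI ballI)
    show "0 \<le> (C1 + C2) * R powr \<alpha>" using C1(1) C2(1) by simp
    fix g assume g: "g \<in> \<Gamma>"
    have d: "hyp_dist (g *v x) (g *v y) = R" by (simp add: isom_dist[OF carrier[OF g]] R_def)
    have "\<bar>pint (pot s) x (g *v x) - pint (pot s) x (g *v y)\<bar> \<le> C1 * R powr \<alpha>"
      using C1(2)[OF x orbit_hyp[OF g] act_hyp[OF g y] orbI[OF g]] d orbit_hyp[OF g] by simp
    moreover have "\<bar>pint (pot s) x (g *v y) - pint (pot s) y (g *v y)\<bar> \<le> C2 * R powr \<alpha>"
      using C2(2)[OF act_hyp[OF g y] x y x_orb] x by (simp add: R_def)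
    ultimately show "\<bar>pint (pot s) y (g *v y) - pint (pot s) x (g *v x)\<bar> \<le> (C1 + C2) * R powr \<alpha>"
      by (simp add: distrib_right)
  qed
qed

section \<open>Convergence of the Poincare series\<close>

definition converges :: "real \<Rightarrow> bool" where
  "converges s \<longleftrightarrow> (\<exists>B. \<forall>A. finite A \<and> A \<subseteq> \<Gamma> \<longrightarrow> (\<Sum>g\<in>A. wt s g) \<le> B)"

text \<open>Passes from the conventions of the critical exponent (origin, annuli, no shift) to the
  weights at \<open>x\<close>: changing the base point alters integrals and displacements by bounded
  amounts, and within an annulus the displacement of the origin is \<open>n\<close> up to 1.\<close>

lemma annulus_sum_compare:
  "\<exists>C\<ge>1. \<forall>g\<in>\<Gamma>. \<forall>n. real n - 1 < hyp_dist origin (g *v origin) \<and> hyp_dist origin (g *v origin) \<le> real n \<longrightarrow>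
     exp (path_integral \<Gamma> F origin (g *v origin)) \<le> C * exp (s * real n) * wt s g \<and>
     wt s g \<le> C * exp (- s * real n) * exp (path_integral \<Gamma> F origin (g *v origin))"
proof -
  obtain C where C: "C \<ge> 0" "\<And>g. g \<in> \<Gamma> \<Longrightarrow> \<bar>pint (pot 0) origin (g *v origin) - pint (pot 0) x (g *v x)\<bar> \<le> C"
    using pint_base_change[OF origin_in_hyp_space] by blast
  define E where "E = hyp_dist origin x"
  have E: "0 \<le> E" using x by (simp add: E_def)
  have pi: "path_integral \<Gamma> F origin z = pint (pot 0) origin z" for z
    by (simp add: path_integral_def pint_def pot_def)
  show ?thesis
  proof (intro exI[of _ "exp (C + \<bar>s\<bar> * (2 * E + 1))"] conjI ballI allI impI)
    show "1 \<le> exp (C + \<bar>s\<bar> * (2 * E + 1))" using C E by simp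
    fix g n assume g: "g \<in> \<Gamma>" and n: "real n - 1 < hyp_dist origin (g *v origin) \<and> hyp_dist origin (g *v origin) \<le> real n"
    note go = act_hyp[OF g origin_in_hyp_space]
    have "hyp_dist (g *v x) (g *v origin) = E" by (simp add: isom_dist[OF carrier[OF g]] E_def hyp_dist_commute)
    then have "\<bar>len g - hyp_dist origin (g *v origin)\<bar> \<le> 2 * E"
      using hyp_dist_triangle[OF origin_in_hyp_space x go] hyp_dist_triangle[OF x orbit_hyp[OF g] go]
        hyp_dist_triangle[OF x origin_in_hyp_space orbit_hyp[OF g]] hyp_dist_triangle[OF origin_in_hyp_space go orbit_hyp[OF g]]
      by (simp add: len_def E_def hyp_dist_commute)
    then have "\<bar>len g - real n\<bar> \<le> 2 * E + 1" using n by linarith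
    then have "\<bar>s\<bar> * \<bar>len g - real n\<bar> \<le> \<bar>s\<bar> * (2 * E + 1)" by (intro mult_left_mono) auto
    then have 1: "\<bar>s * len g - s * real n\<bar> \<le> \<bar>s\<bar> * (2 * E + 1)" by (simp add: right_diff_distrib[symmetric] abs_mult)
    have w: "wt s g = exp (pint (pot 0) x (g *v x) - s * len g)"
      unfolding wt_def pint_pot_shift[OF x orbit_hyp[OF g], of s] by (simp add: len_def)
    show "exp (path_integral \<Gamma> F origin (g *v origin)) \<le> exp (C + \<bar>s\<bar> * (2 * E + 1)) * exp (s * real n) * wt s g"
      unfolding w pi mult_exp_exp using C(2)[OF g] 1 by simp
    show "wt s g \<le> exp (C + \<bar>s\<bar> * (2 * E + 1)) * exp (- s * real n) * exp (path_integral \<Gamma> F origin (g *v origin))"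
      unfolding w pi mult_exp_exp using C(2)[OF g] 1 by simp
  qed
qed

definition annulus :: "nat \<Rightarrow> 'n mink_mat set" where
  "annulus n = {g \<in> \<Gamma>. real n - 1 < hyp_dist origin (g *v origin) \<and> hyp_dist origin (g *v origin) \<le> real n}"

lemma finite_annulus: "finite (annulus n)"
  unfolding annulus_def by (rule finite_subset[OF _ finite_orbit_ball_origin[of "real n"]]) auto

lemma annulus_sum_eq: "annulus_sum \<Gamma> F n = (\<Sum>g\<in>annulus n. exp (path_integral \<Gamma> F origin (g *v origin)))"
  by (simp add: annulus_sum_def annulus_def)

lemma critical_exponent_le:
  assumes "converges s" shows "critical_exponent \<Gamma> F \<le> ereal s"
proof -
  obtain B where B: "\<And>A. finite A \<Longrightarrow> A \<subseteq> \<Gamma> \<Longrightarrow> (\<Sum>g\<in>A. wt s g) \<le> B" using assms by (auto simp: converges_def)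
  obtain C where C: "C \<ge> 1" "\<And>g n. g \<in> annulus n \<Longrightarrow> exp (path_integral \<Gamma> F origin (g *v origin)) \<le> C * exp (s * real n) * wt s g"
    using annulus_sum_compare[of s] unfolding annulus_def by blast
  define D where "D = C * (\<bar>B\<bar> + 1)"
  have D: "0 < D" unfolding D_def using C by (intro mult_pos_pos) auto
  have a: "annulus_sum \<Gamma> F n \<le> D * exp (s * real n)" for n
  proof -
    have "annulus_sum \<Gamma> F n \<le> (\<Sum>g\<in>annulus n. C * exp (s * real n) * wt s g)"
      unfolding annulus_sum_eq by (intro sum_mono C)
    also have "\<dots> = C * exp (s * real n) * (\<Sum>g\<in>annulus n. wt s g)" by (simp only: sum_distrib_left)
    also have "\<dots> \<le> C * exp (s * real n) * (\<bar>B\<bar> + 1)"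
      using B[OF finite_annulus, of n] C by (intro mult_left_mono) (auto simp: annulus_def)
    finally show ?thesis by (simp add: D_def mult_ac)
  qed
  have "limsup (\<lambda>n. if annulus_sum \<Gamma> F n = 0 then -\<infinity> else ereal (1 / real n * ln (annulus_sum \<Gamma> F n)))
      \<le> limsup (\<lambda>n. ereal (s + ln D / real n))"
  proof (rule Limsup_mono)
    show "\<forall>\<^sub>F n in sequentially. (if annulus_sum \<Gamma> F n = 0 then -\<infinity> else ereal (1 / real n * ln (annulus_sum \<Gamma> F n))) \<le> ereal (s + ln D / real n)"
      using eventually_gt_at_top[of 0]
    proof eventually_elim
      case (elim n)
      show ?case
      proof (cases "annulus_sum \<Gamma> F n = 0")
        case False
        have "0 \<le> annulus_sum \<Gamma> F n" unfolding annulus_sum_eq by (intro sum_nonneg) auto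
        then have p: "0 < annulus_sum \<Gamma> F n" using False by simp
        then have "ln (annulus_sum \<Gamma> F n) \<le> ln (D * exp (s * real n))" using a[of n] D by simp
        also have "\<dots> = ln D + s * real n" using D by (simp add: ln_mult)
        finally have "1 / real n * ln (annulus_sum \<Gamma> F n) \<le> 1 / real n * (ln D + s * real n)" using elim by (intro mult_left_mono) auto
        also have "\<dots> = s + ln D / real n" using elim by (simp add: field_simps)
        finally show ?thesis using False by simp
      qed simp
    qed
  qed
  also have "limsup (\<lambda>n. ereal (s + ln D / real n)) = ereal s"
  proof (rule lim_imp_Limsup)
    have "(\<lambda>n. s + ln D * (1 / real n)) \<longlonglongrightarrow> s + ln D * 0" by (intro tendsto_intros lim_1_over_n)
    then show "(\<lambda>n. ereal (s + ln D / real n)) \<longlonglongrightarrow> ereal s" by simp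
  qed simp
  finally show ?thesis unfolding critical_exponent_def .
qed

lemma converges_above:
  assumes "critical_exponent \<Gamma> F < ereal s" shows "converges s"
proof -
  \<comment> \<open>An exponent strictly in between makes the annulus sums at \<open>s\<close> decay
    geometrically with ratio \<open>exp (r - s)\<close>; the finitely many small \<open>n\<close>,
    about which the upper limit says nothing, go into \<open>D\<close>.\<close>
  obtain r where r: "critical_exponent \<Gamma> F < ereal r" "ereal r < ereal s" using ereal_dense2[OF assms] by blast
  have "\<forall>\<^sub>F n in sequentially. (if annulus_sum \<Gamma> F n = 0 then -\<infinity> else ereal (1 / real n * ln (annulus_sum \<Gamma> F n))) < ereal r"
    using r(1) unfolding critical_exponent_def by (rule Limsup_lessD)
  then obtain N where N: "\<And>n. n \<ge> N \<Longrightarrow> (if annulus_sum \<Gamma> F n = 0 then -\<infinity> else ereal (1 / real n * ln (annulus_sum \<Gamma> F n))) < ereal r"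
    unfolding eventually_sequentially by blast
  have nn: "0 \<le> annulus_sum \<Gamma> F n" for n unfolding annulus_sum_eq by (intro sum_nonneg) auto
  define D where "D = 1 + (\<Sum>n\<le>N. annulus_sum \<Gamma> F n * exp (- r * real n))"
  have D1: "1 \<le> D" unfolding D_def using nn by (simp add: sum_nonneg)
  have a: "annulus_sum \<Gamma> F n \<le> D * exp (r * real n)" for n
  proof (cases "n \<le> N")
    case True
    have "annulus_sum \<Gamma> F n * exp (- r * real n) \<le> (\<Sum>n\<le>N. annulus_sum \<Gamma> F n * exp (- r * real n))"
      using True nn by (intro member_le_sum) auto
    then have "annulus_sum \<Gamma> F n * exp (- r * real n) * exp (r * real n) \<le> D * exp (r * real n)"
      by (intro mult_right_mono) (auto simp: D_def)
    then show ?thesis by (simp add: mult.assoc mult_exp_exp)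
  next
    case False
    then have n: "n \<ge> N" "0 < n" by auto
    show ?thesis
    proof (cases "annulus_sum \<Gamma> F n = 0")
      case True
      then show ?thesis using D1 by simp
    next
      case F: False
      then have p: "0 < annulus_sum \<Gamma> F n" using nn[of n] by simp
      have "1 / real n * ln (annulus_sum \<Gamma> F n) < r" using N[OF n(1)] F by simp
      then have "ln (annulus_sum \<Gamma> F n) < r * real n" using n by (simp add: field_simps)
      then have "annulus_sum \<Gamma> F n < exp (r * real n)" using p by (metis exp_less_cancel_iff exp_ln)
      also have "\<dots> \<le> D * exp (r * real n)" using D1 by simp
      finally show ?thesis by simp
    qed
  qed
  obtain C where C: "C \<ge> 1" "\<And>g n. g \<in> annulus n \<Longrightarrow> wt s g \<le> C * exp (- s * real n) * exp (path_integral \<Gamma> F origin (g *v origin))"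
    using annulus_sum_compare[of s] unfolding annulus_def by blast
  define \<rho> where "\<rho> = exp (r - s)"
  have \<rho>: "0 < \<rho>" "\<rho> < 1" using r by (auto simp: \<rho>_def)
  have ann: "(\<Sum>g\<in>annulus n. wt s g) \<le> C * D * \<rho> ^ n" for n
  proof -
    have "(\<Sum>g\<in>annulus n. wt s g) \<le> (\<Sum>g\<in>annulus n. C * exp (- s * real n) * exp (path_integral \<Gamma> F origin (g *v origin)))"
      by (intro sum_mono C)
    also have "\<dots> = C * exp (- s * real n) * annulus_sum \<Gamma> F n" unfolding annulus_sum_eq by (simp only: sum_distrib_left)
    also have "\<dots> \<le> C * exp (- s * real n) * (D * exp (r * real n))" using a C by (intro mult_left_mono) auto
    also have "\<dots> = C * D * (exp (- s * real n) * exp (r * real n))" by simp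
    also have "exp (- s * real n) * exp (r * real n) = \<rho> ^ n"
      unfolding mult_exp_exp \<rho>_def by (simp add: exp_of_nat_mult[symmetric] algebra_simps)
    finally show ?thesis .
  qed
  show ?thesis unfolding converges_def
  proof (intro exI[of _ "C * D * (1 / (1 - \<rho>))"] allI impI)
    fix A assume A: "finite A \<and> A \<subseteq> \<Gamma>"
    define m where "m = Max (insert 0 ((\<lambda>g. nat \<lceil>hyp_dist origin (g *v origin)\<rceil>) ` A))"
    have "A \<subseteq> (\<Union>n\<le>m. annulus n)"
    proof
      fix g assume g: "g \<in> A"
      define n where "n = nat \<lceil>hyp_dist origin (g *v origin)\<rceil>"
      have "0 \<le> hyp_dist origin (g *v origin)" using g A act_hyp origin_in_hyp_space by (intro hyp_dist_nonneg) blast+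
      then have "g \<in> annulus n" using g A unfolding annulus_def n_def by (auto; linarith)
      moreover have "n \<le> m" unfolding m_def n_def using A g by (intro Max_ge) auto
      ultimately show "g \<in> (\<Union>n\<le>m. annulus n)" by blast
    qed
    then have "(\<Sum>g\<in>A. wt s g) \<le> (\<Sum>g\<in>(\<Union>n\<le>m. annulus n). wt s g)"
      using wt_pos by (intro sum_mono2) (auto simp: finite_annulus less_imp_le)
    also have "\<dots> \<le> (\<Sum>n\<le>m. \<Sum>g\<in>annulus n. wt s g)"
      by (rule sum_UNION_le) (auto simp: finite_annulus less_imp_le[OF wt_pos])
    also have "\<dots> \<le> (\<Sum>n\<le>m. C * D * \<rho> ^ n)" by (intro sum_mono ann)
    also have "\<dots> = C * D * (\<Sum>n\<le>m. \<rho> ^ n)" by (simp only: sum_distrib_left)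
    also have "\<dots> \<le> C * D * (1 / (1 - \<rho>))"
    proof (intro mult_left_mono)
      have "(\<Sum>n\<le>m. \<rho> ^ n) \<le> (\<Sum>n. \<rho> ^ n)" using \<rho> by (intro sum_le_suminf) (auto intro: summable_geometric)
      then show "(\<Sum>n\<le>m. \<rho> ^ n) \<le> 1 / (1 - \<rho>)" using \<rho> by (simp add: suminf_geometric)
    qed (use C D1 in auto)
    finally show "(\<Sum>g\<in>A. wt s g) \<le> C * D * (1 / (1 - \<rho>))" .
  qed
qed

section \<open>Submultiplicativity of shell sums and divergence at the critical exponent\<close>

abbreviation lshell :: "real \<Rightarrow> nat \<Rightarrow> 'n mink_mat set" where "lshell \<equiv> len_shell \<Gamma> len"

lemma finite_lshell: "finite (lshell L j)"
  unfolding len_shell_def by (rule finite_subset[OF _ finite_len[of "(real j + 1) * L"]]) auto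

text \<open>An element of the shell \<open>i\<close> is the product of one in the shell \<open>j\<close> and one in a shell close to
  \<open>i - j\<close>, since the orbit is quasi-convex.\<close>

lemma shell_submultiplicative:
  "\<exists>L C. 0 < L \<and> 0 \<le> C \<and> (\<forall>j i. j + 1 \<le> i \<longrightarrow>
     (\<Sum>g\<in>lshell L i. wt s g) \<le> C * (\<Sum>g\<in>lshell L j. wt s g) *
       ((\<Sum>g\<in>lshell L (i - j - 1). wt s g) + (\<Sum>g\<in>lshell L (i - j). wt s g) + (\<Sum>g\<in>lshell L (i - j + 1). wt s g)))"
proof -
  obtain C1 where C1: "C1 \<ge> 0" "\<And>g t. g \<in> \<Gamma> \<Longrightarrow> 0 \<le> t \<Longrightarrow> t \<le> len g \<Longrightarrow>
    (\<exists>h\<in>\<Gamma>. len h + hyp_dist (h *v x) (g *v x) \<le> len g + C1 \<and> \<bar>len h - t\<bar> \<le> C1)"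
    using orbit_quasi_convex[OF x] unfolding len_def by blast
  define L where "L = 2 * C1 + 1"
  have L: "0 < L" "C1 < L / 2" "C1 \<le> L" using C1(1) by (auto simp: L_def)
  obtain C2 where C2: "C2 \<ge> 0" "\<And>a h z. a \<in> hyp_space \<Longrightarrow> h \<in> \<Gamma> \<Longrightarrow> z \<in> hyp_space \<Longrightarrow>
     hyp_dist a (h *v x) + hyp_dist (h *v x) z \<le> hyp_dist a z + C1 \<Longrightarrow>
     \<bar>pint (pot s) a z - pint (pot s) a (h *v x) - pint (pot s) (h *v x) z\<bar> \<le> C2"
    using pint_orbit_almost_geodesic[OF C1(1)] by blast
  have split: "\<exists>h k. h \<in> lshell L j \<and> k \<in> lshell L (i - j - 1) \<union> lshell L (i - j) \<union> lshell L (i - j + 1) \<and> g = h ** k \<and>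
      wt s g \<le> exp C2 * (wt s h * wt s k)" if ij: "j + 1 \<le> i" and g: "g \<in> lshell L i" for i j g
  proof -
    \<comment> \<open>The middle of shell \<open>j\<close>: the displacement is met up to
      \<open>C1\<close>, which is less than \<open>L / 2\<close>, so the orbit point falls into that
      shell.\<close>
    define t where "t = real j * L + L / 2"
    have gG: "g \<in> \<Gamma>" and gl: "real i * L \<le> len g" "len g < (real i + 1) * L" using g by (auto simp: len_shell_def)
    have "(real j + 1) * L \<le> real i * L" using ij L by (intro mult_right_mono) auto
    then have t: "0 \<le> t" "t \<le> len g" using L gl by (auto simp: t_def algebra_simps)
    obtain h where h: "h \<in> \<Gamma>" "len h + hyp_dist (h *v x) (g *v x) \<le> len g + C1" "\<bar>len h - t\<bar> \<le> C1"
      using C1(2)[OF gG t] by blast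
    have hs: "h \<in> lshell L j" using h L by (auto simp: len_shell_def t_def algebra_simps)
    define k where "k = ginv h ** g"
    have k: "k \<in> \<Gamma>" unfolding k_def by (intro mult_in ginv_in h gG)
    have hk: "g = h ** k" by (simp add: k_def matrix_mul_assoc ginv_mult h)
    have lk: "len k = hyp_dist (h *v x) (g *v x)" unfolding k_def by (rule dist_orbit[OF h(1), symmetric])
    have "len g - len h \<le> len k"
      using hyp_dist_triangle[OF x orbit_hyp[OF h(1)] orbit_hyp[OF gG]] unfolding lk by (simp add: len_def)
    moreover have "len h < (real j + 1) * L" "real j * L \<le> len h" using hs by (auto simp: len_shell_def)
    ultimately have A: "(real i - real j - 1) * L < len k" "len k < (real i - real j + 2) * L"
      using h(2) gl L lk by (auto simp: algebra_simps)
    define n where "n = i - j - 1"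
    have "real i - real j - 1 = real n" "real i - real j + 2 = real n + 3" using ij by (simp_all add: n_def of_nat_diff)
    then have nk: "real n * L < len k" "len k < (real n + 3) * L" using A by (simp_all only:)
    have ni: "i - j = n + 1" "i - j - 1 = n" using ij by (auto simp: n_def)
    have kin: "k \<in> lshell L (i - j - 1) \<union> lshell L (i - j) \<union> lshell L (i - j + 1)"
      unfolding ni using nk k by (auto simp: len_shell_def algebra_simps)
    have "\<bar>pint (pot s) x (g *v x) - pint (pot s) x (h *v x) - pint (pot s) (h *v x) (g *v x)\<bar> \<le> C2"
      using h(2) by (intro C2 x h orbit_hyp gG) (simp add: len_def)
    moreover have "pint (pot s) (h *v x) (g *v x) = pint (pot s) x (k *v x)"
      using pint_pot_invariant[OF h(1), of s x "k *v x"] by (simp add: hk matrix_vector_mul_assoc)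
    ultimately have "wt s g \<le> exp C2 * (wt s h * wt s k)" unfolding wt_def mult_exp_exp by simp
    then show ?thesis using hs kin hk by blast
  qed
  have "(\<Sum>g\<in>lshell L i. wt s g) \<le> exp C2 * (\<Sum>g\<in>lshell L j. wt s g) *
       ((\<Sum>g\<in>lshell L (i - j - 1). wt s g) + (\<Sum>g\<in>lshell L (i - j). wt s g) + (\<Sum>g\<in>lshell L (i - j + 1). wt s g))"
    if ij: "j + 1 \<le> i" for i j
  proof -
    let ?U = "lshell L (i - j - 1) \<union> lshell L (i - j) \<union> lshell L (i - j + 1)"
    obtain h k where hk: "\<And>g. g \<in> lshell L i \<Longrightarrow> h g \<in> lshell L j \<and> k g \<in> ?U \<and> g = h g ** k g \<and>
      wt s g \<le> exp C2 * (wt s (h g) * wt s (k g))" using split[OF ij] by metis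
    let ?\<iota> = "\<lambda>g. (h g, k g)"
    \<comment> \<open>The pair determines \<open>g\<close> as its product, so the sum over the shell
      is dominated by a full double sum.\<close>
    have inj: "inj_on ?\<iota> (lshell L i)"
    proof (rule inj_onI)
      fix a b assume "a \<in> lshell L i" "b \<in> lshell L i" "(h a, k a) = (h b, k b)"
      then show "a = b" using hk[of a] hk[of b] by (metis prod.inject)
    qed
    have "(\<Sum>g\<in>lshell L i. wt s g) \<le> (\<Sum>g\<in>lshell L i. (\<lambda>(a, b). exp C2 * (wt s a * wt s b)) (?\<iota> g))"
      using hk by (intro sum_mono) auto
    also have "\<dots> = (\<Sum>p\<in>?\<iota> ` lshell L i. (\<lambda>(a, b). exp C2 * (wt s a * wt s b)) p)"
      using sum.reindex[OF inj, of "\<lambda>(a, b). exp C2 * (wt s a * wt s b)"] by (simp add: o_def)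
    also have "\<dots> \<le> (\<Sum>p\<in>lshell L j \<times> ?U. (\<lambda>(a, b). exp C2 * (wt s a * wt s b)) p)"
      using hk wt_pos by (intro sum_mono2) (auto simp: finite_lshell less_imp_le)
    also have "\<dots> = (\<Sum>a\<in>lshell L j. \<Sum>b\<in>?U. exp C2 * (wt s a * wt s b))" by (simp only: sum.cartesian_product)
    also have "\<dots> = exp C2 * (\<Sum>a\<in>lshell L j. wt s a) * (\<Sum>b\<in>?U. wt s b)"
      unfolding mult.assoc sum_product by (simp only: sum_distrib_left)
    also have "\<dots> \<le> exp C2 * (\<Sum>a\<in>lshell L j. wt s a) *
       ((\<Sum>g\<in>lshell L (i - j - 1). wt s g) + (\<Sum>g\<in>lshell L (i - j). wt s g) + (\<Sum>g\<in>lshell L (i - j + 1). wt s g))"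
    proof (intro mult_left_mono)
      have u: "(\<Sum>b\<in>X \<union> Y. wt s b) \<le> (\<Sum>b\<in>X. wt s b) + (\<Sum>b\<in>Y. wt s b)" if "finite X" "finite Y" for X Y
        using sum.union_inter[OF that, of "wt s"] sum_nonneg[of "X \<inter> Y" "wt s"] wt_pos by (simp add: less_imp_le)
      show "(\<Sum>b\<in>?U. wt s b) \<le> (\<Sum>g\<in>lshell L (i - j - 1). wt s g) + (\<Sum>g\<in>lshell L (i - j). wt s g) + (\<Sum>g\<in>lshell L (i - j + 1). wt s g)"
        using u[of "lshell L (i - j - 1) \<union> lshell L (i - j)" "lshell L (i - j + 1)"] u[of "lshell L (i - j - 1)" "lshell L (i - j)"]
        by (simp add: finite_lshell)
      show "0 \<le> exp C2 * (\<Sum>a\<in>lshell L j. wt s a)"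
        by (intro mult_nonneg_nonneg sum_nonneg less_imp_le[OF wt_pos]) simp
    qed
    finally show ?thesis .
  qed
  then show ?thesis using L by (intro exI[of _ L] exI[of _ "exp C2"]) auto
qed

text \<open>On shell \<open>i\<close>, passing from exponent \<open>s\<close> to \<open>r\<close>
  multiplies the weights by the \<open>i\<close>-th power of \<open>exp ((s - r) * L)\<close> up to
  the bounded factor \<open>E\<close>, whichever of the two exponents is larger.\<close>

lemma converges_of_shell_bound:
  assumes L: "0 < L" and S: "\<And>i. (\<Sum>g\<in>lshell L i. wt s g) \<le> K * q ^ i" and q: "0 < q" "q * exp ((s - r) * L) < 1" and K: "0 \<le> K"
  shows "converges r"
proof -
  define \<rho> where "\<rho> = q * exp ((s - r) * L)"
  have \<rho>: "0 < \<rho>" "\<rho> < 1" using q by (auto simp: \<rho>_def)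
  define E where "E = exp (\<bar>s - r\<bar> * L)"
  have sh: "(\<Sum>g\<in>lshell L i. wt r g) \<le> E * K * \<rho> ^ i" for i
  proof -
    have "(\<Sum>g\<in>lshell L i. wt r g) \<le> (\<Sum>g\<in>lshell L i. E * exp ((s - r) * L) ^ i * wt s g)"
    proof (rule sum_mono)
      fix g assume g: "g \<in> lshell L i"
      then have "\<bar>len g - real i * L\<bar> \<le> L" by (auto simp: len_shell_def algebra_simps)
      then have "\<bar>s - r\<bar> * \<bar>len g - real i * L\<bar> \<le> \<bar>s - r\<bar> * L" by (intro mult_left_mono) auto
      then have "\<bar>(s - r) * (len g - real i * L)\<bar> \<le> \<bar>s - r\<bar> * L" by (simp add: abs_mult)
      then have "(s - r) * len g \<le> \<bar>s - r\<bar> * L + real i * ((s - r) * L)" by (simp add: algebra_simps)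
      then have "exp ((s - r) * len g) \<le> E * exp ((s - r) * L) ^ i"
        unfolding E_def exp_of_nat_mult[symmetric] mult_exp_exp by simp
      then show "wt r g \<le> E * exp ((s - r) * L) ^ i * wt s g"
        using wt_shift[of g r s] g wt_pos[of s g] by (simp add: len_shell_def)
    qed
    also have "\<dots> = E * exp ((s - r) * L) ^ i * (\<Sum>g\<in>lshell L i. wt s g)" by (simp only: sum_distrib_left)
    also have "\<dots> \<le> E * exp ((s - r) * L) ^ i * (K * q ^ i)" using S by (intro mult_left_mono) (auto simp: E_def)
    also have "\<dots> = E * K * \<rho> ^ i" by (simp add: \<rho>_def power_mult_distrib)
    finally show ?thesis .
  qed
  show ?thesis unfolding converges_def
  proof (intro exI[of _ "E * K * (1 / (1 - \<rho>))"] allI impI)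
    fix A assume A: "finite A \<and> A \<subseteq> \<Gamma>"
    define m where "m = Max (insert 0 ((\<lambda>g. nat \<lfloor>len g / L\<rfloor>) ` A))"
    have "A \<subseteq> (\<Union>n\<le>m. lshell L n)"
    proof
      fix g assume g: "g \<in> A"
      define n where "n = nat \<lfloor>len g / L\<rfloor>"
      have "g \<in> lshell L n" unfolding n_def using len_nonneg g A by (intro len_shell_index[OF L]) auto
      moreover have "n \<le> m" unfolding m_def n_def using A g by (intro Max_ge) auto
      ultimately show "g \<in> (\<Union>n\<le>m. lshell L n)" by blast
    qed
    then have "(\<Sum>g\<in>A. wt r g) \<le> (\<Sum>g\<in>(\<Union>n\<le>m. lshell L n). wt r g)"
      using wt_pos by (intro sum_mono2) (auto simp: finite_lshell less_imp_le)
    also have "\<dots> \<le> (\<Sum>n\<le>m. \<Sum>g\<in>lshell L n. wt r g)"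
      by (rule sum_UNION_le) (auto simp: finite_lshell less_imp_le[OF wt_pos])
    also have "\<dots> \<le> (\<Sum>n\<le>m. E * K * \<rho> ^ n)" by (intro sum_mono sh)
    also have "\<dots> = E * K * (\<Sum>n\<le>m. \<rho> ^ n)" by (simp only: sum_distrib_left)
    also have "\<dots> \<le> E * K * (1 / (1 - \<rho>))"
    proof (intro mult_left_mono)
      have "(\<Sum>n\<le>m. \<rho> ^ n) \<le> (\<Sum>n. \<rho> ^ n)" using \<rho> by (intro sum_le_suminf) (auto intro: summable_geometric)
      then show "(\<Sum>n\<le>m. \<rho> ^ n) \<le> 1 / (1 - \<rho>)" using \<rho> by (simp add: suminf_geometric)
    qed (use K in \<open>auto simp: E_def\<close>)
    finally show "(\<Sum>g\<in>A. wt r g) \<le> E * K * (1 / (1 - \<rho>))" .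
  qed
qed

text \<open>Finiteness comes from submultiplicativity instead of a volume count: with the fixed
  shell 2 it bounds the shell sums at exponent 0 exponentially, and a large enough exponent beats
  that.\<close>

lemma critical_exponent_finite: "critical_exponent \<Gamma> F < \<infinity>"
proof -
  obtain L C where L: "0 < L" "0 \<le> C" and rec: "\<And>j i. j + 1 \<le> i \<Longrightarrow>
     (\<Sum>g\<in>lshell L i. wt 0 g) \<le> C * (\<Sum>g\<in>lshell L j. wt 0 g) *
       ((\<Sum>g\<in>lshell L (i - j - 1). wt 0 g) + (\<Sum>g\<in>lshell L (i - j). wt 0 g) + (\<Sum>g\<in>lshell L (i - j + 1). wt 0 g))"
    using shell_submultiplicative[of 0] by blast
  define \<theta> where "\<theta> = C * (\<Sum>g\<in>lshell L 2. wt 0 g)"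
  define q where "q = max 1 (3 * \<theta>)"
  have nn: "0 \<le> (\<Sum>g\<in>lshell L j. wt 0 g)" for j using wt_pos by (intro sum_nonneg less_imp_le)
  have \<theta>: "0 \<le> \<theta>" using L nn by (simp add: \<theta>_def)
  have q1: "1 \<le> q" by (simp add: q_def)
  have qn: "3 * \<theta> \<le> q ^ n" if "1 \<le> n" for n
  proof -
    have "q ^ 1 \<le> q ^ n" by (rule power_increasing[OF that q1])
    then show ?thesis by (simp add: q_def)
  qed
  obtain K where K: "K \<ge> 0" "\<And>i. (\<Sum>g\<in>lshell L i. wt 0 g) \<le> K * q ^ i"
  proof -
    have "\<exists>K\<ge>0. \<forall>i. (\<Sum>g\<in>lshell L i. wt 0 g) \<le> K * q ^ i"
    proof (rule recurrence_growth[where \<theta> = \<theta> and j = 2])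
      show "(\<Sum>g\<in>lshell L i. wt 0 g) \<le> \<theta> * ((\<Sum>g\<in>lshell L (i - 2 - 1). wt 0 g) + (\<Sum>g\<in>lshell L (i - 2). wt 0 g) + (\<Sum>g\<in>lshell L (i - 2 + 1). wt 0 g))"
        if "2 + 1 \<le> i" for i unfolding \<theta>_def using rec[OF that] .
      show "3 * \<theta> \<le> q ^ (2 + 1)" "3 * \<theta> \<le> q ^ 2" "3 * \<theta> \<le> q ^ (2 - 1)" by (intro qn; simp)+
    qed (use nn \<theta> q1 in auto)
    then show thesis using that by blast
  qed
  define r where "r = (ln q + 1) / L"
  have "converges r"
  proof (rule converges_of_shell_bound[OF L(1) K(2)])
    show "q * exp ((0 - r) * L) < 1"
    proof -
      have "q * exp ((0 - r) * L) = exp (ln q) * exp (- ln q - 1)" using q1 L by (simp add: r_def)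
      also have "\<dots> = exp (- 1)" unfolding mult_exp_exp by simp
      finally show ?thesis by simp
    qed
  qed (use q1 K in auto)
  then have "critical_exponent \<Gamma> F \<le> ereal r" by (rule critical_exponent_le)
  then show ?thesis by (rule order.strict_trans1) simp
qed

text \<open>If the series converged, some shell sum would be so small that submultiplicativity
  forces geometric decay of the shell sums; the series would then converge at a strictly smaller
  exponent, which contradicts that \<delta> is critical.\<close>

lemma diverges_at_critical:
  assumes "critical_exponent \<Gamma> F = ereal \<delta>" shows "\<not> converges \<delta>"
proof
  assume "converges \<delta>"
  then obtain B where B: "\<And>A. finite A \<Longrightarrow> A \<subseteq> \<Gamma> \<Longrightarrow> (\<Sum>g\<in>A. wt \<delta> g) \<le> B" by (auto simp: converges_def)
  obtain L C where L: "0 < L" "0 \<le> C" and rec: "\<And>j i. j + 1 \<le> i \<Longrightarrow>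
     (\<Sum>g\<in>lshell L i. wt \<delta> g) \<le> C * (\<Sum>g\<in>lshell L j. wt \<delta> g) *
       ((\<Sum>g\<in>lshell L (i - j - 1). wt \<delta> g) + (\<Sum>g\<in>lshell L (i - j). wt \<delta> g) + (\<Sum>g\<in>lshell L (i - j + 1). wt \<delta> g))"
    using shell_submultiplicative[of \<delta>] by blast
  let ?S = "\<lambda>j. \<Sum>g\<in>lshell L j. wt \<delta> g"
  have nn: "0 \<le> ?S j" for j using wt_pos by (intro sum_nonneg less_imp_le)
  have part: "(\<Sum>j<n. ?S j) \<le> B" for n
  proof -
    have "(\<Sum>j<n. ?S j) = (\<Sum>g\<in>(\<Union>j<n. lshell L j). wt \<delta> g)"
    proof (rule sum.UNION_disjoint[symmetric])
      show "\<forall>i\<in>{..<n}. \<forall>j\<in>{..<n}. i \<noteq> j \<longrightarrow> lshell L i \<inter> lshell L j = {}"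
        by (intro ballI impI len_shell_disjoint[OF L(1)])
    qed (auto simp: finite_lshell)
    also have "\<dots> \<le> B"
    proof (rule B)
      show "(\<Union>j<n. lshell L j) \<subseteq> \<Gamma>" by (auto simp: len_shell_def)
    qed (simp add: finite_lshell)
    finally show ?thesis .
  qed
  have "summable ?S" by (rule summableI_nonneg_bounded[OF nn part])
  then have "?S \<longlonglongrightarrow> 0" by (rule summable_LIMSEQ_zero)
  then have "(\<lambda>j. 3 * (C * ?S j)) \<longlonglongrightarrow> 3 * (C * 0)" by (intro tendsto_intros)
  then have "\<forall>\<^sub>F j in sequentially. 3 * (C * ?S j) < 1 / 2" by (rule order_tendstoD) simp
  then have "\<forall>\<^sub>F j in sequentially. 3 * (C * ?S j) < 1 / 2 \<and> 2 \<le> j"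
    using eventually_ge_at_top[of 2] by eventually_elim auto
  then obtain j where j: "3 * (C * ?S j) < 1 / 2" "2 \<le> j"
    by (metis (mono_tags, lifting) eventually_happens trivial_limit_sequentially)
  \<comment> \<open>Below 1, so lower powers are larger and the bound by the power
    \<open>j + 1\<close> implies those by \<open>j\<close> and \<open>j - 1\<close>.\<close>
  define q where "q = root (j + 1) (1 / 2)"
  have q: "0 < q" "q < 1" by (auto simp: q_def real_root_gt_zero real_root_lt_1_iff)
  have q2: "q ^ (j + 1) = 1 / 2" unfolding q_def by (rule real_root_pow_pos2) auto
  have qn: "3 * (C * ?S j) \<le> q ^ n" if "n \<le> j + 1" for n
    using power_decreasing[OF that, of q] q q2 j by linarith
  obtain K where K: "K \<ge> 0" "\<And>i. ?S i \<le> K * q ^ i"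
  proof -
    have "\<exists>K\<ge>0. \<forall>i. ?S i \<le> K * q ^ i"
    proof (rule recurrence_growth[where \<theta> = "C * ?S j" and j = j])
      show "?S i \<le> C * ?S j * (?S (i - j - 1) + ?S (i - j) + ?S (i - j + 1))" if "j + 1 \<le> i" for i using rec[OF that] .
      show "3 * (C * ?S j) \<le> q ^ (j + 1)" "3 * (C * ?S j) \<le> q ^ j" "3 * (C * ?S j) \<le> q ^ (j - 1)" by (intro qn; simp)+
    qed (use nn q(1) L(2) j(2) in auto)
    then show thesis using that by blast
  qed
  \<comment> \<open>Half of the decay rate is given away; the remaining ratio per shell is the
    square root of \<open>q\<close>.\<close>
  define \<kappa> where "\<kappa> = - ln q / (2 * L)"
  have \<kappa>: "0 < \<kappa>" unfolding \<kappa>_def using q L by (intro divide_pos_pos) auto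
  have "converges (\<delta> - \<kappa>)"
  proof (rule converges_of_shell_bound[OF L(1) K(2)])
    show "q * exp ((\<delta> - (\<delta> - \<kappa>)) * L) < 1"
    proof -
      have "q * exp ((\<delta> - (\<delta> - \<kappa>)) * L) = exp (ln q) * exp (- ln q / 2)" using q L by (simp add: \<kappa>_def)
      also have "\<dots> = exp (ln q / 2)" unfolding mult_exp_exp by simp
      also have "\<dots> < 1" using q by simp
      finally show ?thesis .
    qed
  qed (use q K in auto)
  then have "critical_exponent \<Gamma> F \<le> ereal (\<delta> - \<kappa>)" by (rule critical_exponent_le)
  then show False using assms \<kappa> by simp
qed

text \<open>The bound on the potential is known over the hull, so it is integrated along the segment
  from a point \<open>y\<close> of the hull to its translate; the change of base point costs a
  constant.\<close>

lemma pint_upper_bound: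
  assumes sup: "(SUP P\<in>Omega \<Gamma>. ereal (F P)) \<le> ereal c"
  shows "\<exists>C\<ge>0. \<forall>g\<in>\<Gamma>. pint (pot 0) x (g *v x) \<le> c * len g + C"
proof -
  obtain y where y: "y \<in> hyp_hull (limit_set \<Gamma>)"
    using hyp_hull_nonempty[OF _ _ _ limit_set_ideal] two_limit_points by blast
  then have yH: "y \<in> hyp_space" using hyp_hull_subset by blast
  obtain K \<alpha> B where "hyp_potential (pot 0) K \<alpha> orb B" using pot_potential by blast
  then interpret hyp_potential "pot 0" K \<alpha> orb B .
  obtain C where C: "C \<ge> 0" "\<And>g. g \<in> \<Gamma> \<Longrightarrow> \<bar>pint (pot 0) y (g *v y) - pint (pot 0) x (g *v x)\<bar> \<le> C"
    using pint_base_change[OF yH] by blast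
  define E where "E = hyp_dist x y"
  have E: "0 \<le> E" using x yH by (simp add: E_def)
  show ?thesis
  proof (intro exI[of _ "C + \<bar>c\<bar> * (2 * E)"] conjI ballI)
    show "0 \<le> C + \<bar>c\<bar> * (2 * E)" using C E by simp
    fix g assume g: "g \<in> \<Gamma>"
    note gy = act_hyp[OF g yH]
    define l where "l = hyp_dist y (g *v y)"
    have l: "0 \<le> l" using yH gy by (simp add: l_def)
    have "pint (pot 0) y (g *v y) \<le> c * l"
    proof (cases "0 < l")
      case False
      then have "l = 0" using l by simp
      then show ?thesis by (simp add: pint_def l_def)
    next
      case True
      define v where "v = geo_dir y (g *v y)"
      have v: "(y, v) \<in> hyp_unit_tangent" "g *v y = geo_point y v l"
        using geo_dir_props[OF yH gy] True by (auto simp: l_def v_def)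
      have "integral {0..l} (\<lambda>s. pot 0 (geo_flow s (y, v))) \<le> integral {0..l} (\<lambda>s. c)"
      proof (rule integral_le)
        fix s assume s: "s \<in> {0..l}"
        define P where "P = tangent_orbit \<Gamma> (geo_flow s (y, v))"
        have p: "geo_point y v s \<in> hyp_hull (limit_set \<Gamma>)" unfolding v_def
          using geo_point_in_hyp_hull[OF y hull_invariant[OF g y], of s] s True by (simp add: l_def)
        have "P \<in> quot_unit_tangent \<Gamma>" unfolding P_def quot_unit_tangent_def geo_flow_eq
          by (intro imageI geo_flow_in_tangent v)
        moreover have "fst ` P = point_orbit \<Gamma> (geo_point y v s)"
          unfolding P_def tangent_orbit_def point_orbit_def geo_flow_eq by (auto simp: image_image)
        ultimately have "P \<in> Omega \<Gamma>" unfolding Omega_def using p by auto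
        then have "ereal (F P) \<le> ereal c" using sup by (meson SUP_upper order_trans)
        then show "pot 0 (geo_flow s (y, v)) \<le> c" by (simp add: pot_def lift_potential_def P_def)
      qed (auto intro: integrable_flow[OF v(1)])
      then show ?thesis unfolding v(2) pint_geo_point[OF v(1) l] using l by (simp add: mult.commute)
    qed
    moreover have "c * l \<le> c * len g + \<bar>c\<bar> * (2 * E)"
    proof -
      have "hyp_dist (g *v x) (g *v y) = E" by (simp add: isom_dist[OF carrier[OF g]] E_def)
      then have "\<bar>l - len g\<bar> \<le> 2 * E"
        using hyp_dist_triangle[OF yH x gy] hyp_dist_triangle[OF x orbit_hyp[OF g] gy]
          hyp_dist_triangle[OF x yH orbit_hyp[OF g]] hyp_dist_triangle[OF yH gy orbit_hyp[OF g]]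
        by (simp add: len_def E_def l_def hyp_dist_commute)
      then have "\<bar>c\<bar> * \<bar>l - len g\<bar> \<le> \<bar>c\<bar> * (2 * E)" by (intro mult_left_mono) auto
      then have "\<bar>c * (l - len g)\<bar> \<le> \<bar>c\<bar> * (2 * E)" by (simp add: abs_mult)
      then show ?thesis by (simp add: right_diff_distrib)
    qed
    ultimately show "pint (pot 0) x (g *v x) \<le> c * len g + (C + \<bar>c\<bar> * (2 * E))" using C(2)[OF g] by linarith
  qed
qed

end

section \<open>The Gibbs cocycle\<close>

lemma one_plus_le_exp:
  fixes a t :: real
  assumes "0 < a" "0 \<le> t"
  shows "1 + t \<le> (1 + 1 / a) * exp (a * t)"
proof -
  have "a * t \<le> exp (a * t)" using exp_ge_add_one_self[of "a * t"] by linarith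
  then have "t \<le> 1 / a * exp (a * t)" using assms by (simp add: field_simps)
  moreover have "1 \<le> exp (a * t)" using assms by (simp only: one_le_exp_iff) simp
  ultimately show ?thesis unfolding distrib_right by linarith
qed

context gibbs_setting
begin

definition cdiff :: "real \<Rightarrow> 'n mink \<Rightarrow> 'n mink \<Rightarrow> real" where
  "cdiff s y z = pint (pot s) y z - pint (pot s) x z"

text \<open>Arbitrary families converging to \<xi> are allowed, so that one limit serves every ray
  in the definition of the Gibbs cocycle. Along the ray from \<open>x\<close> the differences are
  Cauchy: a ray to an arbitrary ideal point may move away from the orbit, so the error has a factor
  \<open>1 + t\<close>, but the exponential contraction outweighs it.\<close>

lemma cocycle_limit_exists:
  assumes y: "y \<in> hyp_space" and \<xi>: "\<xi> \<in> ideal_boundary"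
  shows "\<exists>L. \<forall>f::real \<Rightarrow> 'n mink. (\<forall>r. f r \<in> hyp_space) \<longrightarrow> ((\<lambda>r. klein (f r)) \<longlongrightarrow> \<xi>) at_top \<longrightarrow>
    ((\<lambda>r. cdiff s y (f r)) \<longlongrightarrow> L) at_top"
proof -
  obtain K \<alpha> B where "hyp_potential (pot s) K \<alpha> orb B" using pot_potential by blast
  then interpret hyp_potential "pot s" K \<alpha> orb B .
  obtain C where C: "C \<ge> 0" "\<And>x y v w b m t r r'. (x, v) \<in> hyp_unit_tangent \<Longrightarrow> (x, w) \<in> hyp_unit_tangent \<Longrightarrow> y \<in> hyp_space \<Longrightarrow> b \<in> orb \<Longrightarrow>
      hyp_dist x y \<le> m \<Longrightarrow> m \<le> t \<Longrightarrow> t \<le> r \<Longrightarrow> t \<le> r' \<Longrightarrow> 2 * (sinh t * sqrt (half_sin_sq v w)) \<le> 1 \<Longrightarrow>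
    \<bar>(pint (pot s) y (geo_point x v r) - pint (pot s) x (geo_point x v r)) -
     (pint (pot s) y (geo_point x w r') - pint (pot s) x (geo_point x w r'))\<bar> \<le>
     C * (1 + hyp_dist b (geo_point x v t)) * (exp (\<alpha> * (m - t)) + (sinh t * sqrt (half_sin_sq v w)) powr \<alpha>)"
    using cocycle_holder by blast
  define m where "m = hyp_dist x y"
  have m: "0 \<le> m" using x y by (simp add: m_def)
  define v where "v = ray_dir x \<xi>"
  have v: "(x, v) \<in> hyp_unit_tangent" unfolding v_def by (rule ray_dir_tangent[OF x \<xi>])
  define E where "E t = C * (1 + t) * exp (\<alpha> * (m - t))" for t
  have bnd: "\<bar>cdiff s y (geo_point x v r) - cdiff s y (geo_point x w r')\<bar> \<le> E t + C * (1 + t) * (sinh t * sqrt (half_sin_sq v w)) powr \<alpha>"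
    if "(x, w) \<in> hyp_unit_tangent" "m \<le> t" "t \<le> r" "t \<le> r'" "2 * (sinh t * sqrt (half_sin_sq v w)) \<le> 1" for w t r r'
    using C(2)[OF v that(1) y x_orb, of m t r r'] that m hyp_dist_geo_point_0[OF v, of t]
    by (simp add: cdiff_def m_def E_def distrib_left)
  have E0: "(E \<longlongrightarrow> 0) at_top"
  proof (rule Lim_null_comparison)
    define D where "D = C * (1 + 1 / (\<alpha> / 2)) * exp (\<alpha> * m)"
    show "\<forall>\<^sub>F t in at_top. norm (E t) \<le> D * exp (- (\<alpha> / 2 * t))"
      using eventually_ge_at_top[of 0]
    proof eventually_elim
      case (elim t)
      have "E t \<le> C * ((1 + 1 / (\<alpha> / 2)) * exp (\<alpha> / 2 * t)) * exp (\<alpha> * (m - t))"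
        unfolding E_def using one_plus_le_exp[of "\<alpha> / 2" t] alpha elim C(1) by (intro mult_right_mono mult_left_mono) auto
      also have "\<dots> = C * (1 + 1 / (\<alpha> / 2)) * (exp (\<alpha> / 2 * t) * exp (\<alpha> * (m - t)))" by (simp only: mult_ac)
      also have "exp (\<alpha> / 2 * t) * exp (\<alpha> * (m - t)) = exp (\<alpha> * m) * exp (- (\<alpha> / 2 * t))"
        unfolding mult_exp_exp by (simp add: algebra_simps)
      finally have "E t \<le> D * exp (- (\<alpha> / 2 * t))" by (simp add: D_def mult.assoc)
      moreover have "0 \<le> E t" unfolding E_def using C(1) elim by simp
      ultimately show ?case by simp
    qed
    have "filterlim (\<lambda>t. \<alpha> / 2 * t) at_top at_top"
      using alpha by (intro filterlim_tendsto_pos_mult_at_top[OF tendsto_const _ filterlim_ident]) auto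
    then have "((\<lambda>t. exp (- (\<alpha> / 2 * t))) \<longlongrightarrow> 0) at_top"
      by (intro filterlim_compose[OF exp_at_bot] filterlim_compose[OF filterlim_uminus_at_bot_at_top])
    then show "((\<lambda>t. D * exp (- (\<alpha> / 2 * t))) \<longlongrightarrow> 0) at_top" by (rule tendsto_mult_right_zero)
  qed
  have tail: "\<bar>cdiff s y (geo_point x v r) - cdiff s y (geo_point x v r')\<bar> \<le> E t" if "m \<le> t" "t \<le> r" "t \<le> r'" for t r r'
    using bnd[OF v that] half_sin_sq_self[OF v] by simp
  define a where "a n = cdiff s y (geo_point x v (real n))" for n
  have "Cauchy a"
  proof (rule metric_CauchyI)
    fix e :: real assume "0 < e"
    then have "\<forall>\<^sub>F t in at_top. E t < e" using order_tendstoD(2)[OF E0] by blast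
    then have "\<forall>\<^sub>F t in at_top. E t < e \<and> m \<le> t" using eventually_ge_at_top[of m] by eventually_elim auto
    then obtain t where t: "E t < e" "m \<le> t"
      by (metis (mono_tags, lifting) eventually_happens trivial_limit_at_top_linorder)
    show "\<exists>M. \<forall>i\<ge>M. \<forall>j\<ge>M. dist (a i) (a j) < e"
    proof (intro exI[of _ "nat \<lceil>t\<rceil>"] allI impI)
      fix i j assume "i \<ge> nat \<lceil>t\<rceil>" "j \<ge> nat \<lceil>t\<rceil>"
      then have "t \<le> real i" "t \<le> real j" by linarith+
      then show "dist (a i) (a j) < e" using tail[OF t(2), of "real i" "real j"] t(1) by (simp add: a_def dist_real_def)
    qed
  qed
  then obtain L where L: "a \<longlonglongrightarrow> L" using Cauchy_convergent_iff[of a] by (auto simp: convergent_def)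
  have Lt: "\<bar>cdiff s y (geo_point x v t) - L\<bar> \<le> E t" if t: "m \<le> t" for t
  proof (rule tendsto_upperbound)
    show "(\<lambda>n. \<bar>cdiff s y (geo_point x v t) - a n\<bar>) \<longlonglongrightarrow> \<bar>cdiff s y (geo_point x v t) - L\<bar>"
      by (intro tendsto_intros L)
    show "\<forall>\<^sub>F n in sequentially. \<bar>cdiff s y (geo_point x v t) - a n\<bar> \<le> E t"
    proof -
      have "\<forall>\<^sub>F n in sequentially. t \<le> real n" using filterlim_real_sequentially unfolding filterlim_at_top by blast
      then show ?thesis by eventually_elim (auto simp: a_def intro: tail[OF t])
    qed
  qed simp
  show ?thesis
  proof (intro exI[of _ L] allI impI)
    fix f :: "real \<Rightarrow> 'n mink" assume f: "\<forall>r. f r \<in> hyp_space" and lim: "((\<lambda>r. klein (f r)) \<longlongrightarrow> \<xi>) at_top"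
    note k = klein_tendstoD[OF x \<xi> always_eventually[OF f] lim]
    show "((\<lambda>r. cdiff s y (f r)) \<longlongrightarrow> L) at_top"
    proof (rule tendstoI)
      \<comment> \<open>The order of choices matters: \<open>t\<close> is fixed to make the tail
        error small, and only afterwards does \<open>r\<close> become so large that the direction of
        \<open>f r\<close> is indistinguishable from that of \<xi> at time \<open>t\<close>.\<close>
      fix e :: real assume e: "0 < e"
      have "\<forall>\<^sub>F t in at_top. E t < e / 4" using order_tendstoD(2)[OF E0, of "e / 4"] e by simp
      then have "\<forall>\<^sub>F t in at_top. E t < e / 4 \<and> max m 1 \<le> t" using eventually_ge_at_top[of "max m 1"] by eventually_elim auto
      then obtain t where t: "E t < e / 4" "max m 1 \<le> t"
        by (metis (mono_tags, lifting) eventually_happens trivial_limit_at_top_linorder)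
      let ?h = "\<lambda>r. half_sin_sq (ray_dir x \<xi>) (geo_dir x (f r))"
      have l1: "((\<lambda>r. sinh t * sqrt (?h r)) \<longlongrightarrow> sinh t * sqrt 0) at_top" by (intro tendsto_intros k(2))
      then have l2: "((\<lambda>r. sinh t * sqrt (?h r)) \<longlongrightarrow> 0) at_top" by simp
      have "\<forall>\<^sub>F r in at_top. 0 < hyp_dist x (f r)" using k(1) unfolding filterlim_at_top_dense by blast
      then have nn: "\<forall>\<^sub>F r in at_top. 0 \<le> sinh t * sqrt (?h r)"
      proof eventually_elim
        case (elim r)
        then show ?case using half_sin_sq_nonneg[OF ray_dir_tangent[OF x \<xi>] geo_dir_props(1)[OF x f[rule_format] elim]] t by simp
      qed
      have "((\<lambda>r. (sinh t * sqrt (?h r)) powr \<alpha>) \<longlongrightarrow> 0) at_top"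
        using alpha nn by (intro tendsto_zero_powrI[OF l2 tendsto_const]) auto
      then have "((\<lambda>r. C * (1 + t) * (sinh t * sqrt (?h r)) powr \<alpha>) \<longlongrightarrow> 0) at_top" by (rule tendsto_mult_right_zero)
      then have e1: "\<forall>\<^sub>F r in at_top. C * (1 + t) * (sinh t * sqrt (?h r)) powr \<alpha> < e / 4"
        using order_tendstoD(2)[of _ 0 at_top "e / 4"] e by fastforce
      have e2: "\<forall>\<^sub>F r in at_top. sinh t * sqrt (?h r) < 1 / 2" using order_tendstoD(2)[OF l2, of "1 / 2"] by simp
      have e3: "\<forall>\<^sub>F r in at_top. t < hyp_dist x (f r)" using k(1) unfolding filterlim_at_top_dense by blast
      show "\<forall>\<^sub>F r in at_top. dist (cdiff s y (f r)) L < e"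
        using e1 e2 e3
      proof eventually_elim
        case (elim r)
        have p: "0 < hyp_dist x (f r)" using elim(3) t by linarith
        note w = geo_dir_props[OF x f[rule_format] p]
        have "\<bar>cdiff s y (geo_point x v t) - cdiff s y (geo_point x (geo_dir x (f r)) (hyp_dist x (f r)))\<bar>
            \<le> E t + C * (1 + t) * (sinh t * sqrt (half_sin_sq v (geo_dir x (f r)))) powr \<alpha>"
          using elim t by (intro bnd w) (auto simp: v_def)
        then have "\<bar>cdiff s y (geo_point x v t) - cdiff s y (f r)\<bar> < e / 4 + e / 4"
          using elim(1) t(1) w(2) by (simp add: v_def)
        moreover have "\<bar>cdiff s y (geo_point x v t) - L\<bar> < e / 4" using Lt[of t] t by auto
        ultimately show ?case using e unfolding dist_real_def by linarith
      qed
    qed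
  qed
qed

text \<open>The logarithm of the density of the measure at \<open>y\<close> with respect to the one at \<open>x\<close>.\<close>

definition lcoc :: "real \<Rightarrow> 'n mink \<Rightarrow> 'n mink \<Rightarrow> real" where
  "lcoc s y \<xi> = - gibbs_cocycle \<Gamma> (\<lambda>P. F P - s) \<xi> y x"

lemma lcoc_tendsto:
  assumes y: "y \<in> hyp_space" and \<xi>: "\<xi> \<in> ideal_boundary"
    and f: "\<And>r. f r \<in> hyp_space" "((\<lambda>r::real. klein (f r)) \<longlongrightarrow> \<xi>) at_top"
  shows "((\<lambda>r. cdiff s y (f r)) \<longlongrightarrow> lcoc s y \<xi>) at_top"
proof -
  obtain L where L: "\<And>f::real \<Rightarrow> 'n mink. (\<forall>r. f r \<in> hyp_space) \<Longrightarrow> ((\<lambda>r. klein (f r)) \<longlongrightarrow> \<xi>) at_top \<Longrightarrow>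
    ((\<lambda>r. cdiff s y (f r)) \<longlongrightarrow> L) at_top" using cocycle_limit_exists[OF y \<xi>] by blast
  have pi: "path_integral \<Gamma> (\<lambda>P. F P - s) a z = pint (pot s) a z" for a z
    by (simp add: path_integral_def pint_def pot_def lift_potential_def)
  have "gibbs_cocycle \<Gamma> (\<lambda>P. F P - s) \<xi> y x = - L"
    unfolding gibbs_cocycle_def pi
  proof (rule the_equality)
    have lim: "((\<lambda>t. pint (pot s) x (fst (geo_flow t u)) - pint (pot s) y (fst (geo_flow t u))) \<longlongrightarrow> - L) at_top"
      if u: "u \<in> hyp_unit_tangent" "ray_tendsto u \<xi>" for u
    proof -
      have "((\<lambda>t. - cdiff s y (fst (geo_flow t u))) \<longlongrightarrow> - L) at_top"
        using u geo_point_in_hyp_space[of "fst u" "snd u"]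
        by (intro tendsto_minus L) (auto simp: ray_tendsto_def geo_flow_eq[of _ "fst u" "snd u", simplified])
      then show ?thesis by (simp add: cdiff_def)
    qed
    then show "\<forall>u\<in>hyp_unit_tangent. ray_tendsto u \<xi> \<longrightarrow>
        ((\<lambda>t. pint (pot s) x (fst (geo_flow t u)) - pint (pot s) y (fst (geo_flow t u))) \<longlongrightarrow> - L) at_top" by blast
    fix L' assume L': "\<forall>u\<in>hyp_unit_tangent. ray_tendsto u \<xi> \<longrightarrow>
        ((\<lambda>t. pint (pot s) x (fst (geo_flow t u)) - pint (pot s) y (fst (geo_flow t u))) \<longlongrightarrow> L') at_top"
    note u = ray_dir_tangent[OF x \<xi>] ray_tendsto_ray_dir[OF x \<xi>]
    have "\<not> trivial_limit (at_top :: real filter)" by simp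
    from tendsto_unique[OF this L'[rule_format, OF u] lim[OF u]] show "L' = - L" .
  qed
  then show ?thesis using L f by (simp add: lcoc_def)
qed

lemma lcoc_tendsto_ray:
  assumes y: "y \<in> hyp_space" and \<xi>: "\<xi> \<in> ideal_boundary"
  shows "((\<lambda>r. cdiff s y (geo_point x (ray_dir x \<xi>) r)) \<longlongrightarrow> lcoc s y \<xi>) at_top"
  using lcoc_tendsto[OF y \<xi>, of "\<lambda>r. geo_point x (ray_dir x \<xi>) r"] geo_point_in_hyp_space[OF ray_dir_tangent[OF x \<xi>]]
    ray_tendsto_ray_dir[OF x \<xi>] by (simp add: ray_tendsto_def geo_flow_eq)

text \<open>For limit points the rays stay near the orbit, so the distance factor is bounded. The
  two errors, from the merging of the geodesics issuing from \<open>x\<close> and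
  \<open>g *v x\<close> and from the separation of the two rays, are balanced by comparing halfway
  between the time \<open>m\<close> and the separation time \<open>T\<close>; this halves the
  Hoelder exponent.\<close>

lemma lcoc_holder:
  "\<exists>A \<beta>. 0 \<le> A \<and> 0 < \<beta> \<and> (\<forall>\<xi>\<in>limit_set \<Gamma>. \<forall>\<eta>\<in>limit_set \<Gamma>. \<forall>g\<in>\<Gamma>. \<forall>m. len g \<le> m \<and>
     sqrt (half_sin_sq (ray_dir x \<xi>) (ray_dir x \<eta>)) \<le> exp (- m) \<longrightarrow>
     \<bar>lcoc s (g *v x) \<xi> - lcoc s (g *v x) \<eta>\<bar> \<le> A * (exp m * sqrt (half_sin_sq (ray_dir x \<xi>) (ray_dir x \<eta>))) powr \<beta>)"
proof -
  obtain K \<alpha> B where "hyp_potential (pot s) K \<alpha> orb B" using pot_potential by blast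
  then interpret hyp_potential "pot s" K \<alpha> orb B .
  obtain C where C: "C \<ge> 0" "\<And>x y v w b m t r r'. (x, v) \<in> hyp_unit_tangent \<Longrightarrow> (x, w) \<in> hyp_unit_tangent \<Longrightarrow> y \<in> hyp_space \<Longrightarrow> b \<in> orb \<Longrightarrow>
      hyp_dist x y \<le> m \<Longrightarrow> m \<le> t \<Longrightarrow> t \<le> r \<Longrightarrow> t \<le> r' \<Longrightarrow> 2 * (sinh t * sqrt (half_sin_sq v w)) \<le> 1 \<Longrightarrow>
    \<bar>(pint (pot s) y (geo_point x v r) - pint (pot s) x (geo_point x v r)) -
     (pint (pot s) y (geo_point x w r') - pint (pot s) x (geo_point x w r'))\<bar> \<le>
     C * (1 + hyp_dist b (geo_point x v t)) * (exp (\<alpha> * (m - t)) + (sinh t * sqrt (half_sin_sq v w)) powr \<alpha>)"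
    using cocycle_holder by blast
  obtain D where D: "D \<ge> 0" "\<And>\<xi> t. \<xi> \<in> limit_set \<Gamma> \<Longrightarrow> t \<ge> 0 \<Longrightarrow> \<exists>h\<in>\<Gamma>. hyp_dist (h *v x) (geo_point x (ray_dir x \<xi>) t) \<le> D"
    using orbit_near_ray[OF x] by blast
  show ?thesis
  proof (rule exI[of _ "C * (1 + D) * 2"], rule exI[of _ "\<alpha> / 2"], intro conjI ballI allI impI)
    show "0 \<le> C * (1 + D) * 2" "0 < \<alpha> / 2" using C D alpha by auto
    fix \<xi> \<eta> g m assume \<xi>: "\<xi> \<in> limit_set \<Gamma>" and \<eta>: "\<eta> \<in> limit_set \<Gamma>" and g: "g \<in> \<Gamma>"
      and a: "len g \<le> m \<and> sqrt (half_sin_sq (ray_dir x \<xi>) (ray_dir x \<eta>)) \<le> exp (- m)"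
    have I: "\<xi> \<in> ideal_boundary" "\<eta> \<in> ideal_boundary" using \<xi> \<eta> limit_set_ideal by auto
    define v w where "v = ray_dir x \<xi>" and "w = ray_dir x \<eta>"
    have v: "(x, v) \<in> hyp_unit_tangent" and w: "(x, w) \<in> hyp_unit_tangent"
      using ray_dir_tangent[OF x] I by (auto simp: v_def w_def)
    define d where "d = sqrt (half_sin_sq v w)"
    have d0: "0 \<le> d" unfolding d_def using half_sin_sq_nonneg[OF v w] by simp
    have m: "0 \<le> m" using len_nonneg[OF g] a by linarith
    show "\<bar>lcoc s (g *v x) \<xi> - lcoc s (g *v x) \<eta>\<bar> \<le> C * (1 + D) * 2 * (exp m * sqrt (half_sin_sq (ray_dir x \<xi>) (ray_dir x \<eta>))) powr (\<alpha> / 2)"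
    proof (cases "d = 0")
      case True
      then have "half_sin_sq (ray_dir x \<xi>) (ray_dir x \<eta>) = 0" by (simp add: d_def v_def w_def)
      then have "\<xi> = \<eta>" by (rule ray_dir_inj[OF x I])
      then show ?thesis using C D by simp
    next
      case False
      then have dp: "0 < d" using d0 by simp
      define T where "T = - ln d"
      have dT: "d = exp (- T)" using dp by (simp add: T_def)
      have "exp (- T) \<le> exp (- m)" using a dT by (simp add: d_def v_def w_def)
      then have mT: "m \<le> T" by simp
      define t where "t = (T + m) / 2"
      have t: "m \<le> t" "0 \<le> t" using mT m by (auto simp: t_def)
      have sh: "2 * sinh t \<le> exp t" by (simp add: sinh_field_def)
      have e: "exp t * exp (- T) = exp (- ((T - m) / 2))" unfolding mult_exp_exp by (simp add: t_def field_simps)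
      have shd: "2 * (sinh t * d) \<le> exp (- ((T - m) / 2))"
        using mult_right_mono[OF sh d0] e by (simp add: dT)
      also have "\<dots> \<le> 1" using mT by simp
      finally have le1: "2 * (sinh t * d) \<le> 1" .
      obtain h where h: "h \<in> \<Gamma>" "hyp_dist (h *v x) (geo_point x v t) \<le> D" using D(2)[OF \<xi> t(2)] by (auto simp: v_def)
      have bd: "\<bar>cdiff s (g *v x) (geo_point x v r) - cdiff s (g *v x) (geo_point x w r)\<bar> \<le> C * (1 + D) * 2 * (exp m * d) powr (\<alpha> / 2)"
        if r: "t \<le> r" for r
      proof -
        have "\<bar>cdiff s (g *v x) (geo_point x v r) - cdiff s (g *v x) (geo_point x w r)\<bar>
           \<le> C * (1 + hyp_dist (h *v x) (geo_point x v t)) * (exp (\<alpha> * (m - t)) + (sinh t * d) powr \<alpha>)"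
          unfolding cdiff_def d_def using C(2)[OF v w orbit_hyp[OF g] orbI[OF h(1)], of m t r r] a t r le1 by (simp add: len_def d_def)
        also have "\<dots> \<le> C * (1 + D) * (exp (\<alpha> * (m - t)) + (sinh t * d) powr \<alpha>)"
          using h(2) C(1) by (intro mult_right_mono mult_left_mono add_nonneg_nonneg) auto
        also have "\<dots> \<le> C * (1 + D) * ((exp m * d) powr (\<alpha> / 2) + (exp m * d) powr (\<alpha> / 2))"
        proof (intro mult_left_mono add_mono)
          have *: "(exp m * d) powr (\<alpha> / 2) = exp (\<alpha> * (- ((T - m) / 2)))"
          proof -
            have "exp m * d = exp (m - T)" unfolding dT mult_exp_exp by simp
            then have "(exp m * d) powr (\<alpha> / 2) = exp (\<alpha> / 2 * (m - T))" by (simp only: powr_def) simp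
            also have "\<alpha> / 2 * (m - T) = \<alpha> * (- ((T - m) / 2))" by (simp add: field_simps)
            finally show ?thesis .
          qed
          show "exp (\<alpha> * (m - t)) \<le> (exp m * d) powr (\<alpha> / 2)" unfolding * by (simp add: t_def field_simps)
          have "(sinh t * d) powr \<alpha> \<le> exp (- ((T - m) / 2)) powr \<alpha>"
          proof (intro powr_mono2)
            have "0 \<le> sinh t * d" using t d0 by simp
            then show "sinh t * d \<le> exp (- ((T - m) / 2))" using shd by linarith
          qed (use alpha t d0 in auto)
          also have "\<dots> = (exp m * d) powr (\<alpha> / 2)" unfolding * by (simp only: powr_def) simp
          finally show "(sinh t * d) powr \<alpha> \<le> (exp m * d) powr (\<alpha> / 2)" .
        qed (use C D in auto)
        finally show ?thesis by simp
      qed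
      have "((\<lambda>r. \<bar>cdiff s (g *v x) (geo_point x v r) - cdiff s (g *v x) (geo_point x w r)\<bar>) \<longlongrightarrow>
          \<bar>lcoc s (g *v x) \<xi> - lcoc s (g *v x) \<eta>\<bar>) at_top"
        unfolding v_def w_def by (intro tendsto_intros lcoc_tendsto_ray orbit_hyp g I)
      then have "\<bar>lcoc s (g *v x) \<xi> - lcoc s (g *v x) \<eta>\<bar> \<le> C * (1 + D) * 2 * (exp m * d) powr (\<alpha> / 2)"
        by (rule tendsto_upperbound) (auto intro!: eventually_mono[OF eventually_ge_at_top[of t] bd])
      then show ?thesis by (simp add: d_def v_def w_def)
    qed
  qed
qed

text \<open>If \<open>h *v x\<close> lies almost on the geodesics from \<open>x\<close> and from
  \<open>g *v x\<close> towards \<xi>, the two tails beyond it are the same integral and cancel,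
  leaving a difference of two finite integrals.\<close>

lemma lcoc_coarse:
  fixes C0 :: real
  assumes "0 \<le> C0"
  shows "\<exists>C\<ge>0. \<forall>\<xi>\<in>ideal_boundary. \<forall>g\<in>\<Gamma>. \<forall>h\<in>\<Gamma>. \<forall>r0. (\<forall>r\<ge>r0.
      hyp_dist (g *v x) (h *v x) + hyp_dist (h *v x) (geo_point x (ray_dir x \<xi>) r) \<le> hyp_dist (g *v x) (geo_point x (ray_dir x \<xi>) r) + C0 \<and>
      hyp_dist x (h *v x) + hyp_dist (h *v x) (geo_point x (ray_dir x \<xi>) r) \<le> hyp_dist x (geo_point x (ray_dir x \<xi>) r) + C0) \<longrightarrow>
    \<bar>lcoc s (g *v x) \<xi> - (pint (pot s) (g *v x) (h *v x) - pint (pot s) x (h *v x))\<bar> \<le> C"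
proof -
  obtain C where C: "C \<ge> 0" "\<And>a h z. a \<in> hyp_space \<Longrightarrow> h \<in> \<Gamma> \<Longrightarrow> z \<in> hyp_space \<Longrightarrow>
     hyp_dist a (h *v x) + hyp_dist (h *v x) z \<le> hyp_dist a z + C0 \<Longrightarrow>
     \<bar>pint (pot s) a z - pint (pot s) a (h *v x) - pint (pot s) (h *v x) z\<bar> \<le> C"
    using pint_orbit_almost_geodesic[OF assms] by blast
  show ?thesis
  proof (intro exI[of _ "2 * C"] conjI ballI allI impI)
    show "0 \<le> 2 * C" using C by simp
    fix \<xi> g h r0 assume \<xi>: "\<xi> \<in> ideal_boundary" and g: "g \<in> \<Gamma>" and h: "h \<in> \<Gamma>"
      and a: "\<forall>r\<ge>r0.
      hyp_dist (g *v x) (h *v x) + hyp_dist (h *v x) (geo_point x (ray_dir x \<xi>) r) \<le> hyp_dist (g *v x) (geo_point x (ray_dir x \<xi>) r) + C0 \<and>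
      hyp_dist x (h *v x) + hyp_dist (h *v x) (geo_point x (ray_dir x \<xi>) r) \<le> hyp_dist x (geo_point x (ray_dir x \<xi>) r) + C0"
    note z = geo_point_in_hyp_space[OF ray_dir_tangent[OF x \<xi>]]
    have bd: "\<bar>cdiff s (g *v x) (geo_point x (ray_dir x \<xi>) r) - (pint (pot s) (g *v x) (h *v x) - pint (pot s) x (h *v x))\<bar> \<le> 2 * C"
      if "r0 \<le> r" for r
      using C(2)[OF orbit_hyp[OF g] h z[of r]] C(2)[OF x h z[of r]] a that unfolding cdiff_def by fastforce
    have "((\<lambda>r. \<bar>cdiff s (g *v x) (geo_point x (ray_dir x \<xi>) r) - (pint (pot s) (g *v x) (h *v x) - pint (pot s) x (h *v x))\<bar>) \<longlongrightarrow>
       \<bar>lcoc s (g *v x) \<xi> - (pint (pot s) (g *v x) (h *v x) - pint (pot s) x (h *v x))\<bar>) at_top"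
      by (intro tendsto_intros lcoc_tendsto_ray orbit_hyp g \<xi>)
    then show "\<bar>lcoc s (g *v x) \<xi> - (pint (pot s) (g *v x) (h *v x) - pint (pot s) x (h *v x))\<bar> \<le> 2 * C"
      by (rule tendsto_upperbound) (auto intro!: eventually_mono[OF eventually_ge_at_top[of r0] bd])
  qed
qed

lemma pint_orbit: "h \<in> \<Gamma> \<Longrightarrow> pint (pot s) (h *v x) (g *v x) = pint (pot s) x ((ginv h ** g) *v x)"
  using pint_pot_invariant[of h s x "ginv h *v (g *v x)"] by (simp add: ginv_act flip: matrix_vector_mul_assoc)

lemma ginv_mult_swap: assumes "g \<in> \<Gamma>" "h \<in> \<Gamma>" shows "ginv g ** h = ginv (ginv h ** g)"
proof -
  have "(ginv g ** h) ** (ginv h ** g) = ginv g ** (h ** ginv h) ** g" by (simp only: matrix_mul_assoc)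
  then have 1: "(ginv g ** h) ** (ginv h ** g) = mat 1" by (simp add: ginv_mult assms)
  have k: "ginv h ** g \<in> \<Gamma>" by (intro mult_in ginv_in assms)
  have "ginv g ** h = (ginv g ** h) ** ((ginv h ** g) ** ginv (ginv h ** g))" by (simp add: ginv_mult(2)[OF k])
  also have "\<dots> = ((ginv g ** h) ** (ginv h ** g)) ** ginv (ginv h ** g)" by (simp only: matrix_mul_assoc)
  finally show ?thesis using 1 by simp
qed

text \<open>\<open>hh \<xi> i\<close> moves \<open>x\<close> close to the time \<open>i\<close> point of the ray to \<open>\<xi>\<close>; for suitable \<open>i\<close> this is the
  centre of the tripod formed by \<open>x\<close>, \<open>g x\<close> and \<open>\<xi>\<close>.\<close>

lemma tripod_decomposition:
  "\<exists>C\<ge>0. \<exists>hh. \<forall>\<xi>\<in>limit_set \<Gamma>. (\<forall>i. hh \<xi> i \<in> \<Gamma>) \<and> (\<forall>g\<in>\<Gamma>. \<forall>w. (x, w) \<in> hyp_unit_tangent \<and> g *v x = geo_point x w (len g) \<longrightarrow>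
    (\<exists>i::nat. real i \<le> len g \<and> half_sin_sq (ray_dir x \<xi>) w \<le> exp (- 2 * real i) \<and>
      \<bar>len (ginv (hh \<xi> i) ** g) - (len g - real i)\<bar> \<le> C \<and>
      wt s g * exp (lcoc s (g *v x) \<xi>) \<le> exp C * (wt s (ginv (hh \<xi> i) ** g) * wt s (ginv (ginv (hh \<xi> i) ** g)))))"
proof -
  obtain D where D: "D \<ge> 0" "\<And>\<xi> t. \<xi> \<in> limit_set \<Gamma> \<Longrightarrow> t \<ge> 0 \<Longrightarrow> \<exists>h\<in>\<Gamma>. hyp_dist (h *v x) (geo_point x (ray_dir x \<xi>) t) \<le> D"
    using orbit_near_ray[OF x] by blast
  have "\<forall>\<xi>\<in>limit_set \<Gamma>. \<exists>h. \<forall>i::nat. h i \<in> \<Gamma> \<and> hyp_dist (h i *v x) (geo_point x (ray_dir x \<xi>) (real i)) \<le> D"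
  proof
    fix \<xi> assume \<xi>: "\<xi> \<in> limit_set \<Gamma>"
    have "\<forall>i::nat. \<exists>h. h \<in> \<Gamma> \<and> hyp_dist (h *v x) (geo_point x (ray_dir x \<xi>) (real i)) \<le> D"
      using D(2)[OF \<xi>, of "real _"] by auto
    then show "\<exists>h. \<forall>i::nat. h i \<in> \<Gamma> \<and> hyp_dist (h i *v x) (geo_point x (ray_dir x \<xi>) (real i)) \<le> D"
      by (rule choice)
  qed
  then obtain hh where hh: "\<And>\<xi> i. \<xi> \<in> limit_set \<Gamma> \<Longrightarrow> hh \<xi> i \<in> \<Gamma> \<and> hyp_dist (hh \<xi> i *v x) (geo_point x (ray_dir x \<xi>) (real i)) \<le> D"
    by metis
  define C0 where "C0 = 2 * D + 6"
  have C0: "0 \<le> C0" using D by (simp add: C0_def)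
  obtain C1 where C1: "C1 \<ge> 0" "\<And>a h z. a \<in> hyp_space \<Longrightarrow> h \<in> \<Gamma> \<Longrightarrow> z \<in> hyp_space \<Longrightarrow>
     hyp_dist a (h *v x) + hyp_dist (h *v x) z \<le> hyp_dist a z + C0 \<Longrightarrow>
     \<bar>pint (pot s) a z - pint (pot s) a (h *v x) - pint (pot s) (h *v x) z\<bar> \<le> C1"
    using pint_orbit_almost_geodesic[OF C0] by blast
  obtain C2 where C2: "C2 \<ge> 0" "\<And>\<xi> g h r0. \<xi> \<in> ideal_boundary \<Longrightarrow> g \<in> \<Gamma> \<Longrightarrow> h \<in> \<Gamma> \<Longrightarrow> (\<And>r. r \<ge> r0 \<Longrightarrow>
      hyp_dist (g *v x) (h *v x) + hyp_dist (h *v x) (geo_point x (ray_dir x \<xi>) r) \<le> hyp_dist (g *v x) (geo_point x (ray_dir x \<xi>) r) + C0 \<and>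
      hyp_dist x (h *v x) + hyp_dist (h *v x) (geo_point x (ray_dir x \<xi>) r) \<le> hyp_dist x (geo_point x (ray_dir x \<xi>) r) + C0) \<Longrightarrow>
    \<bar>lcoc s (g *v x) \<xi> - (pint (pot s) (g *v x) (h *v x) - pint (pot s) x (h *v x))\<bar> \<le> C2"
    using lcoc_coarse[OF C0] by (metis (no_types, lifting))
  show ?thesis
  proof (rule exI[of _ "max (D + 1) (C1 + C2)"], rule conjI, use D in simp, rule exI[of _ hh], intro ballI conjI allI impI)
    fix \<xi> i assume "\<xi> \<in> limit_set \<Gamma>" then show "hh \<xi> i \<in> \<Gamma>" using hh by blast
  next
    fix \<xi> g w assume \<xi>: "\<xi> \<in> limit_set \<Gamma>" and g: "g \<in> \<Gamma>" and w: "(x, w) \<in> hyp_unit_tangent \<and> g *v x = geo_point x w (len g)"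
    have \<xi>I: "\<xi> \<in> ideal_boundary" using \<xi> limit_set_ideal by blast
    define v where "v = ray_dir x \<xi>"
    have v: "(x, v) \<in> hyp_unit_tangent" unfolding v_def by (rule ray_dir_tangent[OF x \<xi>I])
    have w1: "(x, w) \<in> hyp_unit_tangent" and w2: "g *v x = geo_point x w (len g)" using w by auto
    have l0: "0 \<le> len g" by (rule len_nonneg[OF g])
    let ?P = "\<lambda>i::nat. real i \<le> len g \<and> half_sin_sq v w \<le> exp (- 2 * real i)"
    have P0: "?P 0" using l0 half_sin_sq_le_1[OF v w1] by simp
    have Pb: "i \<le> nat \<lfloor>len g\<rfloor>" if "?P i" for i using that by linarith
    \<comment> \<open>The last integer time at which the angle still keeps the ray and the segment
      to \<open>g *v x\<close> within bounded distance. Time 0 always qualifies, since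
      \<open>half_sin_sq\<close> is at most 1.\<close>
    define i where "i = (GREATEST i. ?P i)"
    have i: "?P i" unfolding i_def by (rule GreatestI_nat[of ?P 0, OF P0 Pb])
    have i1: "\<not> ?P (i + 1)" using Greatest_le_nat[of ?P "i + 1", OF _ Pb] unfolding i_def[symmetric] by auto
    define h where "h = hh \<xi> i"
    have h: "h \<in> \<Gamma>" "hyp_dist (h *v x) (geo_point x v (real i)) \<le> D" using hh[OF \<xi>, of i] by (auto simp: h_def v_def)
    note hx = orbit_hyp[OF h(1)] and gX = orbit_hyp[OF g] and pv = geo_point_in_hyp_space[OF v] and pw = geo_point_in_hyp_space[OF w1]
    have c1: "hyp_dist (geo_point x v (real i)) (geo_point x w (real i)) \<le> 1"
    proof -
      have "sqrt (half_sin_sq v w) \<le> sqrt (exp (- 2 * real i))" using i by (intro real_sqrt_le_mono) auto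
      also have "sqrt (exp (- 2 * real i)) = exp (- real i)" by (rule real_sqrt_unique) (simp_all add: power2_eq_square mult_exp_exp)
      finally have "2 * sinh (real i) * sqrt (half_sin_sq v w) \<le> exp (real i) * exp (- real i)"
        using half_sin_sq_nonneg[OF v w1] by (intro mult_mono) (auto simp: sinh_field_def)
      then show ?thesis using hyp_dist_same_time_le[OF v w1, of "real i"] by (simp add: mult_exp_exp)
    qed
    have c2: "hyp_dist (geo_point x w (real i)) (g *v x) = len g - real i"
      unfolding w2 using hyp_dist_geo_point[OF w1, of "real i" "len g"] i by simp
    have hg: "hyp_dist (h *v x) (g *v x) \<le> D + 1 + (len g - real i)"
      using hyp_dist_triangle[OF hx pv[of "real i"] gX] hyp_dist_triangle[OF pv[of "real i"] pw[of "real i"] gX] h(2) c1 c2 by linarith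
    have xp: "hyp_dist x (geo_point x v (real i)) = real i" by (rule hyp_dist_geo_point_0[OF v]) simp
    have xh: "hyp_dist x (h *v x) \<le> real i + D"
      using hyp_dist_triangle[OF x pv[of "real i"] hx] h(2) xp by (simp add: hyp_dist_commute)
    have hg': "len g - real i - D \<le> hyp_dist (h *v x) (g *v x)"
      using hyp_dist_triangle[OF x hx gX] xh by (simp add: len_def)
    have k: "\<bar>len (ginv h ** g) - (len g - real i)\<bar> \<le> D + 1"
      using hg hg' dist_orbit[OF h(1), of g] by simp
    have ray: "hyp_dist (h *v x) (geo_point x v r) \<le> D + (r - real i)" if "real i \<le> r" for r
      using hyp_dist_triangle[OF hx pv[of "real i"] pv[of r]] h(2) hyp_dist_geo_point[OF v, of "real i" r] that by simp
    have "\<bar>pint (pot s) x (g *v x) - pint (pot s) x (h *v x) - pint (pot s) (h *v x) (g *v x)\<bar> \<le> C1"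
      by (intro C1 x h gX) (use xh hg D in \<open>simp add: len_def C0_def\<close>)
    moreover have "\<bar>lcoc s (g *v x) \<xi> - (pint (pot s) (g *v x) (h *v x) - pint (pot s) x (h *v x))\<bar> \<le> C2"
    proof (rule C2(2)[OF \<xi>I g h(1), of "real i"])
      fix r assume r: "real i \<le> r"
      then have r0: "0 \<le> r" using of_nat_0_le_iff[of i] by linarith
      \<comment> \<open>Maximality of \<open>i\<close> has two possible causes: the segment ends
        within unit time, or the angle is too wide for time \<open>i + 1\<close>, and then distances
        nearly add beyond the centre.\<close>
      have "len g + r - 2 * real i - 5 \<le> hyp_dist (g *v x) (geo_point x v r)"
      proof (cases "len g < real i + 1")
        case True
        have "r - len g \<le> hyp_dist (g *v x) (geo_point x v r)"
          using hyp_dist_diff_le[OF w1 v l0 r0] unfolding w2[symmetric] by simp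
        then show ?thesis using True by linarith
      next
        case False
        then have "real (i + 1) \<le> len g" by simp
        then have "\<not> half_sin_sq v w \<le> exp (- 2 * real (i + 1))" using i1 by blast
        then have "exp (- 2 * (real i + 1)) \<le> half_sin_sq w v"
          by (simp only: half_sin_sq_commute[of w v] of_nat_add of_nat_1 not_le less_imp_le)
        then have "len g + r - 2 * (real i + 1) - 3 \<le> hyp_dist (geo_point x w (len g)) (geo_point x v r)"
          by (intro wide_angle_dist[OF w1 v l0 r0]) auto
        then show ?thesis by (simp add: w2[symmetric])
      qed
      then show "hyp_dist (g *v x) (h *v x) + hyp_dist (h *v x) (geo_point x (ray_dir x \<xi>) r)
          \<le> hyp_dist (g *v x) (geo_point x (ray_dir x \<xi>) r) + C0 \<and>
        hyp_dist x (h *v x) + hyp_dist (h *v x) (geo_point x (ray_dir x \<xi>) r) \<le> hyp_dist x (geo_point x (ray_dir x \<xi>) r) + C0"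
        using ray[OF r] hg xh hyp_dist_geo_point_0[OF v r0] by (simp add: v_def[symmetric] C0_def hyp_dist_commute)
    qed
    moreover have "pint (pot s) (h *v x) (g *v x) = pint (pot s) x ((ginv h ** g) *v x)" by (rule pint_orbit[OF h(1)])
    moreover have "pint (pot s) (g *v x) (h *v x) = pint (pot s) x (ginv (ginv h ** g) *v x)"
      unfolding pint_orbit[OF g] ginv_mult_swap[OF g h(1)] ..
    ultimately have "wt s g * exp (lcoc s (g *v x) \<xi>) \<le> exp (C1 + C2) * (wt s (ginv h ** g) * wt s (ginv (ginv h ** g)))"
      unfolding wt_def mult_exp_exp by simp
    also have "\<dots> \<le> exp (max (D + 1) (C1 + C2)) * (wt s (ginv h ** g) * wt s (ginv (ginv h ** g)))"
      by (intro mult_right_mono) (auto simp: less_imp_le[OF wt_pos])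
    finally have W: "wt s g * exp (lcoc s (g *v x) \<xi>) \<le> exp (max (D + 1) (C1 + C2)) * (wt s (ginv h ** g) * wt s (ginv (ginv h ** g)))" .
    show "\<exists>i::nat. real i \<le> len g \<and> half_sin_sq (ray_dir x \<xi>) w \<le> exp (- 2 * real i) \<and>
      \<bar>len (ginv (hh \<xi> i) ** g) - (len g - real i)\<bar> \<le> max (D + 1) (C1 + C2) \<and>
      wt s g * exp (lcoc s (g *v x) \<xi>) \<le> exp (max (D + 1) (C1 + C2)) * (wt s (ginv (hh \<xi> i) ** g) * wt s (ginv (ginv (hh \<xi> i) ** g)))"
      using i k W by (intro exI[of _ i]) (auto simp: v_def h_def)
  qed
qed

end

section \<open>Shadow estimates\<close>

locale regular_gibbs = gibbs_setting \<Gamma> F x for \<Gamma> :: "'n::finite mink_mat set" and F x +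
  assumes regular: "regular_potential \<Gamma> F"
begin

definition crit :: real where "crit = real_of_ereal (critical_exponent \<Gamma> F)"

lemma crit_ereal: "critical_exponent \<Gamma> F = ereal crit"
proof -
  have "(SUP P\<in>Omega \<Gamma>. ereal (F P)) < critical_exponent \<Gamma> F" using regular by (simp add: regular_potential_def)
  then have "critical_exponent \<Gamma> F \<noteq> - \<infinity>" by auto
  then show ?thesis using critical_exponent_finite unfolding crit_def by (cases "critical_exponent \<Gamma> F") auto
qed

text \<open>The regularity gap as exponential decay: \<open>c\<close> is strictly between the
  supremum over the hull and the critical exponent, and the rate is what remains,
  \<open>crit - c\<close>.\<close>

lemma wt_decay: "\<exists>\<kappa>>0. \<exists>C>0. \<forall>g\<in>\<Gamma>. wt crit g \<le> C * exp (- \<kappa> * len g)"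
proof -
  have "(SUP P\<in>Omega \<Gamma>. ereal (F P)) < ereal crit" using regular by (simp add: regular_potential_def crit_ereal)
  then obtain c where c: "(SUP P\<in>Omega \<Gamma>. ereal (F P)) < ereal c" "ereal c < ereal crit" using ereal_dense2 by blast
  obtain C where C: "C \<ge> 0" "\<And>g. g \<in> \<Gamma> \<Longrightarrow> pint (pot 0) x (g *v x) \<le> c * len g + C"
    using pint_upper_bound[of c] c(1) by (auto simp: less_imp_le)
  show ?thesis
  proof (rule exI[of _ "crit - c"], rule conjI, use c in simp, rule exI[of _ "exp C"], intro conjI ballI)
    fix g assume g: "g \<in> \<Gamma>"
    have "wt crit g = exp (pint (pot 0) x (g *v x) - crit * len g)"
      unfolding wt_def pint_pot_shift[OF x orbit_hyp[OF g], of crit] by (simp add: len_def)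
    also have "\<dots> \<le> exp (C + - (crit - c) * len g)" using C(2)[OF g] by (simp add: algebra_simps)
    finally show "wt crit g \<le> exp C * exp (- (crit - c) * len g)" by (simp add: mult_exp_exp)
  qed simp
qed

text \<open>The sine of half the visual angle at \<open>x\<close>, which is the exponential of minus
  the Gromov product. The shadow of \<open>g *v x\<close> has radius of order
  \<open>exp (- len g)\<close> for it, the scale required by \<open>shadow_system\<close>.\<close>

definition bdist :: "'n mink \<Rightarrow> 'n mink \<Rightarrow> real" where
  "bdist \<xi> \<eta> = sqrt (half_sin_sq (ray_dir x \<xi>) (ray_dir x \<eta>))"

text \<open>The Radon-Nikodym derivative of the translate of the measure by \<open>g\<close>, as
  \<open>distr_eq_density\<close> confirms.\<close>

definition rn :: "'n mink_mat \<Rightarrow> 'n mink \<Rightarrow> real" where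
  "rn g \<xi> = exp (lcoc crit (g *v x) \<xi>)"

lemma pint_self: "y \<in> hyp_space \<Longrightarrow> pint \<phi> y y = 0"
  by (simp add: pint_def)

lemma exists_direction: "g \<in> \<Gamma> \<Longrightarrow> \<exists>w. (x, w) \<in> hyp_unit_tangent \<and> g *v x = geo_point x w (len g)"
  using exists_geo_point[OF x orbit_hyp] unfolding len_def by metis

lemma ray_dir_limit: "\<xi> \<in> limit_set \<Gamma> \<Longrightarrow> (x, ray_dir x \<xi>) \<in> hyp_unit_tangent"
  using ray_dir_tangent[OF x] limit_set_ideal by blast

lemma sum_exp_le:
  fixes \<theta> m L :: real
  assumes "0 < \<theta>" "0 \<le> m + L"
  shows "(\<Sum>i\<le>nat \<lfloor>m + L\<rfloor>. exp (\<theta> * (real i - m))) \<le> exp (\<theta> * L) * (1 / (1 - exp (- \<theta>)))"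
proof -
  define N where "N = nat \<lfloor>m + L\<rfloor>"
  have N: "real N \<le> m + L" unfolding N_def using assms(2) by linarith
  define \<rho> where "\<rho> = exp (- \<theta>)"
  have \<rho>: "0 < \<rho>" "\<rho> < 1" using assms by (auto simp: \<rho>_def)
  have "(\<Sum>i\<le>N. exp (\<theta> * (real i - m))) \<le> (\<Sum>i<Suc N. exp (\<theta> * L) * \<rho> ^ (Suc N - Suc i))"
    unfolding lessThan_Suc_atMost
  proof (rule sum_mono)
    fix i assume i: "i \<in> {..N}"
    have "\<theta> * (real i - m) \<le> \<theta> * (L - real (N - i))" using i N assms by (intro mult_left_mono) (auto simp: of_nat_diff)
    also have "\<dots> = \<theta> * L + real (N - i) * (- \<theta>)" by (simp add: algebra_simps)
    finally have "exp (\<theta> * (real i - m)) \<le> exp (\<theta> * L + real (N - i) * (- \<theta>))" by simp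
    also have "\<dots> = exp (\<theta> * L) * \<rho> ^ (Suc N - Suc i)" unfolding exp_add exp_of_nat_mult \<rho>_def by simp
    finally show "exp (\<theta> * (real i - m)) \<le> exp (\<theta> * L) * \<rho> ^ (Suc N - Suc i)" .
  qed
  also have "\<dots> = exp (\<theta> * L) * (\<Sum>i<Suc N. \<rho> ^ i)"
    unfolding sum_distrib_left[symmetric] by (simp only: sum.nat_diff_reindex[of "\<lambda>i. \<rho> ^ i" "Suc N"])
  also have "\<dots> \<le> exp (\<theta> * L) * (1 / (1 - \<rho>))"
  proof (intro mult_left_mono)
    have "(\<Sum>i<Suc N. \<rho> ^ i) \<le> (\<Sum>n. \<rho> ^ n)" using \<rho> by (intro sum_le_suminf) (auto intro: summable_geometric)
    then show "(\<Sum>i<Suc N. \<rho> ^ i) \<le> 1 / (1 - \<rho>)" using \<rho> by (simp add: suminf_geometric)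
  qed simp
  finally show ?thesis by (simp add: N_def \<rho>_def)
qed

text \<open>This is where the gap in the regularity assumption is used: the terms decay exponentially with
  the distance from \<open>g x\<close> to the ray, faster than the orbit grows.\<close>

lemma shadow_upper:
  assumes pt: "\<And>g. g \<in> \<Gamma> \<Longrightarrow> pt g \<in> limit_set \<Gamma>"
    and Cs: "0 \<le> Cs" "\<And>g v. g \<in> \<Gamma> \<Longrightarrow> (x, v) \<in> hyp_unit_tangent \<Longrightarrow> g *v x = geo_point x v (len g) \<Longrightarrow>
      half_sin_sq v (ray_dir x (pt g)) \<le> Cs * exp (- 2 * len g)"
    and \<kappa>: "0 < \<kappa>" and C6: "0 < C6" "\<And>g. g \<in> \<Gamma> \<Longrightarrow> wt crit g \<le> C6 * exp (- \<kappa> * len g)"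
  shows "\<exists>C. \<forall>m\<ge>0. \<forall>\<xi>\<in>limit_set \<Gamma>. (\<Sum>g | g \<in> \<Gamma> \<and> m \<le> len g \<and> len g < m + L.
      wt crit g * rn g \<xi> * (1 + exp (len g) * bdist \<xi> (pt g)) powr (\<kappa> / 4)) \<le> C"
proof -
  define \<theta> where "\<theta> = \<kappa> / 4"
  have \<theta>: "0 < \<theta>" using \<kappa> by (simp add: \<theta>_def)
  \<comment> \<open>The decay rate \<kappa> is spent three ways: one half lifts the exponent of the
    weight of \<open>k\<close> into the range of convergence, one quarter pays for the power
    \<theta>, and the last quarter makes the sum over \<open>i\<close> geometric.\<close>
  have "converges (crit + \<kappa> / 2)" by (rule converges_above) (use \<kappa> in \<open>simp add: crit_ereal\<close>)
  then obtain B where B: "\<And>A. finite A \<Longrightarrow> A \<subseteq> \<Gamma> \<Longrightarrow> (\<Sum>g\<in>A. wt (crit + \<kappa> / 2) g) \<le> B" by (auto simp: converges_def)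
  obtain C hh where C: "C \<ge> 0" and hh: "\<And>\<xi> i. \<xi> \<in> limit_set \<Gamma> \<Longrightarrow> hh \<xi> i \<in> \<Gamma>"
    and tri: "\<And>\<xi> g w. \<xi> \<in> limit_set \<Gamma> \<Longrightarrow> g \<in> \<Gamma> \<Longrightarrow> (x, w) \<in> hyp_unit_tangent \<Longrightarrow> g *v x = geo_point x w (len g) \<Longrightarrow>
    (\<exists>i::nat. real i \<le> len g \<and> half_sin_sq (ray_dir x \<xi>) w \<le> exp (- 2 * real i) \<and>
      \<bar>len (ginv (hh \<xi> i) ** g) - (len g - real i)\<bar> \<le> C \<and>
      wt crit g * exp (lcoc crit (g *v x) \<xi>) \<le> exp C * (wt crit (ginv (hh \<xi> i) ** g) * wt crit (ginv (ginv (hh \<xi> i) ** g))))"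
    using tripod_decomposition[of crit] by metis
  define c5 where "c5 = sqrt (2 + 2 * Cs)"
  have c5: "0 \<le> c5" using Cs by (simp add: c5_def)
  define C7 where "C7 = exp C * C6 * ((1 + c5) * exp C) powr \<theta> * exp (\<theta> * C)"
  have C7: "0 \<le> C7" using C6(1) by (simp add: C7_def)
  have single: "\<exists>i k. real i \<le> len g \<and> k \<in> \<Gamma> \<and> g = hh \<xi> i ** k \<and>
      wt crit g * rn g \<xi> * (1 + exp (len g) * bdist \<xi> (pt g)) powr \<theta> \<le> C7 * (exp (\<theta> * (real i - m)) * wt (crit + \<kappa> / 2) k)"
    if \<xi>: "\<xi> \<in> limit_set \<Gamma>" and g: "g \<in> \<Gamma>" and m: "m \<le> len g" for \<xi> g m
  proof -
    obtain w where w: "(x, w) \<in> hyp_unit_tangent" "g *v x = geo_point x w (len g)" using exists_direction[OF g] by blast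
    obtain i where i: "real i \<le> len g" "half_sin_sq (ray_dir x \<xi>) w \<le> exp (- 2 * real i)"
      "\<bar>len (ginv (hh \<xi> i) ** g) - (len g - real i)\<bar> \<le> C"
      "wt crit g * exp (lcoc crit (g *v x) \<xi>) \<le> exp C * (wt crit (ginv (hh \<xi> i) ** g) * wt crit (ginv (ginv (hh \<xi> i) ** g)))"
      using tri[OF \<xi> g w] by blast
    define k where "k = ginv (hh \<xi> i) ** g"
    have k: "k \<in> \<Gamma>" unfolding k_def by (intro mult_in ginv_in hh \<xi> g)
    have gk: "g = hh \<xi> i ** k" by (simp add: k_def matrix_mul_assoc ginv_mult hh \<xi>)
    have "half_sin_sq (ray_dir x \<xi>) (ray_dir x (pt g)) \<le> 2 * exp (- 2 * real i) + 2 * (Cs * exp (- 2 * len g))"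
      using half_sin_sq_triangle[OF ray_dir_limit[OF \<xi>] w(1) ray_dir_limit[OF pt[OF g]]] i(2) Cs(2)[OF g w] by linarith
    also have "\<dots> \<le> 2 * exp (- 2 * real i) + 2 * (Cs * exp (- 2 * real i))"
      using i(1) Cs(1) by (intro add_mono mult_left_mono) auto
    also have "\<dots> = (2 + 2 * Cs) * exp (- 2 * real i)" by (simp add: algebra_simps)
    finally have "bdist \<xi> (pt g) \<le> sqrt ((2 + 2 * Cs) * exp (- 2 * real i))" unfolding bdist_def by (rule real_sqrt_le_mono)
    also have "sqrt ((2 + 2 * Cs) * exp (- 2 * real i)) = c5 * sqrt (exp (- 2 * real i))" by (simp add: real_sqrt_mult c5_def)
    also have "sqrt (exp (- 2 * real i)) = exp (- real i)" by (rule real_sqrt_unique) (simp_all add: power2_eq_square mult_exp_exp)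
    finally have "exp (len g) * bdist \<xi> (pt g) \<le> exp (len g) * (c5 * exp (- real i))" by (intro mult_left_mono) auto
    also have "\<dots> = c5 * (exp (len g) * exp (- real i))" by (simp only: mult_ac)
    also have "exp (len g) * exp (- real i) = exp (len g - real i)" by (simp add: mult_exp_exp)
    finally have "1 + exp (len g) * bdist \<xi> (pt g) \<le> 1 * exp (len g - real i) + c5 * exp (len g - real i)"
      using i(1) by (intro add_mono) auto
    also have "\<dots> = (1 + c5) * exp (len g - real i)" by (simp only: distrib_right)
    also have "\<dots> \<le> (1 + c5) * exp (C + len k)" using i(3) c5 by (intro mult_left_mono) (auto simp: k_def)
    finally have 1: "1 + exp (len g) * bdist \<xi> (pt g) \<le> (1 + c5) * exp C * exp (len k)" by (simp add: exp_add mult.assoc)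
    have bd0: "0 \<le> bdist \<xi> (pt g)" unfolding bdist_def
      using half_sin_sq_nonneg[OF ray_dir_limit[OF \<xi>] ray_dir_limit[OF pt[OF g]]] by simp
    have "(1 + exp (len g) * bdist \<xi> (pt g)) powr \<theta> \<le> ((1 + c5) * exp C * exp (len k)) powr \<theta>"
      using 1 bd0 \<theta> by (intro powr_mono2) auto
    also have "\<dots> = ((1 + c5) * exp C) powr \<theta> * exp (\<theta> * len k)"
      using c5 by (simp only: powr_mult) (simp add: powr_def[of "exp (len k)"])
    finally have 2: "(1 + exp (len g) * bdist \<xi> (pt g)) powr \<theta> \<le> ((1 + c5) * exp C) powr \<theta> * exp (\<theta> * len k)" .
    have "wt crit k * wt crit (ginv k) \<le> wt crit k * (C6 * exp (- \<kappa> * len k))"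
      using C6(2)[OF ginv_in[OF k]] wt_pos[of crit k] by (intro mult_left_mono) (auto simp: len_ginv[OF k])
    then have "exp C * (wt crit k * wt crit (ginv k)) \<le> exp C * (wt crit k * (C6 * exp (- \<kappa> * len k)))"
      by (rule mult_left_mono) simp
    then have 3: "wt crit g * rn g \<xi> \<le> exp C * (wt crit k * (C6 * exp (- \<kappa> * len k)))"
      using i(4) unfolding rn_def k_def by linarith
    have "wt crit g * rn g \<xi> * (1 + exp (len g) * bdist \<xi> (pt g)) powr \<theta>
      \<le> (exp C * (wt crit k * (C6 * exp (- \<kappa> * len k)))) * (((1 + c5) * exp C) powr \<theta> * exp (\<theta> * len k))"
      by (rule mult_mono[OF 3 2]) (use wt_pos[of crit k] C6(1) in auto)
    also have "\<dots> = (exp C * C6 * ((1 + c5) * exp C) powr \<theta>) * (exp (- \<kappa> * len k) * exp (\<theta> * len k) * wt crit k)"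
      by (simp only: mult_ac)
    also have "exp (- \<kappa> * len k) * exp (\<theta> * len k) * wt crit k = exp (- \<theta> * len k) * wt (crit + \<kappa> / 2) k"
      unfolding wt_shift[OF k, of "crit + \<kappa> / 2" crit] mult.assoc[symmetric] mult_exp_exp by (simp add: \<theta>_def algebra_simps)
    also have "(exp C * C6 * ((1 + c5) * exp C) powr \<theta>) * (exp (- \<theta> * len k) * wt (crit + \<kappa> / 2) k) \<le>
       (exp C * C6 * ((1 + c5) * exp C) powr \<theta>) * ((exp (\<theta> * C) * exp (\<theta> * (real i - m))) * wt (crit + \<kappa> / 2) k)"
    proof (intro mult_left_mono mult_right_mono)
      have "\<theta> * (m - real i - C) \<le> \<theta> * len k" using i(3) m \<theta> by (intro mult_left_mono) (auto simp: k_def)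
      then show "exp (- \<theta> * len k) \<le> exp (\<theta> * C) * exp (\<theta> * (real i - m))" unfolding mult_exp_exp by (simp add: algebra_simps)
    qed (use C6(1) wt_pos[of "crit + \<kappa> / 2" k] in auto)
    also have "\<dots> = C7 * (exp (\<theta> * (real i - m)) * wt (crit + \<kappa> / 2) k)" by (simp add: C7_def)
    finally show ?thesis using i(1) k gk by blast
  qed
  have B0: "0 \<le> B" using B[of "{}"] by simp
  show ?thesis
  proof (intro exI[of _ "C7 * (exp (\<theta> * \<bar>L\<bar>) * (1 / (1 - exp (- \<theta>))) * B)"] allI impI ballI)
    fix m :: real and \<xi> assume m: "0 \<le> m" and \<xi>: "\<xi> \<in> limit_set \<Gamma>"
    define S where "S = {g. g \<in> \<Gamma> \<and> m \<le> len g \<and> len g < m + L}"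
    have fS: "finite S" unfolding S_def by (rule finite_subset[OF _ finite_len[of "m + L"]]) auto
    have "\<forall>g\<in>S. \<exists>i k. real i \<le> len g \<and> k \<in> \<Gamma> \<and> g = hh \<xi> i ** k \<and>
      wt crit g * rn g \<xi> * (1 + exp (len g) * bdist \<xi> (pt g)) powr \<theta> \<le> C7 * (exp (\<theta> * (real i - m)) * wt (crit + \<kappa> / 2) k)"
      using single[OF \<xi>] by (auto simp: S_def)
    then obtain i k where ik: "\<And>g. g \<in> S \<Longrightarrow> real (i g) \<le> len g \<and> k g \<in> \<Gamma> \<and> g = hh \<xi> (i g) ** k g \<and>
      wt crit g * rn g \<xi> * (1 + exp (len g) * bdist \<xi> (pt g)) powr \<theta> \<le> C7 * (exp (\<theta> * (real (i g) - m)) * wt (crit + \<kappa> / 2) (k g))"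
      by metis
    let ?\<iota> = "\<lambda>g. (i g, k g)"
    let ?c = "\<lambda>(j, h). C7 * (exp (\<theta> * (real j - m)) * wt (crit + \<kappa> / 2) h)"
    \<comment> \<open>For fixed \<xi> the element \<open>hh \<xi> i\<close> depends on
      \<open>i\<close> alone, not on \<open>g\<close>; hence \<open>g\<close> is recovered from the
      pair, and the sum is bounded by a product of two sums.\<close>
    have inj: "inj_on ?\<iota> S"
    proof (rule inj_onI)
      fix a b assume "a \<in> S" "b \<in> S" "?\<iota> a = ?\<iota> b"
      then show "a = b" using ik[of a] ik[of b] by (metis prod.inject)
    qed
    have "(\<Sum>g\<in>S. wt crit g * rn g \<xi> * (1 + exp (len g) * bdist \<xi> (pt g)) powr \<theta>) \<le> (\<Sum>g\<in>S. ?c (?\<iota> g))"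
      using ik by (intro sum_mono) auto
    also have "\<dots> = (\<Sum>p\<in>?\<iota> ` S. ?c p)" using sum.reindex[OF inj, of ?c] by (simp add: o_def)
    also have "\<dots> \<le> (\<Sum>p\<in>{..nat \<lfloor>m + \<bar>L\<bar>\<rfloor>} \<times> k ` S. ?c p)"
    proof (rule sum_mono2)
      show "?\<iota> ` S \<subseteq> {..nat \<lfloor>m + \<bar>L\<bar>\<rfloor>} \<times> k ` S"
      proof (rule image_subsetI)
        fix g assume g: "g \<in> S"
        have "real (i g) \<le> m + \<bar>L\<bar>" using ik[OF g] g by (auto simp: S_def)
        then have "i g \<le> nat \<lfloor>m + \<bar>L\<bar>\<rfloor>" by linarith
        then show "?\<iota> g \<in> {..nat \<lfloor>m + \<bar>L\<bar>\<rfloor>} \<times> k ` S" using g by simp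
      qed
      have "0 \<le> C7 * (exp (\<theta> * (real j - m)) * wt (crit + \<kappa> / 2) h)" for j :: nat and h
        using C7 less_imp_le[OF wt_pos] by (intro mult_nonneg_nonneg) auto
      then show "0 \<le> ?c p" for p by (simp add: case_prod_beta)
    qed (use fS in simp)
    also have "\<dots> = (\<Sum>j\<le>nat \<lfloor>m + \<bar>L\<bar>\<rfloor>. \<Sum>h\<in>k ` S. C7 * (exp (\<theta> * (real j - m)) * wt (crit + \<kappa> / 2) h))"
      by (simp only: sum.cartesian_product)
    also have "\<dots> = C7 * ((\<Sum>j\<le>nat \<lfloor>m + \<bar>L\<bar>\<rfloor>. exp (\<theta> * (real j - m))) * (\<Sum>h\<in>k ` S. wt (crit + \<kappa> / 2) h))"
      unfolding sum_product by (simp only: sum_distrib_left)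
    also have "\<dots> \<le> C7 * ((exp (\<theta> * \<bar>L\<bar>) * (1 / (1 - exp (- \<theta>)))) * B)"
    proof (intro mult_left_mono mult_mono)
      show "(\<Sum>j\<le>nat \<lfloor>m + \<bar>L\<bar>\<rfloor>. exp (\<theta> * (real j - m))) \<le> exp (\<theta> * \<bar>L\<bar>) * (1 / (1 - exp (- \<theta>)))"
        by (rule sum_exp_le[OF \<theta>]) (use m in simp)
      show "(\<Sum>h\<in>k ` S. wt (crit + \<kappa> / 2) h) \<le> B" by (rule B) (use fS ik in auto)
      show "0 \<le> (\<Sum>h\<in>k ` S. wt (crit + \<kappa> / 2) h)" by (intro sum_nonneg less_imp_le wt_pos)
    qed (use C7 \<theta> in auto)
    finally show "(\<Sum>g | g \<in> \<Gamma> \<and> m \<le> len g \<and> len g < m + L.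
      wt crit g * rn g \<xi> * (1 + exp (len g) * bdist \<xi> (pt g)) powr (\<kappa> / 4)) \<le> C7 * (exp (\<theta> * \<bar>L\<bar>) * (1 / (1 - exp (- \<theta>))) * B)"
      by (simp add: S_def \<theta>_def)
  qed
qed

text \<open>An orbit point near the ray to \<xi> is itself a tripod centre: its density at \<xi> is
  the inverse of its weight up to a constant, and \<xi> lies in its shadow at the right
  scale.\<close>

lemma shadow_lower:
  assumes pt: "\<And>g. g \<in> \<Gamma> \<Longrightarrow> pt g \<in> limit_set \<Gamma>"
    and Cs: "0 \<le> Cs" "\<And>g v. g \<in> \<Gamma> \<Longrightarrow> (x, v) \<in> hyp_unit_tangent \<Longrightarrow> g *v x = geo_point x v (len g) \<Longrightarrow>
      half_sin_sq v (ray_dir x (pt g)) \<le> Cs * exp (- 2 * len g)"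
  shows "\<exists>C L. \<forall>m\<ge>0. \<forall>\<xi>\<in>limit_set \<Gamma>. \<exists>g\<in>\<Gamma>. m \<le> len g \<and> len g < m + L \<and> 1 \<le> C * (wt crit g * rn g \<xi>) \<and>
      exp (len g) * bdist \<xi> (pt g) \<le> C"
proof -
  obtain D where D: "D \<ge> 0" "\<And>\<xi> t. \<xi> \<in> limit_set \<Gamma> \<Longrightarrow> t \<ge> 0 \<Longrightarrow> \<exists>h\<in>\<Gamma>. hyp_dist (h *v x) (geo_point x (ray_dir x \<xi>) t) \<le> D"
    using orbit_near_ray[OF x] by blast
  have D2: "0 \<le> 2 * D" using D by simp
  obtain C2 where C2: "C2 \<ge> 0" "\<And>\<xi> g h r0. \<xi> \<in> ideal_boundary \<Longrightarrow> g \<in> \<Gamma> \<Longrightarrow> h \<in> \<Gamma> \<Longrightarrow> (\<And>r. r \<ge> r0 \<Longrightarrow>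
      hyp_dist (g *v x) (h *v x) + hyp_dist (h *v x) (geo_point x (ray_dir x \<xi>) r) \<le> hyp_dist (g *v x) (geo_point x (ray_dir x \<xi>) r) + 2 * D \<and>
      hyp_dist x (h *v x) + hyp_dist (h *v x) (geo_point x (ray_dir x \<xi>) r) \<le> hyp_dist x (geo_point x (ray_dir x \<xi>) r) + 2 * D) \<Longrightarrow>
    \<bar>lcoc crit (g *v x) \<xi> - (pint (pot crit) (g *v x) (h *v x) - pint (pot crit) x (h *v x))\<bar> \<le> C2"
    using lcoc_coarse[OF D2] by (metis (no_types, lifting))
  define Q where "Q = 16 * exp (2 + 6 * D) + 2 * Cs"
  show ?thesis
  proof (rule exI[of _ "exp C2 + sqrt Q"], rule exI[of _ "2 * D + 1"], intro allI impI ballI)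
    fix m :: real and \<xi> assume m: "0 \<le> m" and \<xi>: "\<xi> \<in> limit_set \<Gamma>"
    have \<xi>I: "\<xi> \<in> ideal_boundary" using \<xi> limit_set_ideal by blast
    \<comment> \<open>Later than \<open>m\<close> by \<open>D\<close>, since the orbit point found
      near time \<open>t\<close> is only known to have displacement at least
      \<open>t - D\<close>.\<close>
    define t where "t = m + D"
    have t: "0 \<le> t" using m D by (simp add: t_def)
    define v where "v = ray_dir x \<xi>"
    have v: "(x, v) \<in> hyp_unit_tangent" unfolding v_def by (rule ray_dir_limit[OF \<xi>])
    obtain g where g: "g \<in> \<Gamma>" "hyp_dist (g *v x) (geo_point x v t) \<le> D" using D(2)[OF \<xi> t] by (auto simp: v_def)
    note gX = orbit_hyp[OF g(1)] and pv = geo_point_in_hyp_space[OF v]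
    have xt: "hyp_dist x (geo_point x v t) = t" by (rule hyp_dist_geo_point_0[OF v t])
    have lg: "t - D \<le> len g" "len g \<le> t + D"
      using hyp_dist_triangle[OF x gX pv[of t]] hyp_dist_triangle[OF x pv[of t] gX] g(2) xt
      by (auto simp: len_def hyp_dist_commute)
    have "\<bar>lcoc crit (g *v x) \<xi> - (pint (pot crit) (g *v x) (g *v x) - pint (pot crit) x (g *v x))\<bar> \<le> C2"
    proof (rule C2(2)[OF \<xi>I g(1) g(1), of t])
      fix r assume r: "t \<le> r"
      have "hyp_dist (g *v x) (geo_point x v r) \<le> D + (r - t)"
        using hyp_dist_triangle[OF gX pv[of t] pv[of r]] g(2) hyp_dist_geo_point[OF v, of t r] r by simp
      then show "hyp_dist (g *v x) (g *v x) + hyp_dist (g *v x) (geo_point x (ray_dir x \<xi>) r)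
          \<le> hyp_dist (g *v x) (geo_point x (ray_dir x \<xi>) r) + 2 * D \<and>
        hyp_dist x (g *v x) + hyp_dist (g *v x) (geo_point x (ray_dir x \<xi>) r) \<le> hyp_dist x (geo_point x (ray_dir x \<xi>) r) + 2 * D"
        using lg(2) hyp_dist_geo_point_0[OF v, of r] r t D(1) gX by (simp add: v_def[symmetric] len_def[symmetric])
    qed
    then have "exp (- C2) \<le> wt crit g * rn g \<xi>" unfolding wt_def rn_def mult_exp_exp by (simp add: pint_self[OF gX])
    then have "exp C2 * exp (- C2) \<le> exp C2 * (wt crit g * rn g \<xi>)" by (intro mult_left_mono) auto
    then have 1: "1 \<le> exp C2 * (wt crit g * rn g \<xi>)" by (simp add: mult_exp_exp)
    obtain w where w: "(x, w) \<in> hyp_unit_tangent" "g *v x = geo_point x w (len g)" using exists_direction[OF g(1)] by blast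
    have "half_sin_sq v w \<le> 8 * exp (2 + 4 * D - 2 * t)"
      by (rule nearby_directions[OF v w(1) t len_nonneg[OF g(1)] D(1)]) (use g(2) w(2) in \<open>simp add: hyp_dist_commute\<close>)
    then have h: "half_sin_sq v (ray_dir x (pt g)) \<le> 16 * exp (2 + 4 * D - 2 * t) + 2 * (Cs * exp (- 2 * len g))"
      using half_sin_sq_triangle[OF v w(1) ray_dir_limit[OF pt[OF g(1)]]] Cs(2)[OF g(1) w] by linarith
    have "exp (2 * len g) * half_sin_sq v (ray_dir x (pt g)) \<le> exp (2 * len g) * (16 * exp (2 + 4 * D - 2 * t) + 2 * (Cs * exp (- 2 * len g)))"
      using h by (intro mult_left_mono) auto
    also have "\<dots> = 16 * exp (2 * len g + (2 + 4 * D - 2 * t)) + 2 * Cs" by (simp add: distrib_left exp_add[symmetric] mult.left_commute[of "exp _"])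
    also have "\<dots> \<le> Q" unfolding Q_def using lg(2) by simp
    finally have "sqrt (exp (2 * len g) * half_sin_sq v (ray_dir x (pt g))) \<le> sqrt Q" by (rule real_sqrt_le_mono)
    moreover have "sqrt (exp (2 * len g)) = exp (len g)" by (rule real_sqrt_unique) (simp_all add: power2_eq_square mult_exp_exp)
    ultimately have 2: "exp (len g) * bdist \<xi> (pt g) \<le> sqrt Q" by (simp add: real_sqrt_mult bdist_def v_def)
    have Q0: "0 \<le> sqrt Q" unfolding Q_def using Cs(1) by simp
    have wr: "0 \<le> wt crit g * rn g \<xi>" by (simp add: wt_def rn_def)
    have "1 \<le> (exp C2 + sqrt Q) * (wt crit g * rn g \<xi>)"
      using 1 mult_nonneg_nonneg[OF Q0 wr] by (simp add: distrib_right)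
    moreover have "exp (len g) * bdist \<xi> (pt g) \<le> exp C2 + sqrt Q" using 2 exp_ge_zero[of C2] by linarith
    moreover have "m \<le> len g" "len g < m + (2 * D + 1)" using lg by (auto simp: t_def)
    ultimately show "\<exists>g\<in>\<Gamma>. m \<le> len g \<and> len g < m + (2 * D + 1) \<and> 1 \<le> (exp C2 + sqrt Q) * (wt crit g * rn g \<xi>) \<and>
      exp (len g) * bdist \<xi> (pt g) \<le> exp C2 + sqrt Q" using g(1) by blast
  qed
qed

lemma shadow_system: "\<exists>pt A \<beta> \<theta>. shadow_system \<Gamma> (limit_set \<Gamma>) bdist rn len (wt crit) pt A \<beta> \<theta>"
proof -
  obtain Cs where Cs: "Cs \<ge> 0" "\<forall>g\<in>\<Gamma>. \<exists>\<eta>\<in>limit_set \<Gamma>. \<forall>v. (x, v) \<in> hyp_unit_tangent \<and> g *v x = geo_point x v (len g) \<longrightarrow>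
     half_sin_sq v (ray_dir x \<eta>) \<le> Cs * exp (- 2 * len g)"
    using limit_point_in_shadow[OF x] unfolding len_def by blast
  then obtain pt where pt: "\<And>g. g \<in> \<Gamma> \<Longrightarrow> pt g \<in> limit_set \<Gamma>" "\<And>g v. g \<in> \<Gamma> \<Longrightarrow> (x, v) \<in> hyp_unit_tangent \<Longrightarrow> g *v x = geo_point x v (len g) \<Longrightarrow>
     half_sin_sq v (ray_dir x (pt g)) \<le> Cs * exp (- 2 * len g)" by metis
  obtain \<kappa> C6 where \<kappa>: "\<kappa> > 0" "C6 > 0" "\<And>g. g \<in> \<Gamma> \<Longrightarrow> wt crit g \<le> C6 * exp (- \<kappa> * len g)" using wt_decay by blast
  obtain A \<beta> where A: "0 \<le> A" "0 < \<beta>" "\<And>\<xi> \<eta> g m. \<xi> \<in> limit_set \<Gamma> \<Longrightarrow> \<eta> \<in> limit_set \<Gamma> \<Longrightarrow> g \<in> \<Gamma> \<Longrightarrow> len g \<le> m \<Longrightarrow> bdist \<xi> \<eta> \<le> exp (- m) \<Longrightarrow>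
     \<bar>lcoc crit (g *v x) \<xi> - lcoc crit (g *v x) \<eta>\<bar> \<le> A * (exp m * bdist \<xi> \<eta>) powr \<beta>"
    using lcoc_holder[of crit] unfolding bdist_def by blast
  have "shadow_system \<Gamma> (limit_set \<Gamma>) bdist rn len (wt crit) pt A \<beta> (\<kappa> / 4)"
  proof
    show "0 \<le> bdist \<xi> \<eta>" "bdist \<xi> \<eta> \<le> 1" if "\<xi> \<in> limit_set \<Gamma>" "\<eta> \<in> limit_set \<Gamma>" for \<xi> \<eta>
      using half_sin_sq_nonneg[OF ray_dir_limit ray_dir_limit] half_sin_sq_le_1[OF ray_dir_limit ray_dir_limit] that
      by (auto simp: bdist_def)
    show "bdist \<xi> \<eta> = bdist \<eta> \<xi>" for \<xi> \<eta> by (simp add: bdist_def half_sin_sq_commute)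
    show "\<exists>C. \<forall>m\<ge>0. \<forall>\<xi>\<in>limit_set \<Gamma>. (\<Sum>g | g \<in> \<Gamma> \<and> m \<le> len g \<and> len g < m + L.
      wt crit g * rn g \<xi> * (1 + exp (len g) * bdist \<xi> (pt g)) powr (\<kappa> / 4)) \<le> C" for L
      by (rule shadow_upper[OF pt(1) Cs(1) pt(2) \<kappa>])
    show "\<exists>C L. \<forall>m\<ge>0. \<forall>\<xi>\<in>limit_set \<Gamma>. \<exists>g\<in>\<Gamma>. m \<le> len g \<and> len g < m + L \<and> 1 \<le> C * (wt crit g * rn g \<xi>) \<and>
      exp (len g) * bdist \<xi> (pt g) \<le> C"
      by (rule shadow_lower[OF pt(1) Cs(1) pt(2)])
  qed (use pt(1) A \<kappa> finite_len len_nonneg wt_pos in \<open>auto simp: rn_def\<close>)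
  then show ?thesis by blast
qed

section \<open>The complement of the limit set\<close>

text \<open>These sets exhaust the complement of the limit set, and each of them meets only finitely many of
  its translates; as the Poincare series diverges, they are null sets.\<close>

definition wander :: "nat \<Rightarrow> 'n mink set" where
  "wander n = {\<xi> \<in> ideal_boundary. \<forall>g\<in>\<Gamma>. real n \<le> len g \<longrightarrow> 1 / real n \<le> half_sin_sq (ray_dir x \<xi>) (geo_dir x (g *v x))}"

lemma limit_set_or_wander: "ideal_boundary - limit_set \<Gamma> \<subseteq> (\<Union>n\<in>{0<..}. wander n)"
  using not_limit_setD[OF x] unfolding wander_def len_def by blast

text \<open>For \<xi> away from the direction of \<open>g *v x\<close> the centre of the tripod is
  near \<open>x\<close> itself, so \<open>lcoc\<close> is close to the integral from
  \<open>g *v x\<close> back to \<open>x\<close>. By invariance this is the integral from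
  \<open>x\<close> to \<open>ginv g *v x\<close>, hence the weight of \<open>ginv g\<close>.\<close>

lemma wander_rn_ge:
  assumes "0 < n"
  shows "\<exists>c>0. \<forall>\<xi>\<in>wander n. \<forall>g\<in>\<Gamma>. real n \<le> len g \<longrightarrow> c * wt crit (ginv g) \<le> rn g \<xi>"
proof -
  define k where "k = ln (real n) / 2"
  have k: "0 \<le> k" "exp (- 2 * k) = 1 / real n" using assms by (auto simp: k_def exp_minus inverse_eq_divide)
  have k3: "0 \<le> 2 * k + 3" using k by simp
  obtain C2 where C2: "C2 \<ge> 0" "\<And>\<xi> g h r0. \<xi> \<in> ideal_boundary \<Longrightarrow> g \<in> \<Gamma> \<Longrightarrow> h \<in> \<Gamma> \<Longrightarrow> (\<And>r. r \<ge> r0 \<Longrightarrow>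
      hyp_dist (g *v x) (h *v x) + hyp_dist (h *v x) (geo_point x (ray_dir x \<xi>) r) \<le> hyp_dist (g *v x) (geo_point x (ray_dir x \<xi>) r) + (2 * k + 3) \<and>
      hyp_dist x (h *v x) + hyp_dist (h *v x) (geo_point x (ray_dir x \<xi>) r) \<le> hyp_dist x (geo_point x (ray_dir x \<xi>) r) + (2 * k + 3)) \<Longrightarrow>
    \<bar>lcoc crit (g *v x) \<xi> - (pint (pot crit) (g *v x) (h *v x) - pint (pot crit) x (h *v x))\<bar> \<le> C2"
    using lcoc_coarse[OF k3] by (metis (no_types, lifting))
  show ?thesis
  proof (intro exI[of _ "exp (- C2)"] conjI ballI impI)
    fix \<xi> g assume \<xi>: "\<xi> \<in> wander n" and g: "g \<in> \<Gamma>" and l: "real n \<le> len g"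
    have \<xi>I: "\<xi> \<in> ideal_boundary" using \<xi> by (simp add: wander_def)
    define v where "v = ray_dir x \<xi>"
    have v: "(x, v) \<in> hyp_unit_tangent" unfolding v_def by (rule ray_dir_tangent[OF x \<xi>I])
    have l0: "0 < len g" using l assms by linarith
    define w where "w = geo_dir x (g *v x)"
    have w: "(x, w) \<in> hyp_unit_tangent" "g *v x = geo_point x w (len g)"
      using geo_dir_props[OF x orbit_hyp[OF g]] l0 by (auto simp: w_def len_def)
    have h: "exp (- 2 * k) \<le> half_sin_sq w v" using \<xi> g l unfolding k(2) by (simp add: wander_def w_def v_def half_sin_sq_commute)
    have "\<bar>lcoc crit (g *v x) \<xi> - (pint (pot crit) (g *v x) (mat 1 *v x) - pint (pot crit) x (mat 1 *v x))\<bar> \<le> C2"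
    proof (rule C2(2)[OF \<xi>I g one_in, of 0])
      fix r :: real assume r: "0 \<le> r"
      have "len g + r - 2 * k - 3 \<le> hyp_dist (g *v x) (geo_point x v r)"
        using wide_angle_dist[OF w(1) v _ r k(1) h, of "len g"] l0 by (simp add: w(2)[symmetric])
      then show "hyp_dist (g *v x) (mat 1 *v x) + hyp_dist (mat 1 *v x) (geo_point x (ray_dir x \<xi>) r)
          \<le> hyp_dist (g *v x) (geo_point x (ray_dir x \<xi>) r) + (2 * k + 3) \<and>
        hyp_dist x (mat 1 *v x) + hyp_dist (mat 1 *v x) (geo_point x (ray_dir x \<xi>) r) \<le> hyp_dist x (geo_point x (ray_dir x \<xi>) r) + (2 * k + 3)"
        using hyp_dist_geo_point_0[OF v r] x k(1) by (simp add: v_def[symmetric] len_def hyp_dist_commute[of "g *v x" x])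
    qed
    moreover have "pint (pot crit) (g *v x) (mat 1 *v x) = pint (pot crit) x (ginv g *v x)"
      using pint_orbit[OF g, of crit "mat 1"] by simp
    ultimately show "exp (- C2) * wt crit (ginv g) \<le> rn g \<xi>"
      unfolding wt_def rn_def mult_exp_exp by (simp add: pint_self[OF x])
  qed simp
qed

text \<open>If both \<xi> and its translate keep an angle from all distant orbit directions, a large
  displacement is impossible: the translate of \<xi> would lie exponentially close to the direction
  of \<open>g *v x\<close>.\<close>

lemma wander_return:
  assumes "0 < n"
  shows "\<exists>N. \<forall>\<xi>\<in>wander n. \<forall>g\<in>\<Gamma>. boundary_act g \<xi> \<in> wander n \<longrightarrow> len g \<le> N"
proof -
  define k where "k = ln (real n) / 2"
  have k: "0 \<le> k" "exp (- 2 * k) = 1 / real n" using assms by (auto simp: k_def exp_minus inverse_eq_divide)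
  define Q where "Q = 16 * exp (2 + 2 * (2 * k + 3))"
  have Q: "0 < Q" by (simp add: Q_def)
  show ?thesis
  proof (intro exI[of _ "max (real n) (ln (real n * Q) / 2)"] ballI impI)
    fix \<xi> g assume \<xi>: "\<xi> \<in> wander n" and g: "g \<in> \<Gamma>" and gw: "boundary_act g \<xi> \<in> wander n"
    show "len g \<le> max (real n) (ln (real n * Q) / 2)"
    proof (cases "real n \<le> len g")
      case True
      have \<xi>I: "\<xi> \<in> ideal_boundary" using \<xi> by (simp add: wander_def)
      have l0: "0 < len g" using True assms by linarith
      have li: "hyp_dist x (ginv g *v x) = len g" using len_ginv[OF g] by (simp add: len_def)
      have u: "(x, geo_dir x (ginv g *v x)) \<in> hyp_unit_tangent" "ginv g *v x = geo_point x (geo_dir x (ginv g *v x)) (hyp_dist x (g *v x))"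
        using geo_dir_props[OF x orbit_hyp[OF ginv_in[OF g]]] l0 li by (auto simp: len_def)
      have v: "(x, geo_dir x (g *v x)) \<in> hyp_unit_tangent" "g *v x = geo_point x (geo_dir x (g *v x)) (hyp_dist x (g *v x))"
        using geo_dir_props[OF x orbit_hyp[OF g]] l0 by (auto simp: len_def)
      have "exp (- 2 * k) \<le> half_sin_sq (geo_dir x (ginv g *v x)) (ray_dir x \<xi>)"
        using \<xi> ginv_in[OF g] True len_ginv[OF g] unfolding k(2) by (simp add: wander_def half_sin_sq_commute)
      then have "half_sin_sq (geo_dir x (g *v x)) (ray_dir x (boundary_act g \<xi>)) \<le> Q * exp (- 2 * len g)"
        unfolding Q_def len_def using direction_of_translate[OF x g \<xi>I k(1) u _ v] by simp
      moreover have "1 / real n \<le> half_sin_sq (geo_dir x (g *v x)) (ray_dir x (boundary_act g \<xi>))"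
        using gw g True by (simp add: wander_def half_sin_sq_commute)
      ultimately have "1 / real n \<le> Q * exp (- 2 * len g)" by linarith
      then have "1 \<le> real n * Q * exp (- 2 * len g)" using assms by (simp add: divide_le_eq mult_ac)
      then have "exp (2 * len g) * 1 \<le> exp (2 * len g) * (real n * Q * exp (- 2 * len g))" by (intro mult_left_mono) auto
      also have "\<dots> = real n * Q * (exp (2 * len g) * exp (- 2 * len g))" by (simp only: mult_ac)
      finally have "exp (2 * len g) \<le> real n * Q" by (simp add: mult_exp_exp)
      then have "ln (exp (2 * len g)) \<le> ln (real n * Q)" using assms Q by (subst ln_le_cancel_iff) auto
      then show ?thesis by simp
    qed simp
  qed
qed

end

section \<open>Stationary measures\<close>

lemma space_boundary_borel [simp]: "space boundary_borel = ideal_boundary"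
  by (simp add: boundary_borel_def space_restrict_space)

lemma continuous_on_ray_dir:
  assumes "x \<in> hyp_space" shows "continuous_on ideal_boundary (ray_dir x)"
proof -
  have "mform x \<xi> \<noteq> 0" if "\<xi> \<in> ideal_boundary" for \<xi> using ideal_boundary_mform_neg[OF assms that] by simp
  then show ?thesis unfolding ray_dir_def by (intro continuous_intros continuous_mform) auto
qed

lemma boundary_act_measurable:
  assumes g: "g \<in> carrier isom_group" shows "boundary_act g \<in> measurable boundary_borel boundary_borel"
proof -
  have "continuous_on ideal_boundary (\<lambda>z. g *v z)"
    by (intro linear_continuous_on matrix_vector_mul_bounded_linear)
  then have "continuous_on ideal_boundary (\<lambda>z. (1 / (g *v z) $ None) *\<^sub>R (g *v z))"
    using boundary_act_in(2)[OF g] by (intro continuous_intros) auto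
  then have "boundary_act g \<in> borel_measurable boundary_borel"
    unfolding boundary_borel_def by (intro borel_measurable_continuous_on_restrict) (simp add: boundary_act_def klein_def)
  then show ?thesis
    unfolding boundary_borel_def using boundary_act_in(1)[OF g]
    by (intro measurable_restrict_space2) (auto simp: space_restrict_space)
qed

lemma boundary_act_mult:
  assumes g: "g \<in> carrier isom_group" and h: "h \<in> carrier isom_group" and \<xi>: "\<xi> \<in> ideal_boundary"
  shows "boundary_act (g ** h) \<xi> = boundary_act g (boundary_act h \<xi>)"
proof -
  have "1 / (h *v \<xi>) $ None \<noteq> 0" using boundary_act_in(2)[OF h \<xi>] by simp
  then have "klein (g *v klein (h *v \<xi>)) = klein (g *v (h *v \<xi>))"
    unfolding klein_def[of "h *v \<xi>"] matrix_vector_mult_scaleR by (rule klein_scale)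
  then show ?thesis by (simp add: boundary_act_def matrix_vector_mul_assoc)
qed

lemma nn_integral_count_space_exhaust:
  fixes a :: "'a \<Rightarrow> ennreal"
  assumes "\<And>n. finite (U n)" "incseq U" "(\<Union>n. U n) = X"
  shows "(\<lambda>n. \<Sum>g\<in>U n. a g) \<longlonglongrightarrow> (\<integral>\<^sup>+ g. a g \<partial>count_space X)"
proof -
  let ?f = "\<lambda>n g. a g * indicator (U n) g"
  have "(\<lambda>n. \<integral>\<^sup>+ g. ?f n g \<partial>count_space X) \<longlonglongrightarrow> (\<integral>\<^sup>+ g. a g * indicator X g \<partial>count_space X)"
  proof (rule nn_integral_LIMSEQ)
    show "incseq ?f" using assms(2) by (auto simp: incseq_def le_fun_def indicator_def intro!: mult_left_mono)
    show "(\<lambda>n. ?f n g) \<longlonglongrightarrow> a g * indicator X g" for g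
    proof (cases "g \<in> X")
      case True
      then obtain m where m: "g \<in> U m" using assms(3) by blast
      have "\<forall>\<^sub>F n in sequentially. ?f n g = a g * indicator X g"
        using eventually_ge_at_top[of m] by eventually_elim (use m True assms(2) in \<open>auto simp: incseq_def indicator_def\<close>)
      then show ?thesis by (rule tendsto_eventually)
    next
      case False
      then have "g \<notin> U n" for n using assms(3) by blast
      then show ?thesis using False by simp
    qed
  qed simp
  moreover have "(\<integral>\<^sup>+ g. ?f n g \<partial>count_space X) = (\<Sum>g\<in>U n. a g)" for n
  proof -
    have "(\<integral>\<^sup>+ g. ?f n g \<partial>count_space X) = (\<Sum>g\<in>U n. ?f n g)"
      using assms by (intro nn_integral_count_space') auto
    then show ?thesis by simp
  qed
  moreover have "(\<integral>\<^sup>+ g. a g * indicator X g \<partial>count_space X) = (\<integral>\<^sup>+ g. a g \<partial>count_space X)"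
    by (intro nn_integral_cong) simp
  ultimately show ?thesis by simp
qed

section \<open>The Patterson-Sullivan measure and its translates\<close>

locale ps_setting = regular_gibbs \<Gamma> F x for \<Gamma> :: "'n::finite mink_mat set" and F x +
  fixes M :: "'n mink \<Rightarrow> 'n mink measure"
  assumes ps: "patterson_sullivan \<Gamma> F M" and prob: "prob_space (M x)"
begin

abbreviation "\<mu> \<equiv> M x"

lemma sets_mu: "sets \<mu> = sets boundary_borel"
  using ps x unfolding patterson_sullivan_def by blast

lemma space_mu: "space \<mu> = ideal_boundary"
  using sets_eq_imp_space_eq[OF sets_mu] by simp

lemma measurable_mu: "measurable \<mu> N = measurable boundary_borel N"
  by (rule measurable_cong_sets[OF sets_mu refl])

text \<open>The logarithm of the density is a pointwise limit, along the rays from \<open>x\<close>,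
  of functions continuous in \<xi>: directions depend continuously on \<xi>, and path integrals on
  their endpoint.\<close>

lemma rn_measurable: assumes g: "g \<in> \<Gamma>" shows "rn g \<in> borel_measurable \<mu>"
proof -
  obtain K \<alpha> B where "hyp_potential (pot crit) K \<alpha> orb B" using pot_potential by blast
  then interpret hyp_potential "pot crit" K \<alpha> orb B .
  obtain C where C: "C \<ge> 0" "\<And>y p p' b. y \<in> hyp_space \<Longrightarrow> p \<in> hyp_space \<Longrightarrow> p' \<in> hyp_space \<Longrightarrow>
      b \<in> orb \<Longrightarrow> hyp_dist p p' \<le> 1 \<Longrightarrow>
      \<bar>pint (pot crit) y p - pint (pot crit) y p'\<bar> \<le> C * (1 + hyp_dist b p) * hyp_dist p p' powr \<alpha>"
    using pint_endpoint[of 1] by force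
  have cont: "continuous_on hyp_space (\<lambda>z. pint (pot crit) y z)" if y: "y \<in> hyp_space" for y
    unfolding continuous_on_def
  proof
    fix p :: "'n mink" assume p: "p \<in> hyp_space"
    have "continuous_on hyp_space (\<lambda>z. hyp_dist p z)" using p by (intro continuous_intros) auto
    then have d: "((\<lambda>z. hyp_dist p z) \<longlongrightarrow> 0) (at p within hyp_space)"
      using p unfolding continuous_on_def by (metis hyp_dist_self)
    have H: "\<forall>\<^sub>F z in at p within hyp_space. z \<in> hyp_space" by (simp add: eventually_at_filter)
    show "((\<lambda>z. pint (pot crit) y z) \<longlongrightarrow> pint (pot crit) y p) (at p within hyp_space)"
    proof (rule LIM_zero_cancel, rule Lim_null_comparison)
      have "\<forall>\<^sub>F z in at p within hyp_space. hyp_dist p z < 1" using order_tendstoD(2)[OF d, of 1] by simp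
      then show "\<forall>\<^sub>F z in at p within hyp_space. norm (pint (pot crit) y z - pint (pot crit) y p) \<le> C * (1 + hyp_dist x p) * hyp_dist p z powr \<alpha>"
        using H
      proof eventually_elim
        case (elim z)
        then show ?case using C(2)[OF y p elim(2) x_orb] by (simp add: abs_minus_commute)
      qed
      have nn: "\<forall>\<^sub>F z in at p within hyp_space. 0 \<le> hyp_dist p z" using H by eventually_elim (use p in simp)
      have "((\<lambda>z. hyp_dist p z powr \<alpha>) \<longlongrightarrow> 0) (at p within hyp_space)"
        using alpha nn by (intro tendsto_zero_powrI[OF d tendsto_const]) auto
      then show "((\<lambda>z. C * (1 + hyp_dist x p) * hyp_dist p z powr \<alpha>) \<longlongrightarrow> 0) (at p within hyp_space)"
        by (rule tendsto_mult_right_zero)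
    qed
  qed
  have pt: "continuous_on ideal_boundary (\<lambda>\<xi>. geo_point x (ray_dir x \<xi>) r)" for r
    unfolding geo_point_def by (intro continuous_intros continuous_on_ray_dir x)
  have pH: "(\<lambda>\<xi>. geo_point x (ray_dir x \<xi>) r) ` ideal_boundary \<subseteq> hyp_space" for r
    using geo_point_in_hyp_space[OF ray_dir_tangent[OF x]] by blast
  have "(\<lambda>\<xi>. lcoc crit (g *v x) \<xi>) \<in> borel_measurable boundary_borel"
  proof (rule borel_measurable_LIMSEQ_real)
    fix \<xi> :: "'n mink" assume "\<xi> \<in> space boundary_borel"
    then have \<xi>: "\<xi> \<in> ideal_boundary" by simp
    show "(\<lambda>n. cdiff crit (g *v x) (geo_point x (ray_dir x \<xi>) (real n))) \<longlonglongrightarrow> lcoc crit (g *v x) \<xi>"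
      by (rule filterlim_compose[OF lcoc_tendsto_ray[OF orbit_hyp[OF g] \<xi>] filterlim_real_sequentially])
  next
    fix n :: nat
    have "continuous_on ideal_boundary (\<lambda>\<xi>. cdiff crit (g *v x) (geo_point x (ray_dir x \<xi>) (real n)))"
      unfolding cdiff_def
      by (intro continuous_on_diff continuous_on_compose2[OF cont[OF orbit_hyp[OF g]] pt pH] continuous_on_compose2[OF cont[OF x] pt pH])
    then show "(\<lambda>\<xi>. cdiff crit (g *v x) (geo_point x (ray_dir x \<xi>) (real n))) \<in> borel_measurable boundary_borel"
      unfolding boundary_borel_def by (rule borel_measurable_continuous_on_restrict)
  qed
  then show ?thesis unfolding measurable_mu rn_def by measurable
qed

lemma distr_eq_density:
  assumes g: "g \<in> \<Gamma>"
  shows "distr \<mu> boundary_borel (boundary_act g) = density \<mu> (\<lambda>\<xi>. ennreal (rn g \<xi>))"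
proof -
  have "distr \<mu> boundary_borel (boundary_act g) = M (g *v x)"
    using ps g x unfolding patterson_sullivan_def by blast
  also have "\<dots> = density \<mu> (\<lambda>\<xi>. ennreal (exp (- gibbs_cocycle \<Gamma> (\<lambda>P. F P - crit) \<xi> (g *v x) x)))"
    using ps orbit_hyp[OF g] x unfolding patterson_sullivan_def crit_def by blast
  finally show ?thesis by (simp add: rn_def lcoc_def)
qed

lemma emeasure_distr_eq:
  assumes g: "g \<in> \<Gamma>" and A: "A \<in> sets boundary_borel"
  shows "emeasure (distr \<mu> boundary_borel (boundary_act g)) A = (\<integral>\<^sup>+ \<xi>. ennreal (rn g \<xi>) * indicator A \<xi> \<partial>\<mu>)"
  unfolding distr_eq_density[OF g] using rn_measurable[OF g] A by (intro emeasure_density) (auto simp: sets_mu)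

lemma nn_integral_rn: assumes g: "g \<in> \<Gamma>" shows "(\<integral>\<^sup>+ \<xi>. ennreal (rn g \<xi>) \<partial>\<mu>) = 1"
proof -
  interpret prob_space \<mu> by (rule prob)
  have m: "boundary_act g \<in> measurable \<mu> boundary_borel"
    unfolding measurable_mu by (rule boundary_act_measurable[OF carrier[OF g]])
  have "emeasure (distr \<mu> boundary_borel (boundary_act g)) ideal_boundary = 1"
    using prob_space.emeasure_space_1[OF prob_space_distr[OF m]] by simp
  moreover have "(ideal_boundary :: 'n mink set) \<in> sets boundary_borel" using sets.top[of boundary_borel] by simp
  ultimately have "(\<integral>\<^sup>+ \<xi>. ennreal (rn g \<xi>) * indicator ideal_boundary \<xi> \<partial>\<mu>) = 1" using emeasure_distr_eq[OF g] by metis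
  moreover have "(\<integral>\<^sup>+ \<xi>. ennreal (rn g \<xi>) * indicator ideal_boundary \<xi> \<partial>\<mu>) = (\<integral>\<^sup>+ \<xi>. ennreal (rn g \<xi>) \<partial>\<mu>)"
    by (intro nn_integral_cong) (simp add: space_mu)
  ultimately show ?thesis by simp
qed

lemma wander_sets: "wander n \<in> sets boundary_borel"
proof -
  have "{\<xi> \<in> space boundary_borel. \<forall>g\<in>{g\<in>\<Gamma>. real n \<le> len g}. 1 / real n \<le> half_sin_sq (ray_dir x \<xi>) (geo_dir x (g *v x))} \<in> sets boundary_borel"
  proof (rule sets.sets_Collect_countable_All')
    fix g assume "g \<in> {g\<in>\<Gamma>. real n \<le> len g}"
    have "continuous_on ideal_boundary (\<lambda>\<xi>. half_sin_sq (ray_dir x \<xi>) (geo_dir x (g *v x)))"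
      unfolding half_sin_sq_def by (intro continuous_intros continuous_mform continuous_on_ray_dir x) auto
    then have [measurable]: "(\<lambda>\<xi>. half_sin_sq (ray_dir x \<xi>) (geo_dir x (g *v x))) \<in> borel_measurable boundary_borel"
      unfolding boundary_borel_def by (rule borel_measurable_continuous_on_restrict)
    show "{\<xi> \<in> space boundary_borel. 1 / real n \<le> half_sin_sq (ray_dir x \<xi>) (geo_dir x (g *v x))} \<in> sets boundary_borel"
      by measurable
  next
    show "countable {g\<in>\<Gamma>. real n \<le> len g}" using countable_group by (rule countable_subset[rotated]) auto
  qed
  moreover have "wander n = {\<xi> \<in> space boundary_borel. \<forall>g\<in>{g\<in>\<Gamma>. real n \<le> len g}. 1 / real n \<le> half_sin_sq (ray_dir x \<xi>) (geo_dir x (g *v x))}"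
    by (auto simp: wander_def)
  ultimately show ?thesis by simp
qed

text \<open>A Borel-Cantelli count. Two elements that bring the same ideal point into
  \<open>?K\<close> differ by one of displacement at most \<open>N\<close>, so the preimages of
  \<open>?K\<close> overlap at most \<open>N'\<close> times and their measures have bounded sums.
  Each is at least a constant times the weight of the inverse times the measure of
  \<open>?K\<close>; if that measure were positive, the Poincare series would converge.\<close>

lemma wander_null:
  assumes n: "0 < n" shows "emeasure \<mu> (wander n) = 0"
proof (rule ccontr)
  interpret prob_space \<mu> by (rule prob)
  let ?K = "wander n"
  assume "emeasure \<mu> ?K \<noteq> 0"
  then have a: "0 < measure \<mu> ?K" by (simp add: emeasure_eq_measure zero_less_measure_iff)
  obtain c where c: "c > 0" "\<And>\<xi> g. \<xi> \<in> ?K \<Longrightarrow> g \<in> \<Gamma> \<Longrightarrow> real n \<le> len g \<Longrightarrow> c * wt crit (ginv g) \<le> rn g \<xi>"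
    using wander_rn_ge[OF n] by blast
  obtain N where N: "\<And>\<xi> g. \<xi> \<in> ?K \<Longrightarrow> g \<in> \<Gamma> \<Longrightarrow> boundary_act g \<xi> \<in> ?K \<Longrightarrow> len g \<le> N"
    using wander_return[OF n] by blast
  define N' where "N' = card {g\<in>\<Gamma>. len g \<le> N}"
  have mult: "(\<Sum>g\<in>A. indicator ?K (boundary_act g \<xi>)) \<le> (of_nat N' :: ennreal)"
    if A: "finite A" "A \<subseteq> \<Gamma>" and \<xi>: "\<xi> \<in> ideal_boundary" for A \<xi>
  proof -
    define A' where "A' = {g \<in> A. boundary_act g \<xi> \<in> ?K}"
    have "(\<Sum>g\<in>A. indicator ?K (boundary_act g \<xi>)) = (\<Sum>g\<in>A. if g \<in> A' then 1 else (0::ennreal))"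
      by (intro sum.cong) (auto simp: A'_def indicator_def)
    also have "\<dots> = (\<Sum>g\<in>A \<inter> A'. 1)" using A(1) by (subst sum.inter_restrict) auto
    also have "\<dots> = of_nat (card (A \<inter> A'))" by simp
    also have "A \<inter> A' = A'" by (auto simp: A'_def)
    also have "card A' \<le> N'"
    proof (cases "A' = {}")
      case False
      then obtain g0 where g0: "g0 \<in> A'" by blast
      have g0\<Gamma>: "g0 \<in> \<Gamma>" using g0 A by (auto simp: A'_def)
      show ?thesis unfolding N'_def
      proof (rule card_inj_on_le)
        show "inj_on (\<lambda>g. g ** ginv g0) A'"
        proof (rule inj_onI)
          fix g h assume "g ** ginv g0 = h ** ginv g0"
          then have "(g ** ginv g0) ** g0 = (h ** ginv g0) ** g0" by simp
          then show "g = h" by (simp add: matrix_mul_assoc[symmetric] ginv_mult(1)[OF g0\<Gamma>])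
        qed
        show "(\<lambda>g. g ** ginv g0) ` A' \<subseteq> {g\<in>\<Gamma>. len g \<le> N}"
        proof clarify
          fix g assume g: "g \<in> A'"
          have g\<Gamma>: "g \<in> \<Gamma>" using g A by (auto simp: A'_def)
          have k: "g ** ginv g0 \<in> \<Gamma>" by (intro mult_in ginv_in g\<Gamma> g0\<Gamma>)
          have "boundary_act (g ** ginv g0) (boundary_act g0 \<xi>) = boundary_act ((g ** ginv g0) ** g0) \<xi>"
            by (rule boundary_act_mult[OF carrier[OF k] carrier[OF g0\<Gamma>] \<xi>, symmetric])
          also have "(g ** ginv g0) ** g0 = g" by (simp add: matrix_mul_assoc[symmetric] ginv_mult(1)[OF g0\<Gamma>])
          finally have "boundary_act (g ** ginv g0) (boundary_act g0 \<xi>) \<in> ?K" using g by (simp add: A'_def)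
          then have "len (g ** ginv g0) \<le> N" using N[OF _ k] g0 by (auto simp: A'_def)
          then show "g ** ginv g0 \<in> \<Gamma> \<and> len (g ** ginv g0) \<le> N" using k by blast
        qed
        show "finite {g\<in>\<Gamma>. len g \<le> N}" by (rule finite_len)
      qed
    qed simp
    then have "of_nat (card A') \<le> (of_nat N' :: ennreal)" by simp
    finally show ?thesis .
  qed
  have K: "?K \<in> sets \<mu>" using wander_sets sets_mu by simp
  have main: "(\<Sum>g\<in>A. wt crit (ginv g)) \<le> real N' / (c * measure \<mu> ?K)"
    if A: "finite A" "A \<subseteq> {g\<in>\<Gamma>. real n \<le> len g}" for A
  proof -
    have A\<Gamma>: "A \<subseteq> \<Gamma>" using A by auto
    have "ennreal (\<Sum>g\<in>A. c * wt crit (ginv g) * measure \<mu> ?K) = (\<Sum>g\<in>A. ennreal (c * wt crit (ginv g)) * emeasure \<mu> ?K)"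
      using c(1) less_imp_le[OF wt_pos] by (subst sum_ennreal[symmetric]) (auto simp: emeasure_eq_measure ennreal_mult)
    also have "\<dots> = (\<Sum>g\<in>A. \<integral>\<^sup>+ \<xi>. ennreal (c * wt crit (ginv g)) * indicator ?K \<xi> \<partial>\<mu>)"
      using K by (simp add: nn_integral_cmult_indicator)
    also have "\<dots> \<le> (\<Sum>g\<in>A. \<integral>\<^sup>+ \<xi>. ennreal (rn g \<xi>) * indicator ?K \<xi> \<partial>\<mu>)"
      using A c(2) by (intro sum_mono nn_integral_mono) (auto simp: indicator_def intro!: ennreal_leI)
    also have "\<dots> = (\<Sum>g\<in>A. emeasure (distr \<mu> boundary_borel (boundary_act g)) ?K)"
      using A by (intro sum.cong refl emeasure_distr_eq[symmetric] wander_sets) auto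
    also have "\<dots> = (\<Sum>g\<in>A. \<integral>\<^sup>+ \<xi>. indicator ?K (boundary_act g \<xi>) \<partial>\<mu>)"
    proof (intro sum.cong refl)
      fix g assume g: "g \<in> A"
      then have m: "boundary_act g \<in> measurable \<mu> boundary_borel"
        unfolding measurable_mu using A\<Gamma> by (intro boundary_act_measurable carrier) auto
      show "emeasure (distr \<mu> boundary_borel (boundary_act g)) ?K = (\<integral>\<^sup>+ \<xi>. indicator ?K (boundary_act g \<xi>) \<partial>\<mu>)"
        using nn_integral_distr[OF m, of "indicator ?K"] wander_sets by simp
    qed
    also have "\<dots> = (\<integral>\<^sup>+ \<xi>. (\<Sum>g\<in>A. indicator ?K (boundary_act g \<xi>)) \<partial>\<mu>)"
    proof (intro nn_integral_sum[symmetric])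
      fix g assume g: "g \<in> A"
      then have m: "boundary_act g \<in> measurable \<mu> boundary_borel"
        unfolding measurable_mu using A\<Gamma> by (intro boundary_act_measurable carrier) auto
      show "(\<lambda>\<xi>. indicator ?K (boundary_act g \<xi>) :: ennreal) \<in> borel_measurable \<mu>"
        by (rule measurable_compose[OF m borel_measurable_indicator[OF wander_sets]])
    qed
    also have "\<dots> \<le> (\<integral>\<^sup>+ \<xi>. of_nat N' \<partial>\<mu>)"
      by (intro nn_integral_mono mult[OF A(1) A\<Gamma>]) (simp add: space_mu)
    also have "\<dots> = ennreal (real N')" by (simp add: emeasure_space_1 ennreal_of_nat_eq_real_of_nat)
    finally have "(\<Sum>g\<in>A. c * wt crit (ginv g) * measure \<mu> ?K) \<le> real N'" by (simp add: ennreal_le_iff)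
    moreover have "(\<Sum>g\<in>A. c * wt crit (ginv g) * measure \<mu> ?K) = (\<Sum>g\<in>A. wt crit (ginv g)) * (c * measure \<mu> ?K)"
      by (simp add: sum_distrib_left sum_distrib_right mult_ac)
    ultimately show ?thesis using a c(1) by (simp add: le_divide_eq)
  qed
  have "converges crit" unfolding converges_def
  proof (intro exI allI impI)
    fix A assume A: "finite A \<and> A \<subseteq> \<Gamma>"
    let ?P = "\<lambda>g. real n \<le> len g"
    have "(\<Sum>g\<in>A. wt crit g) = (\<Sum>g\<in>{g\<in>A. ?P g}. wt crit g) + (\<Sum>g\<in>{g\<in>A. \<not> ?P g}. wt crit g)"
      using A by (subst sum.union_disjoint[symmetric]) (auto intro: sum.cong)
    also have "(\<Sum>g\<in>{g\<in>A. \<not> ?P g}. wt crit g) \<le> (\<Sum>g\<in>{g\<in>\<Gamma>. len g \<le> real n}. wt crit g)"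
      using A less_imp_le[OF wt_pos] by (intro sum_mono2 finite_len) auto
    \<comment> \<open>The bound concerns weights of inverses; inversion preserves the displacement,
      so it maps far elements to far elements.\<close>
    also have "(\<Sum>g\<in>{g\<in>A. ?P g}. wt crit g) = (\<Sum>g\<in>ginv ` {g\<in>A. ?P g}. wt crit (ginv g))"
    proof (subst sum.reindex)
      show "inj_on ginv {g \<in> A. ?P g}" using ginv_ginv A by (intro inj_on_inverseI[of _ ginv]) auto
      show "(\<Sum>g\<in>{g\<in>A. ?P g}. wt crit g) = (\<Sum>g\<in>{g\<in>A. ?P g}. ((\<lambda>g. wt crit (ginv g)) \<circ> ginv) g)"
        using ginv_ginv A by (intro sum.cong) auto
    qed
    also have "\<dots> \<le> real N' / (c * measure \<mu> ?K)"
      using A ginv_in len_ginv by (intro main) auto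
    finally show "(\<Sum>g\<in>A. wt crit g) \<le> real N' / (c * measure \<mu> ?K) + (\<Sum>g\<in>{g\<in>\<Gamma>. len g \<le> real n}. wt crit g)" by simp
  qed
  then show False using diverges_at_critical[OF crit_ereal] by blast
qed

lemma AE_limit_set: "AE \<xi> in \<mu>. \<xi> \<in> limit_set \<Gamma>"
proof -
  have "AE \<xi> in \<mu>. \<forall>n\<in>{0::nat<..}. \<xi> \<notin> wander n"
  proof (subst AE_ball_countable)
    show "\<forall>n\<in>{0::nat<..}. AE \<xi> in \<mu>. \<xi> \<notin> wander n"
    proof
      fix n :: nat assume "n \<in> {0<..}"
      then have "wander n \<in> null_sets \<mu>" using wander_null[of n] wander_sets by (auto simp: null_sets_def sets_mu)
      then show "AE \<xi> in \<mu>. \<xi> \<notin> wander n" by (rule AE_not_in)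
    qed
  qed simp
  moreover have "AE \<xi> in \<mu>. \<xi> \<in> ideal_boundary" by (rule AE_I2) (simp add: space_mu)
  ultimately show ?thesis
  proof eventually_elim
    case (elim \<xi>)
    then show ?case using limit_set_or_wander by blast
  qed
qed

section \<open>The stationary probability measure on the group and its moment\<close>

theorem exists_stationary_pmf:
  "\<exists>\<nu>. set_pmf \<nu> = \<Gamma> \<and> exponential_moment \<nu> \<and> stationary \<nu> \<mu>"
proof -
  interpret prob_space \<mu> by (rule prob)
  obtain pt A \<beta> \<theta> where S: "shadow_system \<Gamma> (limit_set \<Gamma>) bdist rn len (wt crit) pt A \<beta> \<theta>"
    using shadow_system by blast
  interpret sh: shadow_system \<Gamma> "limit_set \<Gamma>" bdist rn len "wt crit" pt A \<beta> \<theta> by (rule S)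
  obtain c L \<rho>0 where L: "0 < L" and \<rho>0: "0 \<le> \<rho>0" "\<rho>0 < 1" and c: "\<And>g. g \<in> \<Gamma> \<Longrightarrow> 0 < c g"
    and dec: "\<And>\<xi> j. \<xi> \<in> limit_set \<Gamma> \<Longrightarrow> 0 \<le> 1 - (\<Sum>i<j. \<Sum>g\<in>sh.shell L i. c g * rn g \<xi>)"
      "\<And>\<xi> j. \<xi> \<in> limit_set \<Gamma> \<Longrightarrow> 1 - (\<Sum>i<j. \<Sum>g\<in>sh.shell L i. c g * rn g \<xi>) \<le> \<rho>0 ^ j"
    using sh.exists_decomposition by blast
  \<comment> \<open>Raised to at least 1/2 because the moment exponent uses
    \<open>ln \<rho>\<close>, and \<open>\<rho>0\<close> may be 0.\<close>
  define \<rho> where "\<rho> = max \<rho>0 (1 / 2)"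
  have \<rho>: "0 < \<rho>" "\<rho> < 1" using \<rho>0 by (auto simp: \<rho>_def)
  have dec': "1 - (\<Sum>i<j. \<Sum>g\<in>sh.shell L i. c g * rn g \<xi>) \<le> \<rho> ^ j" if "\<xi> \<in> limit_set \<Gamma>" for \<xi> j
    using dec(2)[OF that, of j] power_mono[of \<rho>0 \<rho> j] \<rho>0 by (simp add: \<rho>_def)
  define U where "U n = (\<Union>i<n. sh.shell L i)" for n
  have fU: "finite (U n)" for n unfolding U_def using sh.finite_shell by blast
  have incU: "incseq U" unfolding incseq_def U_def by (auto intro: order.strict_trans2)
  have unU: "(\<Union>n. U n) = \<Gamma>"
  proof
    show "(\<Union>n. U n) \<subseteq> \<Gamma>" by (auto simp: U_def len_shell_def)
    show "\<Gamma> \<subseteq> (\<Union>n. U n)"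
    proof
      fix g assume g: "g \<in> \<Gamma>"
      define n where "n = nat \<lfloor>len g / L\<rfloor>"
      have "g \<in> sh.shell L n" unfolding n_def by (rule len_shell_index[where len = len and g = g]) (use L g len_nonneg[OF g] in auto)
      then show "g \<in> (\<Union>n. U n)" by (auto simp: U_def)
    qed
  qed
  have sumU: "(\<Sum>g\<in>U n. a g) = (\<Sum>i<n. \<Sum>g\<in>sh.shell L i. a g)" for n and a :: "'n mink_mat \<Rightarrow> 'z::comm_monoid_add"
    unfolding U_def
  proof (rule sum.UNION_disjoint)
    show "\<forall>i\<in>{..<n}. \<forall>j\<in>{..<n}. i \<noteq> j \<longrightarrow> sh.shell L i \<inter> sh.shell L j = {}"
      by (intro ballI impI len_shell_disjoint[OF L])
  qed (auto simp: sh.finite_shell)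
  have cr: "0 \<le> c g * rn g \<xi>" if "g \<in> \<Gamma>" for g \<xi> using c[OF that] by (simp add: rn_def)
  have one: "(\<integral>\<^sup>+ g. ennreal (c g * rn g \<xi>) \<partial>count_space \<Gamma>) = 1" if \<xi>: "\<xi> \<in> limit_set \<Gamma>" for \<xi>
  proof -
    have "(\<lambda>n. \<Sum>g\<in>U n. ennreal (c g * rn g \<xi>)) \<longlonglongrightarrow> (\<integral>\<^sup>+ g. ennreal (c g * rn g \<xi>) \<partial>count_space \<Gamma>)"
      by (rule nn_integral_count_space_exhaust[OF fU incU unU])
    moreover have "(\<lambda>n. \<Sum>g\<in>U n. ennreal (c g * rn g \<xi>)) \<longlonglongrightarrow> ennreal 1"
    proof -
      have "(\<lambda>n. 1 - (\<Sum>i<n. \<Sum>g\<in>sh.shell L i. c g * rn g \<xi>)) \<longlonglongrightarrow> 0"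
      proof (rule tendsto_sandwich)
        show "\<forall>\<^sub>F n in sequentially. 0 \<le> 1 - (\<Sum>i<n. \<Sum>g\<in>sh.shell L i. c g * rn g \<xi>)"
          using dec(1)[OF \<xi>] by (intro always_eventually allI)
        show "\<forall>\<^sub>F n in sequentially. 1 - (\<Sum>i<n. \<Sum>g\<in>sh.shell L i. c g * rn g \<xi>) \<le> \<rho> ^ n"
          using dec'[OF \<xi>] by (intro always_eventually allI)
        show "(\<lambda>n. \<rho> ^ n) \<longlonglongrightarrow> 0" using \<rho> by (intro LIMSEQ_power_zero) simp
      qed simp
      then have "(\<lambda>n. 1 - (1 - (\<Sum>i<n. \<Sum>g\<in>sh.shell L i. c g * rn g \<xi>))) \<longlonglongrightarrow> 1 - 0" by (intro tendsto_intros)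
      then have "(\<lambda>n. ennreal (\<Sum>g\<in>U n. c g * rn g \<xi>)) \<longlonglongrightarrow> ennreal 1" unfolding sumU by (intro tendsto_ennrealI) simp
      moreover have "(\<Sum>g\<in>U n. ennreal (c g * rn g \<xi>)) = ennreal (\<Sum>g\<in>U n. c g * rn g \<xi>)" for n
        using cr unU by (intro sum_ennreal) blast
      ultimately show ?thesis by simp
    qed
    ultimately show ?thesis using LIMSEQ_unique by fastforce
  qed
  have rnm [measurable]: "(\<lambda>\<xi>. ennreal (rn g \<xi>)) \<in> borel_measurable \<mu>" if "g \<in> \<Gamma>" for g
    using rn_measurable[OF that] by measurable
  \<comment> \<open>The decomposition of 1 is integrated over \<open>A\<close>, and sum and integral
    are exchanged; it holds on the limit set, which has full measure.\<close>
  have stat: "emeasure \<mu> A = (\<integral>\<^sup>+ g. ennreal (c g) * emeasure (distr \<mu> boundary_borel (boundary_act g)) A \<partial>count_space \<Gamma>)"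
    if A: "A \<in> sets boundary_borel" for A
  proof -
    have A': "A \<in> sets \<mu>" using A sets_mu by simp
    have "emeasure \<mu> A = (\<integral>\<^sup>+ \<xi>. indicator A \<xi> \<partial>\<mu>)" using A' by simp
    also have "\<dots> = (\<integral>\<^sup>+ \<xi>. (\<integral>\<^sup>+ g. ennreal (c g) * (ennreal (rn g \<xi>) * indicator A \<xi>) \<partial>count_space \<Gamma>) \<partial>\<mu>)"
    proof (rule nn_integral_cong_AE)
      show "AE \<xi> in \<mu>. indicator A \<xi> = (\<integral>\<^sup>+ g. ennreal (c g) * (ennreal (rn g \<xi>) * indicator A \<xi>) \<partial>count_space \<Gamma>)"
        using AE_limit_set
      proof eventually_elim
        case (elim \<xi>)
        have "(\<integral>\<^sup>+ g. ennreal (c g) * (ennreal (rn g \<xi>) * indicator A \<xi>) \<partial>count_space \<Gamma>) =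
            (\<integral>\<^sup>+ g. ennreal (c g * rn g \<xi>) * indicator A \<xi> \<partial>count_space \<Gamma>)"
          using c by (intro nn_integral_cong) (simp add: ennreal_mult rn_def mult.assoc less_imp_le)
        also have "\<dots> = (\<integral>\<^sup>+ g. ennreal (c g * rn g \<xi>) \<partial>count_space \<Gamma>) * indicator A \<xi>"
          by (rule nn_integral_multc) simp
        finally show ?case using one[OF elim] by simp
      qed
    qed
    also have "\<dots> = (\<integral>\<^sup>+ g. (\<integral>\<^sup>+ \<xi>. ennreal (c g) * (ennreal (rn g \<xi>) * indicator A \<xi>) \<partial>\<mu>) \<partial>count_space \<Gamma>)"
      using rnm A' by (intro nn_integral_count_space_nn_integral countable_group) (auto intro!: borel_measurable_times_ennreal)
    also have "\<dots> = (\<integral>\<^sup>+ g. ennreal (c g) * emeasure (distr \<mu> boundary_borel (boundary_act g)) A \<partial>count_space \<Gamma>)"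
    proof (rule nn_integral_cong)
      fix g assume "g \<in> space (count_space \<Gamma>)"
      then have g: "g \<in> \<Gamma>" by simp
      show "(\<integral>\<^sup>+ \<xi>. ennreal (c g) * (ennreal (rn g \<xi>) * indicator A \<xi>) \<partial>\<mu>) =
          ennreal (c g) * emeasure (distr \<mu> boundary_borel (boundary_act g)) A"
        unfolding emeasure_distr_eq[OF g A] using rnm[OF g] A' by (intro nn_integral_cmult) auto
    qed
    finally show ?thesis .
  qed
  define p where "p g = (if g \<in> \<Gamma> then c g else 0)" for g
  have p0: "0 \<le> p g" for g using c by (auto simp: p_def less_imp_le)
  have conv: "(\<integral>\<^sup>+ g. ennreal (p g) * f g \<partial>count_space UNIV) = (\<integral>\<^sup>+ g. ennreal (c g) * f g \<partial>count_space \<Gamma>)" for f :: "'n mink_mat \<Rightarrow> ennreal"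
  proof -
    have "(\<integral>\<^sup>+ g. ennreal (p g) * f g \<partial>count_space UNIV) = (\<integral>\<^sup>+ g. ennreal (p g) * f g \<partial>count_space \<Gamma>)"
      by (rule nn_integral_count_space_eq) (auto simp: p_def)
    also have "\<dots> = (\<integral>\<^sup>+ g. ennreal (c g) * f g \<partial>count_space \<Gamma>)" by (rule nn_integral_cong) (simp add: p_def)
    finally show ?thesis .
  qed
  \<comment> \<open>Total mass 1 comes from testing stationarity on the whole boundary, where every
    translate has measure 1.\<close>
  have p1: "(\<integral>\<^sup>+ g. ennreal (p g) \<partial>count_space UNIV) = 1"
  proof -
    have ib: "(ideal_boundary :: 'n mink set) \<in> sets boundary_borel" using sets.top[of boundary_borel] by simp
    have "(\<integral>\<^sup>+ g. ennreal (p g) \<partial>count_space UNIV) = (\<integral>\<^sup>+ g. ennreal (c g) * 1 \<partial>count_space \<Gamma>)"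
      using conv[of "\<lambda>_. 1"] by simp
    also have "\<dots> = (\<integral>\<^sup>+ g. ennreal (c g) * emeasure (distr \<mu> boundary_borel (boundary_act g)) ideal_boundary \<partial>count_space \<Gamma>)"
    proof (rule nn_integral_cong)
      fix g assume "g \<in> space (count_space \<Gamma>)"
      then have m: "boundary_act g \<in> measurable \<mu> boundary_borel"
        unfolding measurable_mu by (intro boundary_act_measurable carrier) simp
      show "ennreal (c g) * 1 = ennreal (c g) * emeasure (distr \<mu> boundary_borel (boundary_act g)) ideal_boundary"
        using prob_space.emeasure_space_1[OF prob_space_distr[OF m]] by simp
    qed
    also have "\<dots> = emeasure \<mu> ideal_boundary" by (rule stat[OF ib, symmetric])
    also have "\<dots> = 1" using emeasure_space_1 by (simp add: space_mu)
    finally show ?thesis .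
  qed
  define \<nu> where "\<nu> = embed_pmf p"
  have pmf\<nu>: "pmf \<nu> g = p g" for g unfolding \<nu>_def by (rule pmf_embed_pmf[OF p0 p1])
  have int\<nu>: "(\<integral>\<^sup>+ g. f g \<partial>measure_pmf \<nu>) = (\<integral>\<^sup>+ g. ennreal (c g) * f g \<partial>count_space \<Gamma>)" for f
    unfolding nn_integral_measure_pmf pmf\<nu> by (rule conv)
  have supp: "set_pmf \<nu> = \<Gamma>"
    using c by (auto simp: set_pmf_eq pmf\<nu> p_def) (metis less_irrefl)
  have st: "stationary \<nu> \<mu>" unfolding stationary_def int\<nu> using stat by blast
  \<comment> \<open>As each density integrates to 1, the mass of shell \<open>j\<close> is the
    integral of what this shell removes from the remainder, which is at most the remainder before
    it.\<close>
  have shell_mass: "(\<Sum>g\<in>sh.shell L j. c g) \<le> \<rho> ^ j" for j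
  proof -
    have sub: "g \<in> \<Gamma>" if "g \<in> sh.shell L j" for g using that by (simp add: len_shell_def)
    have "ennreal (\<Sum>g\<in>sh.shell L j. c g) = (\<Sum>g\<in>sh.shell L j. ennreal (c g))"
      using c sub by (intro sum_ennreal[symmetric] less_imp_le) auto
    also have "\<dots> = (\<Sum>g\<in>sh.shell L j. ennreal (c g) * (\<integral>\<^sup>+ \<xi>. ennreal (rn g \<xi>) \<partial>\<mu>))"
      using nn_integral_rn sub by (intro sum.cong) auto
    also have "\<dots> = (\<Sum>g\<in>sh.shell L j. (\<integral>\<^sup>+ \<xi>. ennreal (c g) * ennreal (rn g \<xi>) \<partial>\<mu>))"
      using rnm sub by (intro sum.cong refl nn_integral_cmult[symmetric]) auto
    also have "\<dots> = (\<integral>\<^sup>+ \<xi>. (\<Sum>g\<in>sh.shell L j. ennreal (c g) * ennreal (rn g \<xi>)) \<partial>\<mu>)"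
      using rnm sub by (intro nn_integral_sum[symmetric] borel_measurable_times_ennreal) auto
    also have "\<dots> \<le> (\<integral>\<^sup>+ \<xi>. ennreal (\<rho> ^ j) \<partial>\<mu>)"
    proof (rule nn_integral_mono_AE)
      show "AE \<xi> in \<mu>. (\<Sum>g\<in>sh.shell L j. ennreal (c g) * ennreal (rn g \<xi>)) \<le> ennreal (\<rho> ^ j)"
        using AE_limit_set
      proof eventually_elim
        case (elim \<xi>)
        have "(\<Sum>g\<in>sh.shell L j. ennreal (c g) * ennreal (rn g \<xi>)) = (\<Sum>g\<in>sh.shell L j. ennreal (c g * rn g \<xi>))"
          using c sub by (intro sum.cong refl ennreal_mult[symmetric]) (auto simp: rn_def less_imp_le)
        also have "\<dots> = ennreal (\<Sum>g\<in>sh.shell L j. c g * rn g \<xi>)" using cr sub by (intro sum_ennreal) auto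
        also have "\<dots> \<le> ennreal (\<rho> ^ j)"
          using dec(1)[OF elim, of "Suc j"] dec'[OF elim, of j] by (intro ennreal_leI) simp
        finally show ?case .
      qed
    qed
    also have "\<dots> = ennreal (\<rho> ^ j)" by (simp add: emeasure_space_1)
    finally show ?thesis using \<rho> by (simp add: ennreal_le_iff)
  qed
  have em: "exponential_moment \<nu>"
  proof -
    obtain C where C: "C > 0" "\<And>g :: 'n mink_mat. g \<in> carrier isom_group \<Longrightarrow> norm g \<le> C * exp (hyp_dist origin (g *v origin))"
      using isom_norm_le by blast
    define E where "E = hyp_dist origin x"
    \<comment> \<open>Half of the decay rate of the shell masses: norms raised to this power grow
      per shell by the inverse square root of \<rho>, so the moment is bounded by a geometric series
      whose ratio \<open>r\<close> is the square root of \<rho>.\<close>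
    define \<epsilon> where "\<epsilon> = - ln \<rho> / (2 * L)"
    have \<epsilon>: "0 < \<epsilon>" unfolding \<epsilon>_def using \<rho> L by (intro divide_pos_pos) auto
    define D where "D = (C * exp (2 * E)) powr \<epsilon> * exp (\<epsilon> * L)"
    have D: "0 \<le> D" by (simp add: D_def)
    define r where "r = \<rho> * exp (\<epsilon> * L)"
    have "r = exp (ln \<rho>) * exp (- ln \<rho> / 2)" using \<rho> L by (simp add: r_def \<epsilon>_def)
    also have "\<dots> = exp (ln \<rho> / 2)" unfolding mult_exp_exp by simp
    finally have r: "0 < r" "r < 1" using \<rho> by auto
    have nb: "norm g powr \<epsilon> \<le> D * exp (\<epsilon> * L) ^ j" if g: "g \<in> sh.shell L j" for g j
    proof -
      have g\<Gamma>: "g \<in> \<Gamma>" and gl: "len g \<le> (real j + 1) * L" using g by (auto simp: len_shell_def)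
      have "hyp_dist (g *v x) (g *v origin) = E" by (simp add: isom_dist[OF carrier[OF g\<Gamma>]] E_def hyp_dist_commute)
      then have "hyp_dist origin (g *v origin) \<le> 2 * E + len g"
        using hyp_dist_triangle[OF origin_in_hyp_space x act_hyp[OF g\<Gamma> origin_in_hyp_space]]
          hyp_dist_triangle[OF x orbit_hyp[OF g\<Gamma>] act_hyp[OF g\<Gamma> origin_in_hyp_space]] by (simp add: len_def E_def)
      then have "C * exp (hyp_dist origin (g *v origin)) \<le> C * (exp (2 * E) * exp ((real j + 1) * L))"
        unfolding mult_exp_exp using gl C(1) by (intro mult_left_mono) auto
      then have "norm g \<le> (C * exp (2 * E)) * exp ((real j + 1) * L)" using C(2)[OF carrier[OF g\<Gamma>]] by simp
      then have "norm g powr \<epsilon> \<le> ((C * exp (2 * E)) * exp ((real j + 1) * L)) powr \<epsilon>" using \<epsilon> by (intro powr_mono2) auto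
      also have "\<dots> = (C * exp (2 * E)) powr \<epsilon> * exp ((real j + 1) * L) powr \<epsilon>" by (simp only: powr_mult)
      also have "exp ((real j + 1) * L) powr \<epsilon> = exp (\<epsilon> * L + real j * (\<epsilon> * L))"
        by (simp add: powr_def algebra_simps)
      also have "\<dots> = exp (\<epsilon> * L) * exp (\<epsilon> * L) ^ j" by (simp only: exp_add exp_of_nat_mult)
      finally show ?thesis by (simp add: D_def mult.assoc)
    qed
    have part: "(\<Sum>g\<in>U n. c g * norm g powr \<epsilon>) \<le> D * (1 / (1 - r))" for n
    proof -
      have "(\<Sum>g\<in>U n. c g * norm g powr \<epsilon>) = (\<Sum>j<n. \<Sum>g\<in>sh.shell L j. c g * norm g powr \<epsilon>)" by (rule sumU)
      also have "\<dots> \<le> (\<Sum>j<n. D * r ^ j)"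
      proof (rule sum_mono)
        fix j
        have "(\<Sum>g\<in>sh.shell L j. c g * norm g powr \<epsilon>) \<le> (\<Sum>g\<in>sh.shell L j. c g * (D * exp (\<epsilon> * L) ^ j))"
        proof (rule sum_mono)
          fix g assume g: "g \<in> sh.shell L j"
          then have "0 \<le> c g" using c[of g] by (simp add: len_shell_def)
          then show "c g * norm g powr \<epsilon> \<le> c g * (D * exp (\<epsilon> * L) ^ j)" by (intro mult_left_mono nb[OF g])
        qed
        also have "\<dots> = (\<Sum>g\<in>sh.shell L j. c g) * (D * exp (\<epsilon> * L) ^ j)" by (simp only: sum_distrib_right)
        also have "\<dots> \<le> \<rho> ^ j * (D * exp (\<epsilon> * L) ^ j)" using shell_mass D by (intro mult_right_mono) auto
        also have "\<dots> = D * r ^ j" by (simp add: r_def power_mult_distrib)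
        finally show "(\<Sum>g\<in>sh.shell L j. c g * norm g powr \<epsilon>) \<le> D * r ^ j" .
      qed
      also have "\<dots> = D * (\<Sum>j<n. r ^ j)" by (simp only: sum_distrib_left)
      also have "\<dots> \<le> D * (1 / (1 - r))"
      proof (intro mult_left_mono D)
        have "(\<Sum>j<n. r ^ j) \<le> (\<Sum>j. r ^ j)" using r by (intro sum_le_suminf) (auto intro: summable_geometric)
        then show "(\<Sum>j<n. r ^ j) \<le> 1 / (1 - r)" using r by (simp add: suminf_geometric)
      qed
      finally show ?thesis .
    qed
    have "(\<integral>\<^sup>+ g. ennreal (norm g powr \<epsilon>) \<partial>measure_pmf \<nu>) = (\<integral>\<^sup>+ g. ennreal (c g * norm g powr \<epsilon>) \<partial>count_space \<Gamma>)"
      unfolding int\<nu> using c by (intro nn_integral_cong) (simp add: ennreal_mult less_imp_le)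
    also have "\<dots> \<le> ennreal (D * (1 / (1 - r)))"
    proof (rule LIMSEQ_le_const2[OF nn_integral_count_space_exhaust[OF fU incU unU]], intro exI allI impI)
      fix n
      have "(\<Sum>g\<in>U n. ennreal (c g * norm g powr \<epsilon>)) = ennreal (\<Sum>g\<in>U n. c g * norm g powr \<epsilon>)"
        using c unU by (intro sum_ennreal mult_nonneg_nonneg less_imp_le[OF c]) auto
      also have "\<dots> \<le> ennreal (D * (1 / (1 - r)))" by (intro ennreal_leI part)
      finally show "(\<Sum>g\<in>U n. ennreal (c g * norm g powr \<epsilon>)) \<le> ennreal (D * (1 / (1 - r)))" .
    qed
    also have "\<dots> < \<infinity>" by simp
    finally show ?thesis unfolding exponential_moment_def using \<epsilon> by blast
  qed
  show ?thesis using supp em st by blast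
qed

end

theorem theorem1p2:
  fixes \<Gamma> :: "'n::finite mink_mat set"
    and F :: "'n potential"
    and M :: "'n mink \<Rightarrow> 'n mink measure"
    and x :: "'n mink"
    and \<mu> :: "'n mink measure"
  assumes "2 \<le> CARD('n)"
    and "subgroup \<Gamma> isom_group"
    and "topological_space_class.discrete \<Gamma>"
    and "torsion_free \<Gamma>"
    and "nonelementary \<Gamma>"
    and "convex_cocompact \<Gamma>"
    and "regular_potential \<Gamma> F"
    and "patterson_sullivan \<Gamma> F M"
    and "x \<in> hyp_space"
    and "\<mu> = M x"
    and "prob_space \<mu>"
  shows "\<exists>\<nu> :: 'n mink_mat pmf.
           set_pmf \<nu> \<subseteq> \<Gamma> \<and> exponential_moment \<nu> \<and> stationary \<nu> \<mu> \<and>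
           generate isom_group (set_pmf \<nu>) = \<Gamma>"
proof -
  have "holder_potential \<Gamma> F" using assms(7) by (simp add: regular_potential_def)
  moreover have "prob_space (M x)" using assms(10,11) by simp
  ultimately interpret ps_setting \<Gamma> F x M
    using assms(2-9)
    by (intro ps_setting.intro regular_gibbs.intro gibbs_setting.intro cocompact_isom_group.intro discrete_isom_group.intro
        ps_setting_axioms.intro regular_gibbs_axioms.intro gibbs_setting_axioms.intro cocompact_isom_group_axioms.intro)
  obtain \<nu> where \<nu>: "set_pmf \<nu> = \<Gamma>" "exponential_moment \<nu>" "stationary \<nu> (M x)"
    using exists_stationary_pmf by blast
  have "\<Gamma> = generate isom_group \<Gamma>"
    by (rule group.generateI[OF group_isom_group assms(2)]) auto
  then show ?thesis using \<nu> assms(10) by (intro exI[of _ \<nu>]) simp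
qed

end
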